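(* For every simplicial group $G$, there is an equivalence $$\mathcal{Z}(G)\simeq\mathrm{Map}_G(\mathrm{E}G,G_{\mathrm{conj}})$$ of its homotopy coherent center with the homotopy fixed point space of the conjugation action of $G$ on itself.
   Context: Spaces are simplicial sets; $\mathrm{Map}(X,Y)_n=\mathrm{Mor}(\Delta^n\times X,Y)$. A simplicial group (or simplicial monoid) $G$ is regarded as a simplicial category (category enriched in spaces) with one object. The homotopy coherent center of $G$ is $\mathcal{Z}(G)=\mathrm{Tot}(\Pi^\bullet G)$, the space of maps of cosimplicial spaces from $\Delta^\bullet$ to $\Pi^\bullet G$, where $\Pi^nG=\mathrm{Map}(G^n,G)$ with coface maps $\Pi^{n-1}G\to\Pi^nG$: $(d^0\Phi)(f_1,\dots,f_n)=f_1\Phi(f_2,\dots,f_n)$, $(d^k\Phi)(f_1,\dots,f_n)=\Phi(f_1,\dots,f_kf_{k+1},\dots,f_n)$ for $0<k<n$, $(d^n\Phi)(f_1,\dots,f_n)=\Phi(f_1,\dots,f_{n-1})f_n$, and codegeneracy maps $(s^k\Phi)(f_1,\dots,f_n)=\Phi(f_1,\dots,f_k,1,f_{k+1},\dots,f_n)$. $G_{\mathrm{conj}}$ is $G$ with the action of $G$ by conjugation. $\mathrm{E}G\to\star$ is a free resolution of the point, i.e. $\mathrm{E}G$ is a contractible space with free $G$-action. $\mathrm{Map}_G$ denotes the space of $G$-equivariant maps. *)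

theory Defs
  imports "HOL-Algebra.Group_Action"
begin

section \<open>Simplicial sets\<close>

text \<open>
  A simplicial set is given by its sets of simplices, its faces
  \<open>Face X n i : X_n \<rightarrow> X_(n-1)\<close> (for \<open>n > 0\<close>, \<open>i \<le> n\<close>) and its degeneracies
  \<open>Degen X n i : X_n \<rightarrow> X_(n+1)\<close> (for \<open>i \<le> n\<close>).
  The first index is always the dimension of the argument.
\<close>

record 'a sset =
  Simp :: "nat \<Rightarrow> 'a set"
  Face :: "nat \<Rightarrow> nat \<Rightarrow> 'a \<Rightarrow> 'a"
  Degen :: "nat \<Rightarrow> nat \<Rightarrow> 'a \<Rightarrow> 'a"

locale simplicial_set =
  fixes X :: "'a sset"
  assumes face_closed:
      "\<And>n i x. x \<in> Simp X (Suc n) \<Longrightarrow> i \<le> Suc n \<Longrightarrow> Face X (Suc n) i x \<in> Simp X n"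
    and degen_closed:
      "\<And>n i x. x \<in> Simp X n \<Longrightarrow> i \<le> n \<Longrightarrow> Degen X n i x \<in> Simp X (Suc n)"
    and face_face:
      "\<And>n i j x. x \<in> Simp X (Suc (Suc n)) \<Longrightarrow> i < j \<Longrightarrow> j \<le> Suc (Suc n) \<Longrightarrow>
        Face X (Suc n) i (Face X (Suc (Suc n)) j x)
          = Face X (Suc n) (j - 1) (Face X (Suc (Suc n)) i x)"
    and degen_degen:
      "\<And>n i j x. x \<in> Simp X n \<Longrightarrow> i \<le> j \<Longrightarrow> j \<le> n \<Longrightarrow>
        Degen X (Suc n) i (Degen X n j x) = Degen X (Suc n) (Suc j) (Degen X n i x)"
    and face_degen_less:
      "\<And>n i j x. x \<in> Simp X (Suc n) \<Longrightarrow> i < j \<Longrightarrow> j \<le> Suc n \<Longrightarrow>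
        Face X (Suc (Suc n)) i (Degen X (Suc n) j x) = Degen X n (j - 1) (Face X (Suc n) i x)"
    and face_degen_eq:
      "\<And>n i j x. x \<in> Simp X n \<Longrightarrow> j \<le> n \<Longrightarrow> i = j \<or> i = Suc j \<Longrightarrow>
        Face X (Suc n) i (Degen X n j x) = x"
    and face_degen_greater:
      "\<And>n i j x. x \<in> Simp X (Suc n) \<Longrightarrow> Suc j < i \<Longrightarrow> i \<le> Suc (Suc n) \<Longrightarrow>
        Face X (Suc (Suc n)) i (Degen X (Suc n) j x) = Degen X n j (Face X (Suc n) (i - 1) x)"

text \<open>
  Simplicial maps are extensional, so that equality of maps is equality in HOL and the simplices
  of a mapping space are not counted with multiplicity.
\<close>

definition smap :: "'a sset \<Rightarrow> 'b sset \<Rightarrow> (nat \<Rightarrow> 'a \<Rightarrow> 'b) set" where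
  "smap X Y = {f.
     (\<forall>n. f n \<in> Simp X n \<rightarrow>\<^sub>E Simp Y n) \<and>
     (\<forall>n. \<forall>x\<in>Simp X (Suc n). \<forall>i\<le>Suc n. f n (Face X (Suc n) i x) = Face Y (Suc n) i (f (Suc n) x)) \<and>
     (\<forall>n. \<forall>x\<in>Simp X n. \<forall>i\<le>n. f (Suc n) (Degen X n i x) = Degen Y n i (f n x))}"

definition sid :: "'a sset \<Rightarrow> nat \<Rightarrow> 'a \<Rightarrow> 'a" where
  "sid X = (\<lambda>n. \<lambda>x\<in>Simp X n. x)"

definition scomp :: "'a sset \<Rightarrow> (nat \<Rightarrow> 'b \<Rightarrow> 'c) \<Rightarrow> (nat \<Rightarrow> 'a \<Rightarrow> 'b) \<Rightarrow> nat \<Rightarrow> 'a \<Rightarrow> 'c" where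
  "scomp X g f = (\<lambda>n. compose (Simp X n) (g n) (f n))"

definition point :: "unit sset" where
  "point = \<lparr>Simp = (\<lambda>n. {()}), Face = (\<lambda>n i x. x), Degen = (\<lambda>n i x. x)\<rparr>"

definition prod_sset :: "'a sset \<Rightarrow> 'b sset \<Rightarrow> ('a \<times> 'b) sset"  (infixr \<open>\<times>\<^sub>s\<close> 80) where
  "X \<times>\<^sub>s Y = \<lparr>Simp = (\<lambda>n. Simp X n \<times> Simp Y n),
     Face = (\<lambda>n i. map_prod (Face X n i) (Face Y n i)),
     Degen = (\<lambda>n i. map_prod (Degen X n i) (Degen Y n i))\<rparr>"

text \<open>The \<open>p\<close>-fold power \<open>X^p\<close>, whose \<open>n\<close>-simplices are the lists of length \<open>p\<close> over \<open>X_n\<close>.\<close>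

definition pow_sset :: "'a sset \<Rightarrow> nat \<Rightarrow> 'a list sset" where
  "pow_sset X p = \<lparr>Simp = (\<lambda>n. {xs. length xs = p \<and> set xs \<subseteq> Simp X n}),
     Face = (\<lambda>n i. map (Face X n i)),
     Degen = (\<lambda>n i. map (Degen X n i))\<rparr>"

text \<open>
  An \<open>m\<close>-simplex of the standard simplex \<open>\<Delta>^n\<close> is a monotone map \<open>[m] \<rightarrow> [n]\<close>, written as the
  list of its \<open>m + 1\<close> values. Precomposition with the \<open>i\<close>-th coface (codegeneracy) of the simplex
  category deletes (repeats) the \<open>i\<close>-th entry; postcomposition is \<open>map\<close>.
\<close>

definition std_simplex :: "nat \<Rightarrow> nat list sset"  (\<open>\<Delta>\<close>) where
  "\<Delta> n = \<lparr>Simp = (\<lambda>m. {xs. length xs = Suc m \<and> sorted xs \<and> set xs \<subseteq> {..n}}),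
     Face = (\<lambda>m i xs. take i xs @ drop (Suc i) xs),
     Degen = (\<lambda>m i xs. take (Suc i) xs @ drop i xs)\<rparr>"

definition \<delta> :: "nat \<Rightarrow> nat \<Rightarrow> nat" where
  "\<delta> i j = (if j < i then j else Suc j)"

definition \<sigma> :: "nat \<Rightarrow> nat \<Rightarrow> nat" where
  "\<sigma> i j = (if j \<le> i then j else j - 1)"

text \<open>
  \<open>Map(X, Y)_n = Mor(\<Delta>^n \<times> X, Y)\<close>. The operators \<open>pre_face\<close> and \<open>pre_degen\<close> precompose with
  \<open>\<delta>^i \<times> X : \<Delta>^(n-1) \<times> X \<rightarrow> \<Delta>^n \<times> X\<close> and \<open>\<sigma>^i \<times> X : \<Delta>^(n+1) \<times> X \<rightarrow> \<Delta>^n \<times> X\<close>.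
\<close>

definition pre_face :: "'a sset \<Rightarrow> nat \<Rightarrow> nat \<Rightarrow>
    (nat \<Rightarrow> nat list \<times> 'a \<Rightarrow> 'b) \<Rightarrow> nat \<Rightarrow> nat list \<times> 'a \<Rightarrow> 'b" where
  "pre_face X n i \<phi> = (\<lambda>m. \<lambda>(s, x)\<in>Simp (\<Delta> (n - 1) \<times>\<^sub>s X) m. \<phi> m (map (\<delta> i) s, x))"

definition pre_degen :: "'a sset \<Rightarrow> nat \<Rightarrow> nat \<Rightarrow>
    (nat \<Rightarrow> nat list \<times> 'a \<Rightarrow> 'b) \<Rightarrow> nat \<Rightarrow> nat list \<times> 'a \<Rightarrow> 'b" where
  "pre_degen X n i \<phi> = (\<lambda>m. \<lambda>(s, x)\<in>Simp (\<Delta> (Suc n) \<times>\<^sub>s X) m. \<phi> m (map (\<sigma> i) s, x))"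

definition mapping_space :: "'a sset \<Rightarrow> 'b sset \<Rightarrow> (nat \<Rightarrow> nat list \<times> 'a \<Rightarrow> 'b) sset" where
  "mapping_space X Y = \<lparr>Simp = (\<lambda>n. smap (\<Delta> n \<times>\<^sub>s X) Y), Face = pre_face X, Degen = pre_degen X\<rparr>"


section \<open>Homotopy\<close>

definition elementary_homotopic ::
    "'a sset \<Rightarrow> 'b sset \<Rightarrow> (nat \<Rightarrow> 'a \<Rightarrow> 'b) \<Rightarrow> (nat \<Rightarrow> 'a \<Rightarrow> 'b) \<Rightarrow> bool" where
  "elementary_homotopic X Y f g \<longleftrightarrow>
     (\<exists>H\<in>smap (\<Delta> 1 \<times>\<^sub>s X) Y. \<forall>n. \<forall>x\<in>Simp X n.
        H n (replicate (Suc n) 0, x) = f n x \<and> H n (replicate (Suc n) 1, x) = g n x)"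

text \<open>
  Two maps are homotopic if they lie in the same component of the mapping space; if \<open>Y\<close> is a Kan
  complex, a single elementary homotopy suffices.
\<close>

definition homotopic_maps ::
    "'a sset \<Rightarrow> 'b sset \<Rightarrow> (nat \<Rightarrow> 'a \<Rightarrow> 'b) \<Rightarrow> (nat \<Rightarrow> 'a \<Rightarrow> 'b) \<Rightarrow> bool" where
  "homotopic_maps X Y = equivclp (\<lambda>f g. f \<in> smap X Y \<and> g \<in> smap X Y \<and> elementary_homotopic X Y f g)"

definition homotopy_equivalent :: "'a sset \<Rightarrow> 'b sset \<Rightarrow> bool"  (infix \<open>\<simeq>\<^sub>s\<close> 50) where
  "X \<simeq>\<^sub>s Y \<longleftrightarrow> (\<exists>f\<in>smap X Y. \<exists>g\<in>smap Y X.
     homotopic_maps X X (scomp X g f) (sid X) \<and> homotopic_maps Y Y (scomp Y f g) (sid Y))"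

text \<open>Every horn has a filler; a horn is the family \<open>x i\<close>, \<open>i \<noteq> k\<close>, of its faces.\<close>

definition kan_complex :: "'a sset \<Rightarrow> bool" where
  "kan_complex K \<longleftrightarrow> simplicial_set K \<and>
     (\<forall>n k x. k \<le> Suc n \<longrightarrow>
        (\<forall>i\<le>Suc n. i \<noteq> k \<longrightarrow> x i \<in> Simp K n) \<longrightarrow>
        (\<forall>i j. i < j \<longrightarrow> j \<le> Suc n \<longrightarrow> i \<noteq> k \<longrightarrow> j \<noteq> k \<longrightarrow> 0 < n \<longrightarrow>
           Face K n i (x j) = Face K n (j - 1) (x i)) \<longrightarrow>
        (\<exists>y\<in>Simp K (Suc n). \<forall>i\<le>Suc n. i \<noteq> k \<longrightarrow> Face K (Suc n) i y = x i))"

text \<open>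
  A map \<open>f : X \<rightarrow> Y\<close> is a weak equivalence if it induces a bijection
  \<open>\<pi>\<^sub>0 Map(Y, K) \<rightarrow> \<pi>\<^sub>0 Map(X, K)\<close> for every Kan complex \<open>K\<close>. A definition cannot quantify
  over types, so \<open>K\<close> ranges over the Kan complexes with simplices in \<open>('a + 'b) list\<close>. This is no
  restriction: that type is infinite and at least as large as \<open>'a\<close> and \<open>'b\<close>, and in an
  arbitrary Kan complex the image of countably many maps and homotopies out of \<open>X\<close> and \<open>Y\<close> lies in
  a Kan subcomplex which, closing up under chosen horn fillers, has at most that many simplices.
\<close>

definition weak_equivalence :: "'a sset \<Rightarrow> 'b sset \<Rightarrow> (nat \<Rightarrow> 'a \<Rightarrow> 'b) \<Rightarrow> bool" where
  "weak_equivalence X Y f \<longleftrightarrow> f \<in> smap X Y \<and>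
     (\<forall>K :: ('a + 'b) list sset. kan_complex K \<longrightarrow>
        (\<forall>h\<in>smap X K. \<exists>g\<in>smap Y K. homotopic_maps X K (scomp X g f) h) \<and>
        (\<forall>g\<in>smap Y K. \<forall>g'\<in>smap Y K.
           homotopic_maps X K (scomp X g f) (scomp X g' f) \<longrightarrow> homotopic_maps Y K g g'))"

definition contractible :: "'a sset \<Rightarrow> bool" where
  "contractible X \<longleftrightarrow> simplicial_set X \<and> weak_equivalence X point (\<lambda>n. \<lambda>x\<in>Simp X n. ())"


section \<open>Simplicial groups and their actions\<close>

record 'g sgroup =
  Lev :: "nat \<Rightarrow> 'g monoid"
  GFace :: "nat \<Rightarrow> nat \<Rightarrow> 'g \<Rightarrow> 'g"
  GDegen :: "nat \<Rightarrow> nat \<Rightarrow> 'g \<Rightarrow> 'g"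

definition under :: "'g sgroup \<Rightarrow> 'g sset" where
  "under G = \<lparr>Simp = (\<lambda>n. carrier (Lev G n)), Face = GFace G, Degen = GDegen G\<rparr>"

locale simplicial_group =
  fixes G :: "'g sgroup"
  assumes under_simplicial: "simplicial_set (under G)"
    and group_level: "\<And>n. group (Lev G n)"
    and face_hom: "\<And>n i. i \<le> Suc n \<Longrightarrow> GFace G (Suc n) i \<in> hom (Lev G (Suc n)) (Lev G n)"
    and degen_hom: "\<And>n i. i \<le> n \<Longrightarrow> GDegen G n i \<in> hom (Lev G n) (Lev G (Suc n))"

locale simplicial_action =
  fixes G :: "'g sgroup" and X :: "'a sset" and \<alpha> :: "nat \<Rightarrow> 'g \<Rightarrow> 'a \<Rightarrow> 'a"
  assumes space: "simplicial_set X"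
    and action_level: "\<And>n. group_action (Lev G n) (Simp X n) (\<alpha> n)"
    and action_face: "\<And>n i g x. g \<in> carrier (Lev G (Suc n)) \<Longrightarrow> x \<in> Simp X (Suc n) \<Longrightarrow> i \<le> Suc n \<Longrightarrow>
        Face X (Suc n) i (\<alpha> (Suc n) g x) = \<alpha> n (GFace G (Suc n) i g) (Face X (Suc n) i x)"
    and action_degen: "\<And>n i g x. g \<in> carrier (Lev G n) \<Longrightarrow> x \<in> Simp X n \<Longrightarrow> i \<le> n \<Longrightarrow>
        Degen X n i (\<alpha> n g x) = \<alpha> (Suc n) (GDegen G n i g) (Degen X n i x)"

locale free_action = simplicial_action +
  assumes free: "\<And>n x. x \<in> Simp X n \<Longrightarrow> stabilizer (Lev G n) (\<alpha> n) x = {\<one>\<^bsub>Lev G n\<^esub>}"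

locale free_resolution = free_action +
  assumes contractible: "contractible X"

definition conj_action :: "'g sgroup \<Rightarrow> nat \<Rightarrow> 'g \<Rightarrow> 'g \<Rightarrow> 'g" where
  "conj_action G n g = (\<lambda>h\<in>carrier (Lev G n). g \<otimes>\<^bsub>Lev G n\<^esub> h \<otimes>\<^bsub>Lev G n\<^esub> inv\<^bsub>Lev G n\<^esub> g)"

text \<open>\<open>Map_G(X, Y)\<close>, where \<open>G\<close> acts trivially on the factor \<open>\<Delta>^n\<close> of \<open>\<Delta>^n \<times> X\<close>.\<close>

definition equivariant_mapping_space ::
    "'g sgroup \<Rightarrow> 'a sset \<Rightarrow> (nat \<Rightarrow> 'g \<Rightarrow> 'a \<Rightarrow> 'a) \<Rightarrow> 'b sset \<Rightarrow> (nat \<Rightarrow> 'g \<Rightarrow> 'b \<Rightarrow> 'b) \<Rightarrow>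
      (nat \<Rightarrow> nat list \<times> 'a \<Rightarrow> 'b) sset" where
  "equivariant_mapping_space G X \<alpha> Y \<beta> = \<lparr>
     Simp = (\<lambda>n. {\<phi> \<in> smap (\<Delta> n \<times>\<^sub>s X) Y.
       \<forall>m. \<forall>g\<in>carrier (Lev G m). \<forall>s\<in>Simp (\<Delta> n) m. \<forall>x\<in>Simp X m.
         \<phi> m (s, \<alpha> m g x) = \<beta> m g (\<phi> m (s, x))}),
     Face = pre_face X, Degen = pre_degen X\<rparr>"


section \<open>Totalization and the homotopy coherent center\<close>

text \<open>
  A cosimplicial space is given by spaces \<open>Obj C p\<close>, cofaces
  \<open>Coface C p k : Obj C p \<rightarrow> Obj C (p + 1)\<close> for \<open>k \<le> p + 1\<close> and codegeneracies
  \<open>Codegen C p k : Obj C (p + 1) \<rightarrow> Obj C p\<close> for \<open>k \<le> p\<close>.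
\<close>

record 'a cosimp =
  Obj :: "nat \<Rightarrow> 'a sset"
  Coface :: "nat \<Rightarrow> nat \<Rightarrow> nat \<Rightarrow> 'a \<Rightarrow> 'a"
  Codegen :: "nat \<Rightarrow> nat \<Rightarrow> nat \<Rightarrow> 'a \<Rightarrow> 'a"

text \<open>
  The \<open>n\<close>-simplices of \<open>Tot C\<close> are the maps \<open>\<Delta>^n \<times> \<Delta>^\<bullet> \<rightarrow> C\<close> of cosimplicial spaces.
\<close>

definition Tot :: "'a cosimp \<Rightarrow> (nat \<Rightarrow> nat \<Rightarrow> nat list \<times> nat list \<Rightarrow> 'a) sset" where
  "Tot C = \<lparr>
     Simp = (\<lambda>n. {\<phi>.
       (\<forall>p. \<phi> p \<in> smap (\<Delta> n \<times>\<^sub>s \<Delta> p) (Obj C p)) \<and>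
       (\<forall>p. \<forall>k\<le>Suc p. \<forall>m. \<forall>s\<in>Simp (\<Delta> n) m. \<forall>t\<in>Simp (\<Delta> p) m.
          \<phi> (Suc p) m (s, map (\<delta> k) t) = Coface C p k m (\<phi> p m (s, t))) \<and>
       (\<forall>p. \<forall>k\<le>p. \<forall>m. \<forall>s\<in>Simp (\<Delta> n) m. \<forall>t\<in>Simp (\<Delta> (Suc p)) m.
          \<phi> p m (s, map (\<sigma> k) t) = Codegen C p k m (\<phi> (Suc p) m (s, t)))}),
     Face = (\<lambda>n i \<phi> p. pre_face (\<Delta> p) n i (\<phi> p)),
     Degen = (\<lambda>n i \<phi> p. pre_degen (\<Delta> p) n i (\<phi> p))\<rparr>"

text \<open>
  The cosimplicial space \<open>\<Pi>^\<bullet> G\<close>. An \<open>m\<close>-simplex \<open>\<Phi>\<close> of \<open>\<Pi>^p G = Map(G^p, G)\<close> is a map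
  \<open>\<Delta>^m \<times> G^p \<rightarrow> G\<close>, and the formulas are applied in each simplicial degree \<open>q\<close>; entries of
  the lists \<open>fs\<close> are numbered from 0.
\<close>

definition Pi_coface :: "'g sgroup \<Rightarrow> nat \<Rightarrow> nat \<Rightarrow> nat \<Rightarrow>
    (nat \<Rightarrow> nat list \<times> 'g list \<Rightarrow> 'g) \<Rightarrow> nat \<Rightarrow> nat list \<times> 'g list \<Rightarrow> 'g" where
  "Pi_coface G p k m \<Phi> = (\<lambda>q. \<lambda>(s, fs)\<in>Simp (\<Delta> m \<times>\<^sub>s pow_sset (under G) (Suc p)) q.
     if k = 0 then hd fs \<otimes>\<^bsub>Lev G q\<^esub> \<Phi> q (s, tl fs)
     else if k = Suc p then \<Phi> q (s, butlast fs) \<otimes>\<^bsub>Lev G q\<^esub> last fs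
     else \<Phi> q (s, take (k - 1) fs @ [fs ! (k - 1) \<otimes>\<^bsub>Lev G q\<^esub> fs ! k] @ drop (Suc k) fs))"

definition Pi_codegen :: "'g sgroup \<Rightarrow> nat \<Rightarrow> nat \<Rightarrow> nat \<Rightarrow>
    (nat \<Rightarrow> nat list \<times> 'g list \<Rightarrow> 'g) \<Rightarrow> nat \<Rightarrow> nat list \<times> 'g list \<Rightarrow> 'g" where
  "Pi_codegen G p k m \<Phi> = (\<lambda>q. \<lambda>(s, fs)\<in>Simp (\<Delta> m \<times>\<^sub>s pow_sset (under G) p) q.
     \<Phi> q (s, take k fs @ [\<one>\<^bsub>Lev G q\<^esub>] @ drop k fs))"

definition Pi_cosimp :: "'g sgroup \<Rightarrow> (nat \<Rightarrow> nat list \<times> 'g list \<Rightarrow> 'g) cosimp" where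
  "Pi_cosimp G = \<lparr>
     Obj = (\<lambda>p. mapping_space (pow_sset (under G) p) (under G)),
     Coface = Pi_coface G,
     Codegen = Pi_codegen G\<rparr>"

definition homotopy_coherent_center ::
    "'g sgroup \<Rightarrow> (nat \<Rightarrow> nat \<Rightarrow> nat list \<times> nat list \<Rightarrow> nat \<Rightarrow> nat list \<times> 'g list \<Rightarrow> 'g) sset" where
  "homotopy_coherent_center G = Tot (Pi_cosimp G)"

end

theory Submission
  imports Defs "HOL-Algebra.Generated_Groups"
begin

text \<open>
  The theorem holds on the nose for one free resolution of the point, the bar construction \<open>bar G\<close>: an
  \<open>m\<close>-simplex is a list \<open>[g_0, \<dots>, g_m]\<close> over \<open>G_m\<close>, on which \<open>G\<close> acts by left multiplication. An
  equivariant map \<open>\<chi>\<close> from \<open>bar G\<close> to \<open>G_conj\<close> is determined by its values on the lists that start with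
  \<open>1\<close>, that is, on lists of partial products, and
  \<open>\<Phi>(f_1, \<dots>, f_p) = \<chi>[1, f_1, f_1 f_2, \<dots>, f_1 \<cdots> f_p] \<cdot> f_1 \<cdots> f_p\<close>
  are the components of a map from \<open>\<Delta>^\<bullet>\<close> to \<open>\<Pi>^\<bullet> G\<close>: leaving out \<open>g_i\<close> multiplies two adjacent arguments,
  and the factor on the right turns conjugation into the one-sided multiplications that occur in the
  outer cofaces. This identifies \<open>Map_G(bar G, G_conj)\<close> with the homotopy coherent center
  (\<open>center_equivalent_bar\<close>).

  It remains to compare \<open>Map_G(X, G_conj)\<close> for different free resolutions \<open>X\<close>
  (\<open>mapping_space_free_resolution_independent\<close>). Two of them, \<open>X\<close> and \<open>Y\<close>, are compared with \<open>X \<times> Y\<close>, so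
  the point is that for a free space \<open>X\<close> and a contractible \<open>G\<close>-space \<open>C\<close> the projection \<open>X \<times> C \<rightarrow> X\<close>
  induces an equivalence (\<open>mapping_space_times_contractible\<close>). An equivariant map \<open>X \<times> C \<rightarrow> G\<close> is an
  equivariant map \<open>X \<rightarrow> Map(C, G)\<close>. It lifts to the space of those paths in \<open>Map(C, G)\<close> that end in a
  constant map, and such a lift is an equivariant homotopy to a map that does not depend on \<open>C\<close>
  (\<open>equivariant_path_extension\<close>). The lift is constructed simplex by simplex, with one choice for each
  free orbit (\<open>lift_exists\<close>). This requires that the evaluation of the paths at their starting points
  is a trivial Kan fibration (\<open>path_exists\<close>, \<open>path_extends\<close>).

  Here contractibility of \<open>C\<close> enters, which is a statement about homotopy classes of maps from \<open>C\<close> to Kan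
  complexes. Every simplicial group is a Kan complex (\<open>kan_complex_under\<close>), and so maps from \<open>C\<close> to
  simplicial groups are null-homotopic (\<open>contractible_imp_null_homotopic\<close>); this is applied to groups of
  maps into \<open>G\<close>. As the evaluation of paths is a homomorphism of simplicial groups, it suffices to know
  that it is surjective and that all cycles in its kernel bound (\<open>fill_boundary\<close>,
  \<open>paths_from_one_bounds\<close>).
\<close>

section \<open>Deleting and repeating entries of lists\<close>

text \<open>
  These are the faces and degeneracies of \<open>\<Delta> n\<close>, for lists over any type: they also act on the
  simplices of the bar construction.
\<close>

definition omit :: "nat \<Rightarrow> 'a list \<Rightarrow> 'a list" where
  "omit i xs = take i xs @ drop (Suc i) xs"

definition dup :: "nat \<Rightarrow> 'a list \<Rightarrow> 'a list" where
  "dup i xs = take (Suc i) xs @ drop i xs"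

lemma length_omit [simp]: "i < length xs \<Longrightarrow> length (omit i xs) = length xs - 1"
  and length_dup [simp]: "i < length xs \<Longrightarrow> length (dup i xs) = Suc (length xs)"
  by (auto simp: omit_def dup_def)

lemma nth_omit: "i < length xs \<Longrightarrow> j < length xs - 1 \<Longrightarrow> omit i xs ! j = xs ! \<delta> i j"
  by (auto simp: omit_def \<delta>_def nth_append)

lemma nth_dup:
  assumes "i < length xs" "j < Suc (length xs)"
  shows "dup i xs ! j = xs ! \<sigma> i j"
proof (cases "j \<le> i")
  case False
  then have "i + (j - Suc i) = j - 1" by simp
  then show ?thesis using assms False by (simp add: dup_def \<sigma>_def nth_append)
qed (use assms in \<open>auto simp: dup_def \<sigma>_def nth_append\<close>)

lemma map_omit: "map f (omit i xs) = omit i (map f xs)"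
  and map_dup: "map f (dup i xs) = dup i (map f xs)"
  by (simp_all add: omit_def dup_def take_map drop_map)

lemma set_omit_subset: "set (omit i xs) \<subseteq> set xs"
  by (auto simp: omit_def dest: in_set_takeD in_set_dropD)

lemma set_dup_subset: "set (dup i xs) \<subseteq> set xs"
  by (auto simp: dup_def dest: in_set_takeD in_set_dropD)

lemma \<sigma>_mono: "a \<le> b \<Longrightarrow> \<sigma> i a \<le> \<sigma> i b"
  by (auto simp: \<delta>_def \<sigma>_def)

lemma sorted_omit: "sorted xs \<Longrightarrow> i < length xs \<Longrightarrow> sorted (omit i xs)"
  unfolding sorted_iff_nth_mono
  by (intro allI impI) (simp add: nth_omit, simp add: \<delta>_def)

lemma sorted_dup: "sorted xs \<Longrightarrow> i < length xs \<Longrightarrow> sorted (dup i xs)"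
  unfolding sorted_iff_nth_mono
  by (intro allI impI) (simp add: nth_dup \<sigma>_mono, simp add: \<sigma>_def)

lemma omit_replicate_append:
  "omit i (replicate c j @ s) = (if i < c then replicate (c - 1) j @ s else replicate c j @ omit (i - c) s)"
proof (cases "i < c")
  case True
  then have "c - Suc i + i = c - 1" "min i c = i" by auto
  then show ?thesis using True
    by (simp add: omit_def append_assoc[symmetric] replicate_add[symmetric] add.commute del: append_assoc)
next
  case False
  then have "Suc i - c = Suc (i - c)" by auto
  then show ?thesis using False by (simp add: omit_def)
qed

lemma dup_replicate_append:
  "dup i (replicate c j @ s) = (if i < c then replicate (Suc c) j @ s else replicate c j @ dup (i - c) s)"
proof (cases "i < c")
  case True
  then have "Suc i + (c - i) = Suc c" by auto
  then show ?thesis using True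
    by (simp add: dup_def append_assoc[symmetric] replicate_add[symmetric] del: append_assoc replicate.simps)
next
  case False
  then have "Suc i - c = Suc (i - c)" by auto
  then show ?thesis using False by (simp add: dup_def)
qed

lemma sorted_split_least:
  assumes "sorted s" "\<forall>a\<in>set s. j \<le> a"
  obtains c s' where "s = replicate c j @ s'" "sorted s'" "\<forall>a\<in>set s'. Suc j \<le> a"
proof -
  let ?t = "takeWhile (\<lambda>a. a = j) s" and ?d = "dropWhile (\<lambda>a. a = j) s"
  have "replicate (length ?t) j = ?t"
    by (induction s) auto
  then have "s = replicate (length ?t) j @ ?d" by simp
  moreover have "\<forall>a\<in>set ?d. Suc j \<le> a"
    using assms by (induction s) (auto simp: le_less Suc_le_eq)
  ultimately show ?thesis using that sorted_dropWhile[OF assms(1)] by blast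
qed

section \<open>Simplices of the standard simplex as operators\<close>

lemma std_simplex_simps [simp]:
  "Simp (\<Delta> n) m = {xs. length xs = Suc m \<and> sorted xs \<and> set xs \<subseteq> {..n}}"
  "Face (\<Delta> n) m i = omit i"
  "Degen (\<Delta> n) m i = dup i"
  by (auto simp: std_simplex_def omit_def[abs_def] dup_def[abs_def])

lemma prod_sset_simps [simp]:
  "Simp (X \<times>\<^sub>s Y) n = Simp X n \<times> Simp Y n"
  "Face (X \<times>\<^sub>s Y) n i = map_prod (Face X n i) (Face Y n i)"
  "Degen (X \<times>\<^sub>s Y) n i = map_prod (Degen X n i) (Degen Y n i)"
  by (auto simp: prod_sset_def)

lemma omit_omit:
  assumes "i < j" "j < length xs"
  shows "omit i (omit j xs) = omit (j - 1) (omit i xs)"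
  using assms by (intro nth_equalityI) (auto simp: nth_omit \<delta>_def)

lemma dup_dup:
  assumes "i \<le> j" "j < length xs"
  shows "dup i (dup j xs) = dup (Suc j) (dup i xs)"
  using assms by (intro nth_equalityI) (auto simp: nth_dup \<sigma>_def)

lemma omit_dup_less:
  assumes "i < j" "j < length xs"
  shows "omit i (dup j xs) = dup (j - 1) (omit i xs)"
  using assms by (intro nth_equalityI) (auto simp: nth_dup nth_omit \<sigma>_def \<delta>_def)

lemma omit_dup_eq:
  assumes "i = j \<or> i = Suc j" "j < length xs"
  shows "omit i (dup j xs) = xs"
  using assms by (intro nth_equalityI) (auto simp: nth_dup nth_omit \<sigma>_def \<delta>_def)

lemma omit_dup_greater:
  assumes "Suc j < i" "i \<le> length xs"
  shows "omit i (dup j xs) = dup j (omit (i - 1) xs)"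
  using assms by (intro nth_equalityI) (auto simp: nth_dup nth_omit \<sigma>_def \<delta>_def)

lemma simplicial_set_std_simplex: "simplicial_set (\<Delta> n)"
proof
  fix m i x
  show "x \<in> Simp (\<Delta> n) (Suc m) \<Longrightarrow> i \<le> Suc m \<Longrightarrow> Face (\<Delta> n) (Suc m) i x \<in> Simp (\<Delta> n) m"
    using set_omit_subset[of i x] by (auto simp: sorted_omit)
  show "x \<in> Simp (\<Delta> n) m \<Longrightarrow> i \<le> m \<Longrightarrow> Degen (\<Delta> n) m i x \<in> Simp (\<Delta> n) (Suc m)"
    using set_dup_subset[of i x] by (auto simp: sorted_dup)
qed (auto simp del: One_nat_def intro: omit_omit dup_dup omit_dup_less omit_dup_eq omit_dup_greater)

lemma simplicial_set_prod:
  assumes "simplicial_set X" "simplicial_set Y"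
  shows "simplicial_set (X \<times>\<^sub>s Y)"
proof -
  interpret X: simplicial_set X by fact
  interpret Y: simplicial_set Y by fact
  show ?thesis
  proof
    fix n i x
    show "x \<in> Simp (X \<times>\<^sub>s Y) (Suc n) \<Longrightarrow> i \<le> Suc n \<Longrightarrow> Face (X \<times>\<^sub>s Y) (Suc n) i x \<in> Simp (X \<times>\<^sub>s Y) n"
      by (auto simp: X.face_closed Y.face_closed)
    show "x \<in> Simp (X \<times>\<^sub>s Y) n \<Longrightarrow> i \<le> n \<Longrightarrow> Degen (X \<times>\<^sub>s Y) n i x \<in> Simp (X \<times>\<^sub>s Y) (Suc n)"
      by (auto simp: X.degen_closed Y.degen_closed)
  qed (auto simp del: One_nat_def intro: X.face_face Y.face_face X.degen_degen Y.degen_degen X.face_degen_less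
      Y.face_degen_less X.face_degen_eq Y.face_degen_eq X.face_degen_greater Y.face_degen_greater)
qed


text \<open>
  An \<open>m\<close>-simplex \<open>s\<close> of \<open>\<Delta> k\<close> is a monotone map \<open>[m] \<rightarrow> [k]\<close>, so it acts on the
  \<open>k\<close>-simplices of every simplicial set. The action is computed by treating the values
  \<open>k, k - 1, \<dots>, 0\<close> in this order: a value that \<open>s\<close> misses is removed by a face operator, a value
  taken \<open>c\<close> times is repeated by \<open>c - 1\<close> degeneracies. Going downwards, the position of the value
  \<open>j\<close> is \<open>j\<close> itself when its turn comes. In \<open>opr X j n s\<close> the values below \<open>j\<close> are still untouched
  and \<open>n\<close> values, from \<open>j\<close> on, are to be treated.
\<close>

fun degens :: "'a sset \<Rightarrow> nat \<Rightarrow> nat \<Rightarrow> nat \<Rightarrow> 'a \<Rightarrow> 'a" where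
  "degens X d j 0 x = x"
| "degens X d j (Suc c) x = Degen X (d + c) j (degens X d j c x)"

definition block :: "'a sset \<Rightarrow> nat \<Rightarrow> nat \<Rightarrow> nat \<Rightarrow> 'a \<Rightarrow> 'a" where
  "block X d j c x = (if c = 0 then Face X d j x else degens X d j (c - 1) x)"

fun opr :: "'a sset \<Rightarrow> nat \<Rightarrow> nat \<Rightarrow> nat list \<Rightarrow> 'a \<Rightarrow> 'a" where
  "opr X j 0 s x = x"
| "opr X j (Suc n) s x =
     block X (j + length (dropWhile (\<lambda>a. a = j) s)) j (length (takeWhile (\<lambda>a. a = j) s))
       (opr X (Suc j) n (dropWhile (\<lambda>a. a = j) s) x)"

lemma opr_step:
  assumes "\<forall>a\<in>set s. Suc j \<le> a"
  shows "opr X j (Suc n) (replicate c j @ s) x =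
    block X (j + length s) j c (opr X (Suc j) n s x)"
proof -
  have "dropWhile (\<lambda>a. a = j) s = s" "takeWhile (\<lambda>a. a = j) s = []"
    using assms by (cases s; auto)+
  moreover have "dropWhile (\<lambda>a. a = j) (replicate c j @ s) = dropWhile (\<lambda>a. a = j) s"
      "takeWhile (\<lambda>a. a = j) (replicate c j @ s) = replicate c j @ takeWhile (\<lambda>a. a = j) s"
    by (induction c) auto
  ultimately show ?thesis by simp
qed

definition op :: "'a sset \<Rightarrow> nat \<Rightarrow> nat list \<Rightarrow> 'a \<Rightarrow> 'a" where
  "op X k s x = opr X 0 (Suc k) s x"

context simplicial_set
begin

lemma degens_closed: "x \<in> Simp X d \<Longrightarrow> j \<le> d \<Longrightarrow> degens X d j c x \<in> Simp X (d + c)"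
  by (induction c) (auto simp: degen_closed)

lemma face_degens_block:
  assumes "x \<in> Simp X d" "j \<le> d" "i \<le> Suc c"
  shows "Face X (Suc (d + c)) (j + i) (degens X d j (Suc c) x) = degens X d j c x"
  using assms(3)
proof (induction c arbitrary: i)
  case 0
  then have "i = 0 \<or> i = 1" by auto
  then show ?case using face_degen_eq[OF assms(1,2)] by auto
next
  case (Suc c)
  show ?case
  proof (cases "i \<le> 1")
    case True
    then have "i = 0 \<or> i = Suc 0" by auto
    then show ?thesis
      using face_degen_eq[OF degens_closed[OF assms(1,2), of "Suc c"], of j "j + i"] assms(2) by auto
  next
    case False
    then obtain i' where i: "i = Suc i'" "0 < i'" "i' \<le> Suc c" using Suc.prems by (cases i) auto
    have "Face X (Suc (d + Suc c)) (j + i) (degens X d j (Suc (Suc c)) x)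
      = Degen X (d + c) j (Face X (Suc (d + c)) (j + i') (degens X d j (Suc c) x))"
      using face_degen_greater[of "degens X d j (Suc c) x" "d + c" j "j + i"]
        degens_closed[OF assms(1,2), of "Suc c"] i assms(2) by simp
    also have "\<dots> = degens X d j (Suc c) x" using Suc.IH[OF i(3)] by simp
    finally show ?thesis .
  qed
qed

lemma face_degens_above:
  assumes "x \<in> Simp X (Suc d)" "j \<le> d" "0 < i" "j + i \<le> Suc d"
  shows "Face X (Suc (d + c)) (j + i + c) (degens X (Suc d) j c x) = degens X d j c (Face X (Suc d) (j + i) x)"
proof (induction c)
  case (Suc c)
  then show ?case
    using face_degen_greater[of "degens X (Suc d) j c x" "d + c" j "j + i + Suc c"]
      degens_closed[OF assms(1), of j c] assms by simp
qed simp

lemma degen_degens_block: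
  assumes "x \<in> Simp X d" "j \<le> d" "i \<le> c"
  shows "Degen X (d + c) (j + i) (degens X d j c x) = degens X d j (Suc c) x"
  using assms(3)
proof (induction c arbitrary: i)
  case (Suc c)
  show ?case
  proof (cases i)
    case (Suc i')
    have "Degen X (d + Suc c) (j + i) (degens X d j (Suc c) x)
      = Degen X (d + Suc c) j (Degen X (d + c) (j + i') (degens X d j c x))"
      using degen_degen[of "degens X d j c x" "d + c" j "j + i'"]
        degens_closed[OF assms(1,2), of c] Suc Suc.prems assms(2) by simp
    also have "\<dots> = degens X d j (Suc (Suc c)) x" using Suc.IH[of i'] Suc Suc.prems by simp
    finally show ?thesis .
  qed simp
qed simp

lemma degen_degens_above:
  assumes "x \<in> Simp X d" "j \<le> d" "0 < i" "j + i \<le> d"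
  shows "Degen X (d + c) (j + i + c) (degens X d j c x) = degens X (Suc d) j c (Degen X d (j + i) x)"
proof (induction c)
  case (Suc c)
  then show ?case
    using degen_degen[of "degens X d j c x" "d + c" j "j + i + c"]
      degens_closed[OF assms(1), of j c] assms by simp
qed simp

lemma opr_closed:
  assumes "sorted s" "set s \<subseteq> {j..<j + n}" "x \<in> Simp X (j + n - 1)" "0 < j + length s"
  shows "opr X j n s x \<in> Simp X (j + length s - 1)"
  using assms
proof (induction n arbitrary: j s)
  case (Suc n)
  have "\<forall>a\<in>set s. j \<le> a" using Suc.prems(2) by auto
  then obtain c s' where s: "s = replicate c j @ s'" "sorted s'" "\<forall>a\<in>set s'. Suc j \<le> a"
    by (rule sorted_split_least[OF Suc.prems(1)])
  have sub: "set s' \<subseteq> {Suc j..<Suc j + n}" using s Suc.prems(2) by auto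
  have y: "opr X (Suc j) n s' x \<in> Simp X (j + length s')"
    using Suc.IH[OF s(2) sub] Suc.prems by simp
  show ?case
  proof (cases "c = 0")
    case True
    then obtain d where "j + length s' = Suc d" using Suc.prems(4) s(1) by (cases "j + length s'") auto
    then show ?thesis using y face_closed[of _ d j] True opr_step[OF s(3), of X n 0 x]
      by (simp add: s(1) block_def del: opr.simps)
  next
    case False
    then show ?thesis using degens_closed[OF y, of j "c - 1"]
      by (simp add: s(1) opr_step[OF s(3)] block_def add.commute add.left_commute del: opr.simps)
  qed
qed auto

text \<open>
  The \<open>i\<close>-th entry of \<open>s\<close> lies in the block of some value. Inside this block the face cancels a
  degeneracy or, if the value occurs once, becomes the face that removes the value; with the other
  blocks it commutes up to a shift of the index.
\<close>

lemma face_opr: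
  assumes "sorted s" "set s \<subseteq> {j..<j + n}" "x \<in> Simp X (j + n - 1)" "1 < j + length s" "i < length s"
  shows "Face X (j + length s - 1) (j + i) (opr X j n s x) = opr X j n (omit i s) x"
  using assms
proof (induction n arbitrary: j s i)
  case (Suc n)
  have "\<forall>a\<in>set s. j \<le> a" using Suc.prems(2) by auto
  then obtain c s' where s: "s = replicate c j @ s'" "sorted s'" "\<forall>a\<in>set s'. Suc j \<le> a"
    by (rule sorted_split_least[OF Suc.prems(1)])
  have sub: "set s' \<subseteq> {Suc j..<Suc j + n}" using s Suc.prems(2) by auto
  have y: "opr X (Suc j) n s' x \<in> Simp X (j + length s')"
    using opr_closed[OF s(2) sub, of x] Suc.prems by simp
  have s'': "\<forall>a\<in>set (omit i' s'). Suc j \<le> a" for i' using s(3) set_omit_subset[of i' s'] by auto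
  show ?case
  proof (cases "i < c")
    case True
    show ?thesis
    proof (cases "c = 1")
      case True
      then have "s = replicate 1 j @ s'" "omit i s = s'" "i = 0"
        using \<open>i < c\<close> by (simp_all add: s(1) omit_def)
      then show ?thesis using opr_step[OF s(3), of X n 0 x] opr_step[OF s(3), of X n 1 x]
        by (simp add: block_def del: opr.simps)
    next
      case False
      then obtain c' where c: "c = Suc (Suc c')" using \<open>i < c\<close> by (cases c; cases "c - 1") auto
      have "length (replicate c j @ s') = Suc (Suc (c' + length s'))" by (simp add: c)
      then show ?thesis using \<open>i < c\<close> face_degens_block[OF y, of j i c']
        by (simp add: s(1) opr_step[OF s(3)] omit_replicate_append block_def c add.commute add.left_commute
            del: opr.simps replicate.simps)
    qed
  next
    case False
    then obtain i' where i: "i = c + i'" "i' < length s'"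
      using Suc.prems(5) s(1) by (metis add_diff_inverse_nat length_append length_replicate nat_add_left_cancel_less)
    have IH: "Face X (j + length s') (Suc j + i') (opr X (Suc j) n s' x) = opr X (Suc j) n (omit i' s') x"
      using Suc.IH[of s' "Suc j" i', OF s(2) sub] Suc.prems i by (cases "s' = []") simp_all
    have len: "length (omit i' s') = length s' - 1" using i by simp
    show ?thesis
    proof (cases c)
      case 0
      then obtain d where d: "j + length s' = Suc (Suc d)" using Suc.prems(4) s(1)
        by (cases "j + length s'"; cases "j + length s' - 1") auto
      have "Face X (Suc d) (j + i') (Face X (Suc (Suc d)) j (opr X (Suc j) n s' x))
        = Face X (Suc d) j (Face X (Suc (Suc d)) (Suc (j + i')) (opr X (Suc j) n s' x))"
        using face_face[of _ d j "Suc (j + i')"] y d i by simp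
      moreover have "j + (length s' - 1) = Suc d" using d i by auto
      ultimately show ?thesis using 0 i d IH opr_step[OF s''[of i'], of X n 0 x] len opr_step[OF s(3), of X n 0 x]
        by (simp add: s(1) block_def del: opr.simps)
    next
      case (Suc c')
      then obtain d where d: "j + length s' = Suc d" using i by (cases "j + length s'") auto
      have l: "j + (length s' - 1) = d" "j + (Suc (c' + length s') - 1) = Suc (d + c')" using d i by auto
      show ?thesis using Suc i d IH face_degens_above[of "opr X (Suc j) n s' x" d j "Suc i'" c'] y len l
        by (simp add: s(1) opr_step[OF s(3)] opr_step[OF s''] omit_replicate_append block_def
            add.commute add.left_commute del: opr.simps replicate.simps)
    qed
  qed
qed auto

lemma degen_opr:
  assumes "sorted s" "set s \<subseteq> {j..<j + n}" "x \<in> Simp X (j + n - 1)" "i < length s"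
  shows "Degen X (j + length s - 1) (j + i) (opr X j n s x) = opr X j n (dup i s) x"
  using assms
proof (induction n arbitrary: j s i)
  case (Suc n)
  have "\<forall>a\<in>set s. j \<le> a" using Suc.prems(2) by auto
  then obtain c s' where s: "s = replicate c j @ s'" "sorted s'" "\<forall>a\<in>set s'. Suc j \<le> a"
    by (rule sorted_split_least[OF Suc.prems(1)])
  have sub: "set s' \<subseteq> {Suc j..<Suc j + n}" using s Suc.prems(2) by auto
  have y: "opr X (Suc j) n s' x \<in> Simp X (j + length s')"
    using opr_closed[OF s(2) sub, of x] Suc.prems by simp
  have s'': "\<forall>a\<in>set (dup i' s'). Suc j \<le> a" for i' using s(3) set_dup_subset[of i' s'] by auto
  show ?case
  proof (cases "i < c")
    case True
    then obtain c' where c: "c = Suc c'" "i \<le> c'" by (cases c) auto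
    have "j + length s - 1 = j + length s' + c'" "j + (c' + length s') = j + length s' + c'"
      by (simp_all add: s(1) c)
    moreover have "dup i s = replicate (Suc c) j @ s'" using True by (simp add: s(1) dup_replicate_append del: replicate.simps)
    ultimately show ?thesis using degen_degens_block[OF y, of j i c'] c(2)
        opr_step[OF s(3), of X n c x] opr_step[OF s(3), of X n "Suc c" x]
      by (simp add: s(1)[symmetric] block_def c(1)[symmetric] del: opr.simps replicate.simps) (simp add: c(1) del: opr.simps)
  next
    case False
    then obtain i' where i: "i = c + i'" "i' < length s'"
      using Suc.prems(4) s(1) by (metis add_diff_inverse_nat length_append length_replicate nat_add_left_cancel_less)
    have IH: "Degen X (j + length s') (Suc j + i') (opr X (Suc j) n s' x) = opr X (Suc j) n (dup i' s') x"
      using Suc.IH[of s' "Suc j" i', OF s(2) sub] Suc.prems i by simp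
    have len: "length (dup i' s') = Suc (length s')" using i by simp
    show ?thesis
    proof (cases c)
      case 0
      obtain d where d: "j + length s' = Suc d" using i by (cases "j + length s'") auto
      have "Face X (Suc (Suc d)) j (Degen X (Suc d) (Suc (j + i')) (opr X (Suc j) n s' x))
        = Degen X d (j + i') (Face X (Suc d) j (opr X (Suc j) n s' x))"
        using face_degen_less[of _ d j "Suc (j + i')"] y d i by simp
      then show ?thesis using 0 i d IH opr_step[OF s''[of i'], of X n 0 x] len opr_step[OF s(3), of X n 0 x]
        by (simp add: s(1) block_def del: opr.simps)
    next
      case (Suc c')
      have l: "j + length s - 1 = j + length s' + c'" by (simp add: s(1) Suc)
      show ?thesis using Suc i IH degen_degens_above[OF y, of j "Suc i'" c'] len l
        by (simp add: s(1) opr_step[OF s(3)] opr_step[OF s''] dup_replicate_append block_def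
            add.commute add.left_commute del: opr.simps replicate.simps)
    qed
  qed
qed auto

end

lemma opr_upt: "opr X j n [j..<j + n] x = x"
proof (induction n arbitrary: j)
  case (Suc n)
  have "[j..<j + Suc n] = replicate 1 j @ [Suc j..<Suc j + n]"
    by (simp add: upt_rec)
  moreover have "opr X j (Suc n) (replicate 1 j @ [Suc j..<Suc j + n]) x = x"
    using Suc.IH[of "Suc j"] by (subst opr_step) (auto simp: block_def)
  ultimately show ?case by (simp only:)
qed simp

definition \<iota> :: "nat \<Rightarrow> nat list" where
  "\<iota> k = [0..<Suc k]"

lemma \<iota>_simps [simp]: "length (\<iota> k) = Suc k" "sorted (\<iota> k)" "set (\<iota> k) = {..k}" "distinct (\<iota> k)"
  unfolding \<iota>_def by (simp_all del: upt_Suc add: atLeast0LessThan lessThan_Suc_atMost)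

lemma nth_\<iota>: "i \<le> k \<Longrightarrow> \<iota> k ! i = i"
  unfolding \<iota>_def by (simp del: upt_Suc add: nth_upt)

lemma map_nth_\<iota>: "length s = Suc m \<Longrightarrow> map ((!) s) (\<iota> m) = s"
  using map_nth[of s] by (simp add: \<iota>_def)

lemma omit_\<iota>: "i \<le> Suc m \<Longrightarrow> omit i (\<iota> (Suc m)) = map (\<delta> i) (\<iota> m)"
  by (intro nth_equalityI) (auto simp: nth_omit nth_\<iota> \<delta>_def)

lemma dup_\<iota>: "i \<le> m \<Longrightarrow> dup i (\<iota> m) = map (\<sigma> i) (\<iota> (Suc m))"
  by (intro nth_equalityI) (auto simp: nth_dup nth_\<iota> \<sigma>_def)

lemma op_id [simp]: "op X k (\<iota> k) x = x"
  unfolding op_def using opr_upt[of X 0 "Suc k" x] by (simp add: \<iota>_def)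

lemma (in simplicial_set) op_closed:
  assumes "s \<in> Simp (\<Delta> k) m" "x \<in> Simp X k"
  shows "op X k s x \<in> Simp X m"
  using opr_closed[of s 0 "Suc k" x] assms unfolding op_def by fastforce

lemma (in simplicial_set) face_op:
  assumes "s \<in> Simp (\<Delta> k) (Suc m)" "x \<in> Simp X k" "i \<le> Suc m"
  shows "Face X (Suc m) i (op X k s x) = op X k (omit i s) x"
  using face_opr[of s 0 "Suc k" x i] assms unfolding op_def by fastforce

lemma (in simplicial_set) degen_op:
  assumes "s \<in> Simp (\<Delta> k) m" "x \<in> Simp X k" "i \<le> m"
  shows "Degen X m i (op X k s x) = op X k (dup i s) x"
  using degen_opr[of s 0 "Suc k" x i] assms unfolding op_def by fastforce

section \<open>Simplicial maps and the Yoneda lemma\<close>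

lemma smapD:
  assumes "f \<in> smap X Y"
  shows smap_closed: "x \<in> Simp X n \<Longrightarrow> f n x \<in> Simp Y n"
    and smap_undefined: "x \<notin> Simp X n \<Longrightarrow> f n x = undefined"
    and smap_face: "x \<in> Simp X (Suc n) \<Longrightarrow> i \<le> Suc n \<Longrightarrow> f n (Face X (Suc n) i x) = Face Y (Suc n) i (f (Suc n) x)"
    and smap_degen: "x \<in> Simp X n \<Longrightarrow> i \<le> n \<Longrightarrow> f (Suc n) (Degen X n i x) = Degen Y n i (f n x)"
  using assms unfolding smap_def by (auto simp: PiE_def extensional_def)

lemma smap_eqI:
  assumes "f \<in> smap X Y" "g \<in> smap X Y" "\<And>n x. x \<in> Simp X n \<Longrightarrow> f n x = g n x"
  shows "f = g"
proof (intro ext)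
  fix n x show "f n x = g n x"
    using assms smap_undefined[OF assms(1)] smap_undefined[OF assms(2)] by (cases "x \<in> Simp X n") auto
qed

definition restr :: "'a sset \<Rightarrow> (nat \<Rightarrow> 'a \<Rightarrow> 'b) \<Rightarrow> nat \<Rightarrow> 'a \<Rightarrow> 'b" where
  "restr X f = (\<lambda>n. restrict (f n) (Simp X n))"

lemma restr_apply: "x \<in> Simp X n \<Longrightarrow> restr X f n x = f n x"
  by (simp add: restr_def)

lemma restr_smap:
  assumes "simplicial_set X"
    and "\<And>n x. x \<in> Simp X n \<Longrightarrow> f n x \<in> Simp Y n"
    and "\<And>n x i. x \<in> Simp X (Suc n) \<Longrightarrow> i \<le> Suc n \<Longrightarrow> f n (Face X (Suc n) i x) = Face Y (Suc n) i (f (Suc n) x)"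
    and "\<And>n x i. x \<in> Simp X n \<Longrightarrow> i \<le> n \<Longrightarrow> f (Suc n) (Degen X n i x) = Degen Y n i (f n x)"
  shows "restr X f \<in> smap X Y"
  using assms simplicial_set.face_closed[OF assms(1)] simplicial_set.degen_closed[OF assms(1)]
  by (auto simp: smap_def restr_def)

text \<open>
  The standard simplex is generated by its top simplex: repeating entries of \<open>[0, \<dots>, k]\<close> and
  then deleting entries yields all monotone lists. Conversely, a list that misses a value is a face
  of a list that misses fewer, and a list that takes all values has a repetition or is
  \<open>[0, \<dots>, k]\<close> itself.
\<close>

lemma std_simplex_generated:
  assumes id: "Q k (\<iota> k)"
    and face: "\<And>m i s. Q (Suc m) s \<Longrightarrow> s \<in> Simp (\<Delta> k) (Suc m) \<Longrightarrow> i \<le> Suc m \<Longrightarrow> Q m (omit i s)"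
    and degen: "\<And>m i s. Q m s \<Longrightarrow> s \<in> Simp (\<Delta> k) m \<Longrightarrow> i \<le> m \<Longrightarrow> Q (Suc m) (dup i s)"
    and s: "s \<in> Simp (\<Delta> k) m"
  shows "Q m s"
proof -
  have onto: "Q m s" if "s \<in> Simp (\<Delta> k) m" "set s = {..k}" for s m
    using that
  proof (induction m arbitrary: s rule: less_induct)
    case (less m)
    show ?case
    proof (cases "distinct s")
      case True
      then have "s = \<iota> k"
        using less.prems sorted_distinct_set_unique[of s "\<iota> k"] by auto
      then show ?thesis using id less.prems by auto
    next
      case False
      then have "\<not> sorted_wrt (<) s" using strict_sorted_iff by blast
      then obtain i where i: "Suc i < length s" "\<not> s ! i < s ! Suc i"
        using sorted_wrt_iff_nth_Suc_transp[of "(<)" s] by auto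
      have "sorted s" using less.prems by auto
      then have eq: "s ! i = s ! Suc i" using i sorted_nth_mono[of s i "Suc i"] by auto
      obtain m' where m: "m = Suc m'" using i less.prems by (cases m) auto
      have dup: "dup i (omit i s) = s"
      proof (intro nth_equalityI)
        fix a assume "a < length (dup i (omit i s))"
        then have a: "a < length s" using i by simp
        consider "a < i" | "a = i" | "a = Suc i" | b where "a = Suc b" "i < b"
          by (metis linorder_neqE_nat not_less_eq less_SucE Suc_lessE)
        then show "dup i (omit i s) ! a = s ! a"
          using a i eq by cases (auto simp: nth_dup nth_omit \<delta>_def \<sigma>_def)
      qed (use i in simp)
      have "set s \<subseteq> set (omit i s)" using set_dup_subset[of i "omit i s"] dup by simp
      then have set: "set (omit i s) = {..k}" using set_omit_subset[of i s] less.prems(2) by auto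
      have mem: "omit i s \<in> Simp (\<Delta> k) m'"
        using less.prems i m set sorted_omit[of s i] by auto
      have "Q m' (omit i s)" using less.IH[of m' "omit i s"] m mem set by simp
      then show ?thesis using degen[OF _ mem, of i] dup m i less.prems by auto
    qed
  qed
  have "card ({..k} - set s) = c \<Longrightarrow> s \<in> Simp (\<Delta> k) m \<Longrightarrow> Q m s" for c
  proof (induction c arbitrary: s m)
    case 0
    then have "{..k} - set s = {}" by (simp only: card_0_eq finite_Diff finite_atMost)
    then show ?case using onto[OF 0(2)] 0(2) by auto
  next
    case (Suc c)
    then obtain a where a: "a \<le> k" "a \<notin> set s"
      by (metis Diff_iff atMost_iff card.empty ex_in_conv nat.distinct(1))
    define i where "i = length (filter (\<lambda>b. b < a) s)"
    define t where "t = insort a s"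
    have mem: "t \<in> Simp (\<Delta> k) (Suc m)"
      using Suc.prems a by (auto simp: t_def sorted_insort set_insort_key)
    have "sorted s \<Longrightarrow> a \<notin> set s \<Longrightarrow>
        omit (length (filter (\<lambda>b. b < a) s)) (insort a s) = s"
    proof (induction s)
      case (Cons b s)
      show ?case
      proof (cases "b < a")
        case True
        then show ?thesis using Cons by (auto simp: omit_def)
      next
        case False
        then have "filter (\<lambda>b. b < a) (b # s) = []" using Cons.prems by (auto simp: filter_empty_conv)
        then show ?thesis using False Cons.prems by (auto simp: omit_def)
      qed
    qed (simp add: omit_def)
    then have t: "omit i t = s" "i \<le> Suc m"
      using Suc.prems a length_filter_le[of "\<lambda>b. b < a" s] unfolding i_def t_def
      by (simp_all del: length_filter_le)
    have "{..k} - set s = insert a ({..k} - set t)" "a \<notin> {..k} - set t"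
      using a by (auto simp: t_def set_insort_key)
    then have "card ({..k} - set t) = c" using Suc.prems(1) by simp
    then show ?case using Suc.IH[OF _ mem] face[OF _ mem t(2)] t(1) by simp
  qed
  then show ?thesis using s by blast
qed

lemma smap_std_simplex_eq:
  assumes "f \<in> smap (\<Delta> k) Y" "g \<in> smap (\<Delta> k) Y" "f k (\<iota> k) = g k (\<iota> k)"
    and "s \<in> Simp (\<Delta> k) m"
  shows "f m s = g m s"
  using assms(4)
proof (rule std_simplex_generated[where Q = "\<lambda>m s. f m s = g m s", rotated 3])
  fix m i s assume s: "f (Suc m) s = g (Suc m) s" "s \<in> Simp (\<Delta> k) (Suc m)" "i \<le> Suc m"
  then show "f m (omit i s) = g m (omit i s)"
    using smap_face[OF assms(1) s(2,3)] smap_face[OF assms(2) s(2,3)] by simp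
next
  fix m i s assume s: "f m s = g m s" "s \<in> Simp (\<Delta> k) m" "i \<le> m"
  then show "f (Suc m) (dup i s) = g (Suc m) (dup i s)"
    using smap_degen[OF assms(1) s(2,3)] smap_degen[OF assms(2) s(2,3)] by simp
qed (fact assms(3))

lemma (in simplicial_set) op_smap:
  assumes "x \<in> Simp X k"
  shows "restr (\<Delta> k) (\<lambda>m s. op X k s x) \<in> smap (\<Delta> k) X"
  by (rule restr_smap[OF simplicial_set_std_simplex])
     (use op_closed face_op degen_op assms in auto)

lemma op_unique:
  assumes "simplicial_set X" "f \<in> smap (\<Delta> k) X" "s \<in> Simp (\<Delta> k) m"
  shows "f m s = op X k s (f k (\<iota> k))"
proof -
  interpret simplicial_set X by fact
  have id: "\<iota> k \<in> Simp (\<Delta> k) k" by simp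
  show ?thesis
    using smap_std_simplex_eq[OF assms(2) op_smap[OF smap_closed[OF assms(2) id]] _ assms(3)]
      restr_apply[OF id, of "\<lambda>m s. op X k s (f k (\<iota> k))"] restr_apply[OF assms(3)] by simp
qed

text \<open>
  The Yoneda lemma in the form in which it is applied: an expression that is simplicial in \<open>s\<close> is
  the action of \<open>s\<close> on its value at the identity. The rules for \<open>op\<close> below are instances.
\<close>

lemma op_unique':
  assumes "simplicial_set X"
    and "\<And>m s. s \<in> Simp (\<Delta> k) m \<Longrightarrow> f m s \<in> Simp X m"
    and "\<And>m s i. s \<in> Simp (\<Delta> k) (Suc m) \<Longrightarrow> i \<le> Suc m \<Longrightarrow> f m (omit i s) = Face X (Suc m) i (f (Suc m) s)"
    and "\<And>m s i. s \<in> Simp (\<Delta> k) m \<Longrightarrow> i \<le> m \<Longrightarrow> f (Suc m) (dup i s) = Degen X m i (f m s)"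
    and "s \<in> Simp (\<Delta> k) m"
  shows "f m s = op X k s (f k (\<iota> k))"
proof -
  have id: "\<iota> k \<in> Simp (\<Delta> k) k" by simp
  have "restr (\<Delta> k) f \<in> smap (\<Delta> k) X"
    by (rule restr_smap[OF simplicial_set_std_simplex]) (use assms(2-4) in auto)
  from op_unique[OF assms(1) this assms(5)] show ?thesis
    by (simp only: restr_apply[OF id] restr_apply[OF assms(5)])
qed

lemma op_prod:
  assumes "simplicial_set X" "simplicial_set Y" "x \<in> Simp X k" "y \<in> Simp Y k" "s \<in> Simp (\<Delta> k) m"
  shows "op (X \<times>\<^sub>s Y) k s (x, y) = (op X k s x, op Y k s y)"
proof -
  interpret X: simplicial_set X by fact
  interpret Y: simplicial_set Y by fact
  show ?thesis
    by (subst op_unique'[where X = "X \<times>\<^sub>s Y" and f = "\<lambda>m s. (op X k s x, op Y k s y)", OF simplicial_set_prod])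
       (use assms X.op_closed Y.op_closed X.face_op Y.face_op X.degen_op Y.degen_op in auto)
qed

lemma op_natural:
  assumes "simplicial_set X" "simplicial_set Y" "f \<in> smap X Y" "x \<in> Simp X k" "s \<in> Simp (\<Delta> k) m"
  shows "f m (op X k s x) = op Y k s (f k x)"
proof -
  interpret X: simplicial_set X by fact
  show ?thesis
    by (subst op_unique'[where f = "\<lambda>m s. f m (op X k s x)", OF assms(2)])
       (use assms X.op_closed smap_closed[OF assms(3)] smap_face[OF assms(3), symmetric]
          smap_degen[OF assms(3), symmetric] X.face_op X.degen_op in auto)
qed

lemma map_nth_simplex:
  assumes s: "s \<in> Simp (\<Delta> n) m" and t: "t \<in> Simp (\<Delta> m) r"
  shows "map ((!) s) t \<in> Simp (\<Delta> n) r"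
proof -
  have le: "a < length s" if "a \<in> set t" for a using s t that by fastforce
  have "sorted (map ((!) s) t)"
    unfolding sorted_map
    by (rule sorted_wrt_mono_rel[of _ "(\<le>)"]) (use s t le in \<open>auto intro: sorted_nth_mono\<close>)
  moreover have "set (map ((!) s) t) \<subseteq> set s" using le by auto
  ultimately show ?thesis using s t by auto
qed

lemma op_std_simplex:
  assumes "t \<in> Simp (\<Delta> n) k" "s \<in> Simp (\<Delta> k) m"
  shows "op (\<Delta> n) k s t = map ((!) t) s"
proof -
  have "map ((!) t) (\<iota> k) = t" using assms(1) map_nth_\<iota>[of t k] by simp
  then show ?thesis
    by (subst op_unique'[where f = "\<lambda>m s. map ((!) t) s", OF simplicial_set_std_simplex[of n] _ _ _ assms(2)])
       (use map_nth_simplex[OF assms(1)] in \<open>auto simp: map_omit map_dup\<close>)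
qed

lemma (in simplicial_set) op_op:
  assumes "x \<in> Simp X k" "s \<in> Simp (\<Delta> k) m" "t \<in> Simp (\<Delta> m) r"
  shows "op X m t (op X k s x) = op X k (map ((!) s) t) x"
proof -
  have "map ((!) s) (\<iota> m) = s" using assms(2) map_nth_\<iota>[of s m] by simp
  moreover have "op X k (map ((!) s) t) x = op X m t (op X k (map ((!) s) (\<iota> m)) x)"
    by (rule op_unique'[where f = "\<lambda>r t. op X k (map ((!) s) t) x", OF simplicial_set_axioms _ _ _ assms(3)])
       (use map_nth_simplex[OF assms(2)] assms(1) in \<open>auto simp: map_omit map_dup op_closed face_op degen_op\<close>)
  ultimately show ?thesis by simp
qed

section \<open>Homotopies and homotopy equivalences\<close>

lemma restr_prod_smap:
  assumes A: "simplicial_set A" and B: "simplicial_set B"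
    and "\<And>n a b. a \<in> Simp A n \<Longrightarrow> b \<in> Simp B n \<Longrightarrow> f n (a, b) \<in> Simp Y n"
    and "\<And>n i a b. a \<in> Simp A (Suc n) \<Longrightarrow> b \<in> Simp B (Suc n) \<Longrightarrow> i \<le> Suc n \<Longrightarrow>
      f n (Face A (Suc n) i a, Face B (Suc n) i b) = Face Y (Suc n) i (f (Suc n) (a, b))"
    and "\<And>n i a b. a \<in> Simp A n \<Longrightarrow> b \<in> Simp B n \<Longrightarrow> i \<le> n \<Longrightarrow>
      f (Suc n) (Degen A n i a, Degen B n i b) = Degen Y n i (f n (a, b))"
  shows "restr (A \<times>\<^sub>s B) f \<in> smap (A \<times>\<^sub>s B) Y"
  by (rule restr_smap[OF simplicial_set_prod[OF A B]]) (use assms(3-5) in auto)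

lemma smap_prodD:
  assumes "f \<in> smap (A \<times>\<^sub>s B) Y"
  shows smap_prod_closed: "a \<in> Simp A n \<Longrightarrow> b \<in> Simp B n \<Longrightarrow> f n (a, b) \<in> Simp Y n"
    and smap_prod_face: "a \<in> Simp A (Suc n) \<Longrightarrow> b \<in> Simp B (Suc n) \<Longrightarrow> i \<le> Suc n \<Longrightarrow>
      f n (Face A (Suc n) i a, Face B (Suc n) i b) = Face Y (Suc n) i (f (Suc n) (a, b))"
    and smap_prod_degen: "a \<in> Simp A n \<Longrightarrow> b \<in> Simp B n \<Longrightarrow> i \<le> n \<Longrightarrow>
      f (Suc n) (Degen A n i a, Degen B n i b) = Degen Y n i (f n (a, b))"
  using smap_closed[OF assms, of "(a, b)" n] smap_face[OF assms, of "(a, b)" n i]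
    smap_degen[OF assms, of "(a, b)" n i] by simp_all

lemma scomp_apply: "x \<in> Simp X n \<Longrightarrow> scomp X g f n x = g n (f n x)"
  by (simp add: scomp_def compose_def)

lemma sid_apply: "x \<in> Simp X n \<Longrightarrow> sid X n x = x"
  by (simp add: sid_def)

lemma scomp_smap:
  assumes X: "simplicial_set X" and f: "f \<in> smap X Y" and g: "g \<in> smap Y Z"
  shows "scomp X g f \<in> smap X Z"
proof -
  have "scomp X g f = restr X (\<lambda>n x. g n (f n x))"
    by (auto simp: scomp_def restr_def compose_def fun_eq_iff)
  then show ?thesis
    using restr_smap[OF X, of "\<lambda>n x. g n (f n x)" Z] smapD[OF f] smapD[OF g] by simp
qed

lemma sid_smap: "simplicial_set X \<Longrightarrow> sid X \<in> smap X X"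
  using restr_smap[of X "\<lambda>n x. x" X] unfolding sid_def restr_def by blast

lemma replicate_simplex [simp]: "a \<le> n \<Longrightarrow> replicate (Suc m) a \<in> Simp (\<Delta> n) m"
  by auto

lemma scomp_elementary_homotopic:
  assumes X: "simplicial_set X" and f: "f \<in> smap X Y" and g: "g \<in> smap X Y" and k: "k \<in> smap Y Z"
    and h: "elementary_homotopic X Y f g"
  shows "elementary_homotopic X Z (scomp X k f) (scomp X k g)"
proof -
  obtain H where H: "H \<in> smap (\<Delta> 1 \<times>\<^sub>s X) Y"
    "\<forall>n. \<forall>x\<in>Simp X n. H n (replicate (Suc n) 0, x) = f n x \<and> H n (replicate (Suc n) 1, x) = g n x"
    using h unfolding elementary_homotopic_def by blast
  have "scomp (\<Delta> 1 \<times>\<^sub>s X) k H \<in> smap (\<Delta> 1 \<times>\<^sub>s X) Z"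
    by (rule scomp_smap[OF simplicial_set_prod[OF simplicial_set_std_simplex X] H(1) k])
  moreover have "scomp (\<Delta> 1 \<times>\<^sub>s X) k H n (replicate (Suc n) a, x) = k n (H n (replicate (Suc n) a, x))"
    if "x \<in> Simp X n" "a \<le> 1" for n x a
    using that replicate_simplex[of a 1 n] by (intro scomp_apply) (simp del: std_simplex_simps)
  ultimately show ?thesis
    using H(2) unfolding elementary_homotopic_def
    by (intro bexI[of _ "scomp (\<Delta> 1 \<times>\<^sub>s X) k H"]) (simp_all add: scomp_apply del: replicate.simps)
qed

lemma elementary_homotopic_scomp:
  assumes W: "simplicial_set W" and k: "k \<in> smap W X" and h: "elementary_homotopic X Y f g"
  shows "elementary_homotopic W Y (scomp W f k) (scomp W g k)"
proof -
  obtain H where H: "H \<in> smap (\<Delta> 1 \<times>\<^sub>s X) Y"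
    "\<forall>n. \<forall>x\<in>Simp X n. H n (replicate (Suc n) 0, x) = f n x \<and> H n (replicate (Suc n) 1, x) = g n x"
    using h unfolding elementary_homotopic_def by blast
  let ?K = "restr (\<Delta> 1 \<times>\<^sub>s W) (\<lambda>n (t, x). H n (t, k n x))"
  have "?K \<in> smap (\<Delta> 1 \<times>\<^sub>s W) Y"
  proof (rule restr_smap[OF simplicial_set_prod[OF simplicial_set_std_simplex W]])
    fix n x i
    show "x \<in> Simp (\<Delta> 1 \<times>\<^sub>s W) n \<Longrightarrow> (case x of (t, x) \<Rightarrow> H n (t, k n x)) \<in> Simp Y n"
      using smap_closed[OF H(1)] smap_closed[OF k] by auto
    show "x \<in> Simp (\<Delta> 1 \<times>\<^sub>s W) (Suc n) \<Longrightarrow> i \<le> Suc n \<Longrightarrow>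
      (case Face (\<Delta> 1 \<times>\<^sub>s W) (Suc n) i x of (t, x) \<Rightarrow> H n (t, k n x)) =
        Face Y (Suc n) i (case x of (t, x) \<Rightarrow> H (Suc n) (t, k (Suc n) x))"
      using smap_closed[OF k] smap_face[OF H(1), of _ n i] smap_face[OF k] by force
    show "x \<in> Simp (\<Delta> 1 \<times>\<^sub>s W) n \<Longrightarrow> i \<le> n \<Longrightarrow>
      (case Degen (\<Delta> 1 \<times>\<^sub>s W) n i x of (t, x) \<Rightarrow> H (Suc n) (t, k (Suc n) x)) =
        Degen Y n i (case x of (t, x) \<Rightarrow> H n (t, k n x))"
      using smap_closed[OF k] smap_degen[OF H(1), of _ n i] smap_degen[OF k] by force
  qed
  moreover have "?K n (replicate (Suc n) a, x) = H n (replicate (Suc n) a, k n x)"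
    if "x \<in> Simp W n" "a \<le> 1" for n x a
    using that replicate_simplex[of a 1 n] by (subst restr_apply) (simp_all del: std_simplex_simps)
  ultimately show ?thesis
    using H(2) smap_closed[OF k] unfolding elementary_homotopic_def
    by (intro bexI[of _ ?K]) (simp_all add: scomp_apply del: replicate.simps)
qed

lemma homotopic_maps_refl: "homotopic_maps X Y f f"
  by (simp add: homotopic_maps_def)

lemma homotopic_maps_sym: "homotopic_maps X Y f g \<Longrightarrow> homotopic_maps X Y g f"
  unfolding homotopic_maps_def by (rule equivclp_sym)

lemma homotopic_maps_trans: "homotopic_maps X Y f g \<Longrightarrow> homotopic_maps X Y g h \<Longrightarrow> homotopic_maps X Y f h"
  unfolding homotopic_maps_def by (rule equivclp_trans)

lemma elementary_homotopic_imp_homotopic_maps: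
  "f \<in> smap X Y \<Longrightarrow> g \<in> smap X Y \<Longrightarrow> elementary_homotopic X Y f g \<Longrightarrow> homotopic_maps X Y f g"
  unfolding homotopic_maps_def by (simp add: r_into_equivclp)

lemma equivclp_map:
  assumes "equivclp R a b" "\<And>x y. R x y \<Longrightarrow> equivclp S (F x) (F y)"
  shows "equivclp S (F a) (F b)"
  using assms(1)
proof (induction rule: equivclp_induct)
  case (step y z)
  then show ?case using assms(2) by (metis equivclp_sym equivclp_trans)
qed simp

lemma scomp_homotopic_maps:
  assumes "simplicial_set X" "k \<in> smap Y Z" "homotopic_maps X Y f g"
  shows "homotopic_maps X Z (scomp X k f) (scomp X k g)"
  using assms(3) unfolding homotopic_maps_def
  by (rule equivclp_map) (use assms scomp_smap scomp_elementary_homotopic in \<open>blast intro: r_into_equivclp\<close>)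

lemma homotopic_maps_scomp:
  assumes "simplicial_set W" "k \<in> smap W X" "homotopic_maps X Y f g"
  shows "homotopic_maps W Y (scomp W f k) (scomp W g k)"
  using assms(3) unfolding homotopic_maps_def
  by (rule equivclp_map) (use assms scomp_smap elementary_homotopic_scomp in \<open>blast intro: r_into_equivclp\<close>)

lemma scomp_sid:
  assumes "f \<in> smap X Y"
  shows "scomp X f (sid X) = f"
  by (auto simp: scomp_def compose_def sid_def fun_eq_iff smap_undefined[OF assms] restrict_def)

lemma sid_scomp:
  assumes "f \<in> smap X Y"
  shows "scomp X (sid Y) f = f"
  by (auto simp: scomp_def compose_def sid_def fun_eq_iff smap_undefined[OF assms] smap_closed[OF assms] restrict_def)

lemma homotopy_equivalent_sym: "X \<simeq>\<^sub>s Y \<Longrightarrow> Y \<simeq>\<^sub>s X"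
  unfolding homotopy_equivalent_def by blast

lemma homotopy_equivalent_trans:
  assumes "simplicial_set X" "simplicial_set Y" "simplicial_set Z" "X \<simeq>\<^sub>s Y" "Y \<simeq>\<^sub>s Z"
  shows "X \<simeq>\<^sub>s Z"
proof -
  have half: "homotopic_maps X X (scomp X (scomp Z g g') (scomp X f' f)) (sid X)"
    if X: "simplicial_set X" and Y: "simplicial_set Y" and Z: "simplicial_set Z"
      and maps: "f \<in> smap X Y" "g \<in> smap Y X" "f' \<in> smap Y Z" "g' \<in> smap Z Y"
      and h: "homotopic_maps X X (scomp X g f) (sid X)" "homotopic_maps Y Y (scomp Y g' f') (sid Y)"
    for X :: "'x sset" and Y :: "'y sset" and Z :: "'z sset" and f g f' g'
  proof -
    have "scomp X (scomp Z g g') (scomp X f' f) = scomp X g (scomp X (scomp Y g' f') f)"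
      by (auto simp: scomp_def compose_def fun_eq_iff smap_closed[OF maps(1)] smap_closed[OF maps(3)])
    moreover have "homotopic_maps X X (scomp X g (scomp X (scomp Y g' f') f)) (scomp X g (scomp X (sid Y) f))"
      by (intro scomp_homotopic_maps[OF X maps(2)] homotopic_maps_scomp[OF X maps(1)] h(2))
    ultimately show ?thesis using h(1) sid_scomp[OF maps(1)] homotopic_maps_trans by metis
  qed
  obtain f g where fg: "f \<in> smap X Y" "g \<in> smap Y X" "homotopic_maps X X (scomp X g f) (sid X)"
    "homotopic_maps Y Y (scomp Y f g) (sid Y)" using assms(4) unfolding homotopy_equivalent_def by blast
  obtain f' g' where fg': "f' \<in> smap Y Z" "g' \<in> smap Z Y" "homotopic_maps Y Y (scomp Y g' f') (sid Y)"
    "homotopic_maps Z Z (scomp Z f' g') (sid Z)" using assms(5) unfolding homotopy_equivalent_def by blast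
  show ?thesis unfolding homotopy_equivalent_def
    by (intro bexI[of _ "scomp X f' f"] bexI[of _ "scomp Z g g'"] conjI
        half[OF assms(1-3) fg(1,2) fg'(1,2) fg(3) fg'(3)] half[OF assms(3,2,1) fg'(2,1) fg(2,1) fg'(4) fg(4)]
        scomp_smap[OF assms(1) fg(1) fg'(1)] scomp_smap[OF assms(3) fg'(2) fg(2)])
qed

lemma isomorphic_imp_homotopy_equivalent:
  assumes "f \<in> smap X Y" "g \<in> smap Y X"
    and "\<And>n x. x \<in> Simp X n \<Longrightarrow> g n (f n x) = x" "\<And>n y. y \<in> Simp Y n \<Longrightarrow> f n (g n y) = y"
  shows "X \<simeq>\<^sub>s Y"
proof -
  have "scomp X g f = sid X" "scomp Y f g = sid Y"
    using assms(3,4) by (auto simp: scomp_def compose_def sid_def fun_eq_iff)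
  then show ?thesis
    unfolding homotopy_equivalent_def using assms(1,2) homotopic_maps_refl by metis
qed

section \<open>Mapping spaces and the exponential law\<close>

text \<open>
  All mapping spaces below are subspaces of the mapping space \<open>Map(X, Y)\<close>. Their simplicial
  operators are precompositions with monotone maps \<open>u : [n'] \<rightarrow> [n]\<close>.
\<close>

definition pre :: "'a sset \<Rightarrow> nat \<Rightarrow> (nat \<Rightarrow> nat) \<Rightarrow>
    (nat \<Rightarrow> nat list \<times> 'a \<Rightarrow> 'b) \<Rightarrow> nat \<Rightarrow> nat list \<times> 'a \<Rightarrow> 'b" where
  "pre X n u \<phi> = (\<lambda>m. \<lambda>(s, x)\<in>Simp (\<Delta> n \<times>\<^sub>s X) m. \<phi> m (map u s, x))"

definition monotone_index :: "nat \<Rightarrow> nat \<Rightarrow> (nat \<Rightarrow> nat) \<Rightarrow> bool" where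
  "monotone_index n' n u \<longleftrightarrow> (\<forall>i j. i \<le> j \<longrightarrow> j \<le> n' \<longrightarrow> u i \<le> u j) \<and> u n' \<le> n"

lemma pre_face_eq: "pre_face X n i = pre X (n - 1) (\<delta> i)"
  and pre_degen_eq: "pre_degen X n i = pre X (Suc n) (\<sigma> i)"
  by (simp_all add: pre_face_def pre_degen_def pre_def fun_eq_iff)

lemma pre_apply: "s \<in> Simp (\<Delta> n) m \<Longrightarrow> x \<in> Simp X m \<Longrightarrow> pre X n u \<phi> m (s, x) = \<phi> m (map u s, x)"
  by (simp add: pre_def)

lemma monotone_index_\<delta>: "i \<le> Suc n \<Longrightarrow> monotone_index n (Suc n) (\<delta> i)"
  and monotone_index_\<sigma>: "i \<le> n \<Longrightarrow> monotone_index (Suc n) n (\<sigma> i)"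
  by (auto simp: monotone_index_def \<delta>_def \<sigma>_def)

lemma monotone_index_nth: "s \<in> Simp (\<Delta> n) m \<Longrightarrow> monotone_index m n ((!) s)"
  by (auto simp: monotone_index_def sorted_iff_nth_mono subset_iff)

lemma map_monotone_index:
  assumes "monotone_index n' n u" "s \<in> Simp (\<Delta> n') m"
  shows "map u s \<in> Simp (\<Delta> n) m"
proof -
  have "sorted (map u s)" unfolding sorted_map
    by (rule sorted_wrt_mono_rel[of _ "(\<le>)"]) (use assms in \<open>auto simp: monotone_index_def\<close>)
  moreover have "u a \<le> n" if "a \<le> n'" for a using assms that unfolding monotone_index_def by (meson le_refl le_trans)
  ultimately show ?thesis using assms(2) by auto
qed

lemma pre_smap:
  assumes X: "simplicial_set X" and u: "monotone_index n' n u" and \<phi>: "\<phi> \<in> smap (\<Delta> n \<times>\<^sub>s X) Y"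
  shows "pre X n' u \<phi> \<in> smap (\<Delta> n' \<times>\<^sub>s X) Y"
proof -
  note mem = map_monotone_index[OF u]
  have "pre X n' u \<phi> = restr (\<Delta> n' \<times>\<^sub>s X) (\<lambda>m (s, x). \<phi> m (map u s, x))"
    by (simp add: pre_def restr_def)
  moreover have "restr (\<Delta> n' \<times>\<^sub>s X) (\<lambda>m (s, x). \<phi> m (map u s, x)) \<in> smap (\<Delta> n' \<times>\<^sub>s X) Y"
  proof (rule restr_prod_smap[OF simplicial_set_std_simplex X])
    fix m s x i
    show "s \<in> Simp (\<Delta> n') m \<Longrightarrow> x \<in> Simp X m \<Longrightarrow> (case (s, x) of (s, x) \<Rightarrow> \<phi> m (map u s, x)) \<in> Simp Y m"
      using smap_prod_closed[OF \<phi> mem] by (simp del: std_simplex_simps)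
    show "s \<in> Simp (\<Delta> n') (Suc m) \<Longrightarrow> x \<in> Simp X (Suc m) \<Longrightarrow> i \<le> Suc m \<Longrightarrow>
      (case (Face (\<Delta> n') (Suc m) i s, Face X (Suc m) i x) of (s, x) \<Rightarrow> \<phi> m (map u s, x)) =
        Face Y (Suc m) i (case (s, x) of (s, x) \<Rightarrow> \<phi> (Suc m) (map u s, x))"
      using smap_prod_face[OF \<phi> mem] by (simp add: map_omit del: std_simplex_simps(1))
    show "s \<in> Simp (\<Delta> n') m \<Longrightarrow> x \<in> Simp X m \<Longrightarrow> i \<le> m \<Longrightarrow>
      (case (Degen (\<Delta> n') m i s, Degen X m i x) of (s, x) \<Rightarrow> \<phi> (Suc m) (map u s, x)) =
        Degen Y m i (case (s, x) of (s, x) \<Rightarrow> \<phi> m (map u s, x))"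
      using smap_prod_degen[OF \<phi> mem] by (simp add: map_dup del: std_simplex_simps(1))
  qed
  ultimately show ?thesis by simp
qed

lemma pre_pre:
  assumes "monotone_index n'' n' v" "\<And>i. i \<le> n'' \<Longrightarrow> u (v i) = w i"
  shows "pre X n'' v (pre X n' u \<phi>) = pre X n'' w \<phi>"
proof (intro ext, clarify)
  fix m s x
  have "map u (map v s) = map w s" if "s \<in> Simp (\<Delta> n'') m" using that assms(2) by auto
  then show "pre X n'' v (pre X n' u \<phi>) m (s, x) = pre X n'' w \<phi> m (s, x)"
    using map_monotone_index[OF assms(1), of s m] by (auto simp: pre_def simp del: std_simplex_simps map_map)
qed

lemma pre_id:
  assumes "\<phi> \<in> smap (\<Delta> n \<times>\<^sub>s X) Y" "\<And>i. i \<le> n \<Longrightarrow> u i = i"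
  shows "pre X n u \<phi> = \<phi>"
proof (intro ext, clarify)
  fix m s x
  have "map u s = s" if "s \<in> Simp (\<Delta> n) m" using that assms(2) by (auto intro: map_idI)
  then show "pre X n u \<phi> m (s, x) = \<phi> m (s, x)"
    using smap_undefined[OF assms(1), of "(s, x)" m] by (auto simp: pre_def simp del: std_simplex_simps)
qed

definition mspace :: "'a sset \<Rightarrow> (nat \<Rightarrow> (nat \<Rightarrow> nat list \<times> 'a \<Rightarrow> 'b) set) \<Rightarrow> (nat \<Rightarrow> nat list \<times> 'a \<Rightarrow> 'b) sset" where
  "mspace X S = \<lparr>Simp = S, Face = pre_face X, Degen = pre_degen X\<rparr>"

lemma mspace_simps [simp]:
  "Simp (mspace X S) n = S n" "Face (mspace X S) n i = pre X (n - 1) (\<delta> i)" "Degen (mspace X S) n i = pre X (Suc n) (\<sigma> i)"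
  by (simp_all add: mspace_def pre_face_eq pre_degen_eq)

text \<open>
  Spaces of equivariant maps, of maps that are trivial on a subspace and of paths with prescribed ends
  are all of this kind, and the exponential law below applies to each of them.
\<close>

locale map_subspace =
  fixes X :: "'a sset" and Y :: "'b sset" and S
  assumes domain: "simplicial_set X" and codomain: "simplicial_set Y"
    and smap: "\<And>n \<phi>. \<phi> \<in> S n \<Longrightarrow> \<phi> \<in> smap (\<Delta> n \<times>\<^sub>s X) Y"
    and pre_closed: "\<And>n n' u \<phi>. \<phi> \<in> S n \<Longrightarrow> monotone_index n' n u \<Longrightarrow> pre X n' u \<phi> \<in> S n'"
begin

lemma simplicial_set_mspace: "simplicial_set (mspace X S)"
proof
  fix n i j \<phi>
  show "\<phi> \<in> Simp (mspace X S) (Suc n) \<Longrightarrow> i \<le> Suc n \<Longrightarrow> Face (mspace X S) (Suc n) i \<phi> \<in> Simp (mspace X S) n"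
    using pre_closed monotone_index_\<delta> by auto
  show "\<phi> \<in> Simp (mspace X S) n \<Longrightarrow> i \<le> n \<Longrightarrow> Degen (mspace X S) n i \<phi> \<in> Simp (mspace X S) (Suc n)"
    using pre_closed monotone_index_\<sigma> by auto
  show "Face (mspace X S) (Suc n) i (Face (mspace X S) (Suc (Suc n)) j \<phi>)
      = Face (mspace X S) (Suc n) (j - 1) (Face (mspace X S) (Suc (Suc n)) i \<phi>)"
    if "i < j" "j \<le> Suc (Suc n)"
    using that by (simp, subst (1 2) pre_pre[where w = "\<lambda>a. \<delta> j (\<delta> i a)"])
      (auto intro!: monotone_index_\<delta>, auto simp: \<delta>_def)
  show "Degen (mspace X S) (Suc n) i (Degen (mspace X S) n j \<phi>)
      = Degen (mspace X S) (Suc n) (Suc j) (Degen (mspace X S) n i \<phi>)" if "i \<le> j" "j \<le> n"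
    using that by (simp, subst (1 2) pre_pre[where w = "\<lambda>a. \<sigma> j (\<sigma> i a)"])
      (auto intro!: monotone_index_\<sigma>, auto simp: \<sigma>_def)
  show "Face (mspace X S) (Suc (Suc n)) i (Degen (mspace X S) (Suc n) j \<phi>)
      = Degen (mspace X S) n (j - 1) (Face (mspace X S) (Suc n) i \<phi>)" if "i < j" "j \<le> Suc n"
    using that by (simp, subst (1 2) pre_pre[where w = "\<lambda>a. \<sigma> j (\<delta> i a)"])
      (auto intro!: monotone_index_\<sigma> monotone_index_\<delta>, auto simp: \<sigma>_def \<delta>_def)
  show "Face (mspace X S) (Suc n) i (Degen (mspace X S) n j \<phi>) = \<phi>"
    if "\<phi> \<in> Simp (mspace X S) n" "j \<le> n" "i = j \<or> i = Suc j"
    using that by (simp, subst pre_pre[where w = "\<lambda>a. a"])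
      (auto intro!: monotone_index_\<delta> pre_id smap, auto simp: \<sigma>_def \<delta>_def)
  show "Face (mspace X S) (Suc (Suc n)) i (Degen (mspace X S) (Suc n) j \<phi>)
      = Degen (mspace X S) n j (Face (mspace X S) (Suc n) (i - 1) \<phi>)" if "Suc j < i" "i \<le> Suc (Suc n)"
    using that by (simp, subst (1 2) pre_pre[where w = "\<lambda>a. \<sigma> j (\<delta> i a)"])
      (auto intro!: monotone_index_\<sigma> monotone_index_\<delta>, auto simp: \<sigma>_def \<delta>_def)
qed

lemma op_mspace:
  assumes "\<phi> \<in> S k" "s \<in> Simp (\<Delta> k) m"
  shows "op (mspace X S) k s \<phi> = pre X m ((!) s) \<phi>"
proof -
  have "pre X m ((!) s) \<phi> = op (mspace X S) k s (pre X k ((!) (\<iota> k)) \<phi>)"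
  proof (rule op_unique'[where f = "\<lambda>m s. pre X m ((!) s) \<phi>", OF simplicial_set_mspace _ _ _ assms(2)])
    fix m s i
    show "s \<in> Simp (\<Delta> k) m \<Longrightarrow> pre X m ((!) s) \<phi> \<in> Simp (mspace X S) m"
      using pre_closed[OF assms(1)] monotone_index_nth by simp
    show "s \<in> Simp (\<Delta> k) (Suc m) \<Longrightarrow> i \<le> Suc m \<Longrightarrow> pre X m ((!) (omit i s)) \<phi>
        = Face (mspace X S) (Suc m) i (pre X (Suc m) ((!) s) \<phi>)"
      by (simp, subst pre_pre) (auto simp: monotone_index_\<delta> nth_omit)
    show "s \<in> Simp (\<Delta> k) m \<Longrightarrow> i \<le> m \<Longrightarrow> pre X (Suc m) ((!) (dup i s)) \<phi>
        = Degen (mspace X S) m i (pre X m ((!) s) \<phi>)"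
      by (simp, subst pre_pre) (auto simp: monotone_index_\<sigma> nth_dup)
  qed
  also have "pre X k ((!) (\<iota> k)) \<phi> = \<phi>"
    by (rule pre_id[OF smap[OF assms(1)]]) (simp add: nth_\<iota>)
  finally show ?thesis by simp
qed

end

text \<open>
  A simplex \<open>z\<close> of \<open>Z\<close> is a map \<open>\<Delta>^n \<rightarrow> Z\<close>; the adjoint of \<open>\<psi> : Z \<times> X \<rightarrow> Y\<close> sends it to the restriction
  of \<open>\<psi>\<close> along this map.
\<close>

definition curry_at :: "'z sset \<Rightarrow> 'a sset \<Rightarrow> (nat \<Rightarrow> 'z \<times> 'a \<Rightarrow> 'b) \<Rightarrow> nat \<Rightarrow> 'z \<Rightarrow> nat \<Rightarrow> nat list \<times> 'a \<Rightarrow> 'b" where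
  "curry_at Z X \<psi> n z = (\<lambda>m. \<lambda>(s, x)\<in>Simp (\<Delta> n \<times>\<^sub>s X) m. \<psi> m (op Z n s z, x))"

lemma curry_at_apply:
  "s \<in> Simp (\<Delta> n) m \<Longrightarrow> x \<in> Simp X m \<Longrightarrow> curry_at Z X \<psi> n z m (s, x) = \<psi> m (op Z n s z, x)"
  by (simp add: curry_at_def)

lemma curry_at_smap:
  assumes Z: "simplicial_set Z" and X: "simplicial_set X" and \<psi>: "\<psi> \<in> smap (Z \<times>\<^sub>s X) Y" and z: "z \<in> Simp Z n"
  shows "curry_at Z X \<psi> n z \<in> smap (\<Delta> n \<times>\<^sub>s X) Y"
proof -
  interpret Z: simplicial_set Z by fact
  have "curry_at Z X \<psi> n z = restr (\<Delta> n \<times>\<^sub>s X) (\<lambda>m (s, x). \<psi> m (op Z n s z, x))"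
    by (simp add: curry_at_def restr_def)
  moreover have "\<dots> \<in> smap (\<Delta> n \<times>\<^sub>s X) Y"
  proof (rule restr_smap[OF simplicial_set_prod[OF simplicial_set_std_simplex X]])
    fix m x i
    show "x \<in> Simp (\<Delta> n \<times>\<^sub>s X) m \<Longrightarrow> (case x of (s, x) \<Rightarrow> \<psi> m (op Z n s z, x)) \<in> Simp Y m"
      using Z.op_closed[OF _ z] smap_closed[OF \<psi>] by (auto simp del: std_simplex_simps)
    show "x \<in> Simp (\<Delta> n \<times>\<^sub>s X) (Suc m) \<Longrightarrow> i \<le> Suc m \<Longrightarrow>
      (case Face (\<Delta> n \<times>\<^sub>s X) (Suc m) i x of (s, x) \<Rightarrow> \<psi> m (op Z n s z, x)) =
        Face Y (Suc m) i (case x of (s, x) \<Rightarrow> \<psi> (Suc m) (op Z n s z, x))"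
      using Z.op_closed[OF _ z] smap_face[OF \<psi>, of _ m i]
      by (auto simp: Z.face_op[OF _ z, symmetric] simp del: std_simplex_simps(1))
    show "x \<in> Simp (\<Delta> n \<times>\<^sub>s X) m \<Longrightarrow> i \<le> m \<Longrightarrow>
      (case Degen (\<Delta> n \<times>\<^sub>s X) m i x of (s, x) \<Rightarrow> \<psi> (Suc m) (op Z n s z, x)) =
        Degen Y m i (case x of (s, x) \<Rightarrow> \<psi> m (op Z n s z, x))"
      using Z.op_closed[OF _ z] smap_degen[OF \<psi>, of _ m i]
      by (auto simp: Z.degen_op[OF _ z, symmetric] simp del: std_simplex_simps(1))
  qed
  ultimately show ?thesis by simp
qed

lemma (in simplicial_set) op_face:
  assumes "x \<in> Simp X (Suc k)" "i \<le> Suc k" "s \<in> Simp (\<Delta> k) m"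
  shows "op X k s (Face X (Suc k) i x) = op X (Suc k) (map (\<delta> i) s) x"
proof -
  have id: "\<iota> (Suc k) \<in> Simp (\<Delta> (Suc k)) (Suc k)" by simp
  have mem: "omit i (\<iota> (Suc k)) \<in> Simp (\<Delta> (Suc k)) k"
    using simplicial_set.face_closed[OF simplicial_set_std_simplex id assms(2)] by (simp del: std_simplex_simps(1))
  have "map ((!) (omit i (\<iota> (Suc k)))) s = map (\<delta> i) s"
    using assms by (auto simp: nth_omit nth_\<iota> \<delta>_def subset_iff)
  then show ?thesis using op_op[OF assms(1) mem assms(3)] face_op[OF id assms(1,2)]
    by (simp del: map_eq_conv)
qed

lemma (in simplicial_set) op_degen:
  assumes "x \<in> Simp X k" "i \<le> k" "s \<in> Simp (\<Delta> (Suc k)) m"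
  shows "op X (Suc k) s (Degen X k i x) = op X k (map (\<sigma> i) s) x"
proof -
  have id: "\<iota> k \<in> Simp (\<Delta> k) k" by simp
  have mem: "dup i (\<iota> k) \<in> Simp (\<Delta> k) (Suc k)"
    using simplicial_set.degen_closed[OF simplicial_set_std_simplex id assms(2)] by (simp del: std_simplex_simps(1))
  have "map ((!) (dup i (\<iota> k))) s = map (\<sigma> i) s"
    using assms by (auto simp: nth_dup nth_\<iota> \<sigma>_def subset_iff)
  then show ?thesis using op_op[OF assms(1) mem assms(3)] degen_op[OF id assms(1,2)]
    by (simp del: map_eq_conv)
qed

context map_subspace
begin

lemma curry_smap:
  assumes Z: "simplicial_set Z" and \<psi>: "\<And>n z. z \<in> Simp Z n \<Longrightarrow> curry_at Z X \<psi> n z \<in> S n"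
  shows "restr Z (curry_at Z X \<psi>) \<in> smap Z (mspace X S)"
proof (rule restr_smap[OF Z])
  interpret Z: simplicial_set Z by fact
  fix n z i
  show "z \<in> Simp Z n \<Longrightarrow> curry_at Z X \<psi> n z \<in> Simp (mspace X S) n" using \<psi> by simp
  show "curry_at Z X \<psi> n (Face Z (Suc n) i z) = Face (mspace X S) (Suc n) i (curry_at Z X \<psi> (Suc n) z)"
    if "z \<in> Simp Z (Suc n)" "i \<le> Suc n"
  proof (intro ext, clarify)
    fix m s x
    show "curry_at Z X \<psi> n (Face Z (Suc n) i z) m (s, x) = Face (mspace X S) (Suc n) i (curry_at Z X \<psi> (Suc n) z) m (s, x)"
      using Z.op_face[OF that, of s m] map_monotone_index[OF monotone_index_\<delta>[OF that(2)], of s m]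
      by (auto simp: curry_at_def pre_def simp del: std_simplex_simps)
  qed
  show "curry_at Z X \<psi> (Suc n) (Degen Z n i z) = Degen (mspace X S) n i (curry_at Z X \<psi> n z)"
    if "z \<in> Simp Z n" "i \<le> n"
  proof (intro ext, clarify)
    fix m s x
    show "curry_at Z X \<psi> (Suc n) (Degen Z n i z) m (s, x) = Degen (mspace X S) n i (curry_at Z X \<psi> n z) m (s, x)"
      using Z.op_degen[OF that, of s m] map_monotone_index[OF monotone_index_\<sigma>[OF that(2)], of s m]
      by (auto simp: curry_at_def pre_def simp del: std_simplex_simps)
  qed
qed

text \<open>
  In the inverse direction it suffices, by the Yoneda lemma, to evaluate the simplices of the mapping
  space at the identity of \<open>[m]\<close>.
\<close>

definition uncurry :: "'z sset \<Rightarrow> (nat \<Rightarrow> 'z \<Rightarrow> nat \<Rightarrow> nat list \<times> 'a \<Rightarrow> 'b) \<Rightarrow> nat \<Rightarrow> 'z \<times> 'a \<Rightarrow> 'b" where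
  "uncurry Z F = restr (Z \<times>\<^sub>s X) (\<lambda>m (z, x). F m z m (\<iota> m, x))"

lemma uncurry_smap:
  assumes Z: "simplicial_set Z" and F: "F \<in> smap Z (mspace X S)"
  shows "uncurry Z F \<in> smap (Z \<times>\<^sub>s X) Y"
  unfolding uncurry_def
proof (rule restr_smap[OF simplicial_set_prod[OF Z domain]])
  have FS: "F n z \<in> S n" if "z \<in> Simp Z n" for n z using smap_closed[OF F that] by simp
  have id: "\<iota> m \<in> Simp (\<Delta> m) m" for m by simp
  fix m x i
  show "x \<in> Simp (Z \<times>\<^sub>s X) m \<Longrightarrow> (case x of (z, x) \<Rightarrow> F m z m (\<iota> m, x)) \<in> Simp Y m"
    using smap_closed[OF smap[OF FS]] id by fastforce
  show "(case Face (Z \<times>\<^sub>s X) (Suc m) i x of (z, x) \<Rightarrow> F m z m (\<iota> m, x)) =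
        Face Y (Suc m) i (case x of (z, x) \<Rightarrow> F (Suc m) z (Suc m) (\<iota> (Suc m), x))"
    if x: "x \<in> Simp (Z \<times>\<^sub>s X) (Suc m)" and i: "i \<le> Suc m"
  proof -
    obtain z a where za: "x = (z, a)" "z \<in> Simp Z (Suc m)" "a \<in> Simp X (Suc m)" using x by auto
    have "omit i (\<iota> (Suc m)) = map (\<delta> i) (\<iota> m)"
      using i by (rule omit_\<iota>)
    then show ?thesis
      using smap_face[OF smap[OF FS[OF za(2)]], of "(\<iota> (Suc m), a)" m i] smap_face[OF F za(2) i] za i id
        simplicial_set.face_closed[OF domain za(3) i]
      by (simp add: pre_apply del: std_simplex_simps(1))
  qed
  show "(case Degen (Z \<times>\<^sub>s X) m i x of (z, x) \<Rightarrow> F (Suc m) z (Suc m) (\<iota> (Suc m), x)) =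
        Degen Y m i (case x of (z, x) \<Rightarrow> F m z m (\<iota> m, x))"
    if x: "x \<in> Simp (Z \<times>\<^sub>s X) m" and i: "i \<le> m"
  proof -
    obtain z a where za: "x = (z, a)" "z \<in> Simp Z m" "a \<in> Simp X m" using x by auto
    have "dup i (\<iota> m) = map (\<sigma> i) (\<iota> (Suc m))"
      using i by (rule dup_\<iota>)
    then show ?thesis
      using smap_degen[OF smap[OF FS[OF za(2)]], of "(\<iota> m, a)" m i] smap_degen[OF F za(2) i] za i id
        simplicial_set.degen_closed[OF domain za(3) i]
      by (simp add: pre_apply del: std_simplex_simps(1))
  qed
qed

lemma uncurry_apply:
  assumes Z: "simplicial_set Z" and F: "F \<in> smap Z (mspace X S)"
    and "z \<in> Simp Z n" "s \<in> Simp (\<Delta> n) m" "x \<in> Simp X m"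
  shows "uncurry Z F m (op Z n s z, x) = F n z m (s, x)"
proof -
  have FS: "F n z \<in> S n" using smap_closed[OF F assms(3)] by simp
  have "F m (op Z n s z) = pre X m ((!) s) (F n z)"
    using op_natural[OF Z simplicial_set_mspace F assms(3,4)] op_mspace[OF FS assms(4)] by simp
  moreover have "map ((!) s) (\<iota> m) = s" using assms(4) map_nth_\<iota>[of s m] by simp
  ultimately show ?thesis
    using assms simplicial_set.op_closed[OF Z assms(4,3)] unfolding uncurry_def
    by (subst restr_apply) (auto simp: pre_apply)
qed

text \<open>
  Homotopies of maps into a mapping space are given by maps out of a product.
\<close>

lemma elementary_homotopic_curry:
  assumes Z: "simplicial_set Z"
    and S: "\<And>n t z. t \<in> Simp (\<Delta> 1) n \<Longrightarrow> z \<in> Simp Z n \<Longrightarrow> curry_at (\<Delta> 1 \<times>\<^sub>s Z) X \<psi> n (t, z) \<in> S n"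
    and F: "\<And>n z m s x. z \<in> Simp Z n \<Longrightarrow> s \<in> Simp (\<Delta> n) m \<Longrightarrow> x \<in> Simp X m \<Longrightarrow>
      \<psi> m ((replicate (Suc m) 0, op Z n s z), x) = F n z m (s, x)" "F \<in> smap Z (mspace X S)"
    and F': "\<And>n z m s x. z \<in> Simp Z n \<Longrightarrow> s \<in> Simp (\<Delta> n) m \<Longrightarrow> x \<in> Simp X m \<Longrightarrow>
      \<psi> m ((replicate (Suc m) 1, op Z n s z), x) = F' n z m (s, x)" "F' \<in> smap Z (mspace X S)"
  shows "elementary_homotopic Z (mspace X S) F F'"
proof -
  let ?H = "restr (\<Delta> 1 \<times>\<^sub>s Z) (curry_at (\<Delta> 1 \<times>\<^sub>s Z) X \<psi>)"
  have Z1: "simplicial_set (\<Delta> 1 \<times>\<^sub>s Z)" by (rule simplicial_set_prod[OF simplicial_set_std_simplex Z])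
  have "?H n (replicate (Suc n) a, z) = E n z"
    if "a \<le> 1" "z \<in> Simp Z n" and E: "E \<in> smap Z (mspace X S)"
      "\<And>n z m s x. z \<in> Simp Z n \<Longrightarrow> s \<in> Simp (\<Delta> n) m \<Longrightarrow> x \<in> Simp X m \<Longrightarrow>
      \<psi> m ((replicate (Suc m) a, op Z n s z), x) = E n z m (s, x)" for n z a E
  proof -
    have r: "replicate (Suc n) a \<in> Simp (\<Delta> 1) n" using that(1) by (rule replicate_simplex)
    have mem: "(replicate (Suc n) a, z) \<in> Simp (\<Delta> 1 \<times>\<^sub>s Z) n" using r that(2) by (simp del: std_simplex_simps)
    have "curry_at (\<Delta> 1 \<times>\<^sub>s Z) X \<psi> n (replicate (Suc n) a, z) = E n z"
    proof (intro smap_eqI[of _ "\<Delta> n \<times>\<^sub>s X" Y])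
      show "curry_at (\<Delta> 1 \<times>\<^sub>s Z) X \<psi> n (replicate (Suc n) a, z) \<in> smap (\<Delta> n \<times>\<^sub>s X) Y"
        using smap[OF S[OF r that(2)]] .
      show "E n z \<in> smap (\<Delta> n \<times>\<^sub>s X) Y" using smap smap_closed[OF E(1) that(2)] by simp
      fix m x assume "x \<in> Simp (\<Delta> n \<times>\<^sub>s X) m"
      then obtain s y where x: "x = (s, y)" and sy: "s \<in> Simp (\<Delta> n) m" "y \<in> Simp X m"
        by (auto simp del: std_simplex_simps)
      have "map ((!) (replicate (Suc n) a)) s = replicate (Suc m) a"
        using sy(1) nth_mem[of _ s]
          by (intro nth_equalityI) (force simp: subset_iff less_Suc_eq_le simp del: replicate.simps)+
      then have "op (\<Delta> 1 \<times>\<^sub>s Z) n s (replicate (Suc n) a, z) = (replicate (Suc m) a, op Z n s z)"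
        using op_prod[OF simplicial_set_std_simplex Z r that(2) sy(1)] op_std_simplex[OF r sy(1)]
        by simp
      then show "curry_at (\<Delta> 1 \<times>\<^sub>s Z) X \<psi> n (replicate (Suc n) a, z) m x = E n z m x"
        using E(2)[OF that(2) sy] curry_at_apply[OF sy, of "\<Delta> 1 \<times>\<^sub>s Z" \<psi> "(replicate (Suc n) a, z)"] x by simp
    qed
    then show ?thesis using restr_apply[OF mem] by metis
  qed
  moreover have "?H \<in> smap (\<Delta> 1 \<times>\<^sub>s Z) (mspace X S)"
    by (rule curry_smap[OF Z1]) (use S in \<open>auto simp del: std_simplex_simps\<close>)
  ultimately show ?thesis
    unfolding elementary_homotopic_def using F F' by (intro bexI[of _ ?H]) (simp_all del: replicate.simps)
qed

end

lemma map_subspace_full: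
  assumes "simplicial_set X" "simplicial_set Y"
  shows "map_subspace X Y (\<lambda>n. smap (\<Delta> n \<times>\<^sub>s X) Y)"
  by (intro map_subspace.intro) (auto intro: assms pre_smap)

lemma mapping_space_eq: "mapping_space X Y = mspace X (\<lambda>n. smap (\<Delta> n \<times>\<^sub>s X) Y)"
  by (simp add: mapping_space_def mspace_def)

section \<open>Simplicial groups are Kan complexes\<close>

lemma under_simps [simp]:
  "Simp (under G) n = carrier (Lev G n)" "Face (under G) n i = GFace G n i" "Degen (under G) n i = GDegen G n i"
  by (simp_all add: under_def)

context simplicial_group
begin

lemma level_simps [simp]:
  "\<one>\<^bsub>Lev G n\<^esub> \<in> carrier (Lev G n)"
  "x \<in> carrier (Lev G n) \<Longrightarrow> inv\<^bsub>Lev G n\<^esub> x \<in> carrier (Lev G n)"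
  "x \<in> carrier (Lev G n) \<Longrightarrow> y \<in> carrier (Lev G n) \<Longrightarrow> x \<otimes>\<^bsub>Lev G n\<^esub> y \<in> carrier (Lev G n)"
  "x \<in> carrier (Lev G n) \<Longrightarrow> x \<otimes>\<^bsub>Lev G n\<^esub> \<one>\<^bsub>Lev G n\<^esub> = x"
  "x \<in> carrier (Lev G n) \<Longrightarrow> \<one>\<^bsub>Lev G n\<^esub> \<otimes>\<^bsub>Lev G n\<^esub> x = x"
  "x \<in> carrier (Lev G n) \<Longrightarrow> x \<otimes>\<^bsub>Lev G n\<^esub> inv\<^bsub>Lev G n\<^esub> x = \<one>\<^bsub>Lev G n\<^esub>"
  "x \<in> carrier (Lev G n) \<Longrightarrow> inv\<^bsub>Lev G n\<^esub> x \<otimes>\<^bsub>Lev G n\<^esub> x = \<one>\<^bsub>Lev G n\<^esub>"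
  "inv\<^bsub>Lev G n\<^esub> \<one>\<^bsub>Lev G n\<^esub> = \<one>\<^bsub>Lev G n\<^esub>"
  "x \<in> carrier (Lev G n) \<Longrightarrow> inv\<^bsub>Lev G n\<^esub> (inv\<^bsub>Lev G n\<^esub> x) = x"
proof -
  interpret group "Lev G n" by (rule group_level)
  show "\<one>\<^bsub>Lev G n\<^esub> \<in> carrier (Lev G n)"
    "x \<in> carrier (Lev G n) \<Longrightarrow> inv\<^bsub>Lev G n\<^esub> x \<in> carrier (Lev G n)"
    "x \<in> carrier (Lev G n) \<Longrightarrow> y \<in> carrier (Lev G n) \<Longrightarrow> x \<otimes>\<^bsub>Lev G n\<^esub> y \<in> carrier (Lev G n)"
    "x \<in> carrier (Lev G n) \<Longrightarrow> x \<otimes>\<^bsub>Lev G n\<^esub> \<one>\<^bsub>Lev G n\<^esub> = x"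
    "x \<in> carrier (Lev G n) \<Longrightarrow> \<one>\<^bsub>Lev G n\<^esub> \<otimes>\<^bsub>Lev G n\<^esub> x = x"
    "x \<in> carrier (Lev G n) \<Longrightarrow> x \<otimes>\<^bsub>Lev G n\<^esub> inv\<^bsub>Lev G n\<^esub> x = \<one>\<^bsub>Lev G n\<^esub>"
    "x \<in> carrier (Lev G n) \<Longrightarrow> inv\<^bsub>Lev G n\<^esub> x \<otimes>\<^bsub>Lev G n\<^esub> x = \<one>\<^bsub>Lev G n\<^esub>"
    "inv\<^bsub>Lev G n\<^esub> \<one>\<^bsub>Lev G n\<^esub> = \<one>\<^bsub>Lev G n\<^esub>"
    "x \<in> carrier (Lev G n) \<Longrightarrow> inv\<^bsub>Lev G n\<^esub> (inv\<^bsub>Lev G n\<^esub> x) = x"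
    by (simp_all add: r_inv l_inv)
qed

lemma level_assoc: "x \<in> carrier (Lev G n) \<Longrightarrow> y \<in> carrier (Lev G n) \<Longrightarrow> z \<in> carrier (Lev G n) \<Longrightarrow>
    (x \<otimes>\<^bsub>Lev G n\<^esub> y) \<otimes>\<^bsub>Lev G n\<^esub> z = x \<otimes>\<^bsub>Lev G n\<^esub> (y \<otimes>\<^bsub>Lev G n\<^esub> z)"
  using group_level[of n] by (simp add: group.is_monoid monoid.m_assoc)

lemma level_cancel [simp]:
  assumes "x \<in> carrier (Lev G n)" "y \<in> carrier (Lev G n)"
  shows "x \<otimes>\<^bsub>Lev G n\<^esub> (inv\<^bsub>Lev G n\<^esub> x \<otimes>\<^bsub>Lev G n\<^esub> y) = y"
    "inv\<^bsub>Lev G n\<^esub> x \<otimes>\<^bsub>Lev G n\<^esub> (x \<otimes>\<^bsub>Lev G n\<^esub> y) = y"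
  using assms by (simp_all add: level_assoc[symmetric])

lemma level_inv_mult: "x \<in> carrier (Lev G n) \<Longrightarrow> y \<in> carrier (Lev G n) \<Longrightarrow>
    inv\<^bsub>Lev G n\<^esub> (x \<otimes>\<^bsub>Lev G n\<^esub> y) = inv\<^bsub>Lev G n\<^esub> y \<otimes>\<^bsub>Lev G n\<^esub> inv\<^bsub>Lev G n\<^esub> x"
  using group_level[of n] by (rule group.inv_mult_group)

lemma face_simps [simp]:
  assumes "i \<le> Suc n"
  shows "x \<in> carrier (Lev G (Suc n)) \<Longrightarrow> GFace G (Suc n) i x \<in> carrier (Lev G n)"
    "x \<in> carrier (Lev G (Suc n)) \<Longrightarrow> y \<in> carrier (Lev G (Suc n)) \<Longrightarrow>
      GFace G (Suc n) i (x \<otimes>\<^bsub>Lev G (Suc n)\<^esub> y) = GFace G (Suc n) i x \<otimes>\<^bsub>Lev G n\<^esub> GFace G (Suc n) i y"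
    "GFace G (Suc n) i \<one>\<^bsub>Lev G (Suc n)\<^esub> = \<one>\<^bsub>Lev G n\<^esub>"
    "x \<in> carrier (Lev G (Suc n)) \<Longrightarrow>
      GFace G (Suc n) i (inv\<^bsub>Lev G (Suc n)\<^esub> x) = inv\<^bsub>Lev G n\<^esub> GFace G (Suc n) i x"
proof -
  interpret group_hom "Lev G (Suc n)" "Lev G n" "GFace G (Suc n) i"
    using assms face_hom group_level by (simp add: group_hom_def group_hom_axioms_def)
  show "x \<in> carrier (Lev G (Suc n)) \<Longrightarrow> GFace G (Suc n) i x \<in> carrier (Lev G n)"
    "x \<in> carrier (Lev G (Suc n)) \<Longrightarrow> y \<in> carrier (Lev G (Suc n)) \<Longrightarrow>
      GFace G (Suc n) i (x \<otimes>\<^bsub>Lev G (Suc n)\<^esub> y) = GFace G (Suc n) i x \<otimes>\<^bsub>Lev G n\<^esub> GFace G (Suc n) i y"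
    "GFace G (Suc n) i \<one>\<^bsub>Lev G (Suc n)\<^esub> = \<one>\<^bsub>Lev G n\<^esub>"
    "x \<in> carrier (Lev G (Suc n)) \<Longrightarrow>
      GFace G (Suc n) i (inv\<^bsub>Lev G (Suc n)\<^esub> x) = inv\<^bsub>Lev G n\<^esub> GFace G (Suc n) i x"
    by simp_all
qed

lemma degen_simps [simp]:
  assumes "i \<le> n"
  shows "x \<in> carrier (Lev G n) \<Longrightarrow> GDegen G n i x \<in> carrier (Lev G (Suc n))"
    "x \<in> carrier (Lev G n) \<Longrightarrow> y \<in> carrier (Lev G n) \<Longrightarrow>
      GDegen G n i (x \<otimes>\<^bsub>Lev G n\<^esub> y) = GDegen G n i x \<otimes>\<^bsub>Lev G (Suc n)\<^esub> GDegen G n i y"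
    "GDegen G n i \<one>\<^bsub>Lev G n\<^esub> = \<one>\<^bsub>Lev G (Suc n)\<^esub>"
    "x \<in> carrier (Lev G n) \<Longrightarrow>
      GDegen G n i (inv\<^bsub>Lev G n\<^esub> x) = inv\<^bsub>Lev G (Suc n)\<^esub> GDegen G n i x"
proof -
  interpret group_hom "Lev G n" "Lev G (Suc n)" "GDegen G n i"
    using assms degen_hom group_level by (simp add: group_hom_def group_hom_axioms_def)
  show "x \<in> carrier (Lev G n) \<Longrightarrow> GDegen G n i x \<in> carrier (Lev G (Suc n))"
    "x \<in> carrier (Lev G n) \<Longrightarrow> y \<in> carrier (Lev G n) \<Longrightarrow>
      GDegen G n i (x \<otimes>\<^bsub>Lev G n\<^esub> y) = GDegen G n i x \<otimes>\<^bsub>Lev G (Suc n)\<^esub> GDegen G n i y"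
    "GDegen G n i \<one>\<^bsub>Lev G n\<^esub> = \<one>\<^bsub>Lev G (Suc n)\<^esub>"
    "x \<in> carrier (Lev G n) \<Longrightarrow>
      GDegen G n i (inv\<^bsub>Lev G n\<^esub> x) = inv\<^bsub>Lev G (Suc n)\<^esub> GDegen G n i x"
    by simp_all
qed

text \<open>
  The step of Moore's horn filling: if the face \<open>r\<close> of \<open>y\<close> differs from \<open>x r\<close>, multiply \<open>y\<close> by a
  degeneracy of the difference. The faces outside \<open>{j, j + 1}\<close> of this factor are degeneracies of
  quotients that vanish by compatibility.
\<close>

lemma correct_face:
  assumes y: "y \<in> carrier (Lev G (Suc n))" and r: "r = j \<or> r = Suc j" and j: "j \<le> n"
    and I: "\<And>i. i \<in> I \<Longrightarrow> i \<le> Suc n \<and> (i < j \<or> Suc j < i)"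
    and x: "\<And>i. i \<in> I \<Longrightarrow> x i \<in> carrier (Lev G n)" "x r \<in> carrier (Lev G n)"
    and face: "\<And>i. i \<in> I \<Longrightarrow> GFace G (Suc n) i y = x i"
    and below: "\<And>i. i \<in> I \<Longrightarrow> i < j \<Longrightarrow> GFace G n i (x r) = GFace G n (r - 1) (x i)"
    and above: "\<And>i. i \<in> I \<Longrightarrow> Suc j < i \<Longrightarrow> GFace G n r (x i) = GFace G n (i - 1) (x r)"
  shows "\<exists>y'\<in>carrier (Lev G (Suc n)). \<forall>i\<in>insert r I. GFace G (Suc n) i y' = x i"
proof
  let ?c = "inv\<^bsub>Lev G n\<^esub> (GFace G (Suc n) r y) \<otimes>\<^bsub>Lev G n\<^esub> x r"
  let ?y = "y \<otimes>\<^bsub>Lev G (Suc n)\<^esub> GDegen G n j ?c"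
  have rn: "r \<le> Suc n" using r j by auto
  have c: "?c \<in> carrier (Lev G n)" using y x rn by simp
  show "?y \<in> carrier (Lev G (Suc n))" using y c j by simp
  have mult: "GFace G (Suc n) i ?y = GFace G (Suc n) i y \<otimes>\<^bsub>Lev G n\<^esub> GFace G (Suc n) i (GDegen G n j ?c)"
    if "i \<le> Suc n" for i using y c j that by (simp del: degen_simps(2))
  have "GFace G (Suc n) r ?y = x r"
    using mult[OF rn] under_simplicial[THEN simplicial_set.face_degen_eq, of ?c n j r] c j r rn x y
    by simp
  moreover have "GFace G (Suc n) i ?y = x i" if i: "i \<in> I" for i
  proof -
    have ile: "i \<le> Suc n" using I[OF i] by simp
    have "GFace G (Suc n) i (GDegen G n j ?c) = \<one>\<^bsub>Lev G n\<^esub>"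
    proof (cases "i < j")
      case True
      then obtain n' where n: "n = Suc n'" using j by (cases n) auto
      have "GFace G (Suc n') i (GFace G (Suc (Suc n')) r y) = GFace G (Suc n') (r - 1) (GFace G (Suc (Suc n')) i y)"
        using under_simplicial[THEN simplicial_set.face_face, of y n' i r] y n r True rn by auto
      also have "\<dots> = GFace G (Suc n') i (x r)" using face[OF i] below[OF i True] n by simp
      finally have "GFace G (Suc n') i ?c = \<one>\<^bsub>Lev G n'\<^esub>" using n y x rn True j by simp
      then show ?thesis
        using under_simplicial[THEN simplicial_set.face_degen_less, of ?c n' i j] c n True j by simp
    next
      case False
      then have ij: "Suc j < i" using I[OF i] by simp
      then obtain n' where n: "n = Suc n'" using ile j by (cases n) auto
      have "GFace G (Suc n') (i - 1) (GFace G (Suc (Suc n')) r y) = GFace G (Suc n') r (GFace G (Suc (Suc n')) i y)"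
        using under_simplicial[THEN simplicial_set.face_face, of y n' r i] y n r ij ile by auto
      also have "\<dots> = GFace G (Suc n') (i - 1) (x r)" using face[OF i] above[OF i ij] n by simp
      finally have "GFace G (Suc n') (i - 1) ?c = \<one>\<^bsub>Lev G n'\<^esub>" using n y x rn ij ile by simp
      then show ?thesis
        using under_simplicial[THEN simplicial_set.face_degen_greater, of ?c n' j i] c n ij ile j by simp
    qed
    then show ?thesis using mult[OF ile] face[OF i] x(1)[OF i] by simp
  qed
  ultimately show "\<forall>i\<in>insert r I. GFace G (Suc n) i ?y = x i" by simp
qed

text \<open>
  The faces \<open>0, \<dots>, k - 1\<close> are corrected in increasing order with the degeneracies \<open>s_r\<close>, then the faces
  \<open>n + 1, \<dots>, k + 1\<close> in decreasing order with \<open>s_(r - 1)\<close>. Besides the face \<open>r\<close> a correction may change only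
  one neighbouring face, which in this order is still to come or is the omitted face \<open>k\<close>.
\<close>

lemma horn_filler:
  assumes k: "k \<le> Suc n"
    and x: "\<And>i. i \<le> Suc n \<Longrightarrow> i \<noteq> k \<Longrightarrow> x i \<in> carrier (Lev G n)"
    and compat: "\<And>i j. i < j \<Longrightarrow> j \<le> Suc n \<Longrightarrow> i \<noteq> k \<Longrightarrow> j \<noteq> k \<Longrightarrow> 0 < n \<Longrightarrow>
      GFace G n i (x j) = GFace G n (j - 1) (x i)"
  shows "\<exists>y\<in>carrier (Lev G (Suc n)). \<forall>i\<le>Suc n. i \<noteq> k \<longrightarrow> GFace G (Suc n) i y = x i"
proof -
  have low: "r \<le> k \<Longrightarrow> \<exists>y\<in>carrier (Lev G (Suc n)). \<forall>i<r. GFace G (Suc n) i y = x i" for r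
  proof (induction r)
    case 0
    show ?case by (intro bexI[of _ "\<one>\<^bsub>Lev G (Suc n)\<^esub>"]) simp_all
  next
    case (Suc r)
    then obtain y where y: "y \<in> carrier (Lev G (Suc n))" "\<forall>i<r. GFace G (Suc n) i y = x i" by auto
    have "\<exists>y'\<in>carrier (Lev G (Suc n)). \<forall>i\<in>insert r {..<r}. GFace G (Suc n) i y' = x i"
    proof (rule correct_face[OF y(1), of r r])
      show "GFace G n i (x r) = GFace G n (r - 1) (x i)" if "i \<in> {..<r}" "i < r" for i
        using compat[of i r] that Suc.prems k by auto
    qed (use y Suc.prems k x in auto)
    then show ?case by (auto simp: less_Suc_eq)
  qed
  have "t \<le> Suc n - k \<Longrightarrow> \<exists>y\<in>carrier (Lev G (Suc n)).
      \<forall>i\<in>{i. i \<le> Suc n \<and> (i < k \<or> Suc n - t < i)}. GFace G (Suc n) i y = x i" for t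
  proof (induction t)
    case 0
    then show ?case using low[of k] by auto
  next
    case (Suc t)
    let ?I = "{i. i \<le> Suc n \<and> (i < k \<or> Suc n - t < i)}" and ?r = "Suc n - t"
    obtain y where y: "y \<in> carrier (Lev G (Suc n))" "\<forall>i\<in>?I. GFace G (Suc n) i y = x i"
      using Suc by auto
    have "\<exists>y'\<in>carrier (Lev G (Suc n)). \<forall>i\<in>insert ?r ?I. GFace G (Suc n) i y' = x i"
    proof (rule correct_face[OF y(1), of ?r "?r - 1"])
      show "GFace G n i (x ?r) = GFace G n (?r - 1) (x i)" if "i \<in> ?I" "i < ?r - 1" for i
        using compat[of i ?r] that Suc.prems k by auto
      show "GFace G n ?r (x i) = GFace G n (i - 1) (x ?r)" if "i \<in> ?I" "Suc (?r - 1) < i" for i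
        using compat[of ?r i] that Suc.prems k by auto
    qed (use y Suc.prems k x in auto)
    moreover have "{i. i \<le> Suc n \<and> (i < k \<or> Suc n - Suc t < i)} \<subseteq> insert ?r ?I" by auto
    ultimately show ?case by blast
  qed
  from this[of "Suc n - k"] k show ?thesis by (auto simp: neq_iff)
qed

theorem kan_complex_under: "kan_complex (under G)"
  unfolding kan_complex_def using under_simplicial horn_filler by simp

text \<open>
  If all cycles bound, every boundary has a filling: a filling of a horn has the wrong last face by a
  cycle only, and a simplex bounded by this cycle corrects it.
\<close>

lemma fill_boundary:
  assumes bounds: "\<And>z. z \<in> carrier (Lev G n) \<Longrightarrow> (0 < n \<Longrightarrow> \<forall>i\<le>n. GFace G n i z = \<one>\<^bsub>Lev G (n - 1)\<^esub>) \<Longrightarrow>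
      \<exists>w\<in>carrier (Lev G (Suc n)). GFace G (Suc n) (Suc n) w = z \<and> (\<forall>i\<le>n. GFace G (Suc n) i w = \<one>\<^bsub>Lev G n\<^esub>)"
    and x: "\<And>i. i \<le> Suc n \<Longrightarrow> x i \<in> carrier (Lev G n)"
    and compat: "\<And>i j. i < j \<Longrightarrow> j \<le> Suc n \<Longrightarrow> 0 < n \<Longrightarrow> GFace G n i (x j) = GFace G n (j - 1) (x i)"
  shows "\<exists>y\<in>carrier (Lev G (Suc n)). \<forall>i\<le>Suc n. GFace G (Suc n) i y = x i"
proof -
  obtain y where y: "y \<in> carrier (Lev G (Suc n))" "\<forall>i\<le>Suc n. i \<noteq> Suc n \<longrightarrow> GFace G (Suc n) i y = x i"
    using horn_filler[of "Suc n" n x] x compat by auto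
  let ?z = "x (Suc n) \<otimes>\<^bsub>Lev G n\<^esub> inv\<^bsub>Lev G n\<^esub> (GFace G (Suc n) (Suc n) y)"
  have "\<exists>w\<in>carrier (Lev G (Suc n)). GFace G (Suc n) (Suc n) w = ?z \<and> (\<forall>i\<le>n. GFace G (Suc n) i w = \<one>\<^bsub>Lev G n\<^esub>)"
  proof (rule bounds)
    show "?z \<in> carrier (Lev G n)" using x y by simp
    assume "0 < n"
    then obtain n' where n: "n = Suc n'" by (cases n) auto
    have "GFace G n i ?z = \<one>\<^bsub>Lev G (n - 1)\<^esub>" if i: "i \<le> n" for i
    proof -
      have "GFace G (Suc n') i (GFace G (Suc (Suc n')) (Suc n) y) = GFace G (Suc n') n (GFace G (Suc (Suc n')) i y)"
        using under_simplicial[THEN simplicial_set.face_face, of y n' i "Suc n"] y(1) n i by simp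
      also have "\<dots> = GFace G (Suc n') i (x (Suc n))" using y(2) i compat[of i "Suc n"] n by simp
      finally show ?thesis using n i x y(1) by simp
    qed
    then show "\<forall>i\<le>n. GFace G n i ?z = \<one>\<^bsub>Lev G (n - 1)\<^esub>" by blast
  qed
  then obtain w where w: "w \<in> carrier (Lev G (Suc n))" "GFace G (Suc n) (Suc n) w = ?z"
    "\<forall>i\<le>n. GFace G (Suc n) i w = \<one>\<^bsub>Lev G n\<^esub>" by blast
  have "GFace G (Suc n) i (w \<otimes>\<^bsub>Lev G (Suc n)\<^esub> y) = x i" if "i \<le> Suc n" for i
  proof (cases "i = Suc n")
    case True
    then show ?thesis using w y x[of "Suc n"] by (simp add: level_assoc)
  next
    case False
    then show ?thesis using w y x[of i] that by simp
  qed
  then show ?thesis using w(1) y(1) by (intro bexI[of _ "w \<otimes>\<^bsub>Lev G (Suc n)\<^esub> y"]) simp_all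
qed

text \<open>
  A homotopy \<open>\<Delta>^1 \<times> \<Delta>^k \<rightarrow> G\<close> from \<open>z\<close> to \<open>1\<close> that is trivial on \<open>\<Delta>^1 \<times> \<partial>\<Delta>^k\<close> consists of \<open>k + 1\<close>
  simplices \<open>w 0, \<dots>, w k\<close> in which consecutive ones share a face. In the alternating product
  \<open>w k \<cdot> (w (k - 1))\<inverse> \<cdot> w (k - 2) \<cdots>\<close> the shared faces cancel, so \<open>z\<close> is the only face left.
\<close>

lemma bounds_if_prism:
  assumes w: "\<And>i. i \<le> k \<Longrightarrow> w i \<in> carrier (Lev G (Suc k))"
    and first: "GFace G (Suc k) 0 (w 0) = \<one>\<^bsub>Lev G k\<^esub>" and last: "GFace G (Suc k) (Suc k) (w k) = z"
    and shared: "\<And>i. i < k \<Longrightarrow> GFace G (Suc k) (Suc i) (w i) = GFace G (Suc k) (Suc i) (w (Suc i))"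
    and trivial: "\<And>i j. i \<le> k \<Longrightarrow> j \<le> Suc k \<Longrightarrow> j \<noteq> i \<Longrightarrow> j \<noteq> Suc i \<Longrightarrow> GFace G (Suc k) j (w i) = \<one>\<^bsub>Lev G k\<^esub>"
  shows "\<exists>v\<in>carrier (Lev G (Suc k)). GFace G (Suc k) (Suc k) v = z \<and> (\<forall>i\<le>k. GFace G (Suc k) i v = \<one>\<^bsub>Lev G k\<^esub>)"
proof -
  have "i \<le> k \<Longrightarrow> \<exists>v\<in>carrier (Lev G (Suc k)). GFace G (Suc k) (Suc i) v = GFace G (Suc k) (Suc i) (w i) \<and>
      (\<forall>j\<le>Suc k. j \<noteq> Suc i \<longrightarrow> GFace G (Suc k) j v = \<one>\<^bsub>Lev G k\<^esub>)" for i
  proof (induction i)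
    case 0
    have "GFace G (Suc k) j (w 0) = \<one>\<^bsub>Lev G k\<^esub>" if "j \<le> Suc k" "j \<noteq> Suc 0" for j
      using first trivial[of 0 j] that by (cases "j = 0") auto
    then show ?case using w[of 0] by blast
  next
    case (Suc i)
    then obtain v where v: "v \<in> carrier (Lev G (Suc k))" "GFace G (Suc k) (Suc i) v = GFace G (Suc k) (Suc i) (w i)"
      "\<forall>j\<le>Suc k. j \<noteq> Suc i \<longrightarrow> GFace G (Suc k) j v = \<one>\<^bsub>Lev G k\<^esub>" by auto
    let ?v = "w (Suc i) \<otimes>\<^bsub>Lev G (Suc k)\<^esub> inv\<^bsub>Lev G (Suc k)\<^esub> v"
    have faces: "GFace G (Suc k) j ?v = GFace G (Suc k) j (w (Suc i)) \<otimes>\<^bsub>Lev G k\<^esub> inv\<^bsub>Lev G k\<^esub> (GFace G (Suc k) j v)"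
      if "j \<le> Suc k" for j using that v(1) w[OF Suc.prems] by simp
    have "GFace G (Suc k) j ?v = \<one>\<^bsub>Lev G k\<^esub>" if j: "j \<le> Suc k" "j \<noteq> Suc (Suc i)" for j
    proof (cases "j = Suc i")
      case True
      then show ?thesis
        using faces[OF j(1)] v(2) shared[of i] Suc.prems w[of "Suc i"] by simp
    next
      case False
      then show ?thesis
        using faces[OF j(1)] v(3) j trivial[OF Suc.prems j(1)] by simp
    qed
    moreover have "GFace G (Suc k) (Suc (Suc i)) ?v = GFace G (Suc k) (Suc (Suc i)) (w (Suc i))"
      using faces[of "Suc (Suc i)"] v(3) Suc.prems w[of "Suc i"] by simp
    ultimately show ?case using v(1) w[OF Suc.prems] by (intro bexI[of _ ?v]) simp_all
  qed
  from this[of k] show ?thesis using last by force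
qed

end

section \<open>Maps from contractible spaces to simplicial groups\<close>

lemma (in simplicial_group) pointwise_mult:
  assumes A: "simplicial_set A" and f: "f \<in> smap A (under G)" and g: "g \<in> smap A (under G)"
  shows "restr A (\<lambda>n a. f n a \<otimes>\<^bsub>Lev G n\<^esub> g n a) \<in> smap A (under G)"
  using smap_closed[OF f] smap_closed[OF g]
  by (intro restr_smap[OF A]) (simp_all add: smap_face[OF f] smap_face[OF g] smap_degen[OF f] smap_degen[OF g])

lemma (in simplicial_group) pointwise_inv:
  assumes A: "simplicial_set A" and f: "f \<in> smap A (under G)"
  shows "restr A (\<lambda>n a. inv\<^bsub>Lev G n\<^esub> (f n a)) \<in> smap A (under G)"
  using smap_closed[OF f] by (intro restr_smap[OF A]) (simp_all add: smap_face[OF f] smap_degen[OF f])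

lemma smap_snd:
  assumes A: "simplicial_set A" and B: "simplicial_set B" and f: "f \<in> smap B Y"
  shows "restr (A \<times>\<^sub>s B) (\<lambda>n (a, b). f n b) \<in> smap (A \<times>\<^sub>s B) Y"
  by (rule restr_prod_smap[OF A B]) (simp_all add: smap_closed[OF f] smap_face[OF f] smap_degen[OF f])

text \<open>In a simplicial group homotopies \<open>h : f \<rightarrow> g\<close>, \<open>h' : g \<rightarrow> g'\<close> compose to \<open>h \<cdot> g\<inverse> \<cdot> h'\<close>, and
  \<open>f \<cdot> h\<inverse> \<cdot> g\<close> reverses \<open>h\<close>.\<close>

lemma (in simplicial_group) homotopic_maps_imp_elementary:
  assumes C: "simplicial_set C" and h: "homotopic_maps C (under G) f f'" and f: "f \<in> smap C (under G)"
  shows "elementary_homotopic C (under G) f f'"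
proof -
  have C1: "simplicial_set (\<Delta> 1 \<times>\<^sub>s C)" by (rule simplicial_set_prod[OF simplicial_set_std_simplex C])
  have r: "(replicate (Suc n) a, x) \<in> Simp (\<Delta> 1 \<times>\<^sub>s C) n" if "x \<in> Simp C n" "a \<le> 1" for n a x
    using that replicate_simplex[of a 1 n] by (simp del: std_simplex_simps)
  have three: "elementary_homotopic C (under G) (restr C (\<lambda>n x. F1 n x \<otimes>\<^bsub>Lev G n\<^esub> (inv\<^bsub>Lev G n\<^esub> F2 n x \<otimes>\<^bsub>Lev G n\<^esub> F3 n x)))
     (restr C (\<lambda>n x. F1' n x \<otimes>\<^bsub>Lev G n\<^esub> (inv\<^bsub>Lev G n\<^esub> F2' n x \<otimes>\<^bsub>Lev G n\<^esub> F3' n x)))"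
    if h: "elementary_homotopic C (under G) F1 F1'" "elementary_homotopic C (under G) F2 F2'"
      "elementary_homotopic C (under G) F3 F3'" for F1 F1' F2 F2' F3 F3'
  proof -
    obtain H1 H2 H3 where H: "H1 \<in> smap (\<Delta> 1 \<times>\<^sub>s C) (under G)" "H2 \<in> smap (\<Delta> 1 \<times>\<^sub>s C) (under G)" "H3 \<in> smap (\<Delta> 1 \<times>\<^sub>s C) (under G)"
      "\<forall>n. \<forall>x\<in>Simp C n. H1 n (replicate (Suc n) 0, x) = F1 n x \<and> H1 n (replicate (Suc n) 1, x) = F1' n x"
      "\<forall>n. \<forall>x\<in>Simp C n. H2 n (replicate (Suc n) 0, x) = F2 n x \<and> H2 n (replicate (Suc n) 1, x) = F2' n x"
      "\<forall>n. \<forall>x\<in>Simp C n. H3 n (replicate (Suc n) 0, x) = F3 n x \<and> H3 n (replicate (Suc n) 1, x) = F3' n x"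
      using h unfolding elementary_homotopic_def by metis
    note m = pointwise_mult[OF C1 H(1) pointwise_mult[OF C1 pointwise_inv[OF C1 H(2)] H(3)]]
    show ?thesis unfolding elementary_homotopic_def
      by (rule bexI[OF _ m]) (use H(4-6) r in \<open>simp add: restr_apply del: replicate.simps prod_sset_simps(1)\<close>)
  qed
  have refl: "elementary_homotopic C (under G) f f" if f: "f \<in> smap C (under G)" for f
    unfolding elementary_homotopic_def
    by (rule bexI[OF _ smap_snd[OF simplicial_set_std_simplex C f]])
      (use r in \<open>simp add: restr_apply del: replicate.simps prod_sset_simps(1)\<close>)
  have cancel: "restr C (\<lambda>n x. F n x \<otimes>\<^bsub>Lev G n\<^esub> (inv\<^bsub>Lev G n\<^esub> F n x \<otimes>\<^bsub>Lev G n\<^esub> F' n x)) = F'"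
      "restr C (\<lambda>n x. F' n x \<otimes>\<^bsub>Lev G n\<^esub> (inv\<^bsub>Lev G n\<^esub> F n x \<otimes>\<^bsub>Lev G n\<^esub> F n x)) = F'"
    if "F \<in> smap C (under G)" "F' \<in> smap C (under G)" for F F'
    using smap_closed[OF that(1)] smap_closed[OF that(2)] smap_undefined[OF that(2)]
    by (auto simp: restr_def fun_eq_iff)
  have sym: "elementary_homotopic C (under G) g f"
    if "f \<in> smap C (under G)" "g \<in> smap C (under G)" "elementary_homotopic C (under G) f g" for f g
    using three[OF refl[OF that(1)] that(3) refl[OF that(2)]] cancel(1)[OF that(1,2)] cancel(2)[OF that(2,1)] by simp
  have trans: "elementary_homotopic C (under G) f g'"
    if "f \<in> smap C (under G)" "g \<in> smap C (under G)" "g' \<in> smap C (under G)"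
      "elementary_homotopic C (under G) f g" "elementary_homotopic C (under G) g g'" for f g g'
    using three[OF that(4) refl[OF that(2)] that(5)] cancel(1)[OF that(2,3)] cancel(2)[OF that(2,1)] by simp
  have "f' \<in> smap C (under G) \<and> elementary_homotopic C (under G) f f'"
    using h unfolding homotopic_maps_def
  proof (induction rule: equivclp_induct)
    case base
    then show ?case using f refl by blast
  next
    case (step y z)
    then show ?case using sym trans f by blast
  qed
  then show ?thesis by simp
qed

definition sub_sgroup :: "'g sgroup \<Rightarrow> (nat \<Rightarrow> 'g set) \<Rightarrow> 'g sgroup" where
  "sub_sgroup G U = G\<lparr>Lev := \<lambda>n. (Lev G n)\<lparr>carrier := U n\<rparr>\<rparr>"

lemma sub_sgroup_simps [simp]:
  "carrier (Lev (sub_sgroup G U) n) = U n" "\<one>\<^bsub>Lev (sub_sgroup G U) n\<^esub> = \<one>\<^bsub>Lev G n\<^esub>"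
  "x \<otimes>\<^bsub>Lev (sub_sgroup G U) n\<^esub> y = x \<otimes>\<^bsub>Lev G n\<^esub> y"
  "GFace (sub_sgroup G U) = GFace G" "GDegen (sub_sgroup G U) = GDegen G"
  by (simp_all add: sub_sgroup_def)

lemma (in simplicial_group) simplicial_group_sub_sgroup:
  assumes U: "\<And>n. subgroup (U n) (Lev G n)"
    and face: "\<And>n i x. x \<in> U (Suc n) \<Longrightarrow> i \<le> Suc n \<Longrightarrow> GFace G (Suc n) i x \<in> U n"
    and degen: "\<And>n i x. x \<in> U n \<Longrightarrow> i \<le> n \<Longrightarrow> GDegen G n i x \<in> U (Suc n)"
  shows "simplicial_group (sub_sgroup G U)"
proof (intro simplicial_group.intro)
  have mem: "x \<in> carrier (Lev G n)" if "x \<in> U n" for x n using subgroup.mem_carrier[OF U that] .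
  interpret G: simplicial_set "under G" by (rule under_simplicial)
  show "simplicial_set (under (sub_sgroup G U))"
    by standard (use face degen mem G.face_face G.degen_degen G.face_degen_less G.face_degen_eq
      G.face_degen_greater in \<open>simp_all del: One_nat_def\<close>)
  show "group (Lev (sub_sgroup G U) n)" for n
    using subgroup.subgroup_is_group[OF U group_level] by (simp add: sub_sgroup_def)
qed (use face degen subgroup.mem_carrier[OF U] in \<open>auto simp: hom_def\<close>)

fun gen_word :: "('h, 'm) monoid_scheme \<Rightarrow> ('c \<Rightarrow> 'h) \<Rightarrow> ('c + unit) list \<Rightarrow> 'h" where
  "gen_word G f (Inl x # w) = f x \<otimes>\<^bsub>G\<^esub> gen_word G f w"
| "gen_word G f (Inr u # Inl x # w) = inv\<^bsub>G\<^esub> f x \<otimes>\<^bsub>G\<^esub> gen_word G f w"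
| "gen_word G f w = \<one>\<^bsub>G\<^esub>"

text \<open>The subgroup generated by a family indexed by \<open>'c\<close> embeds into the words over \<open>'c\<close>, in which
  \<open>Inr ()\<close> marks that the next letter is inverted.\<close>

lemma (in group) generate_word:
  assumes f: "f ` A \<subseteq> carrier G" and v: "v \<in> generate G (f ` A)"
  shows "\<exists>w. gen_word G f w = v"
proof -
  have "\<forall>w. gen_word G f w \<in> carrier G \<longrightarrow> (\<exists>w'. gen_word G f w' = v \<otimes> gen_word G f w)"
    using v
  proof (induction rule: generate.induct)
    case one
    then show ?case by force
  next
    case (incl h)
    then show ?case by (auto intro: exI[of _ "Inl _ # _"])
  next
    case (inv h)
    then show ?case by (auto intro: exI[of _ "Inr () # Inl _ # _"])
  next
    case (eng h1 h2)
    have mem: "h1 \<in> carrier G" "h2 \<in> carrier G" using eng.hyps generate_in_carrier[OF f] by auto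
    show ?case
    proof (intro allI impI)
      fix w assume w: "gen_word G f w \<in> carrier G"
      then obtain w' where "gen_word G f w' = h2 \<otimes> gen_word G f w" using eng by blast
      moreover from this have "gen_word G f w' \<in> carrier G" using mem w by simp
      ultimately show "\<exists>w'. gen_word G f w' = h1 \<otimes> h2 \<otimes> gen_word G f w" using eng(3) mem w by (metis m_assoc)
    qed
  qed
  then have "\<exists>w'. gen_word G f w' = v \<otimes> gen_word G f []" by (metis gen_word.simps(3) one_closed)
  then show ?thesis using generate_in_carrier[OF f v] by simp
qed

text \<open>
  The definition of contractibility quantifies over the Kan complexes with simplices in one type. A
  Kan complex with simplices in another type is replaced by its copy under an embedding \<open>e\<close> with
  left inverse \<open>d\<close>.
\<close>

lemma kan_complex_transport:
  assumes S: "kan_complex S" and e: "\<And>n x. x \<in> Simp S n \<Longrightarrow> d n (e n x) = x"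
  shows "kan_complex \<lparr>Simp = \<lambda>n. e n ` Simp S n, Face = \<lambda>n i y. e (n - 1) (Face S n i (d n y)),
    Degen = \<lambda>n i y. e (Suc n) (Degen S n i (d n y))\<rparr>" (is "kan_complex ?K")
proof -
  interpret S: simplicial_set S using S unfolding kan_complex_def by blast
  have A: "simplicial_set ?K"
    by standard (auto simp: e S.face_closed S.degen_closed S.face_face S.degen_degen S.face_degen_less
      S.face_degen_eq S.face_degen_greater simp del: One_nat_def simp: diff_Suc_1)
  have B: "\<exists>y\<in>Simp ?K (Suc n). \<forall>i\<le>Suc n. i \<noteq> k \<longrightarrow> Face ?K (Suc n) i y = x i"
    if k: "k \<le> Suc n" and x: "\<forall>i\<le>Suc n. i \<noteq> k \<longrightarrow> x i \<in> Simp ?K n"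
      and c: "\<forall>i j. i < j \<longrightarrow> j \<le> Suc n \<longrightarrow> i \<noteq> k \<longrightarrow> j \<noteq> k \<longrightarrow> 0 < n \<longrightarrow>
           Face ?K n i (x j) = Face ?K n (j - 1) (x i)" for n k x
  proof -
    have x': "d n (x i) \<in> Simp S n" "e n (d n (x i)) = x i" if "i \<le> Suc n" "i \<noteq> k" for i
      using x that e by fastforce+
    have "Face S n i (d n (x j)) = Face S n (j - 1) (d n (x i))"
      if h: "i < j" "j \<le> Suc n" "i \<noteq> k" "j \<noteq> k" "0 < n" for i j
    proof -
      obtain n' where n: "n = Suc n'" using h by (cases n) auto
      have "e n' (Face S n i (d n (x j))) = e n' (Face S n (j - 1) (d n (x i)))"
        using c h n by auto
      then have "d n' (e n' (Face S n i (d n (x j)))) = d n' (e n' (Face S n (j - 1) (d n (x i))))" by simp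
      then show ?thesis using x'[of i] x'[of j] h n by (simp add: e S.face_closed)
    qed
    then have "\<exists>y\<in>Simp S (Suc n). \<forall>i\<le>Suc n. i \<noteq> k \<longrightarrow> Face S (Suc n) i y = d n (x i)"
      using S k x'(1) unfolding kan_complex_def by auto
    then obtain y where "y \<in> Simp S (Suc n)" "\<forall>i\<le>Suc n. i \<noteq> k \<longrightarrow> Face S (Suc n) i y = d n (x i)" by blast
    then show ?thesis using x' e by (intro bexI[of _ "e (Suc n) y"]) auto
  qed
  show ?thesis unfolding kan_complex_def
    by (intro conjI allI impI, rule A) (rule B; assumption)
qed

lemma point_smap: "simplicial_set X \<Longrightarrow> (\<lambda>n. \<lambda>x\<in>Simp X n. ()) \<in> smap X point"
  using restr_smap[of X "\<lambda>n x. ()" point] by (simp add: restr_def point_def)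

lemma simplicial_set_point: "simplicial_set point"
  by standard (simp_all add: point_def)

text \<open>
  The values of \<open>f\<close> generate a simplicial subgroup \<open>U\<close> of \<open>H\<close>. As a simplicial group it is a Kan complex,
  and it is so small that words over the simplices of \<open>C\<close> encode it; so contractibility of \<open>C\<close> says
  that \<open>f : C \<rightarrow> U\<close> is homotopic to a constant map.
\<close>

lemma contractible_imp_null_homotopic:
  fixes C :: "'c sset" and H :: "'h sgroup"
  assumes C: "contractible C" and H: "simplicial_group H" and f: "f \<in> smap C (under H)"
  shows "\<exists>g\<in>smap point (under H). elementary_homotopic C (under H) f (\<lambda>n. \<lambda>c\<in>Simp C n. g n ())"
proof -
  interpret H: simplicial_group H by fact
  have Cs: "simplicial_set C" using C unfolding contractible_def by blast
  interpret C: simplicial_set C by fact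
  define U where "U n = generate (Lev H n) (f n ` Simp C n)" for n
  have sub: "f n ` Simp C n \<subseteq> carrier (Lev H n)" for n using smap_closed[OF f] by auto
  have U: "subgroup (U n) (Lev H n)" for n
    unfolding U_def by (rule group.generate_is_subgroup[OF H.group_level sub])
  have Uc: "x \<in> U n \<Longrightarrow> x \<in> carrier (Lev H n)" for x n using subgroup.mem_carrier[OF U] .
  have U_ops: "x \<otimes>\<^bsub>Lev H n\<^esub> y \<in> U n" "inv\<^bsub>Lev H n\<^esub> x \<in> U n" "\<one>\<^bsub>Lev H n\<^esub> \<in> U n"
    if "x \<in> U n" "y \<in> U n" for x y n
    using subgroup.m_closed[OF U] subgroup.m_inv_closed[OF U] subgroup.one_closed[OF U] that by blast+
  have f_U: "f n c \<in> U n" if "c \<in> Simp C n" for n c unfolding U_def using that by (auto intro: generate.incl)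
  have one_U: "\<one>\<^bsub>Lev H n\<^esub> \<in> U n" for n using subgroup.one_closed[OF U] .
  have face: "GFace H (Suc n) i x \<in> U n" if "x \<in> U (Suc n)" "i \<le> Suc n" for n i x
    using that(1) unfolding U_def
  proof (induction rule: generate.induct)
    case one
    then show ?case using that(2) one_U by (simp add: U_def[symmetric])
  next
    case (incl h)
    then obtain c where "c \<in> Simp C (Suc n)" "h = f (Suc n) c" by auto
    then show ?case using smap_face[OF f, of c n i] that(2) f_U[OF C.face_closed, of c n i] by (simp add: U_def[symmetric])
  next
    case (inv h)
    then obtain c where c: "c \<in> Simp C (Suc n)" "h = f (Suc n) c" by auto
    then show ?case using smap_face[OF f, of c n i] that(2) f_U[OF C.face_closed, of c n i] smap_closed[OF f c(1)]
        U_ops(2) by (simp add: U_def[symmetric])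
  next
    case (eng h1 h2)
    then show ?case using Uc[of _ "Suc n"] U_ops(1) that(2) by (simp add: U_def[symmetric])
  qed
  have degen: "GDegen H n i x \<in> U (Suc n)" if "x \<in> U n" "i \<le> n" for n i x
    using that(1) unfolding U_def
  proof (induction rule: generate.induct)
    case one
    then show ?case using that(2) one_U by (simp add: U_def[symmetric])
  next
    case (incl h)
    then obtain c where "c \<in> Simp C n" "h = f n c" by auto
    then show ?case using smap_degen[OF f, of c n i] that(2) f_U[OF C.degen_closed, of c n i] by (simp add: U_def[symmetric])
  next
    case (inv h)
    then obtain c where c: "c \<in> Simp C n" "h = f n c" by auto
    then show ?case using smap_degen[OF f, of c n i] that(2) f_U[OF C.degen_closed, of c n i] smap_closed[OF f c(1)]
        U_ops(2) by (simp add: U_def[symmetric])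
  next
    case (eng h1 h2)
    then show ?case using Uc[of _ n] U_ops(1) that(2) by (simp add: U_def[symmetric])
  qed
  let ?S = "under (sub_sgroup H U)"
  interpret S: simplicial_group "sub_sgroup H U"
    by (rule H.simplicial_group_sub_sgroup[OF U face degen])
  define d where "d n = gen_word (Lev H n) (f n)" for n
  define e where "e n v = (SOME w. d n w = v)" for n v
  have de: "d n (e n v) = v" if "v \<in> U n" for n v
    using someI_ex[OF group.generate_word[OF H.group_level sub that[unfolded U_def]]] by (simp add: e_def d_def)
  define K :: "('c + unit) list sset" where "K = \<lparr>Simp = \<lambda>n. e n ` Simp ?S n, Face = \<lambda>n i y. e (n - 1) (Face ?S n i (d n y)),
    Degen = \<lambda>n i y. e (Suc n) (Degen ?S n i (d n y))\<rparr>"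
  have K: "kan_complex K" unfolding K_def
    by (rule kan_complex_transport[OF S.kan_complex_under]) (simp add: de)
  then have Ks: "simplicial_set K" unfolding kan_complex_def by blast
  let ?t = "\<lambda>n. \<lambda>x\<in>Simp C n. ()"
  let ?h = "restr C (\<lambda>n c. e n (f n c))"
  have h: "?h \<in> smap C K"
    by (rule restr_smap[OF Cs])
      (auto simp: K_def f_U smap_face[OF f] smap_degen[OF f] de C.face_closed C.degen_closed)
  have d: "restr K d \<in> smap K (under H)"
    by (rule restr_smap[OF Ks]) (auto simp: K_def de face degen Uc)
  obtain g where g: "g \<in> smap point K" "homotopic_maps C K (scomp C g ?t) ?h"
    using C K h unfolding contractible_def weak_equivalence_def by blast
  let ?g = "scomp point (restr K d) g"
  have gs: "?g \<in> smap point (under H)" by (rule scomp_smap[OF simplicial_set_point g(1) d])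
  have "scomp C (restr K d) ?h = f"
  proof (intro ext)
    fix n c
    have "e n (f n c) \<in> Simp K n" if "c \<in> Simp C n" using that f_U by (simp add: K_def)
    then show "scomp C (restr K d) ?h n c = f n c"
      using smap_undefined[OF f, of c n] f_U[of c n] by (auto simp: scomp_def compose_def restr_def de)
  qed
  moreover have "scomp C (restr K d) (scomp C g ?t) = (\<lambda>n. \<lambda>c\<in>Simp C n. ?g n ())"
    by (auto simp: scomp_def compose_def fun_eq_iff point_def)
  ultimately have "homotopic_maps C (under H) f (\<lambda>n. \<lambda>c\<in>Simp C n. ?g n ())"
    using scomp_homotopic_maps[OF Cs d g(2)] homotopic_maps_sym by metis
  then show ?thesis using H.homotopic_maps_imp_elementary[OF Cs _ f] gs by blast
qed

text \<open>
  The empty simplicial set is a Kan complex that receives a map from an empty \<open>C\<close>, but none from the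
  point.
\<close>

lemma contractible_nonempty:
  assumes "contractible (C :: 'c sset)"
  shows "\<exists>c. c \<in> Simp C 0"
proof (rule ccontr)
  assume none: "\<nexists>c. c \<in> Simp C 0"
  interpret C: simplicial_set C using assms unfolding contractible_def by blast
  have empty: "Simp C n = {}" for n
  proof (induction n)
    case (Suc n)
    then show ?case using C.face_closed[of _ n 0] by auto
  qed (use none in auto)
  let ?K = "\<lparr>Simp = \<lambda>n. {}, Face = \<lambda>n i x. x, Degen = \<lambda>n i x. x\<rparr> :: ('c + unit) list sset"
  have "simplicial_set ?K" by standard auto
  then have "kan_complex ?K"
    unfolding kan_complex_def by auto
  moreover have "(\<lambda>n x. undefined) \<in> smap C ?K" using empty by (auto simp: smap_def)
  ultimately obtain g where "g \<in> smap point ?K"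
    using assms unfolding contractible_def weak_equivalence_def by blast
  then show False using smap_closed[of g point ?K "()" 0] by (simp add: point_def)
qed

section \<open>Equivariant lifting for free actions\<close>

text \<open>
  Simplicial actions that need not be extensional, in contrast to \<open>group_action\<close>. This leaves room for
  products and for the trivial action.
\<close>

locale gspace =
  fixes G :: "'g sgroup" and X :: "'a sset" and \<alpha> :: "nat \<Rightarrow> 'g \<Rightarrow> 'a \<Rightarrow> 'a"
  assumes sgroup: "simplicial_group G" and space: "simplicial_set X"
    and act_closed [simp]: "\<And>n g x. g \<in> carrier (Lev G n) \<Longrightarrow> x \<in> Simp X n \<Longrightarrow> \<alpha> n g x \<in> Simp X n"
    and act_one [simp]: "\<And>n x. x \<in> Simp X n \<Longrightarrow> \<alpha> n \<one>\<^bsub>Lev G n\<^esub> x = x"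
    and act_mult: "\<And>n g h x. g \<in> carrier (Lev G n) \<Longrightarrow> h \<in> carrier (Lev G n) \<Longrightarrow> x \<in> Simp X n \<Longrightarrow>
        \<alpha> n (g \<otimes>\<^bsub>Lev G n\<^esub> h) x = \<alpha> n g (\<alpha> n h x)"
    and act_face: "\<And>n i g x. g \<in> carrier (Lev G (Suc n)) \<Longrightarrow> x \<in> Simp X (Suc n) \<Longrightarrow> i \<le> Suc n \<Longrightarrow>
        Face X (Suc n) i (\<alpha> (Suc n) g x) = \<alpha> n (GFace G (Suc n) i g) (Face X (Suc n) i x)"
    and act_degen: "\<And>n i g x. g \<in> carrier (Lev G n) \<Longrightarrow> x \<in> Simp X n \<Longrightarrow> i \<le> n \<Longrightarrow>
        Degen X n i (\<alpha> n g x) = \<alpha> (Suc n) (GDegen G n i g) (Degen X n i x)"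
begin

sublocale G: simplicial_group G by (rule sgroup)
sublocale simplicial_set X by (rule space)

lemma act_inv [simp]:
  assumes "g \<in> carrier (Lev G n)" "x \<in> Simp X n"
  shows "\<alpha> n (inv\<^bsub>Lev G n\<^esub> g) (\<alpha> n g x) = x" "\<alpha> n g (\<alpha> n (inv\<^bsub>Lev G n\<^esub> g) x) = x"
  using assms by (simp_all add: act_mult[symmetric])

lemma op_act:
  assumes s: "s \<in> Simp (\<Delta> k) m" and g: "g \<in> carrier (Lev G k)" and x: "x \<in> Simp X k"
  shows "op X k s (\<alpha> k g x) = \<alpha> m (op (under G) k s g) (op X k s x)"
proof -
  interpret U: simplicial_set "under G" by (rule G.under_simplicial)
  have g': "g \<in> Simp (under G) k" using g by simp
  show ?thesis
    by (subst op_unique'[where f = "\<lambda>m s. \<alpha> m (op (under G) k s g) (op X k s x)", OF space _ _ _ s])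
      (use U.op_closed[OF _ g'] op_closed[OF _ x] U.face_op[OF _ g'] face_op[OF _ x]
        U.degen_op[OF _ g'] degen_op[OF _ x] in \<open>simp_all add: act_face act_degen del: std_simplex_simps(1)\<close>)
qed

end

lemma (in simplicial_group) op_hom:
  assumes s: "s \<in> Simp (\<Delta> k) m" and g: "g \<in> carrier (Lev G k)" and h: "h \<in> carrier (Lev G k)"
  shows "op (under G) k s g \<in> carrier (Lev G m)"
    and "op (under G) k s (g \<otimes>\<^bsub>Lev G k\<^esub> h) = op (under G) k s g \<otimes>\<^bsub>Lev G m\<^esub> op (under G) k s h"
    and "op (under G) k s \<one>\<^bsub>Lev G k\<^esub> = \<one>\<^bsub>Lev G m\<^esub>"
    and "op (under G) k s (inv\<^bsub>Lev G k\<^esub> g) = inv\<^bsub>Lev G m\<^esub> (op (under G) k s g)"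
proof -
  interpret U: simplicial_set "under G" by (rule under_simplicial)
  have g': "g \<in> Simp (under G) k" "h \<in> Simp (under G) k" using g h by simp_all
  note c = U.op_closed[OF _ g'(1), unfolded under_simps] U.op_closed[OF _ g'(2), unfolded under_simps]
  note f = U.face_op[OF _ g'(1), unfolded under_simps] U.face_op[OF _ g'(2), unfolded under_simps]
    U.degen_op[OF _ g'(1), unfolded under_simps] U.degen_op[OF _ g'(2), unfolded under_simps]
  show "op (under G) k s g \<in> carrier (Lev G m)" using c(1)[OF s] .
  show "op (under G) k s (g \<otimes>\<^bsub>Lev G k\<^esub> h) = op (under G) k s g \<otimes>\<^bsub>Lev G m\<^esub> op (under G) k s h"
    by (subst op_unique'[where f = "\<lambda>m s. op (under G) k s g \<otimes>\<^bsub>Lev G m\<^esub> op (under G) k s h", OF under_simplicial _ _ _ s])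
      (use c f in \<open>simp_all del: std_simplex_simps(1)\<close>)
  show "op (under G) k s \<one>\<^bsub>Lev G k\<^esub> = \<one>\<^bsub>Lev G m\<^esub>"
    by (subst op_unique'[where f = "\<lambda>m s. \<one>\<^bsub>Lev G m\<^esub>", OF under_simplicial _ _ _ s]) simp_all
  show "op (under G) k s (inv\<^bsub>Lev G k\<^esub> g) = inv\<^bsub>Lev G m\<^esub> (op (under G) k s g)"
    by (subst op_unique'[where f = "\<lambda>m s. inv\<^bsub>Lev G m\<^esub> (op (under G) k s g)", OF under_simplicial _ _ _ s])
      (use c f in \<open>simp_all del: std_simplex_simps(1)\<close>)
qed

definition equivariant :: "'g sgroup \<Rightarrow> 'a sset \<Rightarrow> (nat \<Rightarrow> 'g \<Rightarrow> 'a \<Rightarrow> 'a) \<Rightarrow> (nat \<Rightarrow> 'g \<Rightarrow> 'b \<Rightarrow> 'b) \<Rightarrow>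
    (nat \<Rightarrow> 'a \<Rightarrow> 'b) \<Rightarrow> bool" where
  "equivariant G X \<alpha> \<beta> f \<longleftrightarrow>
     (\<forall>n. \<forall>g\<in>carrier (Lev G n). \<forall>x\<in>Simp X n. f n (\<alpha> n g x) = \<beta> n g (f n x))"

locale free_gspace = gspace +
  assumes free: "\<And>n g x. g \<in> carrier (Lev G n) \<Longrightarrow> x \<in> Simp X n \<Longrightarrow> \<alpha> n g x = x \<Longrightarrow> g = \<one>\<^bsub>Lev G n\<^esub>"
begin

lemma free_cancel:
  assumes g: "g \<in> carrier (Lev G n)" and h: "h \<in> carrier (Lev G n)" and x: "x \<in> Simp X n"
    and eq: "\<alpha> n g x = \<alpha> n h x"
  shows "g = h"
proof -
  have "\<alpha> n (inv\<^bsub>Lev G n\<^esub> h \<otimes>\<^bsub>Lev G n\<^esub> g) x = x" using eq g h x by (simp add: act_mult)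
  then have "inv\<^bsub>Lev G n\<^esub> h \<otimes>\<^bsub>Lev G n\<^esub> g = \<one>\<^bsub>Lev G n\<^esub>" using free[of "inv\<^bsub>Lev G n\<^esub> h \<otimes>\<^bsub>Lev G n\<^esub> g" n x] g h x by simp
  then have "h \<otimes>\<^bsub>Lev G n\<^esub> (inv\<^bsub>Lev G n\<^esub> h \<otimes>\<^bsub>Lev G n\<^esub> g) = h" using h by simp
  then show ?thesis using g h by simp
qed

text \<open>Choices on a free orbit are made at one representative and transported by the action.\<close>

lemma equivariant_choice:
  assumes P: "gspace G P \<rho>"
    and good: "\<And>x. x \<in> Simp X n \<Longrightarrow> \<exists>y. good x y"
    and closed: "\<And>x y. good x y \<Longrightarrow> y \<in> Simp P n"
    and act: "\<And>g x y. g \<in> carrier (Lev G n) \<Longrightarrow> x \<in> Simp X n \<Longrightarrow> good x y \<Longrightarrow> good (\<alpha> n g x) (\<rho> n g y)"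
  shows "\<exists>w. \<forall>x\<in>Simp X n. good x (w x) \<and> (\<forall>g\<in>carrier (Lev G n). w (\<alpha> n g x) = \<rho> n g (w x))"
proof -
  interpret P: gspace G P \<rho> by (rule P)
  define orb where "orb x = {\<alpha> n g x |g. g \<in> carrier (Lev G n)}" for x
  define rep where "rep x = (SOME z. z \<in> orb x)" for x
  define el where "el x = (SOME g. g \<in> carrier (Lev G n) \<and> \<alpha> n g (rep x) = x)" for x
  define b where "b z = (SOME y. good z y)" for z
  define w where "w x = \<rho> n (el x) (b (rep x))" for x
  have el: "el x \<in> carrier (Lev G n)" "\<alpha> n (el x) (rep x) = x" "rep x \<in> Simp X n" if x: "x \<in> Simp X n" for x
  proof -
    have "x \<in> orb x" using act_one[OF x] unfolding orb_def
      by (auto intro!: exI[of _ "\<one>\<^bsub>Lev G n\<^esub>"])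
    then have "rep x \<in> orb x" unfolding rep_def by (rule someI)
    then obtain g where g: "g \<in> carrier (Lev G n)" "rep x = \<alpha> n g x" unfolding orb_def by blast
    then show "rep x \<in> Simp X n" using x by simp
    have "\<exists>g. g \<in> carrier (Lev G n) \<and> \<alpha> n g (rep x) = x"
      using g x by (intro exI[of _ "inv\<^bsub>Lev G n\<^esub> g"]) simp
    from someI_ex[OF this] show "el x \<in> carrier (Lev G n)" "\<alpha> n (el x) (rep x) = x"
      by (simp_all add: el_def)
  qed
  have b: "good z (b z)" if "z \<in> Simp X n" for z
    unfolding b_def using good[OF that] by (rule someI_ex)
  have "good x (w x)" if x: "x \<in> Simp X n" for x
    using act[OF el(1)[OF x] el(3)[OF x] b[OF el(3)[OF x]]] el(2)[OF x] by (simp add: w_def)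
  moreover have "w (\<alpha> n g x) = \<rho> n g (w x)" if x: "x \<in> Simp X n" and g: "g \<in> carrier (Lev G n)" for x g
  proof -
    have "orb (\<alpha> n g x) = orb x"
    proof (intro equalityI subsetI)
      fix z assume "z \<in> orb (\<alpha> n g x)"
      then obtain h where "h \<in> carrier (Lev G n)" "z = \<alpha> n h (\<alpha> n g x)" unfolding orb_def by blast
      then show "z \<in> orb x" using x g unfolding orb_def
        by (auto intro!: exI[of _ "h \<otimes>\<^bsub>Lev G n\<^esub> g"] simp: act_mult)
    next
      fix z assume "z \<in> orb x"
      then obtain h where "h \<in> carrier (Lev G n)" "z = \<alpha> n h x" unfolding orb_def by blast
      then show "z \<in> orb (\<alpha> n g x)" using x g unfolding orb_def
        by (auto intro!: exI[of _ "h \<otimes>\<^bsub>Lev G n\<^esub> inv\<^bsub>Lev G n\<^esub> g"] simp: act_mult)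
    qed
    then have rep: "rep (\<alpha> n g x) = rep x" by (simp add: rep_def)
    have gx: "\<alpha> n g x \<in> Simp X n" using x g by simp
    have "\<alpha> n (el (\<alpha> n g x)) (rep x) = \<alpha> n (g \<otimes>\<^bsub>Lev G n\<^esub> el x) (rep x)"
      using el(2)[OF gx] el[OF x] rep g by (simp add: act_mult)
    then have "el (\<alpha> n g x) = g \<otimes>\<^bsub>Lev G n\<^esub> el x"
      using free_cancel[OF el(1)[OF gx] _ el(3)[OF x]] el(1)[OF x] g by simp
    then show ?thesis
      using rep g el(1)[OF x] closed[OF b[OF el(3)[OF x]]] by (simp add: w_def P.act_mult)
  qed
  ultimately show ?thesis by blast
qed

end

text \<open>
  Lifting along an equivariant map that is a trivial Kan fibration. The map is presented by its
  fibres over the simplices of \<open>X\<close>: \<open>R n x y\<close> says that \<open>y\<close> lies over \<open>x\<close>. The lift extends a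
  given one on the invariant subspace \<open>A\<close>.
\<close>

locale lifting_problem = X: free_gspace G X \<alpha> + P: gspace G P \<rho>
  for G :: "'g sgroup" and X :: "'a sset" and \<alpha> and P :: "'b sset" and \<rho> +
  fixes R :: "nat \<Rightarrow> 'a \<Rightarrow> 'b \<Rightarrow> bool" and A :: "nat \<Rightarrow> 'a \<Rightarrow> bool" and v0 :: "nat \<Rightarrow> 'a \<Rightarrow> 'b"
  assumes R_closed: "\<And>n x y. R n x y \<Longrightarrow> y \<in> Simp P n"
    and R_face: "\<And>n i x y. x \<in> Simp X (Suc n) \<Longrightarrow> R (Suc n) x y \<Longrightarrow> i \<le> Suc n \<Longrightarrow> R n (Face X (Suc n) i x) (Face P (Suc n) i y)"
    and R_degen: "\<And>n i x y. x \<in> Simp X n \<Longrightarrow> R n x y \<Longrightarrow> i \<le> n \<Longrightarrow> R (Suc n) (Degen X n i x) (Degen P n i y)"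
    and R_act: "\<And>n g x y. x \<in> Simp X n \<Longrightarrow> R n x y \<Longrightarrow> g \<in> carrier (Lev G n) \<Longrightarrow> R n (\<alpha> n g x) (\<rho> n g y)"
    and fill_point: "\<And>x. x \<in> Simp X 0 \<Longrightarrow> \<exists>y. R 0 x y"
    and fill: "\<And>n x y. x \<in> Simp X (Suc n) \<Longrightarrow> (\<And>i. i \<le> Suc n \<Longrightarrow> R n (Face X (Suc n) i x) (y i)) \<Longrightarrow>
      (\<And>i j. i < j \<Longrightarrow> j \<le> Suc n \<Longrightarrow> 0 < n \<Longrightarrow> Face P n i (y j) = Face P n (j - 1) (y i)) \<Longrightarrow>
      \<exists>z. R (Suc n) x z \<and> (\<forall>i\<le>Suc n. Face P (Suc n) i z = y i)"
    and A_face: "\<And>n i x. x \<in> Simp X (Suc n) \<Longrightarrow> A (Suc n) x \<Longrightarrow> i \<le> Suc n \<Longrightarrow> A n (Face X (Suc n) i x)"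
    and A_degen: "\<And>n i x. x \<in> Simp X n \<Longrightarrow> A n x \<Longrightarrow> i \<le> n \<Longrightarrow> A (Suc n) (Degen X n i x)"
    and A_act: "\<And>n g x. x \<in> Simp X n \<Longrightarrow> A n x \<Longrightarrow> g \<in> carrier (Lev G n) \<Longrightarrow> A n (\<alpha> n g x)"
    and v0_R: "\<And>n x. x \<in> Simp X n \<Longrightarrow> A n x \<Longrightarrow> R n x (v0 n x)"
    and v0_face: "\<And>n i x. x \<in> Simp X (Suc n) \<Longrightarrow> A (Suc n) x \<Longrightarrow> i \<le> Suc n \<Longrightarrow>
      v0 n (Face X (Suc n) i x) = Face P (Suc n) i (v0 (Suc n) x)"
    and v0_degen: "\<And>n i x. x \<in> Simp X n \<Longrightarrow> A n x \<Longrightarrow> i \<le> n \<Longrightarrow>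
      v0 (Suc n) (Degen X n i x) = Degen P n i (v0 n x)"
    and v0_act: "\<And>n g x. x \<in> Simp X n \<Longrightarrow> A n x \<Longrightarrow> g \<in> carrier (Lev G n) \<Longrightarrow> v0 n (\<alpha> n g x) = \<rho> n g (v0 n x)"
begin

definition level :: "nat \<Rightarrow> ('a \<Rightarrow> 'b) \<Rightarrow> bool" where
  "level n w \<longleftrightarrow> (\<forall>x\<in>Simp X n. R n x (w x) \<and> (\<forall>g\<in>carrier (Lev G n). w (\<alpha> n g x) = \<rho> n g (w x)) \<and>
     (A n x \<longrightarrow> w x = v0 n x))"

definition lift_upto :: "nat \<Rightarrow> (nat \<Rightarrow> 'a \<Rightarrow> 'b) \<Rightarrow> bool" where
  "lift_upto N f \<longleftrightarrow> (\<forall>n\<le>N. level n (f n)) \<and>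
     (\<forall>n<N. \<forall>x\<in>Simp X (Suc n). \<forall>i\<le>Suc n. f n (Face X (Suc n) i x) = Face P (Suc n) i (f (Suc n) x)) \<and>
     (\<forall>n<N. \<forall>x\<in>Simp X n. \<forall>i\<le>n. f (Suc n) (Degen X n i x) = Degen P n i (f n x))"

lemma levelD:
  assumes "level n w" "x \<in> Simp X n"
  shows level_R: "R n x (w x)" and level_act: "g \<in> carrier (Lev G n) \<Longrightarrow> w (\<alpha> n g x) = \<rho> n g (w x)"
    and level_A: "A n x \<Longrightarrow> w x = v0 n x" and level_closed: "w x \<in> Simp P n"
  using assms R_closed unfolding level_def by blast+

text \<open>
  A simplex in the orbit of a degenerate one may be so in two ways. The simplicial identities
  express both in terms of one simplex of lower dimension, up to group elements, and freeness of
  the action makes these elements agree; hence the values prescribed by both agree.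
\<close>

lemma degenerate_value_unique_le:
  assumes f: "lift_upto N f" and z: "z \<in> Simp X N" "z' \<in> Simp X N" and ij: "i \<le> j" "j \<le> N"
    and k: "k \<in> carrier (Lev G (Suc N))"
    and eq: "Degen X N i z = \<alpha> (Suc N) k (Degen X N j z')"
  shows "Degen P N i (f N z) = \<rho> (Suc N) k (Degen P N j (f N z'))"
proof -
  have lN: "level N (f N)" using f unfolding lift_upto_def by simp
  note fc = level_closed[OF lN]
  have dk: "GFace G (Suc N) i k \<in> carrier (Lev G N)" using k ij by simp
  have z_eq: "z = \<alpha> N (GFace G (Suc N) i k) (Face X (Suc N) i (Degen X N j z'))"
    using X.face_degen_eq[OF z(1), of i i] eq X.act_face[OF k X.degen_closed[OF z(2)], of j i] ij by simp
  show ?thesis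
  proof (cases "i = j")
    case True
    have z1: "z = \<alpha> N (GFace G (Suc N) i k) z'" using z_eq X.face_degen_eq[OF z(2), of i i] True ij by simp
    then have "Degen X N i z = \<alpha> (Suc N) (GDegen G N i (GFace G (Suc N) i k)) (Degen X N i z')"
      using X.act_degen[OF dk z(2)] ij by simp
    then have "k = GDegen G N i (GFace G (Suc N) i k)"
      using eq True X.free_cancel[OF k _ X.degen_closed[OF z(2) ij(2)]] dk ij by simp
    then have "\<rho> (Suc N) k (Degen P N j (f N z')) = \<rho> (Suc N) (GDegen G N i (GFace G (Suc N) i k)) (Degen P N i (f N z'))"
      using True by simp
    also have "\<dots> = Degen P N i (\<rho> N (GFace G (Suc N) i k) (f N z'))"
      using P.act_degen[OF dk fc[OF z(2)]] ij by simp
    also have "\<dots> = Degen P N i (f N z)" using level_act[OF lN z(2) dk] z1 by simp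
    finally show ?thesis by simp
  next
    case False
    then have lt: "i < j" using ij by simp
    then obtain M where N: "N = Suc M" using ij by (cases N) auto
    define W where "W = Face X N i z'"
    have W: "W \<in> Simp X M" unfolding W_def using X.face_closed[of z' M i] z(2) N ij by simp
    define a where "a = GFace G (Suc N) i k"
    have a: "a \<in> carrier (Lev G N)" using dk by (simp add: a_def)
    define b where "b = GFace G N j a"
    have b: "b \<in> carrier (Lev G M)" using a N ij by (simp add: b_def)
    define c where "c = GFace G (Suc N) (Suc j) (inv\<^bsub>Lev G (Suc N)\<^esub> k)"
    have c: "c \<in> carrier (Lev G N)" using k ij by (simp add: c_def)
    have jM: "j - 1 \<le> M" "i \<le> M" using lt ij N by auto
    have sW: "Degen X M (j - 1) W \<in> Simp X N" "Degen X M i W \<in> Simp X N" using X.degen_closed[OF W] jM N by auto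
    have fstep: "f N (Degen X M l W) = Degen P M l (f M W)" if "l \<le> M" for l
      using f that W N unfolding lift_upto_def by simp
    have fW: "f M W \<in> Simp P M" using f W N level_closed[of M "f M" W] unfolding lift_upto_def by simp
    have z1: "z = \<alpha> N a (Degen X M (j - 1) W)"
      using z_eq X.face_degen_less[of z' M i j] z(2) N lt ij by (simp add: a_def W_def)
    have "z' = Face X (Suc N) (Suc j) (\<alpha> (Suc N) (inv\<^bsub>Lev G (Suc N)\<^esub> k) (Degen X N i z))"
      using eq X.degen_closed[OF z(2) ij(2)] k X.face_degen_eq[OF z(2) ij(2), of "Suc j"] by simp
    also have "\<dots> = \<alpha> N c (Face X (Suc N) (Suc j) (Degen X N i z))"
      using X.act_face[OF _ X.degen_closed[OF z(1), of i], of "inv\<^bsub>Lev G (Suc N)\<^esub> k" "Suc j"] k ij by (simp add: c_def)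
    also have "Face X (Suc N) (Suc j) (Degen X N i z) = Degen X M i (Face X N j z)"
      using X.face_degen_greater[of z M i "Suc j"] z(1) N lt ij by simp
    also have "Face X N j z = \<alpha> M b W"
      using z1 X.act_face[of a M "Degen X M (j - 1) W" j] a N sW ij
        X.face_degen_eq[OF W jM(1), of j] lt by (simp add: b_def)
    also have "Degen X M i (\<alpha> M b W) = \<alpha> N (GDegen G M i b) (Degen X M i W)"
      using X.act_degen[OF b W jM(2)] N by simp
    finally have "z' = \<alpha> N c (\<alpha> N (GDegen G M i b) (Degen X M i W))" .
    moreover define e where "e = c \<otimes>\<^bsub>Lev G N\<^esub> GDegen G M i b"
    have sb: "GDegen G M i b \<in> carrier (Lev G N)" using b jM N by simp
    ultimately have z2: "z' = \<alpha> N e (Degen X M i W)" using X.act_mult[OF c sb sW(2)] by (simp add: e_def)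
    have e: "e \<in> carrier (Lev G N)" using c sb by (simp add: e_def)
    let ?V = "Degen X N j (Degen X M i W)"
    have V: "?V \<in> Simp X (Suc N)" using X.degen_closed[OF sW(2) ij(2)] .
    have se: "GDegen G N j e \<in> carrier (Lev G (Suc N))" "GDegen G N i a \<in> carrier (Lev G (Suc N))" using e a ij by auto
    have "Degen X N i z = \<alpha> (Suc N) (GDegen G N i a) ?V"
      using z1 X.act_degen[OF a sW(1), of i] X.degen_degen[OF W, of i "j - 1"] ij lt jM N by simp
    moreover have "\<alpha> (Suc N) k (Degen X N j z') = \<alpha> (Suc N) (k \<otimes>\<^bsub>Lev G (Suc N)\<^esub> GDegen G N j e) ?V"
      using z2 X.act_degen[OF e sW(2) ij(2)] X.act_mult[OF k se(1) V] by simp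
    ultimately have ke: "GDegen G N i a = k \<otimes>\<^bsub>Lev G (Suc N)\<^esub> GDegen G N j e"
      using eq X.free_cancel[OF se(2) _ V] k se(1) by simp
    have sfW: "Degen P M (j - 1) (f M W) \<in> Simp P N" "Degen P M i (f M W) \<in> Simp P N"
      using P.degen_closed[OF fW] jM N by auto
    have "Degen P N i (f N z) = Degen P N i (\<rho> N a (Degen P M (j - 1) (f M W)))"
      using z1 level_act[OF lN sW(1) a] fstep[OF jM(1)] by simp
    also have "\<dots> = \<rho> (Suc N) (GDegen G N i a) (Degen P N j (Degen P M i (f M W)))"
      using P.act_degen[OF a sfW(1), of i] P.degen_degen[OF fW, of i "j - 1"] ij lt jM N by simp
    also have "\<dots> = \<rho> (Suc N) k (\<rho> (Suc N) (GDegen G N j e) (Degen P N j (Degen P M i (f M W))))"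
      using ke P.act_mult[OF k se(1) P.degen_closed[OF sfW(2) ij(2)]] by simp
    also have "\<dots> = \<rho> (Suc N) k (Degen P N j (\<rho> N e (Degen P M i (f M W))))"
      using P.act_degen[OF e sfW(2) ij(2)] by simp
    also have "\<rho> N e (Degen P M i (f M W)) = f N z'"
      using z2 level_act[OF lN sW(2) e] fstep[OF jM(2)] by simp
    finally show ?thesis .
  qed
qed

lemma degenerate_value_unique:
  assumes f: "lift_upto N f" and z: "z \<in> Simp X N" "z' \<in> Simp X N" and ij: "i \<le> N" "j \<le> N"
    and k: "k \<in> carrier (Lev G (Suc N))"
    and eq: "Degen X N i z = \<alpha> (Suc N) k (Degen X N j z')"
  shows "Degen P N i (f N z) = \<rho> (Suc N) k (Degen P N j (f N z'))"
proof (cases "i \<le> j")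
  case True
  then show ?thesis using degenerate_value_unique_le[OF f z _ ij(2) k eq] by simp
next
  case False
  have lN: "level N (f N)" using f unfolding lift_upto_def by simp
  have "Degen X N j z' = \<alpha> (Suc N) (inv\<^bsub>Lev G (Suc N)\<^esub> k) (Degen X N i z)"
    using eq k X.degen_closed[OF z(2) ij(2)] by simp
  then have "Degen P N j (f N z') = \<rho> (Suc N) (inv\<^bsub>Lev G (Suc N)\<^esub> k) (Degen P N i (f N z))"
    using degenerate_value_unique_le[OF f z(2,1) _ ij(1)] False k by simp
  then show ?thesis using k P.degen_closed[OF level_closed[OF lN z(1)] ij(1)] by simp
qed

lemma lift_degen_face:
  assumes f: "lift_upto N f" and z: "z \<in> Simp X N" and i: "i \<le> N" and j: "j \<le> Suc N"
  shows "Face P (Suc N) j (Degen P N i (f N z)) = f N (Face X (Suc N) j (Degen X N i z))"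
proof -
  have lN: "level N (f N)" using f unfolding lift_upto_def by simp
  note fz = level_closed[OF lN z]
  consider "j = i \<or> j = Suc i" | "j < i" | "Suc i < j" by linarith
  then show ?thesis
  proof cases
    case 1
    then show ?thesis using X.face_degen_eq[OF z i 1] P.face_degen_eq[OF fz i 1] by simp
  next
    case 2
    then obtain M where N: "N = Suc M" using i by (cases N) auto
    have zM: "Face X N j z \<in> Simp X M" using X.face_closed[of z M j] z N j 2 i by simp
    have "Face P (Suc N) j (Degen P N i (f N z)) = Degen P M (i - 1) (Face P N j (f N z))"
      using P.face_degen_less[of "f N z" M j i] fz N 2 i by simp
    also have "Face P N j (f N z) = f M (Face X N j z)"
      using f z N 2 i unfolding lift_upto_def by simp
    also have "Degen P M (i - 1) (f M (Face X N j z)) = f N (Degen X M (i - 1) (Face X N j z))"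
      using f zM N 2 i unfolding lift_upto_def by simp
    also have "Degen X M (i - 1) (Face X N j z) = Face X (Suc N) j (Degen X N i z)"
      using X.face_degen_less[of z M j i] z N 2 i by simp
    finally show ?thesis .
  next
    case 3
    then obtain M where N: "N = Suc M" using i j by (cases N) auto
    have zM: "Face X N (j - 1) z \<in> Simp X M" using X.face_closed[of z M "j - 1"] z N j 3 i by simp
    have "Face P (Suc N) j (Degen P N i (f N z)) = Degen P M i (Face P N (j - 1) (f N z))"
      using P.face_degen_greater[of "f N z" M i j] fz N 3 j by simp
    also have "Face P N (j - 1) (f N z) = f M (Face X N (j - 1) z)"
      using f z N 3 j unfolding lift_upto_def by simp
    also have "Degen P M i (f M (Face X N (j - 1) z)) = f N (Degen X M i (Face X N (j - 1) z))"
      using f zM N 3 j unfolding lift_upto_def by simp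
    also have "Degen X M i (Face X N (j - 1) z) = Face X (Suc N) j (Degen X N i z)"
      using X.face_degen_greater[of z M i j] z N 3 j by simp
    finally show ?thesis .
  qed
qed

text \<open>
  The value at \<open>x\<close> is prescribed if \<open>x\<close> lies in \<open>A\<close> or in the orbit of a degenerate simplex; otherwise it
  is a filling of the boundary that the lift on the faces of \<open>x\<close> forms. In all cases the possible
  values form an invariant relation \<open>good\<close>, so that they can be chosen equivariantly.
\<close>

lemma extend_lift:
  assumes f: "lift_upto N f"
  shows "\<exists>f'. lift_upto (Suc N) f' \<and> (\<forall>n\<le>N. f' n = f n)"
proof -
  have lN: "level N (f N)" using f unfolding lift_upto_def by simp
  \<comment> \<open>The element \<open>h\<close> moves \<open>x\<close> to the degenerate simplex \<open>s_i z\<close>.\<close>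
  let ?deg = "\<lambda>x h i z. h \<in> carrier (Lev G (Suc N)) \<and> i \<le> N \<and> z \<in> Simp X N \<and> \<alpha> (Suc N) h x = Degen X N i z"
  define good where "good x y \<longleftrightarrow> R (Suc N) x y \<and>
     (\<forall>i\<le>Suc N. Face P (Suc N) i y = f N (Face X (Suc N) i x)) \<and>
     (\<forall>h i z. ?deg x h i z \<longrightarrow> \<rho> (Suc N) h y = Degen P N i (f N z)) \<and>
     (A (Suc N) x \<longrightarrow> y = v0 (Suc N) x)" for x y
  have "\<exists>w. \<forall>x\<in>Simp X (Suc N). good x (w x) \<and> (\<forall>g\<in>carrier (Lev G (Suc N)). w (\<alpha> (Suc N) g x) = \<rho> (Suc N) g (w x))"
  proof (rule X.equivariant_choice[OF P.gspace_axioms])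
    fix x assume x: "x \<in> Simp X (Suc N)"
    note dx = X.face_closed[OF x]
    show "\<exists>y. good x y"
    proof (cases "A (Suc N) x")
      case True
      have "\<rho> (Suc N) h (v0 (Suc N) x) = Degen P N i (f N z)" if d: "?deg x h i z" for h i z
      proof -
        have "Face X (Suc N) i (\<alpha> (Suc N) h x) = z" using d X.face_degen_eq[of z N i i] by simp
        then have Az: "A N z" using A_face[OF _ A_act[OF x True], of h i] X.degen_closed[of z N i] d x by simp
        have "\<rho> (Suc N) h (v0 (Suc N) x) = v0 (Suc N) (Degen X N i z)" using v0_act[OF x True, of h] d by simp
        also have "\<dots> = Degen P N i (v0 N z)" using v0_degen[OF _ Az] d by simp
        finally show ?thesis using level_A[OF lN _ Az] d by simp
      qed
      moreover have "Face P (Suc N) i (v0 (Suc N) x) = f N (Face X (Suc N) i x)" if "i \<le> Suc N" for i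
        using v0_face[OF x True that] level_A[OF lN dx[OF that] A_face[OF x True that]] by simp
      ultimately have "good x (v0 (Suc N) x)" using v0_R[OF x True] unfolding good_def by blast
      then show ?thesis ..
    next
      case notA: False
      show ?thesis
      proof (cases "\<exists>h i z. ?deg x h i z")
        case True
        then obtain h i z where d: "?deg x h i z" by blast
        let ?k = "inv\<^bsub>Lev G (Suc N)\<^esub> h" and ?v = "Degen P N i (f N z)"
        have hk: "h \<in> carrier (Lev G (Suc N))" "?k \<in> carrier (Lev G (Suc N))" using d by auto
        have x_eq: "x = \<alpha> (Suc N) ?k (Degen X N i z)" using d x X.act_inv(1)[of h "Suc N" x] by simp
        have sz: "Degen X N i z \<in> Simp X (Suc N)" and v: "?v \<in> Simp P (Suc N)"
          using d X.degen_closed P.degen_closed level_closed[OF lN] by auto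
        have "R (Suc N) (Degen X N i z) ?v" using R_degen level_R[OF lN] d by blast
        then have "R (Suc N) x (\<rho> (Suc N) ?k ?v)" using R_act[OF sz _ hk(2)] x_eq by simp
        moreover have "Face P (Suc N) j (\<rho> (Suc N) ?k ?v) = f N (Face X (Suc N) j x)" if j: "j \<le> Suc N" for j
        proof -
          have "Face P (Suc N) j (\<rho> (Suc N) ?k ?v) = \<rho> N (GFace G (Suc N) j ?k) (f N (Face X (Suc N) j (Degen X N i z)))"
            using P.act_face[OF hk(2) v j] lift_degen_face[OF f _ _ j, of z i] d by simp
          also have "\<dots> = f N (\<alpha> N (GFace G (Suc N) j ?k) (Face X (Suc N) j (Degen X N i z)))"
            using level_act[OF lN X.face_closed[OF sz j]] hk(2) j by simp
          also have "\<dots> = f N (Face X (Suc N) j x)" using X.act_face[OF hk(2) sz j] x_eq by simp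
          finally show ?thesis .
        qed
        moreover have "\<rho> (Suc N) h' (\<rho> (Suc N) ?k ?v) = Degen P N i' (f N z')" if d': "?deg x h' i' z'" for h' i' z'
        proof -
          have "Degen X N i' z' = \<alpha> (Suc N) (h' \<otimes>\<^bsub>Lev G (Suc N)\<^esub> ?k) (Degen X N i z)"
            using d' x_eq X.act_mult[OF _ hk(2) sz, of h'] by simp
          then have "Degen P N i' (f N z') = \<rho> (Suc N) (h' \<otimes>\<^bsub>Lev G (Suc N)\<^esub> ?k) ?v"
            using degenerate_value_unique[OF f, of z' z i' i "h' \<otimes>\<^bsub>Lev G (Suc N)\<^esub> ?k"] d d' hk(2) by simp
          then show ?thesis using P.act_mult[OF _ hk(2) v, of h'] d' by simp
        qed
        ultimately have "good x (\<rho> (Suc N) ?k ?v)" using notA unfolding good_def by blast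
        then show ?thesis ..
      next
        case False
        have "\<exists>y. R (Suc N) x y \<and> (\<forall>i\<le>Suc N. Face P (Suc N) i y = f N (Face X (Suc N) i x))"
        proof (rule fill[OF x])
          show "R N (Face X (Suc N) i x) (f N (Face X (Suc N) i x))" if "i \<le> Suc N" for i
            using level_R[OF lN dx[OF that]] .
          fix i j :: nat assume ij: "i < j" "j \<le> Suc N" "0 < N"
          then obtain M where N: "N = Suc M" by (cases N) auto
          have F: "f M (Face X (Suc M) l y) = Face P (Suc M) l (f (Suc M) y)"
            if "l \<le> Suc M" "y \<in> Simp X (Suc M)" for l y
            using f N that unfolding lift_upto_def by simp
          have "Face P N i (f N (Face X (Suc N) j x)) = f M (Face X N i (Face X (Suc N) j x))"
            using F[of i "Face X (Suc N) j x"] dx[of j] N ij by simp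
          also have "\<dots> = f M (Face X N (j - 1) (Face X (Suc N) i x))"
            using X.face_face[of x M i j] x N ij by simp
          also have "\<dots> = Face P N (j - 1) (f N (Face X (Suc N) i x))"
            using F[of "j - 1" "Face X (Suc N) i x"] dx[of i] N ij by simp
          finally show "Face P N i (f N (Face X (Suc N) j x)) = Face P N (j - 1) (f N (Face X (Suc N) i x))" .
        qed
        then show ?thesis using False notA unfolding good_def by blast
      qed
    qed
  next
    show "y \<in> Simp P (Suc N)" if "good x y" for x y using that R_closed unfolding good_def by blast
  next
    fix g x y assume g: "g \<in> carrier (Lev G (Suc N))" and x: "x \<in> Simp X (Suc N)" and good: "good x y"
    have y: "y \<in> Simp P (Suc N)" using good R_closed unfolding good_def by blast
    have "Face P (Suc N) i (\<rho> (Suc N) g y) = f N (Face X (Suc N) i (\<alpha> (Suc N) g x))" if i: "i \<le> Suc N" for i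
      using good P.act_face[OF g y i] X.act_face[OF g x i] level_act[OF lN X.face_closed[OF x i]] g i
      unfolding good_def by simp
    moreover have "\<rho> (Suc N) h (\<rho> (Suc N) g y) = Degen P N i (f N z)" if d: "?deg (\<alpha> (Suc N) g x) h i z" for h i z
    proof -
      have "?deg x (h \<otimes>\<^bsub>Lev G (Suc N)\<^esub> g) i z" using d g x X.act_mult[of h "Suc N" g x] by simp
      then show ?thesis using good P.act_mult[of h "Suc N" g y] d g y unfolding good_def by metis
    qed
    moreover have "\<rho> (Suc N) g y = v0 (Suc N) (\<alpha> (Suc N) g x)" if "A (Suc N) (\<alpha> (Suc N) g x)"
    proof -
      have "A (Suc N) x" using A_act[OF _ that, of "inv\<^bsub>Lev G (Suc N)\<^esub> g"] g x by simp
      then show ?thesis using good v0_act[OF x _ g] unfolding good_def by simp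
    qed
    ultimately show "good (\<alpha> (Suc N) g x) (\<rho> (Suc N) g y)"
      using good R_act[OF x _ g] unfolding good_def by blast
  qed
  then obtain w where w: "\<And>x. x \<in> Simp X (Suc N) \<Longrightarrow> good x (w x)"
    "\<And>x g. x \<in> Simp X (Suc N) \<Longrightarrow> g \<in> carrier (Lev G (Suc N)) \<Longrightarrow> w (\<alpha> (Suc N) g x) = \<rho> (Suc N) g (w x)" by blast
  have "level (Suc N) w" using w unfolding level_def good_def by blast
  moreover have "w (Degen X N i z) = Degen P N i (f N z)" if z: "z \<in> Simp X N" and i: "i \<le> N" for i z
  proof -
    have s: "Degen X N i z \<in> Simp X (Suc N)" using X.degen_closed[OF z i] .
    have "?deg (Degen X N i z) \<one>\<^bsub>Lev G (Suc N)\<^esub> i z" using s z i by simp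
    then have "\<rho> (Suc N) \<one>\<^bsub>Lev G (Suc N)\<^esub> (w (Degen X N i z)) = Degen P N i (f N z)"
      using w(1)[OF s] unfolding good_def by blast
    then show ?thesis using R_closed w(1)[OF s] unfolding good_def by (metis P.act_one)
  qed
  ultimately have "lift_upto (Suc N) (f(Suc N := w))"
    using f w(1) unfolding lift_upto_def good_def by (auto simp: le_Suc_eq less_Suc_eq)
  then show ?thesis by (intro exI[of _ "f(Suc N := w)"]) auto
qed

theorem lift_exists:
  "\<exists>v\<in>smap X P. equivariant G X \<alpha> \<rho> v \<and> (\<forall>n. \<forall>x\<in>Simp X n. R n x (v n x) \<and> (A n x \<longrightarrow> v n x = v0 n x))"
proof -
  have "\<exists>w. \<forall>x\<in>Simp X 0. (R 0 x (w x) \<and> (A 0 x \<longrightarrow> w x = v0 0 x)) \<and>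
    (\<forall>g\<in>carrier (Lev G 0). w (\<alpha> 0 g x) = \<rho> 0 g (w x))"
  proof (rule X.equivariant_choice[OF P.gspace_axioms])
    show "\<exists>y. R 0 x y \<and> (A 0 x \<longrightarrow> y = v0 0 x)" if "x \<in> Simp X 0" for x
      using fill_point[OF that] v0_R[OF that] by blast
    show "R 0 (\<alpha> 0 g x) (\<rho> 0 g y) \<and> (A 0 (\<alpha> 0 g x) \<longrightarrow> \<rho> 0 g y = v0 0 (\<alpha> 0 g x))"
      if g: "g \<in> carrier (Lev G 0)" and x: "x \<in> Simp X 0" and y: "R 0 x y \<and> (A 0 x \<longrightarrow> y = v0 0 x)" for g x y
    proof -
      have "A 0 x" if "A 0 (\<alpha> 0 g x)" using A_act[OF _ that, of "inv\<^bsub>Lev G 0\<^esub> g"] g x by simp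
      then show ?thesis using R_act[OF x _ g] y v0_act[OF x _ g] by auto
    qed
  qed (use R_closed in blast)
  then obtain w where "level 0 w" unfolding level_def by blast
  then have base: "lift_upto 0 (\<lambda>n. w)" unfolding lift_upto_def by simp
  have "\<exists>F. \<forall>N. lift_upto N (F N) \<and> (\<forall>n\<le>N. F (Suc N) n = F N n)"
    by (rule dependent_nat_choice) (use base extend_lift in auto)
  then obtain F where F: "\<And>N. lift_upto N (F N)" "\<And>N n. n \<le> N \<Longrightarrow> F (Suc N) n = F N n" by blast
  let ?v = "\<lambda>n. F n n"
  have lv: "level n (?v n)" for n using F(1)[of n] unfolding lift_upto_def by simp
  have face: "?v n (Face X (Suc n) i x) = Face P (Suc n) i (?v (Suc n) x)"
    if "x \<in> Simp X (Suc n)" "i \<le> Suc n" for n x i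
    using F(1)[of "Suc n"] F(2)[of n n] that unfolding lift_upto_def by (metis lessI le_refl)
  have degen: "?v (Suc n) (Degen X n i x) = Degen P n i (?v n x)"
    if "x \<in> Simp X n" "i \<le> n" for n x i
    using F(1)[of "Suc n"] F(2)[of n n] that unfolding lift_upto_def by (metis lessI le_refl)
  have "restr X ?v \<in> smap X P"
    by (rule restr_smap[OF X.space]) (use level_closed[OF lv] face degen in auto)
  moreover have "equivariant G X \<alpha> \<rho> (restr X ?v)"
    unfolding equivariant_def using level_act[OF lv] by (simp add: restr_apply)
  ultimately show ?thesis
    using level_R[OF lv] level_A[OF lv] by (intro bexI[of _ "restr X ?v"]) (simp_all add: restr_apply)
qed

end

(* From here on simplices of the standard simplices are treated as such, not as lists. *)
declare std_simplex_simps(1) [simp del]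

lemma \<iota>_simplex [simp]: "\<iota> m \<in> Simp (\<Delta> m) m"
  by (simp add: std_simplex_simps)

lemma zero_one_simplex [simp]: "replicate (Suc m) 0 \<in> Simp (\<Delta> 1) m" "replicate (Suc m) 1 \<in> Simp (\<Delta> 1) m"
  by (rule replicate_simplex, simp)+

lemma omit_replicate: "i \<le> Suc n \<Longrightarrow> omit i (replicate (Suc (Suc n)) a) = replicate (Suc n) a"
  using omit_replicate_append[of i "Suc (Suc n)" a "[]"] by simp

lemma dup_replicate: "i \<le> n \<Longrightarrow> dup i (replicate (Suc n) a) = replicate (Suc (Suc n)) a"
  using dup_replicate_append[of i "Suc n" a "[]"] by simp

declare replicate.simps(2) [simp del] replicate_Suc [simp del]

lemma op_const:
  assumes "s \<in> Simp (\<Delta> n) m" "a \<le> k"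
  shows "op (\<Delta> k) n s (replicate (Suc n) a) = replicate (Suc m) a"
proof -
  have "map ((!) (replicate (Suc n) a)) s = replicate (Suc m) a"
    using assms(1) nth_mem[of _ s]
    by (intro nth_equalityI) (force simp: std_simplex_simps subset_iff less_Suc_eq_le)+
  then show ?thesis using op_std_simplex[OF replicate_simplex[OF assms(2)] assms(1)] by simp
qed

section \<open>Groups of maps\<close>

context simplicial_group
begin

definition pmul :: "'a sset \<Rightarrow> (nat \<Rightarrow> 'a \<Rightarrow> 'g) \<Rightarrow> (nat \<Rightarrow> 'a \<Rightarrow> 'g) \<Rightarrow> nat \<Rightarrow> 'a \<Rightarrow> 'g" where
  "pmul A f g = restr A (\<lambda>n a. f n a \<otimes>\<^bsub>Lev G n\<^esub> g n a)"

definition pinv :: "'a sset \<Rightarrow> (nat \<Rightarrow> 'a \<Rightarrow> 'g) \<Rightarrow> nat \<Rightarrow> 'a \<Rightarrow> 'g" where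
  "pinv A f = restr A (\<lambda>n a. inv\<^bsub>Lev G n\<^esub> (f n a))"

definition pone :: "'a sset \<Rightarrow> nat \<Rightarrow> 'a \<Rightarrow> 'g" where
  "pone A = restr A (\<lambda>n a. \<one>\<^bsub>Lev G n\<^esub>)"

lemma pmul_apply: "a \<in> Simp A n \<Longrightarrow> pmul A f g n a = f n a \<otimes>\<^bsub>Lev G n\<^esub> g n a"
  and pinv_apply: "a \<in> Simp A n \<Longrightarrow> pinv A f n a = inv\<^bsub>Lev G n\<^esub> (f n a)"
  and pone_apply: "a \<in> Simp A n \<Longrightarrow> pone A n a = \<one>\<^bsub>Lev G n\<^esub>"
  by (simp_all add: pmul_def pinv_def pone_def restr_apply)

lemma pmul_smap: "simplicial_set A \<Longrightarrow> f \<in> smap A (under G) \<Longrightarrow> g \<in> smap A (under G) \<Longrightarrow> pmul A f g \<in> smap A (under G)"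
  unfolding pmul_def by (rule pointwise_mult)

lemma pinv_smap: "simplicial_set A \<Longrightarrow> f \<in> smap A (under G) \<Longrightarrow> pinv A f \<in> smap A (under G)"
  unfolding pinv_def by (rule pointwise_inv)

lemma pone_smap: "simplicial_set A \<Longrightarrow> pone A \<in> smap A (under G)"
  unfolding pone_def by (rule restr_smap) simp_all

lemma smap_carrier: "f \<in> smap A (under G) \<Longrightarrow> a \<in> Simp A n \<Longrightarrow> f n a \<in> carrier (Lev G n)"
  using smap_closed[of f A "under G" a n] by simp

lemma pre_pmul:
  assumes "monotone_index n' n u"
  shows "pre X n' u (pmul (\<Delta> n \<times>\<^sub>s X) f g) = pmul (\<Delta> n' \<times>\<^sub>s X) (pre X n' u f) (pre X n' u g)"
    and "pre X n' u (pinv (\<Delta> n \<times>\<^sub>s X) f) = pinv (\<Delta> n' \<times>\<^sub>s X) (pre X n' u f)"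
    and "pre X n' u (pone (\<Delta> n \<times>\<^sub>s X)) = pone (\<Delta> n' \<times>\<^sub>s X)"
  using map_monotone_index[OF assms]
  by (auto simp: pre_def pmul_def pinv_def pone_def restr_def fun_eq_iff)

end

definition map_group :: "'g sgroup \<Rightarrow> 'a sset \<Rightarrow> (nat \<Rightarrow> (nat \<Rightarrow> nat list \<times> 'a \<Rightarrow> 'g) set) \<Rightarrow>
    (nat \<Rightarrow> nat list \<times> 'a \<Rightarrow> 'g) sgroup" where
  "map_group G X S = \<lparr>Lev = \<lambda>n. \<lparr>carrier = S n, mult = simplicial_group.pmul G (\<Delta> n \<times>\<^sub>s X),
      one = simplicial_group.pone G (\<Delta> n \<times>\<^sub>s X)\<rparr>,
    GFace = pre_face X, GDegen = pre_degen X\<rparr>"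

lemma under_map_group: "under (map_group G X S) = mspace X S"
  by (simp add: under_def map_group_def mspace_def)

lemma map_group_simps [simp]:
  "carrier (Lev (map_group G X S) n) = S n"
  "\<phi> \<otimes>\<^bsub>Lev (map_group G X S) n\<^esub> \<psi> = simplicial_group.pmul G (\<Delta> n \<times>\<^sub>s X) \<phi> \<psi>"
  "\<one>\<^bsub>Lev (map_group G X S) n\<^esub> = simplicial_group.pone G (\<Delta> n \<times>\<^sub>s X)"
  "GFace (map_group G X S) n i = pre X (n - 1) (\<delta> i)"
  "GDegen (map_group G X S) n i = pre X (Suc n) (\<sigma> i)"
  by (simp_all add: map_group_def pre_face_eq pre_degen_eq)

lemma (in simplicial_group) simplicial_group_map_group:
  assumes S: "map_subspace X (under G) S"
    and mul: "\<And>n \<phi> \<psi>. \<phi> \<in> S n \<Longrightarrow> \<psi> \<in> S n \<Longrightarrow> pmul (\<Delta> n \<times>\<^sub>s X) \<phi> \<psi> \<in> S n"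
    and one: "\<And>n. pone (\<Delta> n \<times>\<^sub>s X) \<in> S n"
    and inv: "\<And>n \<phi>. \<phi> \<in> S n \<Longrightarrow> pinv (\<Delta> n \<times>\<^sub>s X) \<phi> \<in> S n"
  shows "simplicial_group (map_group G X S)"
proof (intro simplicial_group.intro)
  interpret map_subspace X "under G" S by (rule S)
  show "simplicial_set (under (map_group G X S))"
    unfolding under_map_group by (rule simplicial_set_mspace)
  note m = smap_carrier[OF smap]
  show "group (Lev (map_group G X S) n)" for n
  proof (rule groupI)
    fix \<phi> assume "\<phi> \<in> carrier (Lev (map_group G X S) n)"
    then have \<phi>: "\<phi> \<in> S n" by simp
    show "\<one>\<^bsub>Lev (map_group G X S) n\<^esub> \<otimes>\<^bsub>Lev (map_group G X S) n\<^esub> \<phi> = \<phi>"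
      by (simp, rule smap_eqI[OF smap[OF mul[OF one \<phi>]] smap[OF \<phi>]])
        (use m[OF \<phi>] in \<open>auto simp: pmul_apply pone_apply\<close>)
    have "pmul (\<Delta> n \<times>\<^sub>s X) (pinv (\<Delta> n \<times>\<^sub>s X) \<phi>) \<phi> = pone (\<Delta> n \<times>\<^sub>s X)"
      by (rule smap_eqI[OF smap[OF mul[OF inv[OF \<phi>] \<phi>]] smap[OF one]])
        (use m[OF \<phi>] in \<open>auto simp: pmul_apply pone_apply pinv_apply\<close>)
    then show "\<exists>y\<in>carrier (Lev (map_group G X S) n). y \<otimes>\<^bsub>Lev (map_group G X S) n\<^esub> \<phi> = \<one>\<^bsub>Lev (map_group G X S) n\<^esub>"
      using inv[OF \<phi>] by auto
    fix \<psi> \<chi> assume "\<psi> \<in> carrier (Lev (map_group G X S) n)" "\<chi> \<in> carrier (Lev (map_group G X S) n)"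
    then have \<psi>: "\<psi> \<in> S n" and \<chi>: "\<chi> \<in> S n" by auto
    show "\<phi> \<otimes>\<^bsub>Lev (map_group G X S) n\<^esub> \<psi> \<otimes>\<^bsub>Lev (map_group G X S) n\<^esub> \<chi>
      = \<phi> \<otimes>\<^bsub>Lev (map_group G X S) n\<^esub> (\<psi> \<otimes>\<^bsub>Lev (map_group G X S) n\<^esub> \<chi>)"
      by (simp, rule smap_eqI[OF smap[OF mul[OF mul[OF \<phi> \<psi>] \<chi>]] smap[OF mul[OF \<phi> mul[OF \<psi> \<chi>]]]])
        (use m[OF \<phi>] m[OF \<psi>] m[OF \<chi>] in \<open>auto simp: pmul_apply level_assoc\<close>)
  qed (simp_all add: mul one)
qed (use map_subspace.pre_closed[OF S] monotone_index_\<delta> monotone_index_\<sigma>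
    in \<open>auto simp: hom_def pre_pmul(1)[OF monotone_index_\<delta>] pre_pmul(1)[OF monotone_index_\<sigma>]\<close>)

section \<open>Contractible domains\<close>

locale contractible_domain = simplicial_group G for G :: "'g sgroup" +
  fixes C :: "'c sset"
  assumes contractible: "contractible C"
begin

sublocale C: simplicial_set C
  using contractible unfolding contractible_def by blast

lemma C1: "simplicial_set (\<Delta> 1 \<times>\<^sub>s C)"
  by (rule simplicial_set_prod[OF simplicial_set_std_simplex C.simplicial_set_axioms])

text \<open>
  A base point of \<open>C\<close>, given by the degeneracies of a vertex.
\<close>

definition base :: "nat \<Rightarrow> 'c" where
  "base m = op C 0 (replicate (Suc m) 0) (SOME c. c \<in> Simp C 0)"

lemma base_simps [simp]:
  "base m \<in> Simp C m"
  "i \<le> Suc m \<Longrightarrow> Face C (Suc m) i (base (Suc m)) = base m"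
  "i \<le> m \<Longrightarrow> Degen C m i (base m) = base (Suc m)"
proof -
  have v: "(SOME c. c \<in> Simp C 0) \<in> Simp C 0"
    using contractible_nonempty[OF contractible] by (rule someI_ex)
  show "base m \<in> Simp C m" unfolding base_def by (rule C.op_closed[OF _ v]) simp
  show "i \<le> Suc m \<Longrightarrow> Face C (Suc m) i (base (Suc m)) = base m"
    unfolding base_def using C.face_op[OF replicate_simplex[of 0 0 "Suc m"] v, of i] omit_replicate[of i m "0::nat"] by simp
  show "i \<le> m \<Longrightarrow> Degen C m i (base m) = base (Suc m)"
    unfolding base_def using C.degen_op[OF replicate_simplex[of 0 0 m] v, of i] dup_replicate[of i m "0::nat"] by simp
qed

text \<open>
  Relative to a subspace \<open>B\<close> of \<open>D\<close> on which it is trivial, a map \<open>C \<times> D \<rightarrow> G\<close> can be deformed to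
  one that does not depend on \<open>C\<close>: contractibility of \<open>C\<close> is applied to the simplicial group of
  maps \<open>D \<rightarrow> G\<close> that are trivial on \<open>B\<close>.
\<close>

lemma deform_off_C:
  assumes D: "simplicial_set D"
    and f: "f \<in> smap (C \<times>\<^sub>s D) (under G)"
    and fB: "\<And>m c d. c \<in> Simp C m \<Longrightarrow> d \<in> Simp D m \<Longrightarrow> B m d \<Longrightarrow> f m (c, d) = \<one>\<^bsub>Lev G m\<^esub>"
  obtains h where "h \<in> smap ((\<Delta> 1 \<times>\<^sub>s C) \<times>\<^sub>s D) (under G)"
    "\<And>m c d. c \<in> Simp C m \<Longrightarrow> d \<in> Simp D m \<Longrightarrow> h m ((replicate (Suc m) 0, c), d) = f m (c, d)"
    "\<And>m c c' d. c \<in> Simp C m \<Longrightarrow> c' \<in> Simp C m \<Longrightarrow> d \<in> Simp D m \<Longrightarrow>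
      h m ((replicate (Suc m) 1, c), d) = h m ((replicate (Suc m) 1, c'), d)"
    "\<And>m t c d. t \<in> Simp (\<Delta> 1) m \<Longrightarrow> c \<in> Simp C m \<Longrightarrow> d \<in> Simp D m \<Longrightarrow> B m d \<Longrightarrow> h m ((t, c), d) = \<one>\<^bsub>Lev G m\<^esub>"
proof -
  define S where "S n = {\<phi> \<in> smap (\<Delta> n \<times>\<^sub>s D) (under G).
    \<forall>m. \<forall>s\<in>Simp (\<Delta> n) m. \<forall>d\<in>Simp D m. B m d \<longrightarrow> \<phi> m (s, d) = \<one>\<^bsub>Lev G m\<^esub>}" for n
  have nD: "simplicial_set (\<Delta> n \<times>\<^sub>s D)" for n by (rule simplicial_set_prod[OF simplicial_set_std_simplex D])
  have S: "map_subspace D (under G) S"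
    by (intro map_subspace.intro D under_simplicial)
      (auto simp: S_def pre_apply intro: pre_smap[OF D] dest: map_monotone_index)
  interpret S: map_subspace D "under G" S by (rule S)
  have H: "simplicial_group (map_group G D S)"
    by (rule simplicial_group_map_group[OF S])
      (auto simp: S_def pmul_apply pone_apply pinv_apply intro: pmul_smap[OF nD] pinv_smap[OF nD] pone_smap[OF nD])
  have cS: "curry_at C D f n c \<in> S n" if "c \<in> Simp C n" for n c
    using curry_at_smap[OF C.simplicial_set_axioms D f that] fB C.op_closed[OF _ that]
    by (auto simp: S_def curry_at_apply)
  have F: "restr C (curry_at C D f) \<in> smap C (under (map_group G D S))"
    unfolding under_map_group by (rule S.curry_smap[OF C.simplicial_set_axioms cS])
  obtain g where "g \<in> smap point (under (map_group G D S))"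
    "elementary_homotopic C (under (map_group G D S)) (restr C (curry_at C D f)) (\<lambda>n. \<lambda>c\<in>Simp C n. g n ())"
    using contractible_imp_null_homotopic[OF contractible H F] by blast
  then obtain K where K: "K \<in> smap (\<Delta> 1 \<times>\<^sub>s C) (mspace D S)"
    "\<And>n c. c \<in> Simp C n \<Longrightarrow> K n (replicate (Suc n) 0, c) = curry_at C D f n c"
    "\<And>n c. c \<in> Simp C n \<Longrightarrow> K n (replicate (Suc n) 1, c) = g n ()"
    unfolding elementary_homotopic_def under_map_group by (auto simp: restr_apply)
  let ?h = "S.uncurry (\<Delta> 1 \<times>\<^sub>s C) K"
  have h: "?h m ((t, c), d) = K m (t, c) m (\<iota> m, d)"
    if "t \<in> Simp (\<Delta> 1) m" "c \<in> Simp C m" "d \<in> Simp D m" for m t c d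
    using that unfolding S.uncurry_def by (subst restr_apply) auto
  show thesis
  proof (rule that[of ?h])
    show "?h \<in> smap ((\<Delta> 1 \<times>\<^sub>s C) \<times>\<^sub>s D) (under G)" by (rule S.uncurry_smap[OF C1 K(1)])
  next
    fix m c d assume cd: "c \<in> Simp C m" "d \<in> Simp D m"
    show "?h m ((replicate (Suc m) 0, c), d) = f m (c, d)"
      using h[OF _ cd] K(2)[OF cd(1)] curry_at_apply[OF \<iota>_simplex cd(2), of C f c] by simp
  next
    fix m c c' d assume cd: "c \<in> Simp C m" "c' \<in> Simp C m" "d \<in> Simp D m"
    show "?h m ((replicate (Suc m) 1, c), d) = ?h m ((replicate (Suc m) 1, c'), d)"
      using h[OF _ cd(1,3)] h[OF _ cd(2,3)] K(3)[OF cd(1)] K(3)[OF cd(2)] by simp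
  next
    fix m t c d assume tcd: "t \<in> Simp (\<Delta> 1) m" "c \<in> Simp C m" "d \<in> Simp D m" "B m d"
    have "K m (t, c) \<in> S m" using smap_closed[OF K(1), of "(t, c)" m] tcd by simp
    then show "?h m ((t, c), d) = \<one>\<^bsub>Lev G m\<^esub>" using h[OF tcd(1-3)] tcd(3,4) by (simp add: S_def)
  qed
qed

text \<open>
  If \<open>f\<close> is trivial at the base point of \<open>C\<close>, the homotopy may be divided by its own restriction to the
  base point. This does not affect \<open>f\<close>, and it makes the end trivial, as that does not depend on \<open>C\<close>.
\<close>

lemma deform_to_one:
  assumes D: "simplicial_set D"
    and f: "f \<in> smap (C \<times>\<^sub>s D) (under G)"
    and fB: "\<And>m c d. c \<in> Simp C m \<Longrightarrow> d \<in> Simp D m \<Longrightarrow> B m d \<Longrightarrow> f m (c, d) = \<one>\<^bsub>Lev G m\<^esub>"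
    and fbase: "\<And>m d. d \<in> Simp D m \<Longrightarrow> f m (base m, d) = \<one>\<^bsub>Lev G m\<^esub>"
  obtains h where "h \<in> smap ((\<Delta> 1 \<times>\<^sub>s C) \<times>\<^sub>s D) (under G)"
    "\<And>m c d. c \<in> Simp C m \<Longrightarrow> d \<in> Simp D m \<Longrightarrow> h m ((replicate (Suc m) 0, c), d) = f m (c, d)"
    "\<And>m c d. c \<in> Simp C m \<Longrightarrow> d \<in> Simp D m \<Longrightarrow> h m ((replicate (Suc m) 1, c), d) = \<one>\<^bsub>Lev G m\<^esub>"
    "\<And>m t c d. t \<in> Simp (\<Delta> 1) m \<Longrightarrow> c \<in> Simp C m \<Longrightarrow> d \<in> Simp D m \<Longrightarrow> B m d \<Longrightarrow> h m ((t, c), d) = \<one>\<^bsub>Lev G m\<^esub>"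
proof -
  obtain h where h: "h \<in> smap ((\<Delta> 1 \<times>\<^sub>s C) \<times>\<^sub>s D) (under G)"
    "\<And>m c d. c \<in> Simp C m \<Longrightarrow> d \<in> Simp D m \<Longrightarrow> h m ((replicate (Suc m) 0, c), d) = f m (c, d)"
    "\<And>m c c' d. c \<in> Simp C m \<Longrightarrow> c' \<in> Simp C m \<Longrightarrow> d \<in> Simp D m \<Longrightarrow>
      h m ((replicate (Suc m) 1, c), d) = h m ((replicate (Suc m) 1, c'), d)"
    "\<And>m t c d. t \<in> Simp (\<Delta> 1) m \<Longrightarrow> c \<in> Simp C m \<Longrightarrow> d \<in> Simp D m \<Longrightarrow> B m d \<Longrightarrow> h m ((t, c), d) = \<one>\<^bsub>Lev G m\<^esub>"
    using deform_off_C[OF D f fB] by blast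
  have hc: "h m ((t, c), d) \<in> carrier (Lev G m)"
    if "t \<in> Simp (\<Delta> 1) m" "c \<in> Simp C m" "d \<in> Simp D m" for m t c d
    using smap_carrier[OF h(1), of "((t, c), d)" m] that by simp
  let ?h = "restr ((\<Delta> 1 \<times>\<^sub>s C) \<times>\<^sub>s D)
    (\<lambda>m z. h m z \<otimes>\<^bsub>Lev G m\<^esub> inv\<^bsub>Lev G m\<^esub> h m ((fst (fst z), base m), snd z))"
  have app: "?h m ((t, c), d) = h m ((t, c), d) \<otimes>\<^bsub>Lev G m\<^esub> inv\<^bsub>Lev G m\<^esub> h m ((t, base m), d)"
    if "t \<in> Simp (\<Delta> 1) m" "c \<in> Simp C m" "d \<in> Simp D m" for m t c d
    using that by (subst restr_apply) auto
  have face: "h m ((Face (\<Delta> 1) (Suc m) i t, Face C (Suc m) i c), Face D (Suc m) i d) = GFace G (Suc m) i (h (Suc m) ((t, c), d))"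
    if "t \<in> Simp (\<Delta> 1) (Suc m)" "c \<in> Simp C (Suc m)" "d \<in> Simp D (Suc m)" "i \<le> Suc m" for m i t c d
    using smap_face[OF h(1), of "((t, c), d)" m i] that by simp
  have degen: "h (Suc m) ((Degen (\<Delta> 1) m i t, Degen C m i c), Degen D m i d) = GDegen G m i (h m ((t, c), d))"
    if "t \<in> Simp (\<Delta> 1) m" "c \<in> Simp C m" "d \<in> Simp D m" "i \<le> m" for m i t c d
    using smap_degen[OF h(1), of "((t, c), d)" m i] that by simp
  have facebase: "h m ((Face (\<Delta> 1) (Suc m) i t, base m), Face D (Suc m) i d) = GFace G (Suc m) i (h (Suc m) ((t, base (Suc m)), d))"
    if "t \<in> Simp (\<Delta> 1) (Suc m)" "d \<in> Simp D (Suc m)" "i \<le> Suc m" for m i t d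
    using face[of t m "base (Suc m)" d i] that by simp
  have degenbase: "h (Suc m) ((Degen (\<Delta> 1) m i t, base (Suc m)), Degen D m i d) = GDegen G m i (h m ((t, base m), d))"
    if "t \<in> Simp (\<Delta> 1) m" "d \<in> Simp D m" "i \<le> m" for m i t d
    using degen[of t m "base m" d i] that by simp
  show thesis
  proof (rule that[of ?h])
    show "?h \<in> smap ((\<Delta> 1 \<times>\<^sub>s C) \<times>\<^sub>s D) (under G)"
      using hc face facebase degen degenbase
      by (intro restr_prod_smap[OF C1 D]) (auto simp del: std_simplex_simps)
  next
    fix m c d assume cd: "c \<in> Simp C m" "d \<in> Simp D m"
    show "?h m ((replicate (Suc m) 0, c), d) = f m (c, d)"
      using app[OF _ cd, of "replicate (Suc m) 0"] h(2)[OF cd] h(2)[OF _ cd(2), of "base m"] fbase[OF cd(2)]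
        hc[OF _ cd, of "replicate (Suc m) 0"] by simp
  next
    fix m c d assume cd: "c \<in> Simp C m" "d \<in> Simp D m"
    show "?h m ((replicate (Suc m) 1, c), d) = \<one>\<^bsub>Lev G m\<^esub>"
      using app[OF _ cd, of "replicate (Suc m) 1"] h(3)[OF cd(1) _ cd(2), of "base m"]
        hc[OF _ cd, of "replicate (Suc m) 1"] by simp
  next
    fix m t c d assume tcd: "t \<in> Simp (\<Delta> 1) m" "c \<in> Simp C m" "d \<in> Simp D m" "B m d"
    show "?h m ((t, c), d) = \<one>\<^bsub>Lev G m\<^esub>"
      using app[OF tcd(1-3)] h(4)[OF tcd] h(4)[OF tcd(1) _ tcd(3,4), of "base m"] by simp
  qed
qed

text \<open>
  Paths in \<open>Map(C, G)\<close> whose end is a constant map \<open>C \<rightarrow> G\<close>. The evaluation at the starting point is a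
  homomorphism of simplicial groups to \<open>Map(C, G)\<close>, and it will turn out to be a trivial Kan fibration.
\<close>

definition paths :: "nat \<Rightarrow> (nat \<Rightarrow> nat list \<times> nat list \<times> 'c \<Rightarrow> 'g) set" where
  "paths n = {\<gamma> \<in> smap (\<Delta> n \<times>\<^sub>s (\<Delta> 1 \<times>\<^sub>s C)) (under G). \<forall>m. \<forall>s\<in>Simp (\<Delta> n) m. \<forall>c\<in>Simp C m. \<forall>c'\<in>Simp C m.
     \<gamma> m (s, (replicate (Suc m) 1, c)) = \<gamma> m (s, (replicate (Suc m) 1, c'))}"

text \<open>
  The kernel of this homomorphism, which is the simplicial group \<open>F\<close>.
\<close>

definition paths_from_one :: "nat \<Rightarrow> (nat \<Rightarrow> nat list \<times> nat list \<times> 'c \<Rightarrow> 'g) set" where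
  "paths_from_one n = {\<gamma> \<in> paths n. \<forall>m. \<forall>s\<in>Simp (\<Delta> n) m. \<forall>c\<in>Simp C m.
     \<gamma> m (s, (replicate (Suc m) 0, c)) = \<one>\<^bsub>Lev G m\<^esub>}"

abbreviation "F \<equiv> map_group G (\<Delta> 1 \<times>\<^sub>s C) paths_from_one"

lemma pathsD:
  assumes "\<gamma> \<in> paths n"
  shows paths_smap: "\<gamma> \<in> smap (\<Delta> n \<times>\<^sub>s (\<Delta> 1 \<times>\<^sub>s C)) (under G)"
    and paths_end: "s \<in> Simp (\<Delta> n) m \<Longrightarrow> c \<in> Simp C m \<Longrightarrow> c' \<in> Simp C m \<Longrightarrow>
      \<gamma> m (s, (replicate (Suc m) 1, c)) = \<gamma> m (s, (replicate (Suc m) 1, c'))"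
  using assms unfolding paths_def by blast+

lemma nC1: "simplicial_set (\<Delta> n \<times>\<^sub>s (\<Delta> 1 \<times>\<^sub>s C))"
  by (rule simplicial_set_prod[OF simplicial_set_std_simplex C1])

lemma paths_map_subspace: "map_subspace (\<Delta> 1 \<times>\<^sub>s C) (under G) paths"
proof (intro map_subspace.intro C1 under_simplicial)
  fix n n' u \<phi> assume \<phi>: "\<phi> \<in> paths n" and u: "monotone_index n' n u"
  show "pre (\<Delta> 1 \<times>\<^sub>s C) n' u \<phi> \<in> paths n'"
    unfolding paths_def
  proof (intro CollectI conjI allI ballI)
    show "pre (\<Delta> 1 \<times>\<^sub>s C) n' u \<phi> \<in> smap (\<Delta> n' \<times>\<^sub>s (\<Delta> 1 \<times>\<^sub>s C)) (under G)"
      by (rule pre_smap[OF C1 u paths_smap[OF \<phi>]])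
    fix m s c c' assume s: "s \<in> Simp (\<Delta> n') m" and c: "c \<in> Simp C m" "c' \<in> Simp C m"
    show "pre (\<Delta> 1 \<times>\<^sub>s C) n' u \<phi> m (s, replicate (Suc m) 1, c) = pre (\<Delta> 1 \<times>\<^sub>s C) n' u \<phi> m (s, replicate (Suc m) 1, c')"
      using s c paths_end[OF \<phi> map_monotone_index[OF u s] c] by (simp add: pre_apply del: One_nat_def)
  qed
qed (rule paths_smap)

lemma paths_from_one_map_subspace: "map_subspace (\<Delta> 1 \<times>\<^sub>s C) (under G) paths_from_one"
proof (intro map_subspace.intro C1 under_simplicial)
  fix n n' u \<phi> assume \<phi>: "\<phi> \<in> paths_from_one n" and u: "monotone_index n' n u"
  show "pre (\<Delta> 1 \<times>\<^sub>s C) n' u \<phi> \<in> paths_from_one n'"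
    using \<phi> map_subspace.pre_closed[OF paths_map_subspace _ u] map_monotone_index[OF u]
    unfolding paths_from_one_def by (simp add: pre_apply del: One_nat_def)
qed (auto simp: paths_from_one_def simp del: One_nat_def intro: paths_smap)

lemma paths_ops:
  assumes "\<phi> \<in> paths n"
  shows "\<psi> \<in> paths n \<Longrightarrow> pmul (\<Delta> n \<times>\<^sub>s (\<Delta> 1 \<times>\<^sub>s C)) \<phi> \<psi> \<in> paths n"
    and "pinv (\<Delta> n \<times>\<^sub>s (\<Delta> 1 \<times>\<^sub>s C)) \<phi> \<in> paths n"
proof -
  have mem: "(s, replicate (Suc m) 1, c) \<in> Simp (\<Delta> n \<times>\<^sub>s (\<Delta> 1 \<times>\<^sub>s C)) m"
    if "s \<in> Simp (\<Delta> n) m" "c \<in> Simp C m" for s c m using that by (simp del: One_nat_def)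
  show "pinv (\<Delta> n \<times>\<^sub>s (\<Delta> 1 \<times>\<^sub>s C)) \<phi> \<in> paths n"
    unfolding paths_def
  proof (intro CollectI conjI allI ballI pinv_smap[OF nC1] paths_smap[OF assms])
    fix m s c c' assume s: "s \<in> Simp (\<Delta> n) m" and c: "c \<in> Simp C m" "c' \<in> Simp C m"
    show "pinv (\<Delta> n \<times>\<^sub>s (\<Delta> 1 \<times>\<^sub>s C)) \<phi> m (s, replicate (Suc m) 1, c) =
        pinv (\<Delta> n \<times>\<^sub>s (\<Delta> 1 \<times>\<^sub>s C)) \<phi> m (s, replicate (Suc m) 1, c')"
      using paths_end[OF assms s c] by (simp only: pinv_apply[OF mem[OF s c(1)]] pinv_apply[OF mem[OF s c(2)]])
  qed
  assume \<psi>: "\<psi> \<in> paths n"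
  show "pmul (\<Delta> n \<times>\<^sub>s (\<Delta> 1 \<times>\<^sub>s C)) \<phi> \<psi> \<in> paths n"
    unfolding paths_def
  proof (intro CollectI conjI allI ballI pmul_smap[OF nC1] paths_smap[OF assms] paths_smap[OF \<psi>])
    fix m s c c' assume s: "s \<in> Simp (\<Delta> n) m" and c: "c \<in> Simp C m" "c' \<in> Simp C m"
    show "pmul (\<Delta> n \<times>\<^sub>s (\<Delta> 1 \<times>\<^sub>s C)) \<phi> \<psi> m (s, replicate (Suc m) 1, c) =
        pmul (\<Delta> n \<times>\<^sub>s (\<Delta> 1 \<times>\<^sub>s C)) \<phi> \<psi> m (s, replicate (Suc m) 1, c')"
      using paths_end[OF assms s c] paths_end[OF \<psi> s c]
      by (simp only: pmul_apply[OF mem[OF s c(1)]] pmul_apply[OF mem[OF s c(2)]])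
  qed
qed

lemma pone_paths: "pone (\<Delta> n \<times>\<^sub>s (\<Delta> 1 \<times>\<^sub>s C)) \<in> paths n"
  unfolding paths_def using pone_smap[OF nC1] by (simp add: pone_apply del: One_nat_def)

lemma paths_from_one_ops:
  "\<phi> \<in> paths_from_one n \<Longrightarrow> \<psi> \<in> paths_from_one n \<Longrightarrow> pmul (\<Delta> n \<times>\<^sub>s (\<Delta> 1 \<times>\<^sub>s C)) \<phi> \<psi> \<in> paths_from_one n"
  "\<phi> \<in> paths_from_one n \<Longrightarrow> pinv (\<Delta> n \<times>\<^sub>s (\<Delta> 1 \<times>\<^sub>s C)) \<phi> \<in> paths_from_one n"
  "pone (\<Delta> n \<times>\<^sub>s (\<Delta> 1 \<times>\<^sub>s C)) \<in> paths_from_one n"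
  using paths_ops pone_paths unfolding paths_from_one_def by (simp_all add: pmul_apply pinv_apply pone_apply del: One_nat_def)

lemma F_group: "simplicial_group F"
  by (rule simplicial_group_map_group[OF paths_from_one_map_subspace]) (use paths_from_one_ops in auto)

text \<open>
  A simplex of \<open>\<Delta>^n\<close> that misses the value \<open>j\<close> factors through the \<open>j\<close>-th face.
\<close>

lemma trivial_on_boundary:
  assumes z: "0 < n \<Longrightarrow> \<forall>i\<le>n. pre X (n - 1) (\<delta> i) z = pone (\<Delta> (n - 1) \<times>\<^sub>s X)"
    and s: "s \<in> Simp (\<Delta> n) m" "j \<le> n" "j \<notin> set s" and x: "x \<in> Simp X m"
  shows "z m (s, x) = \<one>\<^bsub>Lev G m\<^esub>"
proof -
  have "0 < n" using s by (cases n; cases s) (auto simp: std_simplex_simps)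
  then obtain n' where n: "n = Suc n'" by (cases n) auto
  define u where "u a = (if a < j then a else a - 1)" for a
  let ?t = "map u s"
  have "monotone_index n n' u" using s(2) n by (auto simp: monotone_index_def u_def)
  then have t: "?t \<in> Simp (\<Delta> n') m" using s(1) by (rule map_monotone_index)
  have "\<delta> j (u a) = a" if "a \<in> set s" for a
  proof -
    have "a \<noteq> j" using that s(3) by auto
    then show ?thesis by (auto simp: \<delta>_def u_def)
  qed
  then have "map (\<delta> j) ?t = s" by (simp add: map_idI)
  then have "z m (s, x) = pre X n' (\<delta> j) z m (?t, x)" using pre_apply[OF t x, of "\<delta> j" z] by simp
  then show ?thesis using z s(2) n t x by (simp add: pone_apply)
qed

text \<open>
  For \<open>n = 1\<close> the minimum is a contraction \<open>\<Delta>^1 \<times> \<Delta>^1 \<rightarrow> \<Delta>^1\<close> of the interval to \<open>0\<close>.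
\<close>

definition meet :: "nat list \<Rightarrow> nat list \<Rightarrow> nat list" where
  "meet r t = map2 min r t"

lemma meet_simps:
  assumes "r \<in> Simp (\<Delta> n) m" "t \<in> Simp (\<Delta> n) m"
  shows "meet r t \<in> Simp (\<Delta> n) m"
    "omit i (meet r t) = meet (omit i r) (omit i t)" "dup i (meet r t) = meet (dup i r) (dup i t)"
    "meet (replicate (Suc m) n) t = t" "meet r (replicate (Suc m) n) = r"
    "meet (replicate (Suc m) 0) t = replicate (Suc m) 0" "meet r (replicate (Suc m) 0) = replicate (Suc m) 0"
proof -
  have len: "length r = Suc m" "length t = Suc m" using assms by (auto simp: std_simplex_simps)
  have nth: "meet r t ! i = min (r ! i) (t ! i)" if "i < Suc m" for i using that len by (simp add: meet_def)
  have le: "r ! i \<le> n" "t ! i \<le> n" if "i < Suc m" for i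
  proof -
    have "r ! i \<in> set r" "t ! i \<in> set t" using that len by simp_all
    then show "r ! i \<le> n" "t ! i \<le> n" using assms by (auto simp: std_simplex_simps)
  qed
  have sorted: "r ! i \<le> r ! j" "t ! i \<le> t ! j" if "i \<le> j" "j < Suc m" for i j
    using assms that by (auto simp: std_simplex_simps sorted_iff_nth_mono)
  have l: "length (meet r t) = Suc m" using len by (simp add: meet_def)
  have "sorted (meet r t)"
    unfolding sorted_iff_nth_mono using sorted by (auto simp: l nth min_le_iff_disj)
  moreover have "set (meet r t) \<subseteq> {..n}"
    using le l by (auto simp: in_set_conv_nth nth min_le_iff_disj)
  ultimately show "meet r t \<in> Simp (\<Delta> n) m" using l by (simp add: std_simplex_simps)
  show "omit i (meet r t) = meet (omit i r) (omit i t)" "dup i (meet r t) = meet (dup i r) (dup i t)"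
    using len by (simp_all add: omit_def dup_def meet_def take_map drop_map take_zip drop_zip)
  show "meet (replicate (Suc m) n) t = t" "meet r (replicate (Suc m) n) = r"
    "meet (replicate (Suc m) 0) t = replicate (Suc m) 0" "meet r (replicate (Suc m) 0) = replicate (Suc m) 0"
    using len le by (auto intro!: nth_equalityI simp: meet_def min_absorb1 min_absorb2)
qed

end

context contractible_domain
begin

text \<open>
  A cycle \<open>z\<close> in the kernel is contracted in two steps. Divided by its value \<open>z0\<close> at the base point of
  \<open>C\<close> it is trivial on all of \<open>\<partial>(\<Delta>^n \<times> \<Delta>^1)\<close> and at the base point, so it can be deformed to \<open>1\<close>;
  and \<open>z0\<close> is contracted along the path coordinate.
\<close>

lemma paths_from_one_bounds:
  assumes z: "z \<in> paths_from_one n"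
    and cycle: "0 < n \<Longrightarrow> \<forall>i\<le>n. pre (\<Delta> 1 \<times>\<^sub>s C) (n - 1) (\<delta> i) z = pone (\<Delta> (n - 1) \<times>\<^sub>s (\<Delta> 1 \<times>\<^sub>s C))"
  shows "\<exists>w\<in>carrier (Lev F (Suc n)). GFace F (Suc n) (Suc n) w = z \<and> (\<forall>i\<le>n. GFace F (Suc n) i w = \<one>\<^bsub>Lev F n\<^esub>)"
proof -
  have zp: "z \<in> paths n" and z0: "\<And>m s c. s \<in> Simp (\<Delta> n) m \<Longrightarrow> c \<in> Simp C m \<Longrightarrow> z m (s, (replicate (Suc m) 0, c)) = \<one>\<^bsub>Lev G m\<^esub>"
    using z unfolding paths_from_one_def by auto
  note zs = paths_smap[OF zp]
  have zc: "z m (s, (t, c)) \<in> carrier (Lev G m)" if "s \<in> Simp (\<Delta> n) m" "t \<in> Simp (\<Delta> 1) m" "c \<in> Simp C m" for m s t c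
    using smap_carrier[OF zs, of "(s, (t, c))" m] that by simp
  have zface: "z m (omit i s, (omit i t, Face C (Suc m) i c)) = GFace G (Suc m) i (z (Suc m) (s, (t, c)))"
    if "s \<in> Simp (\<Delta> n) (Suc m)" "t \<in> Simp (\<Delta> 1) (Suc m)" "c \<in> Simp C (Suc m)" "i \<le> Suc m" for m s t c i
    using smap_face[OF zs, of "(s, (t, c))" m i] that by simp
  have zdegen: "z (Suc m) (dup i s, (dup i t, Degen C m i c)) = GDegen G m i (z m (s, (t, c)))"
    if "s \<in> Simp (\<Delta> n) m" "t \<in> Simp (\<Delta> 1) m" "c \<in> Simp C m" "i \<le> m" for m s t c i
    using smap_degen[OF zs, of "(s, (t, c))" m i] that by simp
  have zfaceb: "z m (omit i s, (omit i t, base m)) = GFace G (Suc m) i (z (Suc m) (s, (t, base (Suc m))))"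
    if "s \<in> Simp (\<Delta> n) (Suc m)" "t \<in> Simp (\<Delta> 1) (Suc m)" "i \<le> Suc m" for m s t i
    using zface[OF that(1,2) _ that(3), of "base (Suc m)"] that(3) by simp
  have zdegenb: "z (Suc m) (dup i s, (dup i t, base (Suc m))) = GDegen G m i (z m (s, (t, base m)))"
    if "s \<in> Simp (\<Delta> n) m" "t \<in> Simp (\<Delta> 1) m" "i \<le> m" for m s t i
    using zdegen[OF that(1,2) _ that(3), of "base m"] that(3) by simp
  have zbd: "z m (s, (t, c)) = \<one>\<^bsub>Lev G m\<^esub>"
    if "s \<in> Simp (\<Delta> n) m" "j \<le> n" "j \<notin> set s" "t \<in> Simp (\<Delta> 1) m" "c \<in> Simp C m" for m s t c j
    using trivial_on_boundary[OF cycle that(1-3), of "(t, c)"] that(4,5) by simp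
  have D: "simplicial_set (\<Delta> n \<times>\<^sub>s \<Delta> 1)" by (rule simplicial_set_prod[OF simplicial_set_std_simplex simplicial_set_std_simplex])
  \<comment> \<open>The quotient \<open>z \<cdot> z0\<inverse>\<close>.\<close>
  define f where "f = restr (C \<times>\<^sub>s (\<Delta> n \<times>\<^sub>s \<Delta> 1)) (\<lambda>m x. z m (fst (snd x), (snd (snd x), fst x))
    \<otimes>\<^bsub>Lev G m\<^esub> inv\<^bsub>Lev G m\<^esub> z m (fst (snd x), (snd (snd x), base m)))"
  have f_app: "f m (c, (s, t)) = z m (s, (t, c)) \<otimes>\<^bsub>Lev G m\<^esub> inv\<^bsub>Lev G m\<^esub> z m (s, (t, base m))"
    if "s \<in> Simp (\<Delta> n) m" "t \<in> Simp (\<Delta> 1) m" "c \<in> Simp C m" for m s t c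
    unfolding f_def using that by (subst restr_apply) auto
  have fs: "f \<in> smap (C \<times>\<^sub>s (\<Delta> n \<times>\<^sub>s \<Delta> 1)) (under G)"
    unfolding f_def
    by (rule restr_prod_smap[OF C.simplicial_set_axioms D])
      (auto simp: zc zface zdegen zfaceb zdegenb simp del: One_nat_def)
  \<comment> \<open>The boundary of \<open>\<Delta>^n \<times> \<Delta>^1\<close>.\<close>
  define B where "B m st \<longleftrightarrow> (\<exists>j\<le>n. j \<notin> set (fst st)) \<or> snd st = replicate (Suc m) 0 \<or> snd st = replicate (Suc m) 1"
    for m :: nat and st :: "nat list \<times> nat list"
  have fB: "f m (c, d) = \<one>\<^bsub>Lev G m\<^esub>" if cd: "c \<in> Simp C m" "d \<in> Simp (\<Delta> n \<times>\<^sub>s \<Delta> 1) m" "B m d" for m c d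
  proof -
    obtain s t where d: "d = (s, t)" "s \<in> Simp (\<Delta> n) m" "t \<in> Simp (\<Delta> 1) m" using cd(2) by auto
    consider j where "j \<le> n" "j \<notin> set s" | "t = replicate (Suc m) 0" | "t = replicate (Suc m) 1"
      using cd(3) d(1) unfolding B_def by auto
    then have "z m (s, (t, c)) = z m (s, (t, base m))"
    proof cases
      case 1
      then show ?thesis using zbd[OF d(2) 1 d(3)] cd(1) by simp
    next
      case 2
      then show ?thesis using z0[OF d(2)] cd(1) by simp
    next
      case 3
      then show ?thesis using paths_end[OF zp d(2) cd(1), of "base m"] by simp
    qed
    then show ?thesis using f_app[OF d(2,3) cd(1)] zc[OF d(2,3), of "base m"] d(1) by simp
  qed
  have fbase: "f m (base m, d) = \<one>\<^bsub>Lev G m\<^esub>" if "d \<in> Simp (\<Delta> n \<times>\<^sub>s \<Delta> 1) m" for m d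
    using that f_app[of "fst d" m "snd d" "base m"] zc[of "fst d" m "snd d" "base m"] by (cases d) simp
  obtain h where h: "h \<in> smap ((\<Delta> 1 \<times>\<^sub>s C) \<times>\<^sub>s (\<Delta> n \<times>\<^sub>s \<Delta> 1)) (under G)"
    "\<And>m c d. c \<in> Simp C m \<Longrightarrow> d \<in> Simp (\<Delta> n \<times>\<^sub>s \<Delta> 1) m \<Longrightarrow> h m ((replicate (Suc m) 0, c), d) = f m (c, d)"
    "\<And>m c d. c \<in> Simp C m \<Longrightarrow> d \<in> Simp (\<Delta> n \<times>\<^sub>s \<Delta> 1) m \<Longrightarrow> h m ((replicate (Suc m) 1, c), d) = \<one>\<^bsub>Lev G m\<^esub>"
    "\<And>m t c d. t \<in> Simp (\<Delta> 1) m \<Longrightarrow> c \<in> Simp C m \<Longrightarrow> d \<in> Simp (\<Delta> n \<times>\<^sub>s \<Delta> 1) m \<Longrightarrow> B m d \<Longrightarrow> h m ((t, c), d) = \<one>\<^bsub>Lev G m\<^esub>"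
    using deform_to_one[OF D fs fB fbase] by blast
  have hc: "h m ((r, c), (s, t)) \<in> carrier (Lev G m)"
    if "s \<in> Simp (\<Delta> n) m" "t \<in> Simp (\<Delta> 1) m" "c \<in> Simp C m" "r \<in> Simp (\<Delta> 1) m" for m r s t c
    using smap_carrier[OF h(1), of "((r, c), (s, t))" m] that by simp
  have hface: "h m ((omit i r, Face C (Suc m) i c), (omit i s, omit i t)) = GFace G (Suc m) i (h (Suc m) ((r, c), (s, t)))"
    if "s \<in> Simp (\<Delta> n) (Suc m)" "t \<in> Simp (\<Delta> 1) (Suc m)" "c \<in> Simp C (Suc m)" "r \<in> Simp (\<Delta> 1) (Suc m)" "i \<le> Suc m" for m r s t c i
    using smap_face[OF h(1), of "((r, c), (s, t))" m i] that by simp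
  have hdegen: "h (Suc m) ((dup i r, Degen C m i c), (dup i s, dup i t)) = GDegen G m i (h m ((r, c), (s, t)))"
    if "s \<in> Simp (\<Delta> n) m" "t \<in> Simp (\<Delta> 1) m" "c \<in> Simp C m" "r \<in> Simp (\<Delta> 1) m" "i \<le> m" for m r s t c i
    using smap_degen[OF h(1), of "((r, c), (s, t))" m i] that by simp
  let ?Z = "\<Delta> 1 \<times>\<^sub>s \<Delta> n"
  have Z: "simplicial_set ?Z" by (rule simplicial_set_prod[OF simplicial_set_std_simplex simplicial_set_std_simplex])
  \<comment> \<open>The coordinate \<open>r\<close> is that of the homotopy. The factor \<open>h\<close> deforms \<open>z \<cdot> z0\<inverse>\<close> to \<open>1\<close>, while the other
    factor \<open>z0(s, t) \<cdot> z0(s, min t r)\<inverse>\<close> goes from \<open>z0\<close> to \<open>1\<close>, because \<open>z0\<close> is trivial at \<open>t = 0\<close>.\<close>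
  define hh where "hh = restr (?Z \<times>\<^sub>s (\<Delta> 1 \<times>\<^sub>s C)) (\<lambda>m x.
      h m ((fst (fst x), snd (snd x)), (snd (fst x), fst (snd x))) \<otimes>\<^bsub>Lev G m\<^esub>
      (z m (snd (fst x), (fst (snd x), base m)) \<otimes>\<^bsub>Lev G m\<^esub>
       inv\<^bsub>Lev G m\<^esub> z m (snd (fst x), (meet (fst (snd x)) (fst (fst x)), base m))))"
  have hh_app: "hh m ((r, s), (t, c)) = h m ((r, c), (s, t)) \<otimes>\<^bsub>Lev G m\<^esub>
      (z m (s, (t, base m)) \<otimes>\<^bsub>Lev G m\<^esub> inv\<^bsub>Lev G m\<^esub> z m (s, (meet t r, base m)))"
    if "r \<in> Simp (\<Delta> 1) m" "s \<in> Simp (\<Delta> n) m" "t \<in> Simp (\<Delta> 1) m" "c \<in> Simp C m" for m r s t c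
    unfolding hh_def using that by (subst restr_apply) auto
  have hhs: "hh \<in> smap (?Z \<times>\<^sub>s (\<Delta> 1 \<times>\<^sub>s C)) (under G)"
    unfolding hh_def
    by (rule restr_prod_smap[OF Z C1])
      (auto simp: zc hc hface hdegen zfaceb zdegenb meet_simps(1) meet_simps(2,3)[symmetric] simp del: One_nat_def)
  have hh_bd: "hh m ((r, s), (t, c)) = \<one>\<^bsub>Lev G m\<^esub>"
    if m: "r \<in> Simp (\<Delta> 1) m" "s \<in> Simp (\<Delta> n) m" "t \<in> Simp (\<Delta> 1) m" "c \<in> Simp C m" and j: "j \<le> n" "j \<notin> set s" for m r s t c j
  proof -
    have "B m (s, t)" using j unfolding B_def by auto
    then have "h m ((r, c), (s, t)) = \<one>\<^bsub>Lev G m\<^esub>" using h(4)[OF m(1,4), of "(s, t)"] m by simp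
    then show ?thesis
      using hh_app[OF m] zbd[OF m(2) j m(3)] zbd[OF m(2) j meet_simps(1)[OF m(3,1)]] by simp
  qed
  have hh_0: "hh m ((replicate (Suc m) 0, s), (t, c)) = z m (s, (t, c))"
    if m: "s \<in> Simp (\<Delta> n) m" "t \<in> Simp (\<Delta> 1) m" "c \<in> Simp C m" for m s t c
    using hh_app[OF zero_one_simplex(1) m] h(2)[OF m(3), of "(s, t)"] f_app[OF m] m z0[OF m(1), of "base m"]
      meet_simps(7)[OF m(2) m(2)] zc[OF m] zc[OF m(1,2), of "base m"] by (simp add: level_assoc)
  have hh_1: "hh m ((replicate (Suc m) 1, s), (t, c)) = \<one>\<^bsub>Lev G m\<^esub>"
    if m: "s \<in> Simp (\<Delta> n) m" "t \<in> Simp (\<Delta> 1) m" "c \<in> Simp C m" for m s t c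
    using hh_app[OF zero_one_simplex(2) m] h(3)[OF m(3), of "(s, t)"] m
      meet_simps(5)[OF m(2) m(2)] zc[OF m(1,2), of "base m"] by (simp del: One_nat_def)
  interpret Fs: map_subspace "\<Delta> 1 \<times>\<^sub>s C" "under G" paths_from_one by (rule paths_from_one_map_subspace)
  define H where "H = restr ?Z (curry_at ?Z (\<Delta> 1 \<times>\<^sub>s C) hh)"
  have opZ: "op ?Z k s' (r, s) = (op (\<Delta> 1) k s' r, op (\<Delta> n) k s' s)"
    "op (\<Delta> 1) k s' r \<in> Simp (\<Delta> 1) m" "op (\<Delta> n) k s' s \<in> Simp (\<Delta> n) m"
    if "r \<in> Simp (\<Delta> 1) k" "s \<in> Simp (\<Delta> n) k" "s' \<in> Simp (\<Delta> k) m" for k r s m s'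
    using op_prod[OF simplicial_set_std_simplex simplicial_set_std_simplex that]
      simplicial_set.op_closed[OF simplicial_set_std_simplex that(3)] that by simp_all
  have Hc: "curry_at ?Z (\<Delta> 1 \<times>\<^sub>s C) hh k rs \<in> paths_from_one k" if rs: "rs \<in> Simp ?Z k" for k rs
  proof -
    obtain r s where rs': "rs = (r, s)" "r \<in> Simp (\<Delta> 1) k" "s \<in> Simp (\<Delta> n) k" using rs by auto
    have app: "curry_at ?Z (\<Delta> 1 \<times>\<^sub>s C) hh k rs m (s', (t, c)) = hh m ((op (\<Delta> 1) k s' r, op (\<Delta> n) k s' s), (t, c))"
      if "s' \<in> Simp (\<Delta> k) m" "t \<in> Simp (\<Delta> 1) m" "c \<in> Simp C m" for m s' t c
      using curry_at_apply[OF that(1), of "(t, c)" "\<Delta> 1 \<times>\<^sub>s C" ?Z hh rs] that opZ(1)[OF rs'(2,3) that(1)] rs'(1) by simp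
    have zero: "hh m ((r, s), (replicate (Suc m) 0, c)) = \<one>\<^bsub>Lev G m\<^esub>"
      if m: "r \<in> Simp (\<Delta> 1) m" "s \<in> Simp (\<Delta> n) m" "c \<in> Simp C m" for r s m c
    proof -
      have "h m ((r, c), (s, replicate (Suc m) 0)) = \<one>\<^bsub>Lev G m\<^esub>"
        using h(4)[OF m(1,3), of "(s, replicate (Suc m) 0)"] m(2) by (simp add: B_def)
      then show ?thesis
        using hh_app[OF m(1,2) zero_one_simplex(1) m(3)] z0[OF m(2), of "base m"] meet_simps(6)[OF m(1) m(1)] by simp
    qed
    have one: "hh m ((r, s), (replicate (Suc m) 1, c)) = hh m ((r, s), (replicate (Suc m) 1, c'))"
      if m: "r \<in> Simp (\<Delta> 1) m" "s \<in> Simp (\<Delta> n) m" "c \<in> Simp C m" "c' \<in> Simp C m" for r s m c c'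
    proof -
      have "h m ((r, c), (s, replicate (Suc m) 1)) = \<one>\<^bsub>Lev G m\<^esub>" if "c \<in> Simp C m" for c
        using h(4)[OF m(1) that, of "(s, replicate (Suc m) 1)"] m(2) by (simp add: B_def del: One_nat_def)
      then show ?thesis
        using hh_app[OF m(1,2) zero_one_simplex(2)] m(3,4) by simp
    qed
    show ?thesis
      unfolding paths_from_one_def paths_def
    proof (intro CollectI conjI allI ballI)
      show "curry_at ?Z (\<Delta> 1 \<times>\<^sub>s C) hh k rs \<in> smap (\<Delta> k \<times>\<^sub>s (\<Delta> 1 \<times>\<^sub>s C)) (under G)"
        by (rule curry_at_smap[OF Z C1 hhs rs])
    next
      fix m s' c c' assume m: "s' \<in> Simp (\<Delta> k) m" "c \<in> Simp C m" "c' \<in> Simp C m"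
      note o = opZ[OF rs'(2,3) m(1)]
      show "curry_at ?Z (\<Delta> 1 \<times>\<^sub>s C) hh k rs m (s', replicate (Suc m) 1, c) =
        curry_at ?Z (\<Delta> 1 \<times>\<^sub>s C) hh k rs m (s', replicate (Suc m) 1, c')"
        using app[OF m(1) zero_one_simplex(2) m(2)] app[OF m(1) zero_one_simplex(2) m(3)] one[OF o(2,3) m(2,3)] by simp
    next
      fix m s' c assume m: "s' \<in> Simp (\<Delta> k) m" "c \<in> Simp C m"
      note o = opZ[OF rs'(2,3) m(1)]
      show "curry_at ?Z (\<Delta> 1 \<times>\<^sub>s C) hh k rs m (s', replicate (Suc m) 0, c) = \<one>\<^bsub>Lev G m\<^esub>"
        using app[OF m(1) zero_one_simplex(1) m(2)] zero[OF o(2,3) m(2)] by simp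
    qed
  qed
  have Hs: "H \<in> smap ?Z (mspace (\<Delta> 1 \<times>\<^sub>s C) paths_from_one)"
    unfolding H_def by (rule Fs.curry_smap[OF Z Hc])
  have HP: "H k (r, s) \<in> paths_from_one k" if "r \<in> Simp (\<Delta> 1) k" "s \<in> Simp (\<Delta> n) k" for k r s
    using smap_closed[OF Hs, of "(r, s)" k] that by simp
  have H_eq: "H k (r, s) = \<chi>"
    if rs: "r \<in> Simp (\<Delta> 1) k" "s \<in> Simp (\<Delta> n) k" and \<chi>: "\<chi> \<in> paths_from_one k"
      and eq: "\<And>m s' t c. s' \<in> Simp (\<Delta> k) m \<Longrightarrow> t \<in> Simp (\<Delta> 1) m \<Longrightarrow> c \<in> Simp C m \<Longrightarrow>
        hh m ((op (\<Delta> 1) k s' r, op (\<Delta> n) k s' s), (t, c)) = \<chi> m (s', (t, c))" for k r s \<chi>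
  proof (rule smap_eqI[OF Fs.smap[OF HP[OF rs]] Fs.smap[OF \<chi>]])
    fix m x assume "x \<in> Simp (\<Delta> k \<times>\<^sub>s \<Delta> 1 \<times>\<^sub>s C) m"
    then obtain s' t c where x: "x = (s', (t, c))" "s' \<in> Simp (\<Delta> k) m" "t \<in> Simp (\<Delta> 1) m" "c \<in> Simp C m" by auto
    have "H k (r, s) m x = curry_at ?Z (\<Delta> 1 \<times>\<^sub>s C) hh k (r, s) m (s', (t, c))"
      using rs x(1) by (simp add: H_def restr_apply)
    then show "H k (r, s) m x = \<chi> m x"
      using curry_at_apply[OF x(2), of "(t, c)" "\<Delta> 1 \<times>\<^sub>s C" ?Z hh "(r, s)"] x opZ(1)[OF rs x(2)] eq[OF x(2-4)] by simp
  qed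
  have H0: "H n (replicate (Suc n) 0, \<iota> n) = z"
  proof (rule H_eq[OF _ _ z])
    fix m s' t c assume m: "s' \<in> Simp (\<Delta> n) m" "t \<in> Simp (\<Delta> 1) m" "c \<in> Simp C m"
    have "op (\<Delta> n) n s' (\<iota> n) = s'"
    proof -
      have "map ((!) (\<iota> n)) s' = s'" using m(1) by (intro map_idI) (auto simp: nth_\<iota> std_simplex_simps)
      then show ?thesis using op_std_simplex[OF \<iota>_simplex m(1)] by simp
    qed
    then show "hh m ((op (\<Delta> 1) n s' (replicate (Suc n) 0), op (\<Delta> n) n s' (\<iota> n)), (t, c)) = z m (s', (t, c))"
      using op_const[OF m(1), of 0 1] hh_0[OF m] by simp
  qed simp_all
  have H1: "H k (replicate (Suc k) 1, s) = pone (\<Delta> k \<times>\<^sub>s (\<Delta> 1 \<times>\<^sub>s C))" if s: "s \<in> Simp (\<Delta> n) k" for k s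
  proof (rule H_eq[OF _ s paths_from_one_ops(3)])
    fix m s' t c assume m: "s' \<in> Simp (\<Delta> k) m" "t \<in> Simp (\<Delta> 1) m" "c \<in> Simp C m"
    show "hh m ((op (\<Delta> 1) k s' (replicate (Suc k) 1), op (\<Delta> n) k s' s), (t, c)) = pone (\<Delta> k \<times>\<^sub>s (\<Delta> 1 \<times>\<^sub>s C)) m (s', (t, c))"
      using op_const[OF m(1), of 1 1] hh_1[OF opZ(3)[OF zero_one_simplex(2) s m(1)] m(2,3)] m by (simp add: pone_apply del: One_nat_def)
  qed simp
  have Hbd: "H k (r, s) = pone (\<Delta> k \<times>\<^sub>s (\<Delta> 1 \<times>\<^sub>s C))"
    if r: "r \<in> Simp (\<Delta> 1) k" and s: "s \<in> Simp (\<Delta> n) k" and j: "j \<le> n" "j \<notin> set s" for k r s j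
  proof (rule H_eq[OF r s paths_from_one_ops(3)])
    fix m s' t c assume m: "s' \<in> Simp (\<Delta> k) m" "t \<in> Simp (\<Delta> 1) m" "c \<in> Simp C m"
    have "set (op (\<Delta> n) k s' s) \<subseteq> set s"
      unfolding op_std_simplex[OF s m(1)] using s m(1) by (fastforce simp: std_simplex_simps)
    then have "j \<notin> set (op (\<Delta> n) k s' s)" using j(2) by blast
    then show "hh m ((op (\<Delta> 1) k s' r, op (\<Delta> n) k s' s), (t, c)) = pone (\<Delta> k \<times>\<^sub>s (\<Delta> 1 \<times>\<^sub>s C)) m (s', (t, c))"
      using hh_bd[OF opZ(2,3)[OF r s m(1)] m(2,3) j(1)] m by (simp add: pone_apply)
  qed
  interpret F: simplicial_group F by (rule F_group)
  \<comment> \<open>The homotopy is a map \<open>\<Delta>^1 \<times> \<Delta>^n \<rightarrow> F\<close>. The nondegenerate \<open>(n + 1)\<close>-simplices of the prism are the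
    pairs of \<open>\<tau> i\<close>, which has \<open>i + 1\<close> zeros, and the \<open>i\<close>-th degeneracy of the identity.\<close>
  define \<tau> where "\<tau> i = replicate (Suc i) 0 @ replicate (Suc n - i) (1::nat)" for i
  have \<tau>: "\<tau> i \<in> Simp (\<Delta> 1) (Suc n)" if "i \<le> n" for i
    using that by (auto simp: \<tau>_def std_simplex_simps sorted_append)
  have d\<iota>: "dup i (\<iota> n) \<in> Simp (\<Delta> n) (Suc n)" if "i \<le> n" for i
    using simplicial_set.degen_closed[OF simplicial_set_std_simplex \<iota>_simplex that] by simp
  define w where "w i = H (Suc n) (\<tau> i, dup i (\<iota> n))" for i
  have wface: "GFace F (Suc n) j (w i) = H n (omit j (\<tau> i), omit j (dup i (\<iota> n)))" if "i \<le> n" "j \<le> Suc n" for i j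
    using smap_face[OF Hs, of "(\<tau> i, dup i (\<iota> n))" n j] \<tau>[OF that(1)] d\<iota>[OF that(1)] that unfolding w_def by simp
  have mem: "omit j (\<tau> i) \<in> Simp (\<Delta> 1) n" "omit j (dup i (\<iota> n)) \<in> Simp (\<Delta> n) n" if "i \<le> n" "j \<le> Suc n" for i j
    using simplicial_set.face_closed[OF simplicial_set_std_simplex \<tau>[OF that(1)] that(2)]
      simplicial_set.face_closed[OF simplicial_set_std_simplex d\<iota>[OF that(1)] that(2)] by simp_all
  have "\<exists>v\<in>carrier (Lev F (Suc n)). GFace F (Suc n) (Suc n) v = z \<and> (\<forall>i\<le>n. GFace F (Suc n) i v = \<one>\<^bsub>Lev F n\<^esub>)"
  proof (rule F.bounds_if_prism[of n w])
    show "w i \<in> carrier (Lev F (Suc n))" if "i \<le> n" for i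
      using HP[OF \<tau>[OF that] d\<iota>[OF that]] by (simp add: w_def)
    have "omit 0 (\<tau> 0) = replicate (Suc n) 1"
      unfolding \<tau>_def by (subst omit_replicate_append) simp
    then show "GFace F (Suc n) 0 (w 0) = \<one>\<^bsub>Lev F n\<^esub>"
      using wface[of 0 0] H1[OF mem(2)[of 0 0]] by (simp del: One_nat_def)
    have "omit (Suc n) (\<tau> n) = replicate (Suc n) 0"
      unfolding \<tau>_def by (subst omit_replicate_append) (simp add: omit_def replicate_Suc)
    moreover have "omit (Suc n) (dup n (\<iota> n)) = \<iota> n" by (rule omit_dup_eq) simp_all
    ultimately show "GFace F (Suc n) (Suc n) (w n) = z" using wface[of n "Suc n"] H0 by simp
    show "GFace F (Suc n) (Suc i) (w i) = GFace F (Suc n) (Suc i) (w (Suc i))" if "i < n" for i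
    proof -
      have "omit (Suc i) (dup i (\<iota> n)) = \<iota> n" "omit (Suc i) (dup (Suc i) (\<iota> n)) = \<iota> n"
        using that by (auto intro!: omit_dup_eq)
      moreover have "omit (Suc i) (\<tau> i) = omit (Suc i) (\<tau> (Suc i))"
      proof -
        have "Suc n - i = Suc (n - i)" using that by simp
        then show ?thesis unfolding \<tau>_def omit_replicate_append by (simp add: omit_def replicate_Suc)
      qed
      ultimately show ?thesis using wface[of i "Suc i"] wface[of "Suc i" "Suc i"] that by simp
    qed
    show "GFace F (Suc n) j (w i) = \<one>\<^bsub>Lev F n\<^esub>" if ij: "i \<le> n" "j \<le> Suc n" "j \<noteq> i" "j \<noteq> Suc i" for i j
    proof -
      define v where "v = (if j < i then j else j - 1)"
      have v: "v \<le> n" using ij by (auto simp: v_def)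
      have "v \<notin> set (omit j (dup i (\<iota> n)))"
      proof
        assume "v \<in> set (omit j (dup i (\<iota> n)))"
        then obtain a where a: "a < Suc n" "omit j (dup i (\<iota> n)) ! a = v"
          using ij by (auto simp: in_set_conv_nth)
        have "\<delta> j a < Suc (Suc n)" "\<sigma> i (\<delta> j a) \<le> n" using a(1) ij by (auto simp: \<delta>_def \<sigma>_def)
        then have "\<sigma> i (\<delta> j a) = v" using a ij by (simp add: nth_omit nth_dup nth_\<iota>)
        then show False using ij unfolding v_def \<delta>_def \<sigma>_def by (auto split: if_splits)
      qed
      then show ?thesis using wface[OF ij(1,2)] Hbd[OF mem[OF ij(1,2)] v] by simp
    qed
  qed
  then show ?thesis .
qed

text \<open>
  Contractibility of \<open>C\<close> deforms \<open>x : C \<rightarrow> Map(\<Delta>^k, G)\<close> to a constant map; here the subspace on which the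
  deformation is constrained is empty.
\<close>

lemma path_exists:
  assumes x: "x \<in> smap (\<Delta> k \<times>\<^sub>s C) (under G)"
  shows "\<exists>\<gamma>\<in>paths k. \<forall>m. \<forall>s\<in>Simp (\<Delta> k) m. \<forall>c\<in>Simp C m. \<gamma> m (s, (replicate (Suc m) 0, c)) = x m (s, c)"
proof -
  define f where "f = restr (C \<times>\<^sub>s \<Delta> k) (\<lambda>m z. x m (snd z, fst z))"
  have f: "f \<in> smap (C \<times>\<^sub>s \<Delta> k) (under G)"
    unfolding f_def
    by (rule restr_prod_smap[OF C.simplicial_set_axioms simplicial_set_std_simplex])
      (simp_all add: smap_prod_closed[OF x, simplified] smap_prod_face[OF x, simplified] smap_prod_degen[OF x, simplified])
  define B where "B m d \<longleftrightarrow> False" for m :: nat and d :: "nat list"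
  obtain h where h: "h \<in> smap ((\<Delta> 1 \<times>\<^sub>s C) \<times>\<^sub>s \<Delta> k) (under G)"
    "\<And>m c d. c \<in> Simp C m \<Longrightarrow> d \<in> Simp (\<Delta> k) m \<Longrightarrow> h m ((replicate (Suc m) 0, c), d) = f m (c, d)"
    "\<And>m c c' d. c \<in> Simp C m \<Longrightarrow> c' \<in> Simp C m \<Longrightarrow> d \<in> Simp (\<Delta> k) m \<Longrightarrow>
      h m ((replicate (Suc m) 1, c), d) = h m ((replicate (Suc m) 1, c'), d)"
    "\<And>m t c d. t \<in> Simp (\<Delta> 1) m \<Longrightarrow> c \<in> Simp C m \<Longrightarrow> d \<in> Simp (\<Delta> k) m \<Longrightarrow> B m d \<Longrightarrow> h m ((t, c), d) = \<one>\<^bsub>Lev G m\<^esub>"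
    by (rule deform_off_C[OF simplicial_set_std_simplex f, of B]) (simp add: B_def, rule that)
  let ?\<gamma> = "restr (\<Delta> k \<times>\<^sub>s (\<Delta> 1 \<times>\<^sub>s C)) (\<lambda>m z. h m (snd z, fst z))"
  have \<gamma>: "?\<gamma> \<in> smap (\<Delta> k \<times>\<^sub>s (\<Delta> 1 \<times>\<^sub>s C)) (under G)"
    by (rule restr_prod_smap[OF simplicial_set_std_simplex C1])
      (simp_all add: smap_prod_closed[OF h(1), simplified] smap_prod_face[OF h(1), simplified] smap_prod_degen[OF h(1), simplified])
  have app: "?\<gamma> m (s, (t, c)) = h m ((t, c), s)" if "s \<in> Simp (\<Delta> k) m" "t \<in> Simp (\<Delta> 1) m" "c \<in> Simp C m" for m s t c
    using that by (subst restr_apply) auto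
  show ?thesis
  proof (intro bexI[of _ ?\<gamma>] allI ballI)
    fix m s c assume m: "s \<in> Simp (\<Delta> k) m" "c \<in> Simp C m"
    show "?\<gamma> m (s, (replicate (Suc m) 0, c)) = x m (s, c)"
      using app[OF m(1) zero_one_simplex(1) m(2)] h(2)[OF m(2,1)] m by (simp add: f_def restr_apply)
  next
    show "?\<gamma> \<in> paths k"
      unfolding paths_def
    proof (intro CollectI conjI allI ballI \<gamma>)
      fix m s c c' assume m: "s \<in> Simp (\<Delta> k) m" "c \<in> Simp C m" "c' \<in> Simp C m"
      show "?\<gamma> m (s, (replicate (Suc m) 1, c)) = ?\<gamma> m (s, (replicate (Suc m) 1, c'))"
        using app[OF m(1) zero_one_simplex(2)] m(2,3) h(3)[OF m(2,3,1)] by simp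
    qed
  qed
qed

text \<open>
  The lifting property of a trivial Kan fibration. Since the evaluation at the starting point is a
  surjective homomorphism, the prescribed boundary differs from that of an arbitrary preimage \<open>\<gamma>\<close> of \<open>x\<close>
  by a boundary in the kernel \<open>F\<close>, where all boundaries have fillings.
\<close>

lemma path_extends:
  assumes x: "x \<in> smap (\<Delta> (Suc n) \<times>\<^sub>s C) (under G)"
    and y: "\<And>i. i \<le> Suc n \<Longrightarrow> y i \<in> paths n"
    and y0: "\<And>i m s c. i \<le> Suc n \<Longrightarrow> s \<in> Simp (\<Delta> n) m \<Longrightarrow> c \<in> Simp C m \<Longrightarrow>
      y i m (s, (replicate (Suc m) 0, c)) = x m (map (\<delta> i) s, c)"
    and compat: "\<And>i j. i < j \<Longrightarrow> j \<le> Suc n \<Longrightarrow> 0 < n \<Longrightarrow>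
      pre (\<Delta> 1 \<times>\<^sub>s C) (n - 1) (\<delta> i) (y j) = pre (\<Delta> 1 \<times>\<^sub>s C) (n - 1) (\<delta> (j - 1)) (y i)"
  shows "\<exists>\<gamma>\<in>paths (Suc n). (\<forall>m. \<forall>s\<in>Simp (\<Delta> (Suc n)) m. \<forall>c\<in>Simp C m. \<gamma> m (s, (replicate (Suc m) 0, c)) = x m (s, c)) \<and>
    (\<forall>i\<le>Suc n. pre (\<Delta> 1 \<times>\<^sub>s C) n (\<delta> i) \<gamma> = y i)"
proof -
  let ?C1 = "\<Delta> 1 \<times>\<^sub>s C"
  interpret Ps: map_subspace ?C1 "under G" paths by (rule paths_map_subspace)
  interpret Fs: map_subspace ?C1 "under G" paths_from_one by (rule paths_from_one_map_subspace)
  interpret F: simplicial_group F by (rule F_group)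
  obtain \<gamma> where \<gamma>: "\<gamma> \<in> paths (Suc n)" "\<And>m s c. s \<in> Simp (\<Delta> (Suc n)) m \<Longrightarrow> c \<in> Simp C m \<Longrightarrow>
      \<gamma> m (s, (replicate (Suc m) 0, c)) = x m (s, c)"
    using path_exists[OF x] by blast
  have d\<gamma>: "pre ?C1 n (\<delta> i) \<gamma> \<in> paths n" if "i \<le> Suc n" for i
    by (rule Ps.pre_closed[OF \<gamma>(1) monotone_index_\<delta>[OF that]])
  let ?A = "\<Delta> n \<times>\<^sub>s ?C1"
  define b where "b i = pmul ?A (y i) (pinv ?A (pre ?C1 n (\<delta> i) \<gamma>))" for i
  have bF: "b i \<in> paths_from_one n" if i: "i \<le> Suc n" for i
  proof -
    have "b i m (s, (replicate (Suc m) 0, c)) = \<one>\<^bsub>Lev G m\<^esub>" if m: "s \<in> Simp (\<Delta> n) m" "c \<in> Simp C m" for m s c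
    proof -
      have s': "map (\<delta> i) s \<in> Simp (\<Delta> (Suc n)) m" by (rule map_monotone_index[OF monotone_index_\<delta>[OF i] m(1)])
      have mem: "(replicate (Suc m) 0, c) \<in> Simp ?C1 m" using m(2) by simp
      have "x m (map (\<delta> i) s, c) \<in> carrier (Lev G m)" using smap_carrier[OF x, of "(map (\<delta> i) s, c)" m] s' m by simp
      then show ?thesis
        using y0[OF i m] \<gamma>(2)[OF s' m(2)] pre_apply[OF m(1) mem, of "\<delta> i" \<gamma>] m(1) mem
        by (simp add: b_def pmul_apply pinv_apply)
    qed
    moreover have "b i \<in> paths n" unfolding b_def by (intro paths_ops y i d\<gamma>)
    ultimately show ?thesis unfolding paths_from_one_def by blast
  qed
  have "\<exists>v\<in>carrier (Lev F (Suc n)). \<forall>i\<le>Suc n. GFace F (Suc n) i v = b i"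
  proof (rule F.fill_boundary)
    show "\<exists>w\<in>carrier (Lev F (Suc n)). GFace F (Suc n) (Suc n) w = z \<and> (\<forall>i\<le>n. GFace F (Suc n) i w = \<one>\<^bsub>Lev F n\<^esub>)"
      if "z \<in> carrier (Lev F n)" "0 < n \<Longrightarrow> \<forall>i\<le>n. GFace F n i z = \<one>\<^bsub>Lev F (n - 1)\<^esub>" for z
      using paths_from_one_bounds[of z n] that by simp
    show "b i \<in> carrier (Lev F n)" if "i \<le> Suc n" for i using bF[OF that] by simp
    fix i j :: nat assume ij: "i < j" "j \<le> Suc n" "0 < n"
    then obtain n' where n: "n = Suc n'" by (cases n) auto
    have "pre ?C1 n' (\<delta> i) (pre ?C1 n (\<delta> j) \<gamma>) = pre ?C1 n' (\<delta> (j - 1)) (pre ?C1 n (\<delta> i) \<gamma>)"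
      using n ij by (subst (1 2) pre_pre[where w = "\<lambda>a. \<delta> j (\<delta> i a)"])
        (auto intro!: monotone_index_\<delta>, auto simp: \<delta>_def)
    moreover have mi: "monotone_index n' (Suc n') (\<delta> i)" "monotone_index n' (Suc n') (\<delta> (j - 1))"
      using ij n by (auto intro: monotone_index_\<delta>)
    ultimately show "GFace F n i (b j) = GFace F n (j - 1) (b i)"
      using compat[OF ij]
      by (simp add: b_def n pre_pmul(1,2)[OF mi(1)] pre_pmul(1,2)[OF mi(2)] del: One_nat_def)
  qed
  then obtain v where v: "v \<in> paths_from_one (Suc n)" "\<And>i. i \<le> Suc n \<Longrightarrow> pre ?C1 n (\<delta> i) v = b i" by auto
  have vp: "v \<in> paths (Suc n)" "\<And>m s c. s \<in> Simp (\<Delta> (Suc n)) m \<Longrightarrow> c \<in> Simp C m \<Longrightarrow>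
      v m (s, (replicate (Suc m) 0, c)) = \<one>\<^bsub>Lev G m\<^esub>"
    using v(1) unfolding paths_from_one_def by auto
  let ?g = "pmul (\<Delta> (Suc n) \<times>\<^sub>s ?C1) v \<gamma>"
  have gp: "?g \<in> paths (Suc n)" by (rule paths_ops(1)[OF vp(1) \<gamma>(1)])
  show ?thesis
  proof (intro bexI[OF _ gp] conjI allI ballI impI)
    fix m s c assume m: "s \<in> Simp (\<Delta> (Suc n)) m" "c \<in> Simp C m"
    have "x m (s, c) \<in> carrier (Lev G m)" using smap_carrier[OF x, of "(s, c)" m] m by simp
    then show "?g m (s, (replicate (Suc m) 0, c)) = x m (s, c)"
      using vp(2)[OF m] \<gamma>(2)[OF m] m by (simp add: pmul_apply)
  next
    fix i assume i: "i \<le> Suc n"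
    have "pre ?C1 n (\<delta> i) ?g = pmul ?A (b i) (pre ?C1 n (\<delta> i) \<gamma>)"
      using v(2)[OF i] by (simp add: pre_pmul(1)[OF monotone_index_\<delta>[OF i]] del: One_nat_def)
    also have "\<dots> = y i"
    proof (rule smap_eqI[of _ ?A "under G"])
      show "pmul ?A (b i) (pre ?C1 n (\<delta> i) \<gamma>) \<in> smap ?A (under G)"
        by (intro pmul_smap nC1 Fs.smap[OF bF[OF i]] Ps.smap[OF d\<gamma>[OF i]])
      show "y i \<in> smap ?A (under G)" by (rule Ps.smap[OF y[OF i]])
      fix m a assume a: "a \<in> Simp ?A m"
      then show "pmul ?A (b i) (pre ?C1 n (\<delta> i) \<gamma>) m a = y i m a"
        using smap_carrier[OF Ps.smap[OF y[OF i]] a] smap_carrier[OF Ps.smap[OF d\<gamma>[OF i]] a]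
        by (simp add: b_def pmul_apply pinv_apply level_assoc del: prod_sset_simps)
    qed
    finally show "pre ?C1 n (\<delta> i) ?g = y i" .
  qed
qed

end

section \<open>Extending equivariant maps to paths\<close>

definition prod_action :: "(nat \<Rightarrow> 'g \<Rightarrow> 'a \<Rightarrow> 'a) \<Rightarrow> (nat \<Rightarrow> 'g \<Rightarrow> 'b \<Rightarrow> 'b) \<Rightarrow> nat \<Rightarrow> 'g \<Rightarrow> 'a \<times> 'b \<Rightarrow> 'a \<times> 'b" where
  "prod_action \<alpha> \<beta> n g = map_prod (\<alpha> n g) (\<beta> n g)"

lemma prod_action_simp [simp]: "prod_action \<alpha> \<beta> n g (a, b) = (\<alpha> n g a, \<beta> n g b)"
  by (simp add: prod_action_def)

abbreviation trivial_action :: "nat \<Rightarrow> 'g \<Rightarrow> 'a \<Rightarrow> 'a" where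
  "trivial_action \<equiv> \<lambda>n g x. x"

lemma gspace_prod:
  assumes "gspace G X \<alpha>" "gspace G Y \<beta>"
  shows "gspace G (X \<times>\<^sub>s Y) (prod_action \<alpha> \<beta>)"
proof -
  interpret X: gspace G X \<alpha> by fact
  interpret Y: gspace G Y \<beta> by fact
  show ?thesis
    by (intro gspace.intro X.sgroup simplicial_set_prod X.space Y.space)
      (auto simp: X.act_mult Y.act_mult X.act_face Y.act_face X.act_degen Y.act_degen)
qed

lemma gspace_trivial: "simplicial_group G \<Longrightarrow> simplicial_set X \<Longrightarrow> gspace G X trivial_action"
  by (intro gspace.intro) auto

lemma free_gspace_prod:
  assumes "gspace G X \<alpha>" "free_gspace G Y \<beta>"
  shows "free_gspace G (X \<times>\<^sub>s Y) (prod_action \<alpha> \<beta>)"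
proof -
  interpret Y: free_gspace G Y \<beta> by fact
  show ?thesis
    by (intro free_gspace.intro gspace_prod assms(1) Y.gspace_axioms free_gspace_axioms.intro) (auto simp: Y.free)
qed

lemma (in simplicial_group) gspace_conj: "gspace G (under G) (conj_action G)"
proof (intro gspace.intro simplicial_group_axioms under_simplicial)
  fix n g x assume "g \<in> carrier (Lev G n)" "x \<in> Simp (under G) n"
  then show "conj_action G n g x \<in> Simp (under G) n" by (simp add: conj_action_def)
next
  fix n x assume "x \<in> Simp (under G) n"
  then show "conj_action G n \<one>\<^bsub>Lev G n\<^esub> x = x" by (simp add: conj_action_def)
next
  fix n g h x assume "g \<in> carrier (Lev G n)" "h \<in> carrier (Lev G n)" "x \<in> Simp (under G) n"
  then show "conj_action G n (g \<otimes>\<^bsub>Lev G n\<^esub> h) x = conj_action G n g (conj_action G n h x)"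
    by (simp add: conj_action_def level_inv_mult level_assoc)
qed (simp_all add: conj_action_def)

lemma equivariantD:
  "equivariant G X \<alpha> \<beta> f \<Longrightarrow> g \<in> carrier (Lev G n) \<Longrightarrow> x \<in> Simp X n \<Longrightarrow> f n (\<alpha> n g x) = \<beta> n g (f n x)"
  by (simp add: equivariant_def)

definition subspace :: "'a sset \<Rightarrow> (nat \<Rightarrow> 'a \<Rightarrow> bool) \<Rightarrow> 'a sset" where
  "subspace X A = X\<lparr>Simp := \<lambda>n. {x \<in> Simp X n. A n x}\<rparr>"

lemma subspace_simps [simp]:
  "Simp (subspace X A) n = {x \<in> Simp X n. A n x}" "Face (subspace X A) = Face X" "Degen (subspace X A) = Degen X"
  by (simp_all add: subspace_def)

lemma op_subspace: "op (subspace X A) k s x = op X k s x"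
proof -
  have d: "degens (subspace X A) d j c y = degens X d j c y" for d j c y by (induction c) simp_all
  have "opr (subspace X A) j n s x = opr X j n s x" for j n s
    by (induction n arbitrary: j s) (simp_all add: block_def d)
  then show ?thesis by (simp add: op_def del: opr.simps)
qed

lemma (in simplicial_set) simplicial_set_subspace:
  assumes "\<And>n i x. x \<in> Simp X (Suc n) \<Longrightarrow> A (Suc n) x \<Longrightarrow> i \<le> Suc n \<Longrightarrow> A n (Face X (Suc n) i x)"
    and "\<And>n i x. x \<in> Simp X n \<Longrightarrow> A n x \<Longrightarrow> i \<le> n \<Longrightarrow> A (Suc n) (Degen X n i x)"
  shows "simplicial_set (subspace X A)"
  by standard (use assms face_closed degen_closed face_face degen_degen face_degen_less face_degen_eq
    face_degen_greater in \<open>simp_all del: One_nat_def\<close>)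

locale contractible_gspace = contractible_domain G C + K: gspace G C \<kappa> for G C \<kappa>
begin

sublocale conj: gspace G "under G" "conj_action G" by (rule gspace_conj)

text \<open>
  The action \<open>(g y)(c) = g \<cdot> y(g\<inverse> c) \<cdot> g\<inverse>\<close> on maps out of \<open>C\<close>, for which the evaluation at the starting
  point is equivariant. Over a simplex \<open>s\<close> of \<open>\<Delta>^k\<close> the element \<open>g\<close> of \<open>G_k\<close> acts through its image \<open>s\<^sup>* g\<close>.
\<close>

definition \<rho> :: "nat \<Rightarrow> 'a \<Rightarrow> (nat \<Rightarrow> nat list \<times> nat list \<times> 'b \<Rightarrow> 'a) \<Rightarrow> nat \<Rightarrow> nat list \<times> nat list \<times> 'b \<Rightarrow> 'a" where
  "\<rho> k g y = restr (\<Delta> k \<times>\<^sub>s (\<Delta> 1 \<times>\<^sub>s C)) (\<lambda>m z. conj_action G m (op (under G) k (fst z) g)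
     (y m (fst z, (fst (snd z), \<kappa> m (inv\<^bsub>Lev G m\<^esub> (op (under G) k (fst z) g)) (snd (snd z))))))"

lemma \<rho>_apply:
  assumes "s \<in> Simp (\<Delta> k) m" "t \<in> Simp (\<Delta> 1) m" "c \<in> Simp C m"
  shows "\<rho> k g y m (s, (t, c)) = conj_action G m (op (under G) k s g)
     (y m (s, (t, \<kappa> m (inv\<^bsub>Lev G m\<^esub> (op (under G) k s g)) c)))"
  unfolding \<rho>_def using assms by (subst restr_apply) auto

lemma \<rho>_paths:
  assumes g: "g \<in> carrier (Lev G k)" and y: "y \<in> paths k"
  shows "\<rho> k g y \<in> paths k"
  unfolding paths_def
proof (intro CollectI conjI allI ballI)
  have g': "g \<in> Simp (under G) k" using g by simp
  have og: "op (under G) k s g \<in> carrier (Lev G m)" if "s \<in> Simp (\<Delta> k) m" for s m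
    using op_hom(1)[OF that g g] .
  note f = conj.face_op[OF _ g', simplified] conj.degen_op[OF _ g', simplified]
  have yc: "y m (s, (t, c)) \<in> carrier (Lev G m)" if "s \<in> Simp (\<Delta> k) m" "t \<in> Simp (\<Delta> 1) m" "c \<in> Simp C m" for m s t c
    using smap_carrier[OF paths_smap[OF y], of "(s, (t, c))" m] that by simp
  have yface: "y m (omit i s, (omit i t, Face C (Suc m) i c)) = GFace G (Suc m) i (y (Suc m) (s, (t, c)))"
    if "s \<in> Simp (\<Delta> k) (Suc m)" "t \<in> Simp (\<Delta> 1) (Suc m)" "c \<in> Simp C (Suc m)" "i \<le> Suc m" for m s t c i
    using smap_face[OF paths_smap[OF y], of "(s, (t, c))" m i] that by simp
  have ydegen: "y (Suc m) (dup i s, (dup i t, Degen C m i c)) = GDegen G m i (y m (s, (t, c)))"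
    if "s \<in> Simp (\<Delta> k) m" "t \<in> Simp (\<Delta> 1) m" "c \<in> Simp C m" "i \<le> m" for m s t c i
    using smap_degen[OF paths_smap[OF y], of "(s, (t, c))" m i] that by simp
  have cf: "conj_action G m (GFace G (Suc m) i a) (GFace G (Suc m) i b) = GFace G (Suc m) i (conj_action G (Suc m) a b)"
    if "a \<in> carrier (Lev G (Suc m))" "b \<in> carrier (Lev G (Suc m))" "i \<le> Suc m" for m i a b
    using conj.act_face[of a m b i] that by simp
  have cd: "conj_action G (Suc m) (GDegen G m i a) (GDegen G m i b) = GDegen G m i (conj_action G m a b)"
    if "a \<in> carrier (Lev G m)" "b \<in> carrier (Lev G m)" "i \<le> m" for m i a b
    using conj.act_degen[of a m b i] that by simp
  have kf: "\<kappa> m (inv\<^bsub>Lev G m\<^esub> GFace G (Suc m) i a) (Face C (Suc m) i c) = Face C (Suc m) i (\<kappa> (Suc m) (inv\<^bsub>Lev G (Suc m)\<^esub> a) c)"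
    if "a \<in> carrier (Lev G (Suc m))" "c \<in> Simp C (Suc m)" "i \<le> Suc m" for m i a c
    using K.act_face[of "inv\<^bsub>Lev G (Suc m)\<^esub> a" m c i] that by simp
  have kd: "\<kappa> (Suc m) (inv\<^bsub>Lev G (Suc m)\<^esub> GDegen G m i a) (Degen C m i c) = Degen C m i (\<kappa> m (inv\<^bsub>Lev G m\<^esub> a) c)"
    if "a \<in> carrier (Lev G m)" "c \<in> Simp C m" "i \<le> m" for m i a c
    using K.act_degen[of "inv\<^bsub>Lev G m\<^esub> a" m c i] that by simp
  have cc: "conj_action G m a b \<in> carrier (Lev G m)" if "a \<in> carrier (Lev G m)" "b \<in> carrier (Lev G m)" for m a b
    using conj.act_closed[of a m b] that by simp
  show "\<rho> k g y \<in> smap (\<Delta> k \<times>\<^sub>s (\<Delta> 1 \<times>\<^sub>s C)) (under G)"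
    unfolding \<rho>_def
    by (rule restr_prod_smap[OF simplicial_set_std_simplex C1])
      (auto simp: og yc cc f[symmetric] kf kd yface ydegen cf cd simp del: One_nat_def)
  fix m s c c' assume s: "s \<in> Simp (\<Delta> k) m" and c: "c \<in> Simp C m" "c' \<in> Simp C m"
  have "y m (s, (replicate (Suc m) 1, \<kappa> m (inv\<^bsub>Lev G m\<^esub> (op (under G) k s g)) c))
    = y m (s, (replicate (Suc m) 1, \<kappa> m (inv\<^bsub>Lev G m\<^esub> (op (under G) k s g)) c'))"
    by (rule paths_end[OF y s]) (use og[OF s] c in simp_all)
  then show "\<rho> k g y m (s, replicate (Suc m) 1, c) = \<rho> k g y m (s, replicate (Suc m) 1, c')"
    using \<rho>_apply[OF s zero_one_simplex(2)] c by simp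
qed

lemma path_eqI:
  assumes "y \<in> paths k" "y' \<in> paths k"
    and "\<And>m s t c. s \<in> Simp (\<Delta> k) m \<Longrightarrow> t \<in> Simp (\<Delta> 1) m \<Longrightarrow> c \<in> Simp C m \<Longrightarrow> y m (s, (t, c)) = y' m (s, (t, c))"
  shows "y = y'"
  by (rule smap_eqI[OF paths_smap[OF assms(1)] paths_smap[OF assms(2)]]) (use assms(3) in auto)

lemma gspace_paths: "gspace G (mspace (\<Delta> 1 \<times>\<^sub>s C) paths) \<rho>"
proof (intro gspace.intro simplicial_group_axioms map_subspace.simplicial_set_mspace[OF paths_map_subspace])
  note pre_c = map_subspace.pre_closed[OF paths_map_subspace]
  note pre_a = pre_apply[of _ _ _ "(_, _)" "\<Delta> 1 \<times>\<^sub>s C", simplified]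
  have yc: "y m (s, (t, c)) \<in> carrier (Lev G m)" if "y \<in> paths k" "s \<in> Simp (\<Delta> k) m" "t \<in> Simp (\<Delta> 1) m" "c \<in> Simp C m" for y k m s t c
    using smap_carrier[OF paths_smap[OF that(1)], of "(s, (t, c))" m] that by simp
  show "\<rho> n g x \<in> Simp (mspace (\<Delta> 1 \<times>\<^sub>s C) paths) n"
    if "g \<in> carrier (Lev G n)" "x \<in> Simp (mspace (\<Delta> 1 \<times>\<^sub>s C) paths) n" for n g x
    using \<rho>_paths that by simp
  show "\<rho> n \<one>\<^bsub>Lev G n\<^esub> x = x" if "x \<in> Simp (mspace (\<Delta> 1 \<times>\<^sub>s C) paths) n" for n x
  proof (rule path_eqI[of _ n])
    have x: "x \<in> paths n" using that by simp
    show "\<rho> n \<one>\<^bsub>Lev G n\<^esub> x \<in> paths n" "x \<in> paths n" using \<rho>_paths x by simp_all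
    fix m s t c assume m: "s \<in> Simp (\<Delta> n) m" "t \<in> Simp (\<Delta> 1) m" "c \<in> Simp C m"
    show "\<rho> n \<one>\<^bsub>Lev G n\<^esub> x m (s, t, c) = x m (s, t, c)"
      using \<rho>_apply[OF m, of "\<one>\<^bsub>Lev G n\<^esub>" x] op_hom(3)[OF m(1), of "\<one>\<^bsub>Lev G n\<^esub>" "\<one>\<^bsub>Lev G n\<^esub>"]
        conj.act_one[of "x m (s, t, c)" m] yc[OF x m] m by simp
  qed
  show "\<rho> n (g \<otimes>\<^bsub>Lev G n\<^esub> h) x = \<rho> n g (\<rho> n h x)"
    if "g \<in> carrier (Lev G n)" "h \<in> carrier (Lev G n)" "x \<in> Simp (mspace (\<Delta> 1 \<times>\<^sub>s C) paths) n" for n g h x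
  proof (rule path_eqI[of _ n])
    have x: "x \<in> paths n" using that by simp
    show "\<rho> n (g \<otimes>\<^bsub>Lev G n\<^esub> h) x \<in> paths n" "\<rho> n g (\<rho> n h x) \<in> paths n" using \<rho>_paths x that by simp_all
    fix m s t c assume m: "s \<in> Simp (\<Delta> n) m" "t \<in> Simp (\<Delta> 1) m" "c \<in> Simp C m"
    let ?g = "op (under G) n s g" and ?h = "op (under G) n s h"
    have gh: "?g \<in> carrier (Lev G m)" "?h \<in> carrier (Lev G m)" using op_hom(1)[OF m(1)] that by auto
    have c': "\<kappa> m (inv\<^bsub>Lev G m\<^esub> ?g) c \<in> Simp C m" using gh m by simp
    have "\<rho> n g (\<rho> n h x) m (s, t, c) = conj_action G m ?g (conj_action G m ?h
        (x m (s, t, \<kappa> m (inv\<^bsub>Lev G m\<^esub> ?h) (\<kappa> m (inv\<^bsub>Lev G m\<^esub> ?g) c))))"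
      using \<rho>_apply[OF m, of g "\<rho> n h x"] \<rho>_apply[OF m(1,2) c', of h x] by simp
    also have "\<dots> = conj_action G m (?g \<otimes>\<^bsub>Lev G m\<^esub> ?h) (x m (s, t, \<kappa> m (inv\<^bsub>Lev G m\<^esub> (?g \<otimes>\<^bsub>Lev G m\<^esub> ?h)) c))"
      using gh m yc[OF x m(1,2)] by (simp add: level_inv_mult K.act_mult conj.act_mult)
    also have "\<dots> = \<rho> n (g \<otimes>\<^bsub>Lev G n\<^esub> h) x m (s, t, c)"
      using \<rho>_apply[OF m, of "g \<otimes>\<^bsub>Lev G n\<^esub> h" x] op_hom(2)[OF m(1) that(1,2)] by simp
    finally show "\<rho> n (g \<otimes>\<^bsub>Lev G n\<^esub> h) x m (s, t, c) = \<rho> n g (\<rho> n h x) m (s, t, c)" by simp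
  qed
  show "Face (mspace (\<Delta> 1 \<times>\<^sub>s C) paths) (Suc n) i (\<rho> (Suc n) g x)
      = \<rho> n (GFace G (Suc n) i g) (Face (mspace (\<Delta> 1 \<times>\<^sub>s C) paths) (Suc n) i x)"
    if "g \<in> carrier (Lev G (Suc n))" "x \<in> Simp (mspace (\<Delta> 1 \<times>\<^sub>s C) paths) (Suc n)" "i \<le> Suc n" for n i g x
  proof (rule path_eqI[of _ n])
    have x: "x \<in> paths (Suc n)" using that by simp
    note mi = monotone_index_\<delta>[OF that(3)]
    show "Face (mspace (\<Delta> 1 \<times>\<^sub>s C) paths) (Suc n) i (\<rho> (Suc n) g x) \<in> paths n"
      "\<rho> n (GFace G (Suc n) i g) (Face (mspace (\<Delta> 1 \<times>\<^sub>s C) paths) (Suc n) i x) \<in> paths n"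
      using \<rho>_paths x that pre_c[OF _ mi] by simp_all
    fix m s t c assume m: "s \<in> Simp (\<Delta> n) m" "t \<in> Simp (\<Delta> 1) m" "c \<in> Simp C m"
    have g: "op (under G) n s (GFace G (Suc n) i g) = op (under G) (Suc n) (map (\<delta> i) s) g"
      using conj.op_face[of g n i s m] that m(1) by simp
    have tc: "(t, c') \<in> Simp (\<Delta> 1 \<times>\<^sub>s C) m" if "c' \<in> Simp C m" for c' using m(2) that by simp
    have "op (under G) (Suc n) (map (\<delta> i) s) g \<in> carrier (Lev G m)"
      by (rule op_hom(1)[OF map_monotone_index[OF mi m(1)] that(1) that(1)])
    then show "Face (mspace (\<Delta> 1 \<times>\<^sub>s C) paths) (Suc n) i (\<rho> (Suc n) g x) m (s, t, c)
      = \<rho> n (GFace G (Suc n) i g) (Face (mspace (\<Delta> 1 \<times>\<^sub>s C) paths) (Suc n) i x) m (s, t, c)"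
      using \<rho>_apply[OF m] \<rho>_apply[OF map_monotone_index[OF mi m(1)] m(2,3), of g x] g m
      by (simp add: pre_apply[OF m(1) tc] del: One_nat_def)
  qed
  show "Degen (mspace (\<Delta> 1 \<times>\<^sub>s C) paths) n i (\<rho> n g x)
      = \<rho> (Suc n) (GDegen G n i g) (Degen (mspace (\<Delta> 1 \<times>\<^sub>s C) paths) n i x)"
    if "g \<in> carrier (Lev G n)" "x \<in> Simp (mspace (\<Delta> 1 \<times>\<^sub>s C) paths) n" "i \<le> n" for n i g x
  proof (rule path_eqI[of _ "Suc n"])
    have x: "x \<in> paths n" using that by simp
    note mi = monotone_index_\<sigma>[OF that(3)]
    show "Degen (mspace (\<Delta> 1 \<times>\<^sub>s C) paths) n i (\<rho> n g x) \<in> paths (Suc n)"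
      "\<rho> (Suc n) (GDegen G n i g) (Degen (mspace (\<Delta> 1 \<times>\<^sub>s C) paths) n i x) \<in> paths (Suc n)"
      using \<rho>_paths x that pre_c[OF _ mi] by simp_all
    fix m s t c assume m: "s \<in> Simp (\<Delta> (Suc n)) m" "t \<in> Simp (\<Delta> 1) m" "c \<in> Simp C m"
    have g: "op (under G) (Suc n) s (GDegen G n i g) = op (under G) n (map (\<sigma> i) s) g"
      using conj.op_degen[of g n i s m] that m(1) by simp
    have tc: "(t, c') \<in> Simp (\<Delta> 1 \<times>\<^sub>s C) m" if "c' \<in> Simp C m" for c' using m(2) that by simp
    have "op (under G) n (map (\<sigma> i) s) g \<in> carrier (Lev G m)"
      by (rule op_hom(1)[OF map_monotone_index[OF mi m(1)] that(1) that(1)])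
    then show "Degen (mspace (\<Delta> 1 \<times>\<^sub>s C) paths) n i (\<rho> n g x) m (s, t, c)
      = \<rho> (Suc n) (GDegen G n i g) (Degen (mspace (\<Delta> 1 \<times>\<^sub>s C) paths) n i x) m (s, t, c)"
      using \<rho>_apply[OF m] \<rho>_apply[OF map_monotone_index[OF mi m(1)] m(2,3), of g x] g m
      by (simp add: pre_apply[OF m(1) tc] del: One_nat_def)
  qed
qed

text \<open>
  An equivariant map \<open>\<psi> : X \<times> C \<rightarrow> G\<close> is an equivariant map \<open>X \<rightarrow> Map(C, G)\<close>. Lifting it to the space of
  paths gives an equivariant homotopy \<open>\<Psi>\<close> from \<open>\<psi>\<close> to a map that does not depend on \<open>C\<close>. On the
  invariant subspace \<open>A\<close> the homotopy may be prescribed.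
\<close>

theorem equivariant_path_extension:
  fixes X :: "'x sset" and \<Psi>0 :: "nat \<Rightarrow> 'x \<times> nat list \<times> 'b \<Rightarrow> 'a"
  assumes X: "free_gspace G X \<alpha>"
    and \<psi>: "\<psi> \<in> smap (X \<times>\<^sub>s C) (under G)" "equivariant G (X \<times>\<^sub>s C) (prod_action \<alpha> \<kappa>) (conj_action G) \<psi>"
    and A: "simplicial_set (subspace X A)" "\<And>n g x. x \<in> Simp X n \<Longrightarrow> A n x \<Longrightarrow> g \<in> carrier (Lev G n) \<Longrightarrow> A n (\<alpha> n g x)"
    and \<Psi>0: "restr (subspace X A \<times>\<^sub>s (\<Delta> 1 \<times>\<^sub>s C)) \<Psi>0 \<in> smap (subspace X A \<times>\<^sub>s (\<Delta> 1 \<times>\<^sub>s C)) (under G)"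
    and \<Psi>0_act: "\<And>n x t c g. x \<in> Simp X n \<Longrightarrow> A n x \<Longrightarrow> t \<in> Simp (\<Delta> 1) n \<Longrightarrow> c \<in> Simp C n \<Longrightarrow> g \<in> carrier (Lev G n) \<Longrightarrow>
      \<Psi>0 n (\<alpha> n g x, (t, \<kappa> n g c)) = conj_action G n g (\<Psi>0 n (x, (t, c)))"
    and \<Psi>0_0: "\<And>n x c. x \<in> Simp X n \<Longrightarrow> A n x \<Longrightarrow> c \<in> Simp C n \<Longrightarrow> \<Psi>0 n (x, (replicate (Suc n) 0, c)) = \<psi> n (x, c)"
    and \<Psi>0_1: "\<And>n x c c'. x \<in> Simp X n \<Longrightarrow> A n x \<Longrightarrow> c \<in> Simp C n \<Longrightarrow> c' \<in> Simp C n \<Longrightarrow>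
      \<Psi>0 n (x, (replicate (Suc n) 1, c)) = \<Psi>0 n (x, (replicate (Suc n) 1, c'))"
  obtains \<Psi> where "\<Psi> \<in> smap (X \<times>\<^sub>s (\<Delta> 1 \<times>\<^sub>s C)) (under G)"
    "\<And>n x t c g. x \<in> Simp X n \<Longrightarrow> t \<in> Simp (\<Delta> 1) n \<Longrightarrow> c \<in> Simp C n \<Longrightarrow> g \<in> carrier (Lev G n) \<Longrightarrow>
      \<Psi> n (\<alpha> n g x, (t, \<kappa> n g c)) = conj_action G n g (\<Psi> n (x, (t, c)))"
    "\<And>n x c. x \<in> Simp X n \<Longrightarrow> c \<in> Simp C n \<Longrightarrow> \<Psi> n (x, (replicate (Suc n) 0, c)) = \<psi> n (x, c)"
    "\<And>n x c c'. x \<in> Simp X n \<Longrightarrow> c \<in> Simp C n \<Longrightarrow> c' \<in> Simp C n \<Longrightarrow>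
      \<Psi> n (x, (replicate (Suc n) 1, c)) = \<Psi> n (x, (replicate (Suc n) 1, c'))"
    "\<And>n x t c. x \<in> Simp X n \<Longrightarrow> A n x \<Longrightarrow> t \<in> Simp (\<Delta> 1) n \<Longrightarrow> c \<in> Simp C n \<Longrightarrow> \<Psi> n (x, (t, c)) = \<Psi>0 n (x, (t, c))"
proof -
  interpret X: free_gspace G X \<alpha> by (rule X)
  interpret XA: simplicial_set "subspace X A" by (rule A(1))
  interpret Ps: map_subspace "\<Delta> 1 \<times>\<^sub>s C" "under G" paths by (rule paths_map_subspace)
  let ?C1 = "\<Delta> 1 \<times>\<^sub>s C" and ?P = "mspace (\<Delta> 1 \<times>\<^sub>s C) paths"
  interpret P: gspace G ?P \<rho> by (rule gspace_paths)
  define R where "R k x y \<longleftrightarrow> y \<in> paths k \<and> (\<forall>m. \<forall>s\<in>Simp (\<Delta> k) m. \<forall>c\<in>Simp C m.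
      y m (s, (replicate (Suc m) 0, c)) = \<psi> m (op X k s x, c))" for k x y
  let ?\<Psi>0 = "restr (subspace X A \<times>\<^sub>s ?C1) \<Psi>0"
  define v0 where "v0 = curry_at (subspace X A) ?C1 ?\<Psi>0"
  have opA: "op X k s x \<in> Simp X m" "A m (op X k s x)" if "s \<in> Simp (\<Delta> k) m" "x \<in> Simp X k" "A k x" for k s m x
    using XA.op_closed[OF that(1), of x] that by (simp_all add: op_subspace)
  have v0_app: "v0 k x m (s, (t, c)) = \<Psi>0 m (op X k s x, (t, c))"
    if "s \<in> Simp (\<Delta> k) m" "t \<in> Simp (\<Delta> 1) m" "c \<in> Simp C m" "x \<in> Simp X k" "A k x" for k x m s t c
    using curry_at_apply[OF that(1), of "(t, c)" ?C1 "subspace X A" ?\<Psi>0 x] that opA[OF that(1,4,5)]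
    by (simp add: v0_def op_subspace restr_apply)
  have v0_paths: "v0 k x \<in> paths k" if x: "x \<in> Simp X k" "A k x" for k x
    unfolding paths_def
  proof (intro CollectI conjI allI ballI)
    show "v0 k x \<in> smap (\<Delta> k \<times>\<^sub>s ?C1) (under G)"
      unfolding v0_def by (rule curry_at_smap[OF A(1) C1 \<Psi>0]) (use x in simp)
    fix m s c c' assume m: "s \<in> Simp (\<Delta> k) m" "c \<in> Simp C m" "c' \<in> Simp C m"
    show "v0 k x m (s, replicate (Suc m) 1, c) = v0 k x m (s, replicate (Suc m) 1, c')"
      using v0_app[OF m(1) zero_one_simplex(2) _ x] m(2,3) \<Psi>0_1[OF opA[OF m(1) x] m(2,3)] by simp
  qed
  have v0_smap: "restr (subspace X A) v0 \<in> smap (subspace X A) ?P"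
    unfolding v0_def by (rule Ps.curry_smap[OF A(1)]) (use v0_paths in \<open>simp add: v0_def\<close>)
  have \<psi>_act: "\<psi> n (\<alpha> n g x, \<kappa> n g c) = conj_action G n g (\<psi> n (x, c))"
    if "g \<in> carrier (Lev G n)" "x \<in> Simp X n" "c \<in> Simp C n" for n g x c
    using equivariantD[OF \<psi>(2) that(1), of "(x, c)"] that by simp
  have act_back: "\<kappa> n g (\<kappa> n (inv\<^bsub>Lev G n\<^esub> g) c) = c" if "g \<in> carrier (Lev G n)" "c \<in> Simp C n" for n g c
    using that by simp
  have lp: "lifting_problem G X \<alpha> ?P \<rho> R A v0"
  proof (intro lifting_problem.intro X P.gspace_axioms lifting_problem_axioms.intro)
    show "y \<in> Simp ?P n" if "R n x y" for n x y using that unfolding R_def by simp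
    show "R n (Face X (Suc n) i x) (Face ?P (Suc n) i y)" if x: "x \<in> Simp X (Suc n)" and R: "R (Suc n) x y" and i: "i \<le> Suc n" for n i x y
    proof -
      note mi = monotone_index_\<delta>[OF i]
      have "pre ?C1 n (\<delta> i) y m (s, (replicate (Suc m) 0, c)) = \<psi> m (op X n s (Face X (Suc n) i x), c)"
        if m: "s \<in> Simp (\<Delta> n) m" "c \<in> Simp C m" for m s c
        using R map_monotone_index[OF mi m(1)] m X.op_face[OF x i m(1)] unfolding R_def by (simp add: pre_apply)
      then show ?thesis using R Ps.pre_closed[OF _ mi] unfolding R_def by simp
    qed
    show "R (Suc n) (Degen X n i x) (Degen ?P n i y)" if x: "x \<in> Simp X n" and R: "R n x y" and i: "i \<le> n" for n i x y
    proof -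
      note mi = monotone_index_\<sigma>[OF i]
      have "pre ?C1 (Suc n) (\<sigma> i) y m (s, (replicate (Suc m) 0, c)) = \<psi> m (op X (Suc n) s (Degen X n i x), c)"
        if m: "s \<in> Simp (\<Delta> (Suc n)) m" "c \<in> Simp C m" for m s c
        using R map_monotone_index[OF mi m(1)] m X.op_degen[OF x i m(1)] unfolding R_def by (simp add: pre_apply)
      then show ?thesis using R Ps.pre_closed[OF _ mi] unfolding R_def by simp
    qed
    show "R n (\<alpha> n g x) (\<rho> n g y)" if x: "x \<in> Simp X n" and R: "R n x y" and g: "g \<in> carrier (Lev G n)" for n g x y
    proof -
      have "\<rho> n g y m (s, (replicate (Suc m) 0, c)) = \<psi> m (op X n s (\<alpha> n g x), c)"
        if m: "s \<in> Simp (\<Delta> n) m" "c \<in> Simp C m" for m s c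
      proof -
        let ?g = "op (under G) n s g"
        have g': "?g \<in> carrier (Lev G m)" by (rule op_hom(1)[OF m(1) g g])
        have "\<rho> n g y m (s, (replicate (Suc m) 0, c)) = conj_action G m ?g (\<psi> m (op X n s x, \<kappa> m (inv\<^bsub>Lev G m\<^esub> ?g) c))"
          using \<rho>_apply[OF m(1) zero_one_simplex(1) m(2), of g y] R m g' unfolding R_def by simp
        also have "\<dots> = \<psi> m (\<alpha> m ?g (op X n s x), c)"
          using \<psi>_act[OF g' X.op_closed[OF m(1) x], of "\<kappa> m (inv\<^bsub>Lev G m\<^esub> ?g) c"] g' m(2) by simp
        finally show ?thesis using X.op_act[OF m(1) g x] by simp
      qed
      then show ?thesis using R \<rho>_paths[OF g] unfolding R_def by simp
    qed
    have cx: "curry_at X C \<psi> n x \<in> smap (\<Delta> n \<times>\<^sub>s C) (under G)" if "x \<in> Simp X n" for n x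
      by (rule curry_at_smap[OF X.space C.simplicial_set_axioms \<psi>(1) that])
    show "\<exists>y. R 0 x y" if x: "x \<in> Simp X 0" for x
      using path_exists[OF cx[OF x]] unfolding R_def by (auto simp: curry_at_apply)
    show "\<exists>z. R (Suc n) x z \<and> (\<forall>i\<le>Suc n. Face ?P (Suc n) i z = y i)"
      if x: "x \<in> Simp X (Suc n)" and y: "\<And>i. i \<le> Suc n \<Longrightarrow> R n (Face X (Suc n) i x) (y i)"
        and compat: "\<And>i j. i < j \<Longrightarrow> j \<le> Suc n \<Longrightarrow> 0 < n \<Longrightarrow> Face ?P n i (y j) = Face ?P n (j - 1) (y i)" for n x y
    proof -
      have "\<exists>\<gamma>\<in>paths (Suc n). (\<forall>m. \<forall>s\<in>Simp (\<Delta> (Suc n)) m. \<forall>c\<in>Simp C m. \<gamma> m (s, (replicate (Suc m) 0, c)) = curry_at X C \<psi> (Suc n) x m (s, c)) \<and>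
        (\<forall>i\<le>Suc n. pre ?C1 n (\<delta> i) \<gamma> = y i)"
      proof (rule path_extends[OF cx[OF x]])
        show "y i \<in> paths n" if "i \<le> Suc n" for i using y[OF that] unfolding R_def by simp
        show "y i m (s, (replicate (Suc m) 0, c)) = curry_at X C \<psi> (Suc n) x m (map (\<delta> i) s, c)"
          if "i \<le> Suc n" "s \<in> Simp (\<Delta> n) m" "c \<in> Simp C m" for i m s c
          using y[OF that(1)] that X.op_face[OF x that(1,2)] map_monotone_index[OF monotone_index_\<delta>[OF that(1)] that(2)]
          unfolding R_def by (simp add: curry_at_apply)
        show "pre ?C1 (n - 1) (\<delta> i) (y j) = pre ?C1 (n - 1) (\<delta> (j - 1)) (y i)" if "i < j" "j \<le> Suc n" "0 < n" for i j
          using compat[OF that] by simp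
      qed
      then show ?thesis unfolding R_def by (auto simp: curry_at_apply)
    qed
    show "A n (Face X (Suc n) i x)" if "x \<in> Simp X (Suc n)" "A (Suc n) x" "i \<le> Suc n" for n i x
      using XA.face_closed[of x n i] that by simp
    show "A (Suc n) (Degen X n i x)" if "x \<in> Simp X n" "A n x" "i \<le> n" for n i x
      using XA.degen_closed[of x n i] that by simp
    show "A n (\<alpha> n g x)" if "x \<in> Simp X n" "A n x" "g \<in> carrier (Lev G n)" for n g x
      using A(2) that by simp
    show "R n x (v0 n x)" if x: "x \<in> Simp X n" "A n x" for n x
      using v0_paths[OF x] v0_app[OF _ zero_one_simplex(1) _ x] \<Psi>0_0[OF opA[OF _ x]] unfolding R_def by simp
    show "v0 n (Face X (Suc n) i x) = Face ?P (Suc n) i (v0 (Suc n) x)" if "x \<in> Simp X (Suc n)" "A (Suc n) x" "i \<le> Suc n" for n i x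
      using smap_face[OF v0_smap, of x n i] that XA.face_closed[of x n i] by (simp add: restr_apply)
    show "v0 (Suc n) (Degen X n i x) = Degen ?P n i (v0 n x)" if "x \<in> Simp X n" "A n x" "i \<le> n" for n i x
      using smap_degen[OF v0_smap, of x n i] that XA.degen_closed[of x n i] by (simp add: restr_apply)
    show "v0 n (\<alpha> n g x) = \<rho> n g (v0 n x)" if x: "x \<in> Simp X n" "A n x" and g: "g \<in> carrier (Lev G n)" for n g x
    proof (rule path_eqI[of _ n])
      have gx: "\<alpha> n g x \<in> Simp X n" "A n (\<alpha> n g x)" using x g A(2) by simp_all
      show "v0 n (\<alpha> n g x) \<in> paths n" "\<rho> n g (v0 n x) \<in> paths n" using v0_paths[OF gx] \<rho>_paths[OF g v0_paths[OF x]] .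
      fix m s t c assume m: "s \<in> Simp (\<Delta> n) m" "t \<in> Simp (\<Delta> 1) m" "c \<in> Simp C m"
      let ?g = "op (under G) n s g"
      have g': "?g \<in> carrier (Lev G m)" by (rule op_hom(1)[OF m(1) g g])
      have c': "\<kappa> m (inv\<^bsub>Lev G m\<^esub> ?g) c \<in> Simp C m" using g' m(3) by simp
      have "v0 n (\<alpha> n g x) m (s, t, c) = \<Psi>0 m (\<alpha> m ?g (op X n s x), (t, \<kappa> m ?g (\<kappa> m (inv\<^bsub>Lev G m\<^esub> ?g) c)))"
        using v0_app[OF m gx] X.op_act[OF m(1) g x(1)] act_back[OF g' m(3)] by simp
      also have "\<dots> = \<rho> n g (v0 n x) m (s, t, c)"
        using \<Psi>0_act[OF opA[OF m(1) x] m(2) c' g'] \<rho>_apply[OF m, of g "v0 n x"] v0_app[OF m(1,2) c' x] by simp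
      finally show "v0 n (\<alpha> n g x) m (s, t, c) = \<rho> n g (v0 n x) m (s, t, c)" .
    qed
  qed
  obtain v where v: "v \<in> smap X ?P" "equivariant G X \<alpha> \<rho> v"
    "\<And>n x. x \<in> Simp X n \<Longrightarrow> R n x (v n x)" "\<And>n x. x \<in> Simp X n \<Longrightarrow> A n x \<Longrightarrow> v n x = v0 n x"
    using lifting_problem.lift_exists[OF lp] by blast
  let ?\<Psi> = "Ps.uncurry X v"
  have app: "?\<Psi> n (x, (t, c)) = v n x n (\<iota> n, (t, c))" if "x \<in> Simp X n" "t \<in> Simp (\<Delta> 1) n" "c \<in> Simp C n" for n x t c
    unfolding Ps.uncurry_def using that by (subst restr_apply) auto
  show thesis
  proof (rule that[of ?\<Psi>])
    show "?\<Psi> \<in> smap (X \<times>\<^sub>s ?C1) (under G)" by (rule Ps.uncurry_smap[OF X.space v(1)])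
  next
    fix n x t c g assume a: "x \<in> Simp X n" "t \<in> Simp (\<Delta> 1) n" "c \<in> Simp C n" "g \<in> carrier (Lev G n)"
    have "v n (\<alpha> n g x) = \<rho> n g (v n x)" using equivariantD[OF v(2) a(4,1)] .
    then show "?\<Psi> n (\<alpha> n g x, (t, \<kappa> n g c)) = conj_action G n g (?\<Psi> n (x, (t, c)))"
      using app[of "\<alpha> n g x" n t "\<kappa> n g c"] app[OF a(1-3)] a \<rho>_apply[OF \<iota>_simplex a(2), of "\<kappa> n g c" g "v n x"] by simp
  next
    fix n x c assume a: "x \<in> Simp X n" "c \<in> Simp C n"
    show "?\<Psi> n (x, (replicate (Suc n) 0, c)) = \<psi> n (x, c)"
      using app[OF a(1) zero_one_simplex(1) a(2)] v(3)[OF a(1)] a(2) \<iota>_simplex[of n] unfolding R_def by fastforce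
  next
    fix n x c c' assume a: "x \<in> Simp X n" "c \<in> Simp C n" "c' \<in> Simp C n"
    have "v n x \<in> paths n" using v(3)[OF a(1)] unfolding R_def by simp
    then show "?\<Psi> n (x, (replicate (Suc n) 1, c)) = ?\<Psi> n (x, (replicate (Suc n) 1, c'))"
      using app[OF a(1) zero_one_simplex(2)] a(2,3) paths_end[of "v n x" n "\<iota> n" n c c'] by simp
  next
    fix n x t c assume a: "x \<in> Simp X n" "A n x" "t \<in> Simp (\<Delta> 1) n" "c \<in> Simp C n"
    show "?\<Psi> n (x, (t, c)) = \<Psi>0 n (x, (t, c))"
      using app[OF a(1,3,4)] v(4)[OF a(1,2)] v0_app[OF \<iota>_simplex a(3,4,1,2)] by simp
  qed
qed

end

section \<open>Multiplying a free space by a contractible one\<close>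

definition eq_maps :: "'g sgroup \<Rightarrow> 'a sset \<Rightarrow> (nat \<Rightarrow> 'g \<Rightarrow> 'a \<Rightarrow> 'a) \<Rightarrow> nat \<Rightarrow> (nat \<Rightarrow> nat list \<times> 'a \<Rightarrow> 'g) set" where
  "eq_maps G X \<alpha> n = {\<phi> \<in> smap (\<Delta> n \<times>\<^sub>s X) (under G).
     \<forall>m. \<forall>g\<in>carrier (Lev G m). \<forall>s\<in>Simp (\<Delta> n) m. \<forall>x\<in>Simp X m.
       \<phi> m (s, \<alpha> m g x) = conj_action G m g (\<phi> m (s, x))}"

lemma equivariant_mapping_space_eq:
  "equivariant_mapping_space G X \<alpha> (under G) (conj_action G) = mspace X (eq_maps G X \<alpha>)"
  by (simp add: equivariant_mapping_space_def mspace_def eq_maps_def[abs_def])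

lemma eq_mapsD:
  assumes "\<phi> \<in> eq_maps G X \<alpha> n"
  shows eq_maps_smap: "\<phi> \<in> smap (\<Delta> n \<times>\<^sub>s X) (under G)"
    and eq_maps_act: "g \<in> carrier (Lev G m) \<Longrightarrow> s \<in> Simp (\<Delta> n) m \<Longrightarrow> x \<in> Simp X m \<Longrightarrow>
      \<phi> m (s, \<alpha> m g x) = conj_action G m g (\<phi> m (s, x))"
  using assms unfolding eq_maps_def by blast+

lemma eq_maps_map_subspace:
  assumes "gspace G X \<alpha>"
  shows "map_subspace X (under G) (eq_maps G X \<alpha>)"
proof -
  interpret X: gspace G X \<alpha> by fact
  show ?thesis
  proof (intro map_subspace.intro X.space X.G.under_simplicial)
    fix n n' u \<phi> assume \<phi>: "\<phi> \<in> eq_maps G X \<alpha> n" and u: "monotone_index n' n u"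
    show "pre X n' u \<phi> \<in> eq_maps G X \<alpha> n'"
      unfolding eq_maps_def
      using pre_smap[OF X.space u eq_maps_smap[OF \<phi>]] eq_maps_act[OF \<phi> _ map_monotone_index[OF u]]
      by (simp add: pre_apply)
  qed (rule eq_maps_smap)
qed

lemma curry_at_eq_maps:
  assumes X: "gspace G X \<alpha>" and Z: "simplicial_set Z" and \<psi>: "\<psi> \<in> smap (Z \<times>\<^sub>s X) (under G)"
    and act: "\<And>n g z x. g \<in> carrier (Lev G n) \<Longrightarrow> z \<in> Simp Z n \<Longrightarrow> x \<in> Simp X n \<Longrightarrow>
      \<psi> n (z, \<alpha> n g x) = conj_action G n g (\<psi> n (z, x))"
    and z: "z \<in> Simp Z n"
  shows "curry_at Z X \<psi> n z \<in> eq_maps G X \<alpha> n"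
proof -
  interpret X: gspace G X \<alpha> by fact
  show ?thesis
    unfolding eq_maps_def
    using curry_at_smap[OF Z X.space \<psi> z] act simplicial_set.op_closed[OF Z _ z] by (simp add: curry_at_apply)
qed

lemma (in map_subspace) op_eval:
  assumes "\<phi> \<in> S n" "s \<in> Simp (\<Delta> n) m" "x \<in> Simp X m"
  shows "op (mspace X S) n s \<phi> m (\<iota> m, x) = \<phi> m (s, x)"
proof -
  have "map ((!) s) (\<iota> m) = s" using assms(2) map_nth_\<iota>[of s m] by (simp add: std_simplex_simps)
  then show ?thesis using op_mspace[OF assms(1,2)] assms(3) by (simp add: pre_apply)
qed

lemma (in map_subspace) eval_simps:
  assumes "\<phi> \<in> S m" "x \<in> Simp X m"
  shows "\<phi> m (\<iota> m, x) \<in> Simp Y m"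
proof -
  have "(\<iota> m, x) \<in> Simp (\<Delta> m \<times>\<^sub>s X) m" using assms(2) by simp
  then show ?thesis using smap_closed[OF smap[OF assms(1)]] by blast
qed

lemma (in map_subspace) eval_smap:
  "restr (mspace X S \<times>\<^sub>s X) (\<lambda>m z. fst z m (\<iota> m, snd z)) \<in> smap (mspace X S \<times>\<^sub>s X) Y"
proof -
  have "uncurry (mspace X S) (sid (mspace X S)) \<in> smap (mspace X S \<times>\<^sub>s X) Y"
    by (rule uncurry_smap[OF simplicial_set_mspace sid_smap[OF simplicial_set_mspace]])
  moreover have "uncurry (mspace X S) (sid (mspace X S)) = restr (mspace X S \<times>\<^sub>s X) (\<lambda>m z. fst z m (\<iota> m, snd z))"
    by (auto simp: uncurry_def restr_def fun_eq_iff sid_def)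
  ultimately show ?thesis by simp
qed

lemma (in map_subspace) eval_face:
  assumes "\<phi> \<in> S (Suc m)" "x \<in> Simp X (Suc m)" "i \<le> Suc m"
  shows "pre X m (\<delta> i) \<phi> m (\<iota> m, Face X (Suc m) i x) = Face Y (Suc m) i (\<phi> (Suc m) (\<iota> (Suc m), x))"
  using smap_face[OF eval_smap, of "(\<phi>, x)" m i] assms pre_closed[OF assms(1) monotone_index_\<delta>[OF assms(3)]]
    simplicial_set.face_closed[OF domain assms(2,3)] by (simp add: restr_apply)

lemma (in map_subspace) eval_degen:
  assumes "\<phi> \<in> S m" "x \<in> Simp X m" "i \<le> m"
  shows "pre X (Suc m) (\<sigma> i) \<phi> (Suc m) (\<iota> (Suc m), Degen X m i x) = Degen Y m i (\<phi> m (\<iota> m, x))"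
  using smap_degen[OF eval_smap, of "(\<phi>, x)" m i] assms pre_closed[OF assms(1) monotone_index_\<sigma>[OF assms(3)]]
    simplicial_set.degen_closed[OF domain assms(2,3)] by (simp add: restr_apply)

context contractible_gspace
begin

text \<open>
  Precomposition with the projection \<open>X \<times> C \<rightarrow> X\<close> is the equivalence. For its inverse, the evaluation
  \<open>B \<times> X \<times> C \<rightarrow> G\<close>, where \<open>B\<close> is the space of equivariant maps on the right, is deformed to a map that does
  not depend on \<open>C\<close>; treating all of \<open>B\<close> at once makes the inverse simplicial.
\<close>

theorem mapping_space_times_contractible:
  fixes X :: "'x sset"
  assumes X: "free_gspace G X \<alpha>"
  shows "mspace X (eq_maps G X \<alpha>) \<simeq>\<^sub>s mspace (X \<times>\<^sub>s C) (eq_maps G (X \<times>\<^sub>s C) (prod_action \<alpha> \<kappa>))"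
proof -
  interpret X: free_gspace G X \<alpha> by (rule X)
  let ?XC = "X \<times>\<^sub>s C" and ?S = "eq_maps G X \<alpha>" and ?T = "eq_maps G (X \<times>\<^sub>s C) (prod_action \<alpha> \<kappa>)"
  let ?A = "mspace X ?S" and ?B = "mspace ?XC ?T"
  have XC: "gspace G ?XC (prod_action \<alpha> \<kappa>)" by (rule gspace_prod[OF X.gspace_axioms K.gspace_axioms])
  interpret S: map_subspace X "under G" ?S by (rule eq_maps_map_subspace[OF X.gspace_axioms])
  interpret T: map_subspace ?XC "under G" ?T by (rule eq_maps_map_subspace[OF XC])
  have A: "simplicial_set ?A" by (rule S.simplicial_set_mspace)
  have B: "simplicial_set ?B" by (rule T.simplicial_set_mspace)
  interpret A: simplicial_set ?A by (rule A)
  interpret B: simplicial_set ?B by (rule B)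
  note Cs = C.simplicial_set_axioms
  have XCs: "simplicial_set ?XC" by (rule simplicial_set_prod[OF X.space Cs])
  have opA: "op ?A n s a \<in> ?S m" if "a \<in> ?S n" "s \<in> Simp (\<Delta> n) m" for a n s m using A.op_closed[OF that(2), of a] that by simp
  have opB: "op ?B n s b \<in> ?T m" if "b \<in> ?T n" "s \<in> Simp (\<Delta> n) m" for b n s m using B.op_closed[OF that(2), of b] that by simp
  have Sc: "a m (\<iota> m, x) \<in> carrier (Lev G m)" if "a \<in> ?S m" "x \<in> Simp X m" for a m x
    using S.eval_simps[OF that] by simp
  have Tc: "b m (\<iota> m, (x, c)) \<in> carrier (Lev G m)" if "b \<in> ?T m" "x \<in> Simp X m" "c \<in> Simp C m" for b m x c
    using T.eval_simps[OF that(1), of "(x, c)"] that by simp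
  have Sf: "pre X m (\<delta> i) a m (\<iota> m, Face X (Suc m) i x) = GFace G (Suc m) i (a (Suc m) (\<iota> (Suc m), x))"
    if "a \<in> ?S (Suc m)" "x \<in> Simp X (Suc m)" "i \<le> Suc m" for a m x i using S.eval_face[OF that] by simp
  have Sd: "pre X (Suc m) (\<sigma> i) a (Suc m) (\<iota> (Suc m), Degen X m i x) = GDegen G m i (a m (\<iota> m, x))"
    if "a \<in> ?S m" "x \<in> Simp X m" "i \<le> m" for a m x i using S.eval_degen[OF that] by simp
  have Tf: "pre ?XC m (\<delta> i) b m (\<iota> m, (Face X (Suc m) i x, Face C (Suc m) i c)) = GFace G (Suc m) i (b (Suc m) (\<iota> (Suc m), (x, c)))"
    if "b \<in> ?T (Suc m)" "x \<in> Simp X (Suc m)" "c \<in> Simp C (Suc m)" "i \<le> Suc m" for b m x c i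
    using T.eval_face[OF that(1) _ that(4), of "(x, c)"] that by simp
  have Td: "pre ?XC (Suc m) (\<sigma> i) b (Suc m) (\<iota> (Suc m), (Degen X m i x, Degen C m i c)) = GDegen G m i (b m (\<iota> m, (x, c)))"
    if "b \<in> ?T m" "x \<in> Simp X m" "c \<in> Simp C m" "i \<le> m" for b m x c i
    using T.eval_degen[OF that(1) _ that(4), of "(x, c)"] that by simp
  have Sa: "a m (\<iota> m, \<alpha> m g x) = conj_action G m g (a m (\<iota> m, x))"
    if "a \<in> ?S m" "x \<in> Simp X m" "g \<in> carrier (Lev G m)" for a m x g
    using eq_maps_act[OF that(1,3) \<iota>_simplex that(2)] .
  have Ta: "b m (\<iota> m, (\<alpha> m g x, \<kappa> m g c)) = conj_action G m g (b m (\<iota> m, (x, c)))"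
    if "b \<in> ?T m" "x \<in> Simp X m" "c \<in> Simp C m" "g \<in> carrier (Lev G m)" for b m x c g
    using eq_maps_act[OF that(1,4) \<iota>_simplex, of "(x, c)"] that by simp
  \<comment> \<open>\<open>f\<close> is precomposition with the projection.\<close>
  define \<phi> where "\<phi> = restr (?A \<times>\<^sub>s ?XC) (\<lambda>m z. fst z m (\<iota> m, fst (snd z)))"
  have \<phi>: "\<phi> \<in> smap (?A \<times>\<^sub>s ?XC) (under G)" unfolding \<phi>_def
    by (rule restr_prod_smap[OF A XCs]) (auto simp: Sc Sf Sd)
  have \<phi>_app: "\<phi> m (a, (x, c)) = a m (\<iota> m, x)" if "a \<in> ?S m" "x \<in> Simp X m" "c \<in> Simp C m" for a m x c
    unfolding \<phi>_def using that by (subst restr_apply) auto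
  define f where "f = restr ?A (curry_at ?A ?XC \<phi>)"
  have f_T: "curry_at ?A ?XC \<phi> n a \<in> ?T n" if "a \<in> Simp ?A n" for n a
    by (rule curry_at_eq_maps[OF XC A \<phi> _ that]) (auto simp: \<phi>_app Sa)
  have f: "f \<in> smap ?A ?B" unfolding f_def by (rule T.curry_smap[OF A f_T])
  have f_app: "f n a m (s, (x, c)) = a m (s, x)"
    if "a \<in> ?S n" "s \<in> Simp (\<Delta> n) m" "x \<in> Simp X m" "c \<in> Simp C m" for n a m s x c
    using curry_at_apply[OF that(2), of "(x, c)" ?XC ?A \<phi> a] that \<phi>_app[OF opA[OF that(1,2)]] S.op_eval[OF that(1-3)]
    by (simp add: f_def restr_apply)
  \<comment> \<open>An equivariant homotopy from evaluation to a map independent of \<open>C\<close> gives the inverse \<open>g\<close>.\<close>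
  let ?BX = "?B \<times>\<^sub>s X"
  have BX: "free_gspace G ?BX (prod_action trivial_action \<alpha>)"
    by (rule free_gspace_prod[OF gspace_trivial[OF simplicial_group_axioms B] X])
  have BXs: "simplicial_set ?BX" by (rule simplicial_set_prod[OF B X.space])
  define \<psi> where "\<psi> = restr (?BX \<times>\<^sub>s C) (\<lambda>m z. fst (fst z) m (\<iota> m, (snd (fst z), snd z)))"
  have \<psi>: "\<psi> \<in> smap (?BX \<times>\<^sub>s C) (under G)" unfolding \<psi>_def
    by (rule restr_prod_smap[OF BXs Cs]) (auto simp: Tc Tf Td)
  have \<psi>_app: "\<psi> m ((b, x), c) = b m (\<iota> m, (x, c))" if "b \<in> ?T m" "x \<in> Simp X m" "c \<in> Simp C m" for b m x c
    unfolding \<psi>_def using that by (subst restr_apply) auto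
  have \<psi>_eq: "equivariant G (?BX \<times>\<^sub>s C) (prod_action (prod_action trivial_action \<alpha>) \<kappa>) (conj_action G) \<psi>"
    unfolding equivariant_def by (auto simp: \<psi>_app Ta)
  obtain \<Psi> where \<Psi>: "\<Psi> \<in> smap (?BX \<times>\<^sub>s (\<Delta> 1 \<times>\<^sub>s C)) (under G)"
    "\<And>n x t c g. x \<in> Simp ?BX n \<Longrightarrow> t \<in> Simp (\<Delta> 1) n \<Longrightarrow> c \<in> Simp C n \<Longrightarrow> g \<in> carrier (Lev G n) \<Longrightarrow>
      \<Psi> n (prod_action trivial_action \<alpha> n g x, (t, \<kappa> n g c)) = conj_action G n g (\<Psi> n (x, (t, c)))"
    "\<And>n x c. x \<in> Simp ?BX n \<Longrightarrow> c \<in> Simp C n \<Longrightarrow> \<Psi> n (x, (replicate (Suc n) 0, c)) = \<psi> n (x, c)"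
    "\<And>n x c c'. x \<in> Simp ?BX n \<Longrightarrow> c \<in> Simp C n \<Longrightarrow> c' \<in> Simp C n \<Longrightarrow>
      \<Psi> n (x, (replicate (Suc n) 1, c)) = \<Psi> n (x, (replicate (Suc n) 1, c'))"
  proof -
    have none: "simplicial_set (subspace ?BX (\<lambda>n x. False))" by standard auto
    have none_smap: "restr (subspace ?BX (\<lambda>n x. False) \<times>\<^sub>s (\<Delta> 1 \<times>\<^sub>s C)) (\<lambda>n x. \<one>\<^bsub>Lev G n\<^esub>)
        \<in> smap (subspace ?BX (\<lambda>n x. False) \<times>\<^sub>s (\<Delta> 1 \<times>\<^sub>s C)) (under G)"
      by (rule restr_prod_smap[OF none C1]) auto
    show thesis
    proof (rule equivariant_path_extension[OF BX \<psi> \<psi>_eq none _ none_smap], goal_cases)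
      case (5 \<Psi>)
      show ?case by (rule that[OF 5(1-4)])
    qed simp_all
  qed
  have \<Psi>c: "\<Psi> n ((b, x), (t, c)) \<in> carrier (Lev G n)" if "b \<in> ?T n" "x \<in> Simp X n" "t \<in> Simp (\<Delta> 1) n" "c \<in> Simp C n" for n b x t c
    using smap_carrier[OF \<Psi>(1), of "((b, x), (t, c))" n] that by simp
  have \<Psi>f: "\<Psi> m ((pre ?XC m (\<delta> i) b, Face X (Suc m) i x), (omit i t, Face C (Suc m) i c)) = GFace G (Suc m) i (\<Psi> (Suc m) ((b, x), (t, c)))"
    if "b \<in> ?T (Suc m)" "x \<in> Simp X (Suc m)" "t \<in> Simp (\<Delta> 1) (Suc m)" "c \<in> Simp C (Suc m)" "i \<le> Suc m" for m b x t c i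
    using smap_face[OF \<Psi>(1), of "((b, x), (t, c))" m i] that by simp
  have \<Psi>d: "\<Psi> (Suc m) ((pre ?XC (Suc m) (\<sigma> i) b, Degen X m i x), (dup i t, Degen C m i c)) = GDegen G m i (\<Psi> m ((b, x), (t, c)))"
    if "b \<in> ?T m" "x \<in> Simp X m" "t \<in> Simp (\<Delta> 1) m" "c \<in> Simp C m" "i \<le> m" for m b x t c i
    using smap_degen[OF \<Psi>(1), of "((b, x), (t, c))" m i] that by simp
  have \<Psi>a: "\<Psi> n ((b, \<alpha> n g x), (t, \<kappa> n g c)) = conj_action G n g (\<Psi> n ((b, x), (t, c)))"
    if "b \<in> ?T n" "x \<in> Simp X n" "t \<in> Simp (\<Delta> 1) n" "c \<in> Simp C n" "g \<in> carrier (Lev G n)" for n b x t c g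
    using \<Psi>(2)[of "(b, x)" n t c g] that by simp
  have \<Psi>0: "\<Psi> n ((b, x), (replicate (Suc n) 0, c)) = b n (\<iota> n, (x, c))"
    if "b \<in> ?T n" "x \<in> Simp X n" "c \<in> Simp C n" for n b x c
    using \<Psi>(3)[of "(b, x)" n c] that \<psi>_app[OF that] by simp
  have \<Psi>1: "\<Psi> n ((b, x), (replicate (Suc n) 1, c)) = \<Psi> n ((b, x), (replicate (Suc n) 1, c'))"
    if "b \<in> ?T n" "x \<in> Simp X n" "c \<in> Simp C n" "c' \<in> Simp C n" for n b x c c'
    using \<Psi>(4)[of "(b, x)" n c c'] that by simp
  have \<Psi>1a: "\<Psi> n ((b, \<alpha> n g x), (replicate (Suc n) 1, base n)) = conj_action G n g (\<Psi> n ((b, x), (replicate (Suc n) 1, base n)))"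
    if "b \<in> ?T n" "x \<in> Simp X n" "g \<in> carrier (Lev G n)" for n b x g
    using \<Psi>a[OF that(1,2) zero_one_simplex(2) base_simps(1) that(3)] \<Psi>1[OF that(1), of "\<alpha> n g x" "base n" "\<kappa> n g (base n)"] that by simp
  have \<Psi>1f: "\<Psi> m ((pre ?XC m (\<delta> i) b, Face X (Suc m) i x), (replicate (Suc m) 1, base m)) = GFace G (Suc m) i (\<Psi> (Suc m) ((b, x), (replicate (Suc (Suc m)) 1, base (Suc m))))"
    if "b \<in> ?T (Suc m)" "x \<in> Simp X (Suc m)" "i \<le> Suc m" for m b x i
    using \<Psi>f[OF that(1,2) zero_one_simplex(2) base_simps(1) that(3)] that(3) omit_replicate[OF that(3), of "1::nat"] by simp
  have \<Psi>1d: "\<Psi> (Suc m) ((pre ?XC (Suc m) (\<sigma> i) b, Degen X m i x), (replicate (Suc (Suc m)) 1, base (Suc m))) = GDegen G m i (\<Psi> m ((b, x), (replicate (Suc m) 1, base m)))"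
    if "b \<in> ?T m" "x \<in> Simp X m" "i \<le> m" for m b x i
    using \<Psi>d[OF that(1,2) zero_one_simplex(2) base_simps(1) that(3)] that(3) dup_replicate[OF that(3), of "1::nat"] by simp
  define \<theta> where "\<theta> = restr ?BX (\<lambda>m z. \<Psi> m (z, (replicate (Suc m) 1, base m)))"
  have \<theta>: "\<theta> \<in> smap ?BX (under G)" unfolding \<theta>_def
    by (rule restr_prod_smap[OF B X.space]) (auto simp: \<Psi>c \<Psi>1f \<Psi>1d simp del: One_nat_def)
  have \<theta>_app: "\<theta> m (b, x) = \<Psi> m ((b, x), (replicate (Suc m) 1, base m))" if "b \<in> ?T m" "x \<in> Simp X m" for b m x
    unfolding \<theta>_def using that by (subst restr_apply) auto
  define g where "g = restr ?B (curry_at ?B X \<theta>)"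
  have g_S: "curry_at ?B X \<theta> n b \<in> ?S n" if "b \<in> Simp ?B n" for n b
    by (rule curry_at_eq_maps[OF X.gspace_axioms B \<theta> _ that]) (auto simp: \<theta>_app \<Psi>1a simp del: One_nat_def)
  have g: "g \<in> smap ?B ?A" unfolding g_def by (rule S.curry_smap[OF B g_S])
  have g_app: "g n b m (s, x) = \<Psi> m ((op ?B n s b, x), (replicate (Suc m) 1, base m))"
    if "b \<in> ?T n" "s \<in> Simp (\<Delta> n) m" "x \<in> Simp X m" for n b m s x
    using curry_at_apply[OF that(2,3), of ?B \<theta> b] that \<theta>_app[OF opB[OF that(1,2)] that(3)]
    by (simp add: g_def restr_apply)
  have fS: "f n a \<in> ?T n" if "a \<in> ?S n" for n a using smap_closed[OF f, of a n] that by simp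
  have gT: "g n b \<in> ?S n" if "b \<in> ?T n" for n b using smap_closed[OF g, of b n] that by simp
  have fg: "scomp ?B f g \<in> smap ?B ?B" by (rule scomp_smap[OF B g f])
  have gf: "scomp ?A g f \<in> smap ?A ?A" by (rule scomp_smap[OF A f g])
  have "homotopic_maps ?B ?B (sid ?B) (scomp ?B f g)"
  proof (rule elementary_homotopic_imp_homotopic_maps[OF sid_smap[OF B] fg])
    let ?Z = "\<Delta> 1 \<times>\<^sub>s ?B"
    have Z: "simplicial_set ?Z" by (rule simplicial_set_prod[OF simplicial_set_std_simplex B])
    define \<chi> where "\<chi> = restr (?Z \<times>\<^sub>s ?XC) (\<lambda>m z. \<Psi> m ((snd (fst z), fst (snd z)), (fst (fst z), snd (snd z))))"
    have \<chi>: "\<chi> \<in> smap (?Z \<times>\<^sub>s ?XC) (under G)" unfolding \<chi>_def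
      by (rule restr_prod_smap[OF Z XCs]) (auto simp: \<Psi>c \<Psi>f \<Psi>d simp del: One_nat_def)
    have \<chi>_app: "\<chi> m ((t, b), (x, c)) = \<Psi> m ((b, x), (t, c))"
      if "t \<in> Simp (\<Delta> 1) m" "b \<in> ?T m" "x \<in> Simp X m" "c \<in> Simp C m" for m t b x c
      unfolding \<chi>_def using that by (subst restr_apply) auto
    show "elementary_homotopic ?B ?B (sid ?B) (scomp ?B f g)"
    proof (rule T.elementary_homotopic_curry[OF B, of \<chi>])
      show "curry_at ?Z ?XC \<chi> n (t, b) \<in> ?T n" if "t \<in> Simp (\<Delta> 1) n" "b \<in> Simp ?B n" for n t b
        by (rule curry_at_eq_maps[OF XC Z \<chi>]) (use that in \<open>auto simp: \<chi>_app \<Psi>a simp del: One_nat_def\<close>)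
    next
      fix n b m s xc assume b: "b \<in> Simp ?B n" and s: "s \<in> Simp (\<Delta> n) m" and xc: "xc \<in> Simp ?XC m"
      obtain x c where x: "xc = (x, c)" "x \<in> Simp X m" "c \<in> Simp C m" using xc by auto
      have b': "b \<in> ?T n" using b by simp
      note ob = opB[OF b' s]
      show "\<chi> m ((replicate (Suc m) 0, op ?B n s b), xc) = sid ?B n b m (s, xc)"
        using \<chi>_app[OF zero_one_simplex(1) ob x(2,3)] \<Psi>0[OF ob x(2,3)] T.op_eval[OF b' s xc] x(1) b by (simp add: sid_apply)
      have "scomp ?B f g n b m (s, xc) = g n b m (s, x)"
        using scomp_apply[OF b, of f g] f_app[OF gT[OF b'] s x(2,3)] x(1) by simp
      then show "\<chi> m ((replicate (Suc m) 1, op ?B n s b), xc) = scomp ?B f g n b m (s, xc)"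
        using \<chi>_app[OF zero_one_simplex(2) ob x(2,3)] g_app[OF b' s x(2)] \<Psi>1[OF ob x(2,3) base_simps(1)] x(1) by simp
    qed (rule sid_smap[OF B] fg)+
  qed
  \<comment> \<open>The homotopy from \<open>g \<circ> f\<close> to the identity extends, over \<open>\<Delta> 1 \<times> ?A \<times> X\<close>, the homotopy just used
    (restricted along \<open>f\<close>) at \<open>0\<close> and the constant one at \<open>1\<close>.\<close>
  moreover have "homotopic_maps ?A ?A (scomp ?A g f) (sid ?A)"
  proof (rule elementary_homotopic_imp_homotopic_maps[OF gf sid_smap[OF A]])
    let ?AX = "?A \<times>\<^sub>s X" let ?W = "\<Delta> 1 \<times>\<^sub>s ?AX"
    let ?w = "prod_action trivial_action (prod_action trivial_action \<alpha>)"
    have AX: "free_gspace G ?AX (prod_action trivial_action \<alpha>)"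
      by (rule free_gspace_prod[OF gspace_trivial[OF simplicial_group_axioms A] X])
    have W: "free_gspace G ?W ?w"
      by (rule free_gspace_prod[OF gspace_trivial[OF simplicial_group_axioms simplicial_set_std_simplex] AX])
    have AXs: "simplicial_set ?AX" by (rule simplicial_set_prod[OF A X.space])
    have Ws: "simplicial_set ?W" by (rule simplicial_set_prod[OF simplicial_set_std_simplex AXs])
    define \<psi>' where "\<psi>' = restr (?W \<times>\<^sub>s C) (\<lambda>m z. fst (snd (fst z)) m (\<iota> m, snd (snd (fst z))))"
    have \<psi>': "\<psi>' \<in> smap (?W \<times>\<^sub>s C) (under G)" unfolding \<psi>'_def
      by (rule restr_prod_smap[OF Ws Cs]) (auto simp: Sc Sf Sd)
    have \<psi>'_app: "\<psi>' m ((r, (a, x)), c) = a m (\<iota> m, x)"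
      if "r \<in> Simp (\<Delta> 1) m" "a \<in> ?S m" "x \<in> Simp X m" "c \<in> Simp C m" for r a m x c
      unfolding \<psi>'_def using that by (subst restr_apply) auto
    have \<psi>'_eq: "equivariant G (?W \<times>\<^sub>s C) (prod_action ?w \<kappa>) (conj_action G) \<psi>'"
      unfolding equivariant_def by (auto simp: \<psi>'_app Sa simp del: One_nat_def)
    define E where "E m w \<longleftrightarrow> fst w = replicate (Suc m) 0 \<or> fst w = replicate (Suc m) 1"
      for m and w :: "nat list \<times> (nat \<Rightarrow> nat list \<times> 'x \<Rightarrow> 'a) \<times> 'x"
    have E_face: "E m (Face ?W (Suc m) i w)" if "E (Suc m) w" "i \<le> Suc m" for m w i
      using that unfolding E_def by (cases w) (auto simp: omit_replicate simp del: One_nat_def)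
    have E_degen: "E (Suc m) (Degen ?W m i w)" if "E m w" "i \<le> m" for m w i
      using that unfolding E_def by (cases w) (auto simp: dup_replicate simp del: One_nat_def)
    have Es: "simplicial_set (subspace ?W E)"
      by (rule simplicial_set.simplicial_set_subspace[OF Ws]) (use E_face E_degen in auto)
    define \<Omega>0 where "\<Omega>0 m z = (if fst (fst z) = replicate (Suc m) 0 then \<Psi> m ((f m (fst (snd (fst z))), snd (snd (fst z))), snd z)
        else fst (snd (fst z)) m (\<iota> m, snd (snd (fst z))))"
      for m and z :: "(nat list \<times> (nat \<Rightarrow> nat list \<times> 'x \<Rightarrow> 'a) \<times> 'x) \<times> nat list \<times> 'b"
    have ne: "replicate (Suc m) (1::nat) \<noteq> replicate (Suc m) 0" for m by (simp add: replicate_Suc)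
    have f_face: "f m (pre X m (\<delta> i) a) = pre ?XC m (\<delta> i) (f (Suc m) a)" if "a \<in> ?S (Suc m)" "i \<le> Suc m" for m a i
      using smap_face[OF f, of a m i] that by simp
    have f_degen: "f (Suc m) (pre X (Suc m) (\<sigma> i) a) = pre ?XC (Suc m) (\<sigma> i) (f m a)" if "a \<in> ?S m" "i \<le> m" for m a i
      using smap_degen[OF f, of a m i] that by simp
    have \<Omega>0_0: "\<Omega>0 m ((replicate (Suc m) 0, (a, x)), tc) = \<Psi> m ((f m a, x), tc)"
      and \<Omega>0_1: "\<Omega>0 m ((replicate (Suc m) 1, (a, x)), tc) = a m (\<iota> m, x)" for m a x tc
      using ne[of m] by (simp_all add: \<Omega>0_def del: One_nat_def)
    have \<Omega>0s: "restr (subspace ?W E \<times>\<^sub>s (\<Delta> 1 \<times>\<^sub>s C)) \<Omega>0 \<in> smap (subspace ?W E \<times>\<^sub>s (\<Delta> 1 \<times>\<^sub>s C)) (under G)"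
    proof (rule restr_prod_smap[OF Es C1])
      fix m i w tc
      show "\<Omega>0 m (w, tc) \<in> Simp (under G) m" if "w \<in> Simp (subspace ?W E) m" "tc \<in> Simp (\<Delta> 1 \<times>\<^sub>s C) m"
        using that by (auto simp: E_def \<Omega>0_0 \<Omega>0_1 \<Psi>c fS Sc simp del: One_nat_def)
      show "\<Omega>0 m (Face (subspace ?W E) (Suc m) i w, Face (\<Delta> 1 \<times>\<^sub>s C) (Suc m) i tc) = Face (under G) (Suc m) i (\<Omega>0 (Suc m) (w, tc))"
        if "w \<in> Simp (subspace ?W E) (Suc m)" "tc \<in> Simp (\<Delta> 1 \<times>\<^sub>s C) (Suc m)" "i \<le> Suc m"
        using that by (auto simp: E_def omit_replicate \<Omega>0_0 \<Omega>0_1 \<Psi>f f_face fS Sf simp del: One_nat_def)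
      show "\<Omega>0 (Suc m) (Degen (subspace ?W E) m i w, Degen (\<Delta> 1 \<times>\<^sub>s C) m i tc) = Degen (under G) m i (\<Omega>0 m (w, tc))"
        if "w \<in> Simp (subspace ?W E) m" "tc \<in> Simp (\<Delta> 1 \<times>\<^sub>s C) m" "i \<le> m"
        using that by (auto simp: E_def dup_replicate \<Omega>0_0 \<Omega>0_1 \<Psi>d f_degen fS Sd simp del: One_nat_def)
    qed
    have fev: "f m a m (\<iota> m, (x, c)) = a m (\<iota> m, x)" if "a \<in> ?S m" "x \<in> Simp X m" "c \<in> Simp C m" for m a x c
      using f_app[OF that(1) \<iota>_simplex that(2,3)] .
    obtain \<Omega> where \<Omega>: "\<Omega> \<in> smap (?W \<times>\<^sub>s (\<Delta> 1 \<times>\<^sub>s C)) (under G)"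
      "\<And>n x t c g. x \<in> Simp ?W n \<Longrightarrow> t \<in> Simp (\<Delta> 1) n \<Longrightarrow> c \<in> Simp C n \<Longrightarrow> g \<in> carrier (Lev G n) \<Longrightarrow>
        \<Omega> n (?w n g x, (t, \<kappa> n g c)) = conj_action G n g (\<Omega> n (x, (t, c)))"
      "\<And>n x c c'. x \<in> Simp ?W n \<Longrightarrow> c \<in> Simp C n \<Longrightarrow> c' \<in> Simp C n \<Longrightarrow>
        \<Omega> n (x, (replicate (Suc n) 1, c)) = \<Omega> n (x, (replicate (Suc n) 1, c'))"
      "\<And>n x t c. x \<in> Simp ?W n \<Longrightarrow> E n x \<Longrightarrow> t \<in> Simp (\<Delta> 1) n \<Longrightarrow> c \<in> Simp C n \<Longrightarrow> \<Omega> n (x, (t, c)) = \<Omega>0 n (x, (t, c))"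
    proof (rule equivariant_path_extension[OF W \<psi>' \<psi>'_eq Es _ \<Omega>0s])
      show "E n (?w n g x)" if "x \<in> Simp ?W n" "E n x" "g \<in> carrier (Lev G n)" for n g x
        using that unfolding E_def by (cases x) auto
      show "\<Omega>0 n (?w n g x, (t, \<kappa> n g c)) = conj_action G n g (\<Omega>0 n (x, (t, c)))"
        if "x \<in> Simp ?W n" "E n x" "t \<in> Simp (\<Delta> 1) n" "c \<in> Simp C n" "g \<in> carrier (Lev G n)" for n x t c g
        using that by (cases x) (auto simp: E_def \<Omega>0_0 \<Omega>0_1 \<Psi>a fS Sa simp del: One_nat_def)
      show "\<Omega>0 n (x, (replicate (Suc n) 0, c)) = \<psi>' n (x, c)" if "x \<in> Simp ?W n" "E n x" "c \<in> Simp C n" for n x c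
        using that by (cases x) (auto simp: E_def \<Omega>0_0 \<Omega>0_1 \<Psi>0 fS fev \<psi>'_app simp del: One_nat_def)
      show "\<Omega>0 n (x, (replicate (Suc n) 1, c)) = \<Omega>0 n (x, (replicate (Suc n) 1, c'))"
        if "x \<in> Simp ?W n" "E n x" "c \<in> Simp C n" "c' \<in> Simp C n" for n x c c'
        using that \<Psi>1[OF fS _ that(3,4)] by (cases x) (auto simp: E_def \<Omega>0_0 \<Omega>0_1 simp del: One_nat_def)
    qed (rule that)
    have \<Omega>c: "\<Omega> n ((r, (a, x)), (t, c)) \<in> carrier (Lev G n)"
      if "r \<in> Simp (\<Delta> 1) n" "a \<in> ?S n" "x \<in> Simp X n" "t \<in> Simp (\<Delta> 1) n" "c \<in> Simp C n" for n r a x t c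
      using smap_carrier[OF \<Omega>(1), of "((r, (a, x)), (t, c))" n] that by simp
    have \<Omega>1f: "\<Omega> m ((omit i r, (pre X m (\<delta> i) a, Face X (Suc m) i x)), (replicate (Suc m) 1, base m))
        = GFace G (Suc m) i (\<Omega> (Suc m) ((r, (a, x)), (replicate (Suc (Suc m)) 1, base (Suc m))))"
      if "r \<in> Simp (\<Delta> 1) (Suc m)" "a \<in> ?S (Suc m)" "x \<in> Simp X (Suc m)" "i \<le> Suc m" for m r a x i
      using smap_face[OF \<Omega>(1), of "((r, (a, x)), (replicate (Suc (Suc m)) 1, base (Suc m)))" m i] that
        omit_replicate[OF that(4), of "1::nat"] zero_one_simplex(2)[of "Suc m"] by (simp del: One_nat_def)
    have \<Omega>1d: "\<Omega> (Suc m) ((dup i r, (pre X (Suc m) (\<sigma> i) a, Degen X m i x)), (replicate (Suc (Suc m)) 1, base (Suc m)))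
        = GDegen G m i (\<Omega> m ((r, (a, x)), (replicate (Suc m) 1, base m)))"
      if "r \<in> Simp (\<Delta> 1) m" "a \<in> ?S m" "x \<in> Simp X m" "i \<le> m" for m r a x i
      using smap_degen[OF \<Omega>(1), of "((r, (a, x)), (replicate (Suc m) 1, base m))" m i] that
        dup_replicate[OF that(4), of "1::nat"] zero_one_simplex(2)[of m] by (simp del: One_nat_def)
    have \<Omega>1a: "\<Omega> n ((r, (a, \<alpha> n g x)), (replicate (Suc n) 1, base n)) = conj_action G n g (\<Omega> n ((r, (a, x)), (replicate (Suc n) 1, base n)))"
      if "r \<in> Simp (\<Delta> 1) n" "a \<in> ?S n" "x \<in> Simp X n" "g \<in> carrier (Lev G n)" for n r a x g
      using \<Omega>(2)[of "(r, (a, x))" n "replicate (Suc n) 1" "base n" g]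
        \<Omega>(3)[of "(r, (a, \<alpha> n g x))" n "base n" "\<kappa> n g (base n)"] that zero_one_simplex(2)[of n] by (simp del: One_nat_def)
    let ?Z = "\<Delta> 1 \<times>\<^sub>s ?A"
    have Z: "simplicial_set ?Z" by (rule simplicial_set_prod[OF simplicial_set_std_simplex A])
    define \<chi> where "\<chi> = restr (?Z \<times>\<^sub>s X) (\<lambda>m z. \<Omega> m ((fst (fst z), (snd (fst z), snd z)), (replicate (Suc m) 1, base m)))"
    have \<chi>: "\<chi> \<in> smap (?Z \<times>\<^sub>s X) (under G)" unfolding \<chi>_def
      by (rule restr_prod_smap[OF Z X.space]) (auto simp: \<Omega>c \<Omega>1f \<Omega>1d simp del: One_nat_def)
    have \<chi>_app: "\<chi> m ((r, a), x) = \<Omega> m ((r, (a, x)), (replicate (Suc m) 1, base m))"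
      if "r \<in> Simp (\<Delta> 1) m" "a \<in> ?S m" "x \<in> Simp X m" for m r a x
      unfolding \<chi>_def using that by (subst restr_apply) auto
    show "elementary_homotopic ?A ?A (scomp ?A g f) (sid ?A)"
    proof (rule S.elementary_homotopic_curry[OF A, of \<chi>])
      show "curry_at ?Z X \<chi> n (r, a) \<in> ?S n" if "r \<in> Simp (\<Delta> 1) n" "a \<in> Simp ?A n" for n r a
        by (rule curry_at_eq_maps[OF X.gspace_axioms Z \<chi>]) (use that in \<open>auto simp: \<chi>_app \<Omega>1a simp del: One_nat_def\<close>)
    next
      fix n a m s x assume a: "a \<in> Simp ?A n" and s: "s \<in> Simp (\<Delta> n) m" and x: "x \<in> Simp X m"
      have a': "a \<in> ?S n" using a by simp
      note oa = opA[OF a' s]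
      have end0: "\<chi> m ((replicate (Suc m) 0, op ?A n s a), x) = \<Psi> m ((f m (op ?A n s a), x), (replicate (Suc m) 1, base m))"
        using \<chi>_app[OF zero_one_simplex(1) oa x] \<Omega>(4)[of "(replicate (Suc m) 0, (op ?A n s a, x))" m "replicate (Suc m) 1" "base m"]
          zero_one_simplex[of m] oa x by (simp add: E_def \<Omega>0_0 del: One_nat_def)
      have "scomp ?A g f n a m (s, x) = \<Psi> m ((op ?B n s (f n a), x), (replicate (Suc m) 1, base m))"
        using scomp_apply[OF a, of g f] g_app[OF fS[OF a'] s x] by simp
      then show "\<chi> m ((replicate (Suc m) 0, op ?A n s a), x) = scomp ?A g f n a m (s, x)"
        using end0 op_natural[OF A B f a s] by simp
      have "\<chi> m ((replicate (Suc m) 1, op ?A n s a), x) = op ?A n s a m (\<iota> m, x)"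
        using \<chi>_app[OF zero_one_simplex(2) oa x] \<Omega>(4)[of "(replicate (Suc m) 1, (op ?A n s a, x))" m "replicate (Suc m) 1" "base m"]
          zero_one_simplex[of m] oa x by (simp add: E_def \<Omega>0_1 del: One_nat_def)
      then show "\<chi> m ((replicate (Suc m) 1, op ?A n s a), x) = sid ?A n a m (s, x)"
        using S.op_eval[OF a' s x] a by (simp add: sid_apply)
    qed (rule sid_smap[OF A] gf)+
  qed
  ultimately show ?thesis
    unfolding homotopy_equivalent_def using f g homotopic_maps_sym by blast
qed

end

section \<open>The bar construction\<close>

text \<open>
  The diagonal of the simplicial space \<open>p \<mapsto> G^(p + 1)\<close>: an \<open>m\<close>-simplex is a list of \<open>m + 1\<close> elements of
  \<open>G_m\<close>, and \<open>G\<close> acts by left multiplication on all entries.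
\<close>

definition bar :: "'g sgroup \<Rightarrow> 'g list sset" where
  "bar G = \<lparr>Simp = (\<lambda>m. {gs. length gs = Suc m \<and> set gs \<subseteq> carrier (Lev G m)}),
     Face = (\<lambda>m i gs. omit i (map (GFace G m i) gs)),
     Degen = (\<lambda>m i gs. dup i (map (GDegen G m i) gs))\<rparr>"

definition bar_action :: "'g sgroup \<Rightarrow> nat \<Rightarrow> 'g \<Rightarrow> 'g list \<Rightarrow> 'g list" where
  "bar_action G m g = map (\<lambda>h. g \<otimes>\<^bsub>Lev G m\<^esub> h)"

lemma bar_simps [simp]:
  "Simp (bar G) m = {gs. length gs = Suc m \<and> set gs \<subseteq> carrier (Lev G m)}"
  "Face (bar G) m i gs = omit i (map (GFace G m i) gs)"
  "Degen (bar G) m i gs = dup i (map (GDegen G m i) gs)"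
  by (simp_all add: bar_def)

context simplicial_group
begin

lemma simplicial_set_bar: "simplicial_set (bar G)"
proof
  interpret U: simplicial_set "under G" by (rule under_simplicial)
  note ff = U.face_face[unfolded under_simps] and dd = U.degen_degen[unfolded under_simps]
    and fdl = U.face_degen_less[unfolded under_simps] and fde = U.face_degen_eq[unfolded under_simps]
    and fdg = U.face_degen_greater[unfolded under_simps]
  fix n i j gs
  show "gs \<in> Simp (bar G) (Suc n) \<Longrightarrow> i \<le> Suc n \<Longrightarrow> Face (bar G) (Suc n) i gs \<in> Simp (bar G) n"
    using set_omit_subset[of i "map (GFace G (Suc n) i) gs"] by fastforce
  show "gs \<in> Simp (bar G) n \<Longrightarrow> i \<le> n \<Longrightarrow> Degen (bar G) n i gs \<in> Simp (bar G) (Suc n)"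
    using set_dup_subset[of i "map (GDegen G n i) gs"] by fastforce
  show "Face (bar G) (Suc n) i (Face (bar G) (Suc (Suc n)) j gs) = Face (bar G) (Suc n) (j - 1) (Face (bar G) (Suc (Suc n)) i gs)"
    if gs: "gs \<in> Simp (bar G) (Suc (Suc n))" and ij: "i < j" "j \<le> Suc (Suc n)"
  proof -
    have "map (GFace G (Suc n) i \<circ> GFace G (Suc (Suc n)) j) gs = map (GFace G (Suc n) (j - 1) \<circ> GFace G (Suc (Suc n)) i) gs"
      using gs ff[OF _ ij] by (auto simp del: One_nat_def)
    then show ?thesis using gs ij by (simp add: map_omit omit_omit del: One_nat_def map_eq_conv)
  qed
  show "Degen (bar G) (Suc n) i (Degen (bar G) n j gs) = Degen (bar G) (Suc n) (Suc j) (Degen (bar G) n i gs)"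
    if gs: "gs \<in> Simp (bar G) n" and ij: "i \<le> j" "j \<le> n"
  proof -
    have "map (GDegen G (Suc n) i \<circ> GDegen G n j) gs = map (GDegen G (Suc n) (Suc j) \<circ> GDegen G n i) gs"
      using gs dd[OF _ ij] by auto
    then show ?thesis using gs ij by (simp add: map_dup dup_dup[of i j] del: map_eq_conv)
  qed
  show "Face (bar G) (Suc (Suc n)) i (Degen (bar G) (Suc n) j gs) = Degen (bar G) n (j - 1) (Face (bar G) (Suc n) i gs)"
    if gs: "gs \<in> Simp (bar G) (Suc n)" and ij: "i < j" "j \<le> Suc n"
  proof -
    have "map (GFace G (Suc (Suc n)) i \<circ> GDegen G (Suc n) j) gs = map (GDegen G n (j - 1) \<circ> GFace G (Suc n) i) gs"
      using gs fdl[OF _ ij] by (auto simp del: One_nat_def)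
    then show ?thesis using gs ij by (simp add: map_dup map_omit omit_dup_less del: One_nat_def map_eq_conv)
  qed
  show "Face (bar G) (Suc n) i (Degen (bar G) n j gs) = gs"
    if gs: "gs \<in> Simp (bar G) n" and ij: "j \<le> n" "i = j \<or> i = Suc j"
  proof -
    have "map (GFace G (Suc n) i \<circ> GDegen G n j) gs = gs"
      using gs fde[OF _ ij] by (auto intro!: map_idI)
    then show ?thesis using gs ij by (simp add: map_dup omit_dup_eq)
  qed
  show "Face (bar G) (Suc (Suc n)) i (Degen (bar G) (Suc n) j gs) = Degen (bar G) n j (Face (bar G) (Suc n) (i - 1) gs)"
    if gs: "gs \<in> Simp (bar G) (Suc n)" and ij: "Suc j < i" "i \<le> Suc (Suc n)"
  proof -
    have "map (GFace G (Suc (Suc n)) i \<circ> GDegen G (Suc n) j) gs = map (GDegen G n j \<circ> GFace G (Suc n) (i - 1)) gs"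
      using gs fdg[OF _ ij] by (auto simp del: One_nat_def)
    then show ?thesis using gs ij by (simp add: map_dup map_omit omit_dup_greater del: One_nat_def map_eq_conv)
  qed
qed

lemma free_gspace_bar: "free_gspace G (bar G) (bar_action G)"
proof (intro free_gspace.intro gspace.intro free_gspace_axioms.intro simplicial_group_axioms simplicial_set_bar)
  fix n i g h gs
  show "g \<in> carrier (Lev G n) \<Longrightarrow> gs \<in> Simp (bar G) n \<Longrightarrow> bar_action G n g gs \<in> Simp (bar G) n"
    by (auto simp: bar_action_def)
  show "gs \<in> Simp (bar G) n \<Longrightarrow> bar_action G n \<one>\<^bsub>Lev G n\<^esub> gs = gs"
    by (auto simp: bar_action_def intro!: map_idI)
  show "g \<in> carrier (Lev G n) \<Longrightarrow> h \<in> carrier (Lev G n) \<Longrightarrow> gs \<in> Simp (bar G) n \<Longrightarrow>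
    bar_action G n (g \<otimes>\<^bsub>Lev G n\<^esub> h) gs = bar_action G n g (bar_action G n h gs)"
    by (auto simp: bar_action_def level_assoc subset_iff)
  show "g \<in> carrier (Lev G (Suc n)) \<Longrightarrow> gs \<in> Simp (bar G) (Suc n) \<Longrightarrow> i \<le> Suc n \<Longrightarrow>
    Face (bar G) (Suc n) i (bar_action G (Suc n) g gs) = bar_action G n (GFace G (Suc n) i g) (Face (bar G) (Suc n) i gs)"
    by (auto simp: bar_action_def map_omit subset_iff intro!: arg_cong[of _ _ "omit i"])
  show "g \<in> carrier (Lev G n) \<Longrightarrow> gs \<in> Simp (bar G) n \<Longrightarrow> i \<le> n \<Longrightarrow>
    Degen (bar G) n i (bar_action G n g gs) = bar_action G (Suc n) (GDegen G n i g) (Degen (bar G) n i gs)"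
    by (auto simp: bar_action_def map_dup subset_iff intro!: arg_cong[of _ _ "dup i"])
  show "g = \<one>\<^bsub>Lev G n\<^esub>" if g: "g \<in> carrier (Lev G n)" and gs: "gs \<in> Simp (bar G) n" and eq: "bar_action G n g gs = gs"
  proof -
    obtain a as where a: "gs = a # as" "a \<in> carrier (Lev G n)" using gs by (cases gs) auto
    then have "g \<otimes>\<^bsub>Lev G n\<^esub> a = a" using eq by (simp add: bar_action_def)
    moreover have "(g \<otimes>\<^bsub>Lev G n\<^esub> a) \<otimes>\<^bsub>Lev G n\<^esub> inv\<^bsub>Lev G n\<^esub> a = g \<otimes>\<^bsub>Lev G n\<^esub> (a \<otimes>\<^bsub>Lev G n\<^esub> inv\<^bsub>Lev G n\<^esub> a)"
      using g a(2) by (simp only: level_assoc level_simps)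
    ultimately show ?thesis using g a(2) by simp
  qed
qed

text \<open>
  The contraction replaces an initial segment of the entries by \<open>1\<close>. It is not equivariant.
\<close>

definition bar_contraction :: "nat \<Rightarrow> nat list \<times> 'g list \<Rightarrow> 'g list" where
  "bar_contraction m z = map2 (\<lambda>a g. if a = 0 then \<one>\<^bsub>Lev G m\<^esub> else g) (fst z) (snd z)"

lemma bar_contraction_smap:
  "restr (\<Delta> 1 \<times>\<^sub>s bar G) bar_contraction \<in> smap (\<Delta> 1 \<times>\<^sub>s bar G) (bar G)"
proof (rule restr_prod_smap[OF simplicial_set_std_simplex simplicial_set_bar])
  fix m i t gs
  have omit_map2: "omit i (map2 f xs ys) = map2 f (omit i xs) (omit i ys)"
    if "length xs = length ys" for f :: "nat \<Rightarrow> 'g \<Rightarrow> 'g" and xs ys i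
    using that by (simp add: omit_def take_map drop_map take_zip drop_zip)
  have dup_map2: "dup i (map2 f xs ys) = map2 f (dup i xs) (dup i ys)"
    if "length xs = length ys" for f :: "nat \<Rightarrow> 'g \<Rightarrow> 'g" and xs ys i
    using that by (simp add: dup_def take_map drop_map take_zip drop_zip)
  have map_map2: "map h (map2 (\<lambda>a g. if a = 0 then e else g) xs ys) = map2 (\<lambda>a g. if a = 0 then h e else g) xs (map h ys)"
    for h :: "'g \<Rightarrow> 'g" and e xs and ys :: "'g list" by (induction xs ys rule: list_induct2') auto
  show "bar_contraction m (t, gs) \<in> Simp (bar G) m" if "t \<in> Simp (\<Delta> 1) m" "gs \<in> Simp (bar G) m"
    using that by (auto simp: bar_contraction_def std_simplex_simps dest!: set_zip_rightD split: if_splits)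
  show "bar_contraction m (Face (\<Delta> 1) (Suc m) i t, Face (bar G) (Suc m) i gs) = Face (bar G) (Suc m) i (bar_contraction (Suc m) (t, gs))"
    if "t \<in> Simp (\<Delta> 1) (Suc m)" "gs \<in> Simp (bar G) (Suc m)" "i \<le> Suc m"
    using that by (simp add: bar_contraction_def std_simplex_simps map_map2 omit_map2 del: map_map)
  show "bar_contraction (Suc m) (Degen (\<Delta> 1) m i t, Degen (bar G) m i gs) = Degen (bar G) m i (bar_contraction m (t, gs))"
    if "t \<in> Simp (\<Delta> 1) m" "gs \<in> Simp (bar G) m" "i \<le> m"
    using that by (simp add: bar_contraction_def std_simplex_simps map_map2 dup_map2 del: map_map)
qed

lemma contractible_bar: "contractible (bar G)"
proof -
  let ?B = "bar G" and ?t = "\<lambda>n. \<lambda>x\<in>Simp (bar G) n. ()"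
  let ?e = "restr point (\<lambda>n u. replicate (Suc n) \<one>\<^bsub>Lev G n\<^esub>)"
  have ones: "replicate (Suc n) \<one>\<^bsub>Lev G n\<^esub> \<in> Simp ?B n" for n by auto
  have t: "?t \<in> smap ?B point" by (rule point_smap[OF simplicial_set_bar])
  have e: "?e \<in> smap point ?B"
    by (rule restr_smap[OF simplicial_set_point])
      (use ones in \<open>auto simp: point_def omit_replicate dup_replicate map_replicate\<close>)
  let ?c = "scomp ?B ?e ?t"
  have c: "?c \<in> smap ?B ?B" by (rule scomp_smap[OF simplicial_set_bar t e])
  have "elementary_homotopic ?B ?B ?c (sid ?B)"
    unfolding elementary_homotopic_def
  proof (intro bexI[OF _ bar_contraction_smap] allI ballI conjI)
    fix n gs assume gs: "gs \<in> Simp ?B n"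
    have zeros: "map2 (\<lambda>a g. if a = 0 then \<one>\<^bsub>Lev G n\<^esub> else g) (replicate k (0::nat)) xs = replicate k \<one>\<^bsub>Lev G n\<^esub>"
      if "length xs = k" for k and xs :: "'g list"
      using that by (induction k arbitrary: xs) (auto simp: replicate_Suc length_Suc_conv)
    show "restr (\<Delta> 1 \<times>\<^sub>s ?B) bar_contraction n (replicate (Suc n) 0, gs) = ?c n gs"
      using zeros[of gs "Suc n"] gs zero_one_simplex(1)[of n]
      by (subst restr_apply) (auto simp: bar_contraction_def scomp_def compose_def restr_def point_def)
    have ones': "map2 (\<lambda>a g. if a = 0 then \<one>\<^bsub>Lev G n\<^esub> else g) (replicate k (1::nat)) xs = xs"
      if "length xs = k" for k and xs :: "'g list"
      using that by (induction k arbitrary: xs) (auto simp: replicate_Suc length_Suc_conv)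
    show "restr (\<Delta> 1 \<times>\<^sub>s ?B) bar_contraction n (replicate (Suc n) 1, gs) = sid ?B n gs"
      using ones'[of gs "Suc n"] gs zero_one_simplex(2)[of n]
      by (subst restr_apply) (auto simp: bar_contraction_def sid_def simp del: One_nat_def)
  qed
  then have h: "homotopic_maps ?B ?B ?c (sid ?B)"
    by (rule elementary_homotopic_imp_homotopic_maps[OF c sid_smap[OF simplicial_set_bar]])
  have te: "scomp point (scomp ?B g ?t) ?e = g" if g: "g \<in> smap point K" for g and K :: "('g list + unit) list sset"
  proof (intro ext)
    fix n u
    show "scomp point (scomp ?B g ?t) ?e n u = g n u"
      using ones[of n] by (auto simp: scomp_def compose_def restr_def point_def)
  qed
  show ?thesis
    unfolding contractible_def weak_equivalence_def
  proof (intro conjI allI impI ballI simplicial_set_bar t)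
    fix K :: "('g list + unit) list sset" and f assume f: "f \<in> smap ?B K"
    have eq: "scomp ?B (scomp point f ?e) ?t = scomp ?B f ?c"
      by (auto simp: scomp_def compose_def fun_eq_iff point_def)
    have "homotopic_maps ?B K (scomp ?B f ?c) (scomp ?B f (sid ?B))"
      by (rule scomp_homotopic_maps[OF simplicial_set_bar f h])
    then have "homotopic_maps ?B K (scomp ?B (scomp point f ?e) ?t) f"
      unfolding eq scomp_sid[OF f] .
    then show "\<exists>g\<in>smap point K. homotopic_maps ?B K (scomp ?B g ?t) f"
      by (rule bexI[OF _ scomp_smap[OF simplicial_set_point e f]])
  next
    fix K :: "('g list + unit) list sset" and g g'
    assume g: "g \<in> smap point K" "g' \<in> smap point K" and "homotopic_maps ?B K (scomp ?B g ?t) (scomp ?B g' ?t)"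
    from homotopic_maps_scomp[OF simplicial_set_point e this(3)] show "homotopic_maps point K g g'"
      using te[OF g(1)] te[OF g(2)] by simp
  qed
qed

end

definition swap_map :: "'x sset \<Rightarrow> 'y sset \<Rightarrow> nat \<Rightarrow> (nat \<Rightarrow> nat list \<times> 'x \<times> 'y \<Rightarrow> 'b) \<Rightarrow> nat \<Rightarrow> nat list \<times> 'y \<times> 'x \<Rightarrow> 'b" where
  "swap_map A B n \<phi> = restr (\<Delta> n \<times>\<^sub>s (B \<times>\<^sub>s A)) (\<lambda>m z. \<phi> m (fst z, (snd (snd z), fst (snd z))))"

lemma swap_map_apply:
  "s \<in> Simp (\<Delta> n) m \<Longrightarrow> a \<in> Simp A m \<Longrightarrow> b \<in> Simp B m \<Longrightarrow> swap_map A B n \<phi> m (s, (b, a)) = \<phi> m (s, (a, b))"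
  unfolding swap_map_def by (subst restr_apply) auto

lemma swap_map_smap:
  assumes A: "gspace G A \<alpha>" and B: "gspace G B \<beta>"
  shows "restr (mspace (A \<times>\<^sub>s B) (eq_maps G (A \<times>\<^sub>s B) (prod_action \<alpha> \<beta>))) (swap_map A B)
      \<in> smap (mspace (A \<times>\<^sub>s B) (eq_maps G (A \<times>\<^sub>s B) (prod_action \<alpha> \<beta>))) (mspace (B \<times>\<^sub>s A) (eq_maps G (B \<times>\<^sub>s A) (prod_action \<beta> \<alpha>)))"
proof -
  interpret A: gspace G A \<alpha> by fact
  interpret B: gspace G B \<beta> by fact
  interpret M: map_subspace "A \<times>\<^sub>s B" "under G" "eq_maps G (A \<times>\<^sub>s B) (prod_action \<alpha> \<beta>)"
    by (rule eq_maps_map_subspace[OF gspace_prod[OF A B]])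
  have pre: "swap_map A B n' (pre (A \<times>\<^sub>s B) n' u \<phi>) = pre (B \<times>\<^sub>s A) n' u (swap_map A B n \<phi>)"
    if u: "monotone_index n' n u" for n n' u \<phi>
  proof (intro ext)
    fix m z
    show "swap_map A B n' (pre (A \<times>\<^sub>s B) n' u \<phi>) m z = pre (B \<times>\<^sub>s A) n' u (swap_map A B n \<phi>) m z"
      using map_monotone_index[OF u, of "fst z" m]
      by (cases z) (auto simp: swap_map_def restr_def pre_def)
  qed
  show ?thesis
  proof (rule restr_smap[OF M.simplicial_set_mspace])
    fix n \<phi> assume "\<phi> \<in> Simp (mspace (A \<times>\<^sub>s B) (eq_maps G (A \<times>\<^sub>s B) (prod_action \<alpha> \<beta>))) n"
    then have \<phi>: "\<phi> \<in> eq_maps G (A \<times>\<^sub>s B) (prod_action \<alpha> \<beta>) n" by simp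
    note s = eq_maps_smap[OF \<phi>]
    have c: "\<phi> m (s, (a, b)) \<in> carrier (Lev G m)" if "s \<in> Simp (\<Delta> n) m" "a \<in> Simp A m" "b \<in> Simp B m" for m s a b
      using smap_closed[OF s, of "(s, (a, b))" m] that by simp
    have f: "\<phi> m (omit i s, (Face A (Suc m) i a, Face B (Suc m) i b)) = GFace G (Suc m) i (\<phi> (Suc m) (s, (a, b)))"
      if "s \<in> Simp (\<Delta> n) (Suc m)" "a \<in> Simp A (Suc m)" "b \<in> Simp B (Suc m)" "i \<le> Suc m" for m s a b i
      using smap_face[OF s, of "(s, (a, b))" m i] that by simp
    have d: "\<phi> (Suc m) (dup i s, (Degen A m i a, Degen B m i b)) = GDegen G m i (\<phi> m (s, (a, b)))"
      if "s \<in> Simp (\<Delta> n) m" "a \<in> Simp A m" "b \<in> Simp B m" "i \<le> m" for m s a b i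
      using smap_degen[OF s, of "(s, (a, b))" m i] that by simp
    have "swap_map A B n \<phi> \<in> smap (\<Delta> n \<times>\<^sub>s (B \<times>\<^sub>s A)) (under G)"
      unfolding swap_map_def
      by (rule restr_prod_smap[OF simplicial_set_std_simplex simplicial_set_prod[OF B.space A.space]])
        (auto simp: c f d)
    then show "swap_map A B n \<phi> \<in> Simp (mspace (B \<times>\<^sub>s A) (eq_maps G (B \<times>\<^sub>s A) (prod_action \<beta> \<alpha>))) n"
      using eq_maps_act[OF \<phi>, of _ _ _ "(_, _)"] by (auto simp: eq_maps_def swap_map_apply)
  qed (simp_all add: pre[OF monotone_index_\<delta>] pre[OF monotone_index_\<sigma>])
qed

lemma swap_map_swap_map:
  assumes A: "simplicial_set A" and B: "simplicial_set B" and \<phi>: "\<phi> \<in> smap (\<Delta> n \<times>\<^sub>s (A \<times>\<^sub>s B)) Y"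
  shows "swap_map B A n (swap_map A B n \<phi>) = \<phi>"
  using smap_undefined[OF \<phi>] by (auto simp: swap_map_def restr_def fun_eq_iff)

lemma eq_maps_swap:
  assumes X: "gspace G X \<alpha>" and Y: "gspace G Y \<beta>"
  shows "mspace (X \<times>\<^sub>s Y) (eq_maps G (X \<times>\<^sub>s Y) (prod_action \<alpha> \<beta>)) \<simeq>\<^sub>s
    mspace (Y \<times>\<^sub>s X) (eq_maps G (Y \<times>\<^sub>s X) (prod_action \<beta> \<alpha>))"
proof (rule isomorphic_imp_homotopy_equivalent[OF swap_map_smap[OF X Y] swap_map_smap[OF Y X]])
  fix n \<phi> assume \<phi>: "\<phi> \<in> Simp (mspace (X \<times>\<^sub>s Y) (eq_maps G (X \<times>\<^sub>s Y) (prod_action \<alpha> \<beta>))) n"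
  show "restr (mspace (Y \<times>\<^sub>s X) (eq_maps G (Y \<times>\<^sub>s X) (prod_action \<beta> \<alpha>))) (swap_map Y X) n
      (restr (mspace (X \<times>\<^sub>s Y) (eq_maps G (X \<times>\<^sub>s Y) (prod_action \<alpha> \<beta>))) (swap_map X Y) n \<phi>) = \<phi>"
    using smap_closed[OF swap_map_smap[OF X Y] \<phi>] \<phi>
      swap_map_swap_map[OF gspace.space[OF X] gspace.space[OF Y], of \<phi> n "under G"] eq_maps_smap[of \<phi>]
    by (simp add: restr_apply)
next
  fix n \<phi> assume \<phi>: "\<phi> \<in> Simp (mspace (Y \<times>\<^sub>s X) (eq_maps G (Y \<times>\<^sub>s X) (prod_action \<beta> \<alpha>))) n"
  show "restr (mspace (X \<times>\<^sub>s Y) (eq_maps G (X \<times>\<^sub>s Y) (prod_action \<alpha> \<beta>))) (swap_map X Y) n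
      (restr (mspace (Y \<times>\<^sub>s X) (eq_maps G (Y \<times>\<^sub>s X) (prod_action \<beta> \<alpha>))) (swap_map Y X) n \<phi>) = \<phi>"
    using smap_closed[OF swap_map_smap[OF Y X] \<phi>] \<phi>
      swap_map_swap_map[OF gspace.space[OF Y] gspace.space[OF X], of \<phi> n "under G"] eq_maps_smap[of \<phi>]
    by (simp add: restr_apply)
qed

section \<open>The totalization as a space of equivariant maps\<close>

lemma pow_sset_simps [simp]:
  "Simp (pow_sset X p) n = {xs. length xs = p \<and> set xs \<subseteq> Simp X n}"
  "Face (pow_sset X p) n i = map (Face X n i)" "Degen (pow_sset X p) n i = map (Degen X n i)"
  by (simp_all add: pow_sset_def)

lemma simplicial_set_pow:
  assumes "simplicial_set X"
  shows "simplicial_set (pow_sset X p)"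
proof -
  interpret X: simplicial_set X by fact
  show ?thesis
  proof
    fix n i j x
    show "x \<in> Simp (pow_sset X p) (Suc n) \<Longrightarrow> i \<le> Suc n \<Longrightarrow> Face (pow_sset X p) (Suc n) i x \<in> Simp (pow_sset X p) n"
      using X.face_closed by fastforce
    show "x \<in> Simp (pow_sset X p) n \<Longrightarrow> i \<le> n \<Longrightarrow> Degen (pow_sset X p) n i x \<in> Simp (pow_sset X p) (Suc n)"
      using X.degen_closed by fastforce
  qed (auto simp del: One_nat_def simp: subset_iff intro: X.face_face X.degen_degen X.face_degen_less
      X.face_degen_greater intro!: map_idI X.face_degen_eq)
qed

text \<open>
  Dually to \<open>std_simplex_generated\<close>, every monotone map \<open>[q] \<rightarrow> [p]\<close> arises from the identity of \<open>[q]\<close>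
  by composing with cofaces and codegeneracies on the left.
\<close>

lemma std_simplex_cogenerated:
  assumes id: "Q q (\<iota> q)"
    and coface: "\<And>p k t. Q p t \<Longrightarrow> t \<in> Simp (\<Delta> p) q \<Longrightarrow> k \<le> Suc p \<Longrightarrow> Q (Suc p) (map (\<delta> k) t)"
    and codegen: "\<And>p k t. Q (Suc p) t \<Longrightarrow> t \<in> Simp (\<Delta> (Suc p)) q \<Longrightarrow> k \<le> p \<Longrightarrow> Q p (map (\<sigma> k) t)"
    and t: "t \<in> Simp (\<Delta> p) q"
  shows "Q p t"
proof -
  have onto: "Q p t" if "q - p = c" "t \<in> Simp (\<Delta> p) q" "set t = {..p}" for c p t
    using that
  proof (induction c arbitrary: p t)
    case 0
    have len: "length t = Suc q" "sorted t" using 0 by (auto simp: std_simplex_simps)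
    have "card (set t) = Suc p" using 0 by simp
    then have "p \<le> q" using card_length[of t] len by simp
    then have pq: "p = q" using 0(1) by simp
    then have "distinct t" using \<open>card (set t) = Suc p\<close> len by (simp add: card_distinct)
    then have "t = \<iota> q" using sorted_distinct_set_unique[of t "\<iota> q"] 0 len pq by simp
    then show ?case using id pq by simp
  next
    case (Suc c)
    have len: "length t = Suc q" "sorted t" using Suc.prems by (auto simp: std_simplex_simps)
    have "\<not> distinct t"
      using Suc.prems len distinct_card[of t] by auto
    then have "\<not> sorted_wrt (<) t" using strict_sorted_iff by blast
    then obtain i where i: "Suc i < length t" "\<not> t ! i < t ! Suc i"
      using sorted_wrt_iff_nth_Suc_transp[of "(<)" t] by auto
    then have eq: "t ! i = t ! Suc i" using len sorted_nth_mono[of t i "Suc i"] by auto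
    define k where "k = t ! i"
    have kp: "k \<le> p" using i Suc.prems(3) nth_mem[of i t] unfolding k_def by auto
    define u where "u = map (\<lambda>j. if j \<le> i then t ! j else Suc (t ! j)) [0..<Suc q]"
    have lu: "length u = Suc q" by (simp add: u_def)
    have nu: "u ! j = (if j \<le> i then t ! j else Suc (t ! j))" if "j < Suc q" for j
      using that unfolding u_def by (simp del: upt_Suc)
    have mono: "t ! a \<le> t ! b" if "a \<le> b" "b < Suc q" for a b using len that by (simp add: sorted_nth_mono)
    have tp: "t ! a \<le> p" if "a < Suc q" for a using Suc.prems(3) nth_mem[of a t] that len by auto
    have u: "u \<in> Simp (\<Delta> (Suc p)) q"
    proof -
      have "sorted u" unfolding sorted_iff_nth_mono using mono by (auto simp: lu nu le_SucI)
      moreover have "set u \<subseteq> {..Suc p}" using tp by (auto simp: in_set_conv_nth lu nu le_SucI)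
      ultimately show ?thesis using lu by (simp add: std_simplex_simps)
    qed
    have "map (\<sigma> k) u = t"
    proof (intro nth_equalityI)
      fix j assume "j < length (map (\<sigma> k) u)"
      then have j: "j < Suc q" by (simp add: lu)
      have "t ! j \<le> k" if "j \<le> i" using mono[OF that] i len by (simp add: k_def)
      moreover have "k \<le> t ! j" if "\<not> j \<le> i" using mono[of i j] that j by (simp add: k_def)
      ultimately show "map (\<sigma> k) u ! j = t ! j" using j by (auto simp: lu nu \<sigma>_def)
    qed (simp add: lu len)
    moreover have "set u = {..Suc p}"
    proof
      show "set u \<subseteq> {..Suc p}" using u by (simp add: std_simplex_simps)
      show "{..Suc p} \<subseteq> set u"
      proof
        fix a assume "a \<in> {..Suc p}"
        then have a: "a \<le> Suc p" by simp
        show "a \<in> set u"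
        proof (cases "a \<le> k")
          case True
          then obtain j where j: "j < Suc q" "t ! j = a"
            using Suc.prems(3) kp len by (metis atMost_iff in_set_conv_nth le_trans)
          define j' where "j' = (if j \<le> i then j else i)"
          have "t ! j' = a" "j' \<le> i" "j' < Suc q"
            using j True mono[of i j] i len unfolding j'_def k_def by auto
          then show ?thesis using nu[of j'] lu nth_mem[of j' u] by simp
        next
          case False
          then obtain j where j: "j < Suc q" "t ! j = a - 1"
            using Suc.prems(3) a len by (metis atMost_iff in_set_conv_nth diff_le_mono diff_Suc_1)
          define j' where "j' = (if j \<le> i then Suc i else j)"
          have "t ! j' = a - 1" "\<not> j' \<le> i" "j' < Suc q"
            using j False mono[of j i] i len eq unfolding j'_def k_def by auto
          then show ?thesis using nu[of j'] lu nth_mem[of j' u] False by simp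
        qed
      qed
    qed
    moreover have "q - Suc p = c" using Suc.prems(1) by simp
    ultimately show ?case using codegen[OF Suc.IH[OF _ u] u kp] by simp
  qed
  have "card ({..p} - set t) = c \<Longrightarrow> t \<in> Simp (\<Delta> p) q \<Longrightarrow> Q p t" for c
  proof (induction c arbitrary: p t)
    case 0
    then have "{..p} - set t = {}" by (simp only: card_0_eq finite_Diff finite_atMost)
    then show ?case using onto[OF refl 0(2)] 0(2) by (auto simp: std_simplex_simps)
  next
    case (Suc c)
    then obtain k where k: "k \<le> p" "k \<notin> set t"
      by (metis Diff_iff atMost_iff card.empty ex_in_conv nat.distinct(1))
    have "p \<noteq> 0"
    proof
      assume "p = 0"
      have "length t = Suc q" "set t \<subseteq> {..p}" using Suc.prems(2) by (simp_all add: std_simplex_simps)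
      then have "t ! 0 \<in> set t" "t ! 0 \<le> p" by (simp, metis atMost_iff nth_mem subsetD zero_less_Suc)
      then show False using k \<open>p = 0\<close> by simp
    qed
    then obtain p' where p: "p = Suc p'" by (cases p) auto
    define u where "u a = (if a < k then a else a - 1)" for a
    have "monotone_index p p' u" using k(1) p by (auto simp: monotone_index_def u_def)
    then have mem: "map u t \<in> Simp (\<Delta> p') q" using Suc.prems(2) by (rule map_monotone_index)
    have du: "\<delta> k (u a) = a" if "a \<in> set t" for a
    proof -
      have "a \<noteq> k" using that k(2) by auto
      then show ?thesis by (auto simp: \<delta>_def u_def)
    qed
    then have t: "map (\<delta> k) (map u t) = t" by (simp add: map_idI)
    have "\<delta> k ` ({..p'} - set (map u t)) = ({..p} - set t) - {k}"
    proof (intro equalityI subsetI)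
      fix b assume "b \<in> \<delta> k ` ({..p'} - set (map u t))"
      then obtain a where a: "b = \<delta> k a" "a \<le> p'" "a \<notin> u ` set t" by auto
      have "u (\<delta> k a) = a" by (auto simp: u_def \<delta>_def)
      then have "b \<notin> set t" using a by (metis image_eqI)
      then show "b \<in> ({..p} - set t) - {k}" using a p by (auto simp: \<delta>_def)
    next
      fix b assume b: "b \<in> ({..p} - set t) - {k}"
      then have "b = \<delta> k (u b)" "u b \<le> p'" using p k(1) by (auto simp: u_def \<delta>_def)
      moreover have "u b \<notin> set (map u t)"
      proof
        assume "u b \<in> set (map u t)"
        then obtain a where "a \<in> set t" "u b = u a" by auto
        then have "b = a" using du[of a] \<open>b = \<delta> k (u b)\<close> by simp
        then show False using b \<open>a \<in> set t\<close> by simp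
      qed
      ultimately show "b \<in> \<delta> k ` ({..p'} - set (map u t))" by blast
    qed
    moreover have "inj_on (\<delta> k) ({..p'} - set (map u t))" by (auto simp: inj_on_def \<delta>_def split: if_splits)
    ultimately have "card ({..p'} - set (map u t)) = card (({..p} - set t) - {k})" by (metis card_image)
    also have "\<dots> = c" using Suc.prems(1) k by simp
    finally have "Q p' (map u t)" using Suc.IH mem by blast
    then show ?case using coface[OF _ mem, of k] k(1) p t by simp
  qed
  then show ?thesis using t by blast
qed

fun partial_prod :: "('g, 'm) monoid_scheme \<Rightarrow> 'g list \<Rightarrow> nat \<Rightarrow> 'g" where
  "partial_prod M fs 0 = \<one>\<^bsub>M\<^esub>"
| "partial_prod M fs (Suc j) = partial_prod M fs j \<otimes>\<^bsub>M\<^esub> fs ! j"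

text \<open>
  Homogeneous and inhomogeneous coordinates: \<open>g_0, \<dots>, g_m\<close> is recovered from \<open>g_0\<close> and the quotients
  \<open>f_i = g_(i - 1)\<inverse> \<cdot> g_i\<close> by \<open>g_j = g_0 \<cdot> f_1 \<cdots> f_j\<close>.
\<close>

definition quotients :: "('g, 'm) monoid_scheme \<Rightarrow> 'g list \<Rightarrow> 'g list" where
  "quotients M gs = map (\<lambda>i. inv\<^bsub>M\<^esub> (gs ! i) \<otimes>\<^bsub>M\<^esub> gs ! Suc i) [0..<length gs - 1]"

text \<open>
  The coface \<open>d^k\<close> of \<open>\<Pi>^\<bullet> G\<close>, for functions \<open>u\<close> of lists in a fixed simplicial degree.
\<close>

definition coface_args :: "('g, 'm) monoid_scheme \<Rightarrow> nat \<Rightarrow> nat \<Rightarrow> ('g list \<Rightarrow> 'g) \<Rightarrow> 'g list \<Rightarrow> 'g" where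
  "coface_args M p k u fs = (if k = 0 then hd fs \<otimes>\<^bsub>M\<^esub> u (tl fs)
     else if k = Suc p then u (butlast fs) \<otimes>\<^bsub>M\<^esub> last fs
     else u (take (k - 1) fs @ [fs ! (k - 1) \<otimes>\<^bsub>M\<^esub> fs ! k] @ drop (Suc k) fs))"

definition insert_one :: "('g, 'm) monoid_scheme \<Rightarrow> nat \<Rightarrow> 'g list \<Rightarrow> 'g list" where
  "insert_one M k fs = take k fs @ [\<one>\<^bsub>M\<^esub>] @ drop k fs"

lemma partial_prod_cong: "(\<And>i. i < j \<Longrightarrow> fs ! i = gs ! i) \<Longrightarrow> partial_prod M fs j = partial_prod M gs j"
  by (induction j) auto

context simplicial_group
begin

abbreviation "gpow p \<equiv> pow_sset (under G) p"

lemma simplicial_set_pow_group: "simplicial_set (gpow p)"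
  by (rule simplicial_set_pow[OF under_simplicial])

lemma nth_carrier: "set fs \<subseteq> carrier (Lev G q) \<Longrightarrow> i < length fs \<Longrightarrow> fs ! i \<in> carrier (Lev G q)"
  using nth_mem by blast

lemma partial_prod_closed [simp]:
  "set fs \<subseteq> carrier (Lev G q) \<Longrightarrow> j \<le> length fs \<Longrightarrow> partial_prod (Lev G q) fs j \<in> carrier (Lev G q)"
  by (induction j) (auto simp: nth_carrier)

lemma face_partial_prod:
  "set fs \<subseteq> carrier (Lev G (Suc q)) \<Longrightarrow> j \<le> length fs \<Longrightarrow> i \<le> Suc q \<Longrightarrow>
    GFace G (Suc q) i (partial_prod (Lev G (Suc q)) fs j) = partial_prod (Lev G q) (map (GFace G (Suc q) i) fs) j"
  by (induction j) (auto simp: nth_carrier)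

lemma degen_partial_prod:
  "set fs \<subseteq> carrier (Lev G q) \<Longrightarrow> j \<le> length fs \<Longrightarrow> i \<le> q \<Longrightarrow>
    GDegen G q i (partial_prod (Lev G q) fs j) = partial_prod (Lev G (Suc q)) (map (GDegen G q i) fs) j"
  by (induction j) (auto simp: nth_carrier)

text \<open>
  In the next three lemmas the cosimplicial operators act on the index \<open>j\<close> of the partial products on
  one side and on the list on the other.
\<close>

lemma partial_prod_tl:
  "set fs \<subseteq> carrier (Lev G q) \<Longrightarrow> j < length fs \<Longrightarrow>
    partial_prod (Lev G q) fs (Suc j) = hd fs \<otimes>\<^bsub>Lev G q\<^esub> partial_prod (Lev G q) (tl fs) j"
proof (induction j)
  case 0
  then have "fs ! 0 \<in> carrier (Lev G q)" using nth_carrier by blast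
  then show ?case using 0 by (cases fs) auto
next
  case (Suc j)
  obtain a as where fs: "fs = a # as" using Suc.prems by (cases fs) auto
  have "partial_prod (Lev G q) as j \<in> carrier (Lev G q)" "as ! j \<in> carrier (Lev G q)" "a \<in> carrier (Lev G q)"
    using Suc.prems fs nth_carrier[of as q j] by auto
  then show ?case using Suc fs by (simp add: level_assoc)
qed

lemma partial_prod_merge:
  assumes fs: "set fs \<subseteq> carrier (Lev G q)" "length fs = Suc p" and k: "0 < k" "k \<le> p"
  shows "j \<le> p \<Longrightarrow> partial_prod (Lev G q) (take (k - 1) fs @ [fs ! (k - 1) \<otimes>\<^bsub>Lev G q\<^esub> fs ! k] @ drop (Suc k) fs) j
    = partial_prod (Lev G q) fs (\<delta> k j)"
proof (induction j)
  case (Suc j)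
  let ?ms = "take (k - 1) fs @ [fs ! (k - 1) \<otimes>\<^bsub>Lev G q\<^esub> fs ! k] @ drop (Suc k) fs"
  have IH: "partial_prod (Lev G q) ?ms j = partial_prod (Lev G q) fs (\<delta> k j)" using Suc by simp
  consider "Suc j < k" | "Suc j = k" | "k < Suc j" by linarith
  then show ?case
  proof cases
    case 1
    then have "j < k - 1" by simp
    then have "?ms ! j = fs ! j" using k fs by (simp add: nth_append)
    then show ?thesis using IH 1 by (simp add: \<delta>_def)
  next
    case 2
    then have "?ms ! j = fs ! j \<otimes>\<^bsub>Lev G q\<^esub> fs ! Suc j" using k fs by (auto simp: nth_append)
    moreover have "partial_prod (Lev G q) fs j \<in> carrier (Lev G q)" "fs ! j \<in> carrier (Lev G q)" "fs ! Suc j \<in> carrier (Lev G q)"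
      using Suc.prems fs nth_carrier[OF fs(1)] by auto
    moreover have "\<delta> k j = j" "\<delta> k (Suc j) = Suc (Suc j)" using 2 by (auto simp: \<delta>_def)
    ultimately show ?thesis using IH by (simp add: level_assoc del: append_Cons append_assoc)
  next
    case 3
    then have "?ms ! j = fs ! Suc j" using k fs Suc.prems by (auto simp: nth_append nth_Cons' min_def)
    then show ?thesis using IH 3 by (simp add: \<delta>_def)
  qed
qed (use k in \<open>simp add: \<delta>_def\<close>)

lemma partial_prod_insert_one:
  assumes fs: "set fs \<subseteq> carrier (Lev G q)" and k: "k \<le> length fs"
  shows "j \<le> Suc (length fs) \<Longrightarrow> partial_prod (Lev G q) (insert_one (Lev G q) k fs) j = partial_prod (Lev G q) fs (\<sigma> k j)"
proof (induction j)
  case (Suc j)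
  have IH: "partial_prod (Lev G q) (insert_one (Lev G q) k fs) j = partial_prod (Lev G q) fs (\<sigma> k j)" using Suc by simp
  consider "j < k" | "j = k" | "k < j" by linarith
  then show ?case
  proof cases
    case 1
    then have "insert_one (Lev G q) k fs ! j = fs ! j" using k by (simp add: insert_one_def nth_append)
    then show ?thesis using IH 1 by (simp add: \<sigma>_def)
  next
    case 2
    then have "insert_one (Lev G q) k fs ! j = \<one>\<^bsub>Lev G q\<^esub>" using k by (simp add: insert_one_def nth_append)
    then show ?thesis using IH 2 fs k by (simp add: \<sigma>_def)
  next
    case 3
    then obtain j' where j: "j = Suc j'" "k \<le> j'" by (cases j) auto
    then have "insert_one (Lev G q) k fs ! j = fs ! j'" using k Suc.prems by (simp add: insert_one_def nth_append)
    then show ?thesis using IH 3 j by (simp add: \<sigma>_def)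
  qed
qed (simp add: \<sigma>_def)

lemma quotients_simps:
  assumes "gs \<in> Simp (bar G) m"
  shows "quotients (Lev G m) gs \<in> Simp (gpow m) m"
    and "j \<le> m \<Longrightarrow> partial_prod (Lev G m) (quotients (Lev G m) gs) j = inv\<^bsub>Lev G m\<^esub> (gs ! 0) \<otimes>\<^bsub>Lev G m\<^esub> gs ! j"
proof -
  have c: "gs ! i \<in> carrier (Lev G m)" if "i \<le> m" for i using assms that nth_carrier[of gs m i] by simp
  show "quotients (Lev G m) gs \<in> Simp (gpow m) m"
    using assms c by (auto simp: quotients_def)
  show "j \<le> m \<Longrightarrow> partial_prod (Lev G m) (quotients (Lev G m) gs) j = inv\<^bsub>Lev G m\<^esub> (gs ! 0) \<otimes>\<^bsub>Lev G m\<^esub> gs ! j"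
  proof (induction j)
    case 0
    then show ?case using c[of 0] by simp
  next
    case (Suc j)
    have "quotients (Lev G m) gs ! j = inv\<^bsub>Lev G m\<^esub> (gs ! j) \<otimes>\<^bsub>Lev G m\<^esub> gs ! Suc j"
      using Suc.prems assms by (simp add: quotients_def)
    then show ?case using Suc c[of 0] c[of j] c[of "Suc j"] by (simp add: level_assoc)
  qed
qed

lemma quotients_partial_prod:
  assumes "fs \<in> Simp (gpow q) q"
  shows "quotients (Lev G q) (map (partial_prod (Lev G q) fs) (\<iota> q)) = fs"
proof (intro nth_equalityI)
  have fs: "length fs = q" "set fs \<subseteq> carrier (Lev G q)" using assms by auto
  show "length (quotients (Lev G q) (map (partial_prod (Lev G q) fs) (\<iota> q))) = length fs" using fs by (simp add: quotients_def)
  fix i assume "i < length (quotients (Lev G q) (map (partial_prod (Lev G q) fs) (\<iota> q)))"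
  then have i: "i < q" by (simp add: quotients_def)
  have "partial_prod (Lev G q) fs i \<in> carrier (Lev G q)" "fs ! i \<in> carrier (Lev G q)" using i fs nth_carrier[of fs q i] by auto
  then show "quotients (Lev G q) (map (partial_prod (Lev G q) fs) (\<iota> q)) ! i = fs ! i"
    using i by (simp add: quotients_def nth_\<iota> less_Suc_eq_le)
qed

lemma nth_quotients: "Suc i < length hs \<Longrightarrow> quotients M hs ! i = inv\<^bsub>M\<^esub> (hs ! i) \<otimes>\<^bsub>M\<^esub> hs ! Suc i"
  by (simp add: quotients_def less_diff_conv)

lemma quotients_omit:
  assumes hs: "length hs = Suc (Suc m)" "set hs \<subseteq> carrier (Lev G q)"
  shows "quotients (Lev G q) (omit 0 hs) = tl (quotients (Lev G q) hs)"
    and "quotients (Lev G q) (omit (Suc m) hs) = butlast (quotients (Lev G q) hs)"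
    and "0 < i \<Longrightarrow> i \<le> m \<Longrightarrow> quotients (Lev G q) (omit i hs) =
      take (i - 1) (quotients (Lev G q) hs) @ [quotients (Lev G q) hs ! (i - 1) \<otimes>\<^bsub>Lev G q\<^esub> quotients (Lev G q) hs ! i]
        @ drop (Suc i) (quotients (Lev G q) hs)"
proof -
  let ?Q = "quotients (Lev G q) hs"
  have lQ: "length ?Q = Suc m" using hs by (simp add: quotients_def)
  have lo: "length (quotients (Lev G q) (omit i hs)) = m" if "i \<le> Suc m" for i using that hs by (simp add: quotients_def)
  have no: "quotients (Lev G q) (omit i hs) ! j = inv\<^bsub>Lev G q\<^esub> (hs ! \<delta> i j) \<otimes>\<^bsub>Lev G q\<^esub> hs ! \<delta> i (Suc j)" if "i \<le> Suc m" "j < m" for i j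
    using that hs by (simp add: nth_quotients nth_omit)
  have nQ: "?Q ! j = inv\<^bsub>Lev G q\<^esub> (hs ! j) \<otimes>\<^bsub>Lev G q\<^esub> hs ! Suc j" if "j \<le> m" for j
    using that hs by (simp add: nth_quotients)
  show "quotients (Lev G q) (omit 0 hs) = tl ?Q"
    by (rule nth_equalityI) (auto simp: lo lQ no nQ nth_tl \<delta>_def)
  show "quotients (Lev G q) (omit (Suc m) hs) = butlast ?Q"
    by (rule nth_equalityI) (auto simp: lo lQ no nQ nth_butlast \<delta>_def)
  assume i: "0 < i" "i \<le> m"
  have c: "hs ! j \<in> carrier (Lev G q)" if "j \<le> Suc m" for j using that nth_carrier[OF hs(2)] hs(1) by simp
  show "quotients (Lev G q) (omit i hs) = take (i - 1) ?Q @ [?Q ! (i - 1) \<otimes>\<^bsub>Lev G q\<^esub> ?Q ! i] @ drop (Suc i) ?Q"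
  proof (rule nth_equalityI)
    show "length (quotients (Lev G q) (omit i hs)) = length (take (i - 1) ?Q @ [?Q ! (i - 1) \<otimes>\<^bsub>Lev G q\<^esub> ?Q ! i] @ drop (Suc i) ?Q)"
      using i lo[of i] lQ by simp
    fix j assume "j < length (quotients (Lev G q) (omit i hs))"
    then have j: "j < m" using lo i by simp
    consider "j < i - 1" | "Suc j = i" | j' where "j = i + j'" by (metis Suc_diff_1 i(1) le_add_diff_inverse linorder_neqE_nat not_less not_less_eq)
    then show "quotients (Lev G q) (omit i hs) ! j = (take (i - 1) ?Q @ [?Q ! (i - 1) \<otimes>\<^bsub>Lev G q\<^esub> ?Q ! i] @ drop (Suc i) ?Q) ! j"
    proof cases
      case 1
      then have "j < i" "Suc j < i" by simp_all
      then show ?thesis using 1 i j lQ no[of i j] nQ[of j] by (simp add: nth_append \<delta>_def)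
    next
      case 2
      then have "(take (i - 1) ?Q @ [?Q ! (i - 1) \<otimes>\<^bsub>Lev G q\<^esub> ?Q ! i] @ drop (Suc i) ?Q) ! j = ?Q ! j \<otimes>\<^bsub>Lev G q\<^esub> ?Q ! Suc j"
        using i lQ by (auto simp: nth_append)
      then show ?thesis using 2 i j no[of i j] nQ[of j] nQ[of "Suc j"] c[of j] c[of "Suc j"] c[of "Suc (Suc j)"]
        by (simp add: \<delta>_def level_assoc)
    next
      case 3
      then have "(take (i - 1) ?Q @ [?Q ! (i - 1) \<otimes>\<^bsub>Lev G q\<^esub> ?Q ! i] @ drop (Suc i) ?Q) ! j = ?Q ! Suc j"
        using i j lQ by (auto simp: nth_append nth_Cons' min_def)
      then show ?thesis using 3 i j no[of i j] nQ[of "Suc j"] by (simp add: \<delta>_def)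
    qed
  qed
qed

lemma quotients_dup:
  assumes hs: "length hs = Suc m" "set hs \<subseteq> carrier (Lev G q)" and i: "i \<le> m"
  shows "quotients (Lev G q) (dup i hs) = insert_one (Lev G q) i (quotients (Lev G q) hs)"
proof (rule nth_equalityI)
  let ?Q = "quotients (Lev G q) hs"
  have lQ: "length ?Q = m" using hs by (simp add: quotients_def)
  have ld: "length (quotients (Lev G q) (dup i hs)) = Suc m" using hs i by (simp add: quotients_def)
  show "length (quotients (Lev G q) (dup i hs)) = length (insert_one (Lev G q) i ?Q)"
    using i lQ ld by (simp add: insert_one_def)
  fix j assume "j < length (quotients (Lev G q) (dup i hs))"
  then have j: "j \<le> m" using ld by simp
  have nd: "quotients (Lev G q) (dup i hs) ! j = inv\<^bsub>Lev G q\<^esub> (hs ! \<sigma> i j) \<otimes>\<^bsub>Lev G q\<^esub> hs ! \<sigma> i (Suc j)"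
    using i j hs by (simp add: nth_quotients nth_dup)
  have c: "hs ! j \<in> carrier (Lev G q)" using nth_carrier[OF hs(2)] hs(1) j by simp
  consider "j < i" | "j = i" | j' where "j = Suc (i + j')" by (metis less_imp_Suc_add linorder_neqE_nat)
  then show "quotients (Lev G q) (dup i hs) ! j = insert_one (Lev G q) i ?Q ! j"
  proof cases
    case 1
    then show ?thesis using nd i lQ hs nth_quotients[of j hs "Lev G q"] by (simp add: insert_one_def nth_append \<sigma>_def)
  next
    case 2
    then show ?thesis using nd i lQ c by (simp add: insert_one_def nth_append \<sigma>_def)
  next
    case 3
    then show ?thesis using nd i j lQ hs nth_quotients[of "i + j'" hs "Lev G q"] by (simp add: insert_one_def nth_append \<sigma>_def)
  qed
qed

text \<open>
  The faces of the bar construction match the cofaces. Outside \<open>0 < i \<le> m\<close>, where the list of quotients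
  just loses its first or last entry, the factors \<open>g_0\<close> and \<open>g_(m + 1)\<inverse>\<close> absorb the one-sided
  multiplication in \<open>d^0\<close> and \<open>d^(m + 1)\<close>.
\<close>

lemma coface_args_quotients:
  assumes hs: "length hs = Suc (Suc m)" "set hs \<subseteq> carrier (Lev G q)" and i: "i \<le> Suc m"
    and u: "u (quotients (Lev G q) (omit i hs)) \<in> carrier (Lev G q)"
  shows "hs ! 0 \<otimes>\<^bsub>Lev G q\<^esub> (coface_args (Lev G q) m i u (quotients (Lev G q) hs) \<otimes>\<^bsub>Lev G q\<^esub> inv\<^bsub>Lev G q\<^esub> (hs ! Suc m))
    = omit i hs ! 0 \<otimes>\<^bsub>Lev G q\<^esub> (u (quotients (Lev G q) (omit i hs)) \<otimes>\<^bsub>Lev G q\<^esub> inv\<^bsub>Lev G q\<^esub> (omit i hs ! m))"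
proof -
  let ?Q = "quotients (Lev G q) hs"
  have lQ: "length ?Q = Suc m" using hs by (simp add: quotients_def)
  have c: "hs ! j \<in> carrier (Lev G q)" if "j \<le> Suc m" for j using that nth_carrier[OF hs(2)] hs(1) by simp
  have o: "omit i hs ! 0 = hs ! \<delta> i 0" "omit i hs ! m = hs ! \<delta> i m" using i hs by (simp_all add: nth_omit)
  consider "i = 0" | "i = Suc m" | "0 < i" "i \<le> m" using i by linarith
  then show ?thesis
  proof cases
    case 1
    have "hd ?Q = inv\<^bsub>Lev G q\<^esub> (hs ! 0) \<otimes>\<^bsub>Lev G q\<^esub> hs ! Suc 0"
      using lQ hs nth_quotients[of 0 hs "Lev G q"] by (cases ?Q) auto
    then show ?thesis using 1 o u quotients_omit(1)[OF hs] c[of 0] c[of 1] c[of "Suc m"]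
      by (simp add: coface_args_def \<delta>_def level_assoc)
  next
    case 2
    have "last ?Q = inv\<^bsub>Lev G q\<^esub> (hs ! m) \<otimes>\<^bsub>Lev G q\<^esub> hs ! Suc m"
      using lQ hs nth_quotients[of m hs "Lev G q"] last_conv_nth[of ?Q] by (cases "?Q = []") auto
    then show ?thesis using 2 o u quotients_omit(2)[OF hs] c[of 0] c[of m] c[of "Suc m"]
      by (simp add: coface_args_def \<delta>_def level_assoc)
  next
    case 3
    then show ?thesis using o u quotients_omit(3)[OF hs 3] by (simp add: coface_args_def \<delta>_def)
  qed
qed

lemma coface_args_closed:
  assumes "fs \<in> Simp (gpow (Suc p)) q"
  shows "tl fs \<in> Simp (gpow p) q" "butlast fs \<in> Simp (gpow p) q"
    "0 < k \<Longrightarrow> k \<le> p \<Longrightarrow> take (k - 1) fs @ [fs ! (k - 1) \<otimes>\<^bsub>Lev G q\<^esub> fs ! k] @ drop (Suc k) fs \<in> Simp (gpow p) q"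
proof -
  have fs: "length fs = Suc p" "set fs \<subseteq> carrier (Lev G q)" using assms by auto
  show "tl fs \<in> Simp (gpow p) q" using fs by (cases fs) auto
  show "butlast fs \<in> Simp (gpow p) q" using fs by (auto dest: in_set_butlastD)
  assume k: "0 < k" "k \<le> p"
  have "fs ! (k - 1) \<in> carrier (Lev G q)" "fs ! k \<in> carrier (Lev G q)" using fs k nth_carrier[OF fs(2)] by auto
  then show "take (k - 1) fs @ [fs ! (k - 1) \<otimes>\<^bsub>Lev G q\<^esub> fs ! k] @ drop (Suc k) fs \<in> Simp (gpow p) q"
    using fs k by (auto dest!: in_set_takeD in_set_dropD)
qed

lemma coface_args_cong:
  assumes "fs \<in> Simp (gpow (Suc p)) q" "k \<le> Suc p" "\<And>gs. gs \<in> Simp (gpow p) q \<Longrightarrow> u gs = u' gs"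
  shows "coface_args (Lev G q) p k u fs = coface_args (Lev G q) p k u' fs"
  using assms(2) assms(3)[OF coface_args_closed(1)[OF assms(1)]] assms(3)[OF coface_args_closed(2)[OF assms(1)]]
    assms(3)[OF coface_args_closed(3)[OF assms(1)]] by (auto simp: coface_args_def simp del: pow_sset_simps)

lemma insert_one_closed: "fs \<in> Simp (gpow p) q \<Longrightarrow> insert_one (Lev G q) k fs \<in> Simp (gpow (Suc p)) q"
  by (auto simp: insert_one_def dest: in_set_takeD in_set_dropD)

text \<open>
  Uncurried, an \<open>n\<close>-simplex of the homotopy coherent center is a family of maps
  \<open>\<Delta>^n \<times> \<Delta>^p \<times> G^p \<rightarrow> G\<close> that is compatible with the cosimplicial operators.
\<close>

definition center_family :: "nat \<Rightarrow> (nat \<Rightarrow> nat \<Rightarrow> (nat list \<times> nat list) \<times> 'g list \<Rightarrow> 'g) \<Rightarrow> bool" where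
  "center_family n w \<longleftrightarrow> (\<forall>p. w p \<in> smap ((\<Delta> n \<times>\<^sub>s \<Delta> p) \<times>\<^sub>s gpow p) (under G)) \<and>
     (\<forall>p. \<forall>k\<le>Suc p. \<forall>m. \<forall>s\<in>Simp (\<Delta> n) m. \<forall>t\<in>Simp (\<Delta> p) m. \<forall>fs\<in>Simp (gpow (Suc p)) m.
        w (Suc p) m ((s, map (\<delta> k) t), fs) = coface_args (Lev G m) p k (\<lambda>fs. w p m ((s, t), fs)) fs) \<and>
     (\<forall>p. \<forall>k\<le>p. \<forall>m. \<forall>s\<in>Simp (\<Delta> n) m. \<forall>t\<in>Simp (\<Delta> (Suc p)) m. \<forall>fs\<in>Simp (gpow p) m.
        w p m ((s, map (\<sigma> k) t), fs) = w (Suc p) m ((s, t), insert_one (Lev G m) k fs))"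

lemma center_familyD:
  assumes "center_family n w"
  shows center_family_smap: "w p \<in> smap ((\<Delta> n \<times>\<^sub>s \<Delta> p) \<times>\<^sub>s gpow p) (under G)"
    and center_family_coface: "k \<le> Suc p \<Longrightarrow> s \<in> Simp (\<Delta> n) m \<Longrightarrow> t \<in> Simp (\<Delta> p) m \<Longrightarrow> fs \<in> Simp (gpow (Suc p)) m \<Longrightarrow>
      w (Suc p) m ((s, map (\<delta> k) t), fs) = coface_args (Lev G m) p k (\<lambda>fs. w p m ((s, t), fs)) fs"
    and center_family_codegen: "k \<le> p \<Longrightarrow> s \<in> Simp (\<Delta> n) m \<Longrightarrow> t \<in> Simp (\<Delta> (Suc p)) m \<Longrightarrow> fs \<in> Simp (gpow p) m \<Longrightarrow>
      w p m ((s, map (\<sigma> k) t), fs) = w (Suc p) m ((s, t), insert_one (Lev G m) k fs)"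
proof -
  note c = assms[unfolded center_family_def]
  show "w p \<in> smap ((\<Delta> n \<times>\<^sub>s \<Delta> p) \<times>\<^sub>s gpow p) (under G)" by (rule c[THEN conjunct1, rule_format])
  show "k \<le> Suc p \<Longrightarrow> s \<in> Simp (\<Delta> n) m \<Longrightarrow> t \<in> Simp (\<Delta> p) m \<Longrightarrow> fs \<in> Simp (gpow (Suc p)) m \<Longrightarrow>
      w (Suc p) m ((s, map (\<delta> k) t), fs) = coface_args (Lev G m) p k (\<lambda>fs. w p m ((s, t), fs)) fs"
    by (rule c[THEN conjunct2, THEN conjunct1, rule_format])
  show "k \<le> p \<Longrightarrow> s \<in> Simp (\<Delta> n) m \<Longrightarrow> t \<in> Simp (\<Delta> (Suc p)) m \<Longrightarrow> fs \<in> Simp (gpow p) m \<Longrightarrow>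
      w p m ((s, map (\<sigma> k) t), fs) = w (Suc p) m ((s, t), insert_one (Lev G m) k fs)"
    by (rule c[THEN conjunct2, THEN conjunct2, rule_format])
qed

text \<open>
  All simplices of \<open>\<Delta>^p\<close> in degree \<open>q\<close> arise from the identity of \<open>[q]\<close> by cosimplicial operators, which
  determine the values of the family.
\<close>

lemma center_family_unique:
  assumes w: "center_family n w" and w': "center_family n w'"
    and eq: "\<And>s fs. s \<in> Simp (\<Delta> n) q \<Longrightarrow> fs \<in> Simp (gpow q) q \<Longrightarrow> w q q ((s, \<iota> q), fs) = w' q q ((s, \<iota> q), fs)"
    and t: "t \<in> Simp (\<Delta> p) q" and s: "s \<in> Simp (\<Delta> n) q" and fs: "fs \<in> Simp (gpow p) q"
  shows "w p q ((s, t), fs) = w' p q ((s, t), fs)"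
proof -
  have "\<forall>fs\<in>Simp (gpow p) q. w p q ((s, t), fs) = w' p q ((s, t), fs)"
    using t
  proof (rule std_simplex_cogenerated[where Q = "\<lambda>p t. \<forall>fs\<in>Simp (gpow p) q. w p q ((s, t), fs) = w' p q ((s, t), fs)", rotated 3])
    show "\<forall>fs\<in>Simp (gpow q) q. w q q ((s, \<iota> q), fs) = w' q q ((s, \<iota> q), fs)" using eq s by blast
  next
    fix p k t assume IH: "\<forall>fs\<in>Simp (gpow p) q. w p q ((s, t), fs) = w' p q ((s, t), fs)" and t: "t \<in> Simp (\<Delta> p) q" and k: "k \<le> Suc p"
    show "\<forall>fs\<in>Simp (gpow (Suc p)) q. w (Suc p) q ((s, map (\<delta> k) t), fs) = w' (Suc p) q ((s, map (\<delta> k) t), fs)"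
    proof
      fix fs assume fs: "fs \<in> Simp (gpow (Suc p)) q"
      show "w (Suc p) q ((s, map (\<delta> k) t), fs) = w' (Suc p) q ((s, map (\<delta> k) t), fs)"
        unfolding center_family_coface[OF w k s t fs] center_family_coface[OF w' k s t fs]
        by (rule coface_args_cong[OF fs k]) (rule bspec[OF IH])
    qed
  next
    fix p k t assume IH: "\<forall>fs\<in>Simp (gpow (Suc p)) q. w (Suc p) q ((s, t), fs) = w' (Suc p) q ((s, t), fs)"
      and t: "t \<in> Simp (\<Delta> (Suc p)) q" and k: "k \<le> p"
    show "\<forall>fs\<in>Simp (gpow p) q. w p q ((s, map (\<sigma> k) t), fs) = w' p q ((s, map (\<sigma> k) t), fs)"
    proof
      fix fs assume fs: "fs \<in> Simp (gpow p) q"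
      show "w p q ((s, map (\<sigma> k) t), fs) = w' p q ((s, map (\<sigma> k) t), fs)"
        unfolding center_family_codegen[OF w k s t fs] center_family_codegen[OF w' k s t fs]
        by (rule bspec[OF IH insert_one_closed[OF fs]])
    qed
  qed
  then show ?thesis using fs by blast
qed

lemma center_simps:
  "\<phi> \<in> Simp (homotopy_coherent_center G) n \<longleftrightarrow>
     (\<forall>p. \<phi> p \<in> smap (\<Delta> n \<times>\<^sub>s \<Delta> p) (mapping_space (gpow p) (under G))) \<and>
     (\<forall>p. \<forall>k\<le>Suc p. \<forall>m. \<forall>s\<in>Simp (\<Delta> n) m. \<forall>t\<in>Simp (\<Delta> p) m.
        \<phi> (Suc p) m (s, map (\<delta> k) t) = Pi_coface G p k m (\<phi> p m (s, t))) \<and>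
     (\<forall>p. \<forall>k\<le>p. \<forall>m. \<forall>s\<in>Simp (\<Delta> n) m. \<forall>t\<in>Simp (\<Delta> (Suc p)) m.
        \<phi> p m (s, map (\<sigma> k) t) = Pi_codegen G p k m (\<phi> (Suc p) m (s, t)))"
  "Face (homotopy_coherent_center G) n i \<phi> = (\<lambda>p. pre (\<Delta> p) (n - 1) (\<delta> i) (\<phi> p))"
  "Degen (homotopy_coherent_center G) n i \<phi> = (\<lambda>p. pre (\<Delta> p) (Suc n) (\<sigma> i) (\<phi> p))"
  by (simp_all add: homotopy_coherent_center_def Tot_def Pi_cosimp_def pre_face_eq pre_degen_eq)

lemma Pi_coface_apply:
  "s \<in> Simp (\<Delta> m) q \<Longrightarrow> fs \<in> Simp (gpow (Suc p)) q \<Longrightarrow>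
    Pi_coface G p k m \<Phi> q (s, fs) = coface_args (Lev G q) p k (\<lambda>fs. \<Phi> q (s, fs)) fs"
  by (simp add: Pi_coface_def coface_args_def)

lemma Pi_codegen_apply:
  "s \<in> Simp (\<Delta> m) q \<Longrightarrow> fs \<in> Simp (gpow p) q \<Longrightarrow>
    Pi_codegen G p k m \<Phi> q (s, fs) = \<Phi> q (s, insert_one (Lev G q) k fs)"
  by (simp add: Pi_codegen_def insert_one_def)

lemma op_prod_simplex:
  assumes "s \<in> Simp (\<Delta> n) m" "t \<in> Simp (\<Delta> p) m" "s' \<in> Simp (\<Delta> m) q"
  shows "op (\<Delta> n \<times>\<^sub>s \<Delta> p) m s' (s, t) = (map ((!) s) s', map ((!) t) s')"
  using op_prod[OF simplicial_set_std_simplex simplicial_set_std_simplex assms] op_std_simplex[OF assms(1,3)]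
    op_std_simplex[OF assms(2,3)] by simp

lemma map_space_pow: "map_subspace (gpow p) (under G) (\<lambda>n. smap (\<Delta> n \<times>\<^sub>s gpow p) (under G))"
  by (rule map_subspace_full[OF simplicial_set_pow_group under_simplicial])

lemma simplicial_set_prod_simplices: "simplicial_set (\<Delta> n \<times>\<^sub>s \<Delta> p)"
  by (rule simplicial_set_prod[OF simplicial_set_std_simplex simplicial_set_std_simplex])

lemma center_family_exists:
  assumes \<phi>: "\<phi> \<in> Simp (homotopy_coherent_center G) n"
  obtains w where "center_family n w"
    "\<And>p m s t q s' fs. s \<in> Simp (\<Delta> n) m \<Longrightarrow> t \<in> Simp (\<Delta> p) m \<Longrightarrow> s' \<in> Simp (\<Delta> m) q \<Longrightarrow> fs \<in> Simp (gpow p) q \<Longrightarrow>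
      \<phi> p m (s, t) q (s', fs) = w p q ((map ((!) s) s', map ((!) t) s'), fs)"
proof -
  define w where "w p = map_subspace.uncurry (gpow p) (\<Delta> n \<times>\<^sub>s \<Delta> p) (\<phi> p)" for p
  have \<phi>s: "\<phi> p \<in> smap (\<Delta> n \<times>\<^sub>s \<Delta> p) (mspace (gpow p) (\<lambda>n. smap (\<Delta> n \<times>\<^sub>s gpow p) (under G)))" for p
    using \<phi>[unfolded center_simps mapping_space_eq] by (rule conjunct1[THEN spec])
  have ws: "w p \<in> smap ((\<Delta> n \<times>\<^sub>s \<Delta> p) \<times>\<^sub>s gpow p) (under G)" for p
    unfolding w_def by (rule map_subspace.uncurry_smap[OF map_space_pow simplicial_set_prod_simplices \<phi>s])
  have \<phi>_w: "\<phi> p m (s, t) q (s', fs) = w p q ((map ((!) s) s', map ((!) t) s'), fs)"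
    if "s \<in> Simp (\<Delta> n) m" "t \<in> Simp (\<Delta> p) m" "s' \<in> Simp (\<Delta> m) q" "fs \<in> Simp (gpow p) q" for p m s t q s' fs
  proof -
    have "(s, t) \<in> Simp (\<Delta> n \<times>\<^sub>s \<Delta> p) m" using that by simp
    from map_subspace.uncurry_apply[OF map_space_pow simplicial_set_prod_simplices \<phi>s this that(3,4)]
    show ?thesis unfolding w_def op_prod_simplex[OF that(1-3)] by (rule sym)
  qed
  have w_\<phi>: "w p m ((s, t), fs) = \<phi> p m (s, t) m (\<iota> m, fs)"
    if "s \<in> Simp (\<Delta> n) m" "t \<in> Simp (\<Delta> p) m" "fs \<in> Simp (gpow p) m" for p m s t fs
    using \<phi>_w[OF that(1,2) \<iota>_simplex that(3)] map_nth_\<iota>[of s m] map_nth_\<iota>[of t m] that by (simp add: std_simplex_simps)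
  have "center_family n w"
    unfolding center_family_def
  proof (intro conjI allI impI ballI ws)
    fix p k m s t fs assume k: "k \<le> Suc p" and st: "s \<in> Simp (\<Delta> n) m" "t \<in> Simp (\<Delta> p) m" and fs: "fs \<in> Simp (gpow (Suc p)) m"
    have dt: "map (\<delta> k) t \<in> Simp (\<Delta> (Suc p)) m" by (rule map_monotone_index[OF monotone_index_\<delta>[OF k] st(2)])
    have "\<phi> (Suc p) m (s, map (\<delta> k) t) = Pi_coface G p k m (\<phi> p m (s, t))"
      using k st by (rule \<phi>[unfolded center_simps, THEN conjunct2, THEN conjunct1, rule_format])
    then have "w (Suc p) m ((s, map (\<delta> k) t), fs) = coface_args (Lev G m) p k (\<lambda>fs. \<phi> p m (s, t) m (\<iota> m, fs)) fs"
      using w_\<phi>[OF st(1) dt fs] Pi_coface_apply[OF \<iota>_simplex fs] by simp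
    also have "\<dots> = coface_args (Lev G m) p k (\<lambda>fs. w p m ((s, t), fs)) fs"
      by (rule coface_args_cong[OF fs k]) (simp only: w_\<phi>[OF st])
    finally show "w (Suc p) m ((s, map (\<delta> k) t), fs) = coface_args (Lev G m) p k (\<lambda>fs. w p m ((s, t), fs)) fs" .
  next
    fix p k m s t fs assume k: "k \<le> p" and st: "s \<in> Simp (\<Delta> n) m" "t \<in> Simp (\<Delta> (Suc p)) m" and fs: "fs \<in> Simp (gpow p) m"
    have dt: "map (\<sigma> k) t \<in> Simp (\<Delta> p) m" by (rule map_monotone_index[OF monotone_index_\<sigma>[OF k] st(2)])
    have "\<phi> p m (s, map (\<sigma> k) t) = Pi_codegen G p k m (\<phi> (Suc p) m (s, t))"
      using k st by (rule \<phi>[unfolded center_simps, THEN conjunct2, THEN conjunct2, rule_format])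
    then show "w p m ((s, map (\<sigma> k) t), fs) = w (Suc p) m ((s, t), insert_one (Lev G m) k fs)"
      using w_\<phi>[OF st(1) dt fs] w_\<phi>[OF st insert_one_closed[OF fs]] Pi_codegen_apply[OF \<iota>_simplex fs] by simp
  qed
  then show thesis using that \<phi>_w by blast
qed

definition center_of :: "nat \<Rightarrow> (nat \<Rightarrow> nat \<Rightarrow> (nat list \<times> nat list) \<times> 'g list \<Rightarrow> 'g) \<Rightarrow>
    nat \<Rightarrow> nat \<Rightarrow> nat list \<times> nat list \<Rightarrow> nat \<Rightarrow> nat list \<times> 'g list \<Rightarrow> 'g" where
  "center_of n w p = restr (\<Delta> n \<times>\<^sub>s \<Delta> p) (curry_at (\<Delta> n \<times>\<^sub>s \<Delta> p) (gpow p) (w p))"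

lemma center_of_eq:
  assumes "s \<in> Simp (\<Delta> n) m" "t \<in> Simp (\<Delta> p) m"
  shows "center_of n w p m (s, t) =
    (\<lambda>q. \<lambda>(s', fs)\<in>Simp (\<Delta> m \<times>\<^sub>s gpow p) q. w p q ((map ((!) s) s', map ((!) t) s'), fs))"
proof (intro ext)
  fix q z
  show "center_of n w p m (s, t) q z = (\<lambda>(s', fs)\<in>Simp (\<Delta> m \<times>\<^sub>s gpow p) q. w p q ((map ((!) s) s', map ((!) t) s'), fs)) z"
    using assms op_prod_simplex[OF assms, of "fst z" q]
    by (cases z) (auto simp: center_of_def restr_apply curry_at_def simp del: pow_sset_simps)
qed

lemma center_of_closed:
  assumes w: "center_family n w"
  shows "center_of n w \<in> Simp (homotopy_coherent_center G) n"
  unfolding center_simps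
proof (intro conjI allI impI ballI)
  fix p
  show "center_of n w p \<in> smap (\<Delta> n \<times>\<^sub>s \<Delta> p) (mapping_space (gpow p) (under G))"
    unfolding center_of_def mapping_space_eq
    by (intro map_subspace.curry_smap[OF map_space_pow simplicial_set_prod_simplices]
        curry_at_smap[OF simplicial_set_prod_simplices simplicial_set_pow_group center_family_smap[OF w]])
next
  fix p k m s t assume k: "k \<le> Suc p" and st: "s \<in> Simp (\<Delta> n) m" "t \<in> Simp (\<Delta> p) m"
  have dt: "map (\<delta> k) t \<in> Simp (\<Delta> (Suc p)) m" by (rule map_monotone_index[OF monotone_index_\<delta>[OF k] st(2)])
  show "center_of n w (Suc p) m (s, map (\<delta> k) t) = Pi_coface G p k m (center_of n w p m (s, t))"
  proof (intro ext)
    fix q z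
    show "center_of n w (Suc p) m (s, map (\<delta> k) t) q z = Pi_coface G p k m (center_of n w p m (s, t)) q z"
    proof (cases "z \<in> Simp (\<Delta> m \<times>\<^sub>s gpow (Suc p)) q")
      case True
      then obtain s' fs where z: "z = (s', fs)" "s' \<in> Simp (\<Delta> m) q" "fs \<in> Simp (gpow (Suc p)) q" by (cases z) simp
      have mem: "map ((!) s) s' \<in> Simp (\<Delta> n) q" "map ((!) t) s' \<in> Simp (\<Delta> p) q"
        using map_nth_simplex[OF _ z(2)] st by auto
      have "map ((!) (map (\<delta> k) t)) s' = map (\<delta> k) (map ((!) t) s')"
        using st(2) z(2) by (auto simp: std_simplex_simps subset_iff)
      then have "center_of n w (Suc p) m (s, map (\<delta> k) t) q z
          = coface_args (Lev G q) p k (\<lambda>fs. w p q ((map ((!) s) s', map ((!) t) s'), fs)) fs"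
        using center_family_coface[OF w k mem z(3)] z by (simp add: center_of_eq[OF st(1) dt] del: map_map)
      also have "\<dots> = coface_args (Lev G q) p k (\<lambda>fs. center_of n w p m (s, t) q (s', fs)) fs"
        by (rule coface_args_cong[OF z(3) k]) (simp add: center_of_eq[OF st] z(2))
      finally show ?thesis using Pi_coface_apply[OF z(2,3)] z(1) by simp
    next
      case False
      then show ?thesis by (cases z) (auto simp: center_of_eq[OF st(1) dt] Pi_coface_def simp del: pow_sset_simps)
    qed
  qed
next
  fix p k m s t assume k: "k \<le> p" and st: "s \<in> Simp (\<Delta> n) m" "t \<in> Simp (\<Delta> (Suc p)) m"
  have dt: "map (\<sigma> k) t \<in> Simp (\<Delta> p) m" by (rule map_monotone_index[OF monotone_index_\<sigma>[OF k] st(2)])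
  show "center_of n w p m (s, map (\<sigma> k) t) = Pi_codegen G p k m (center_of n w (Suc p) m (s, t))"
  proof (intro ext)
    fix q z
    show "center_of n w p m (s, map (\<sigma> k) t) q z = Pi_codegen G p k m (center_of n w (Suc p) m (s, t)) q z"
    proof (cases "z \<in> Simp (\<Delta> m \<times>\<^sub>s gpow p) q")
      case True
      then obtain s' fs where z: "z = (s', fs)" "s' \<in> Simp (\<Delta> m) q" "fs \<in> Simp (gpow p) q" by (cases z) simp
      have mem: "map ((!) s) s' \<in> Simp (\<Delta> n) q" "map ((!) t) s' \<in> Simp (\<Delta> (Suc p)) q"
        using map_nth_simplex[OF _ z(2)] st by auto
      have "map ((!) (map (\<sigma> k) t)) s' = map (\<sigma> k) (map ((!) t) s')"
        using st(2) z(2) by (auto simp: std_simplex_simps subset_iff)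
      then have "center_of n w p m (s, map (\<sigma> k) t) q z
          = w (Suc p) q ((map ((!) s) s', map ((!) t) s'), insert_one (Lev G q) k fs)"
        using center_family_codegen[OF w k mem z(3)] z by (simp add: center_of_eq[OF st(1) dt] del: map_map)
      also have "\<dots> = center_of n w (Suc p) m (s, t) q (s', insert_one (Lev G q) k fs)"
        using insert_one_closed[OF z(3), of k] z(2) by (simp add: center_of_eq[OF st] del: pow_sset_simps)
      finally show ?thesis using Pi_codegen_apply[OF z(2,3)] z(1) by simp
    next
      case False
      then show ?thesis by (cases z) (auto simp: center_of_eq[OF st(1) dt] Pi_codegen_def simp del: pow_sset_simps)
    qed
  qed
qed

end

context simplicial_group
begin

text \<open>
  An equivariant map \<open>\<chi>\<close> on the bar construction gives the maps
  \<open>\<Phi>(f_1, \<dots>, f_p) = \<chi>[1, f_1, f_1 f_2, \<dots>, f_1 \<cdots> f_p] \<cdot> f_1 \<cdots> f_p\<close>, where the list is to be read as the \<open>p\<close>-simplex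
  whose vertices are the partial products; a simplex \<open>t\<close> of \<open>\<Delta>^p\<close> selects vertices from it. The factor on
  the right turns the conjugation by \<open>f_1\<close> that equivariance gives for \<open>d^0\<close> into left multiplication.
\<close>

definition bar_family :: "nat \<Rightarrow> (nat \<Rightarrow> nat list \<times> 'g list \<Rightarrow> 'g) \<Rightarrow> nat \<Rightarrow> nat \<Rightarrow> (nat list \<times> nat list) \<times> 'g list \<Rightarrow> 'g" where
  "bar_family n \<chi> p = restr ((\<Delta> n \<times>\<^sub>s \<Delta> p) \<times>\<^sub>s gpow p) (\<lambda>q z.
     \<chi> q (fst (fst z), map (partial_prod (Lev G q) (snd z)) (snd (fst z))) \<otimes>\<^bsub>Lev G q\<^esub> partial_prod (Lev G q) (snd z) p)"

lemma bar_family_apply: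
  assumes "s \<in> Simp (\<Delta> n) q" "t \<in> Simp (\<Delta> p) q" "fs \<in> Simp (gpow p) q"
  shows "bar_family n \<chi> p q ((s, t), fs) =
    \<chi> q (s, map (partial_prod (Lev G q) fs) t) \<otimes>\<^bsub>Lev G q\<^esub> partial_prod (Lev G q) fs p"
  using assms unfolding bar_family_def by (subst restr_apply) auto

lemma gpowD: "fs \<in> Simp (gpow p) q \<Longrightarrow> length fs = p" "fs \<in> Simp (gpow p) q \<Longrightarrow> set fs \<subseteq> carrier (Lev G q)"
  by simp_all

lemma vertices_bar:
  assumes t: "t \<in> Simp (\<Delta> p) q" and fs: "fs \<in> Simp (gpow p) q"
  shows "map (partial_prod (Lev G q) fs) t \<in> Simp (bar G) q"
proof -
  have "partial_prod (Lev G q) fs j \<in> carrier (Lev G q)" if "j \<in> set t" for j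
    using that t gpowD[OF fs] by (intro partial_prod_closed) (auto simp: std_simplex_simps)
  then show ?thesis using t by (auto simp: std_simplex_simps)
qed

lemma center_family_bar_family:
  assumes \<chi>: "\<chi> \<in> eq_maps G (bar G) (bar_action G) n"
  shows "center_family n (bar_family n \<chi>)"
proof -
  note \<chi>s = eq_maps_smap[OF \<chi>]
  have mem: "(s, map (partial_prod (Lev G q) fs) t) \<in> Simp (\<Delta> n \<times>\<^sub>s bar G) q"
    if "s \<in> Simp (\<Delta> n) q" "t \<in> Simp (\<Delta> p) q" "fs \<in> Simp (gpow p) q" for s t fs p q
    using vertices_bar[OF that(2,3)] that(1) by (simp del: bar_simps)
  have \<chi>c: "\<chi> q (s, map (partial_prod (Lev G q) fs) t) \<in> carrier (Lev G q)"
    if "s \<in> Simp (\<Delta> n) q" "t \<in> Simp (\<Delta> p) q" "fs \<in> Simp (gpow p) q" for s t fs p q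
    by (rule smap_carrier[OF \<chi>s mem[OF that]])
  have pc: "partial_prod (Lev G q) fs j \<in> carrier (Lev G q)" if "fs \<in> Simp (gpow p) q" "j \<le> p" for fs p q j
    using gpowD[OF that(1)] that(2) by simp
  have "bar_family n \<chi> p \<in> smap ((\<Delta> n \<times>\<^sub>s \<Delta> p) \<times>\<^sub>s gpow p) (under G)" for p
    unfolding bar_family_def
  proof (rule restr_prod_smap[OF simplicial_set_prod_simplices simplicial_set_pow_group], goal_cases)
    case (1 q a fs)
    then show ?case using \<chi>c[of "fst a" q "snd a" p fs] pc[of fs p q p] by (simp del: pow_sset_simps add: mem_Times_iff)
  next
    case (2 q i a fs)
    obtain s t where a: "a = (s, t)" by (cases a)
    have st: "s \<in> Simp (\<Delta> n) (Suc q)" "t \<in> Simp (\<Delta> p) (Suc q)" using 2(1) a by simp_all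
    have fs: "length fs = p" "set fs \<subseteq> carrier (Lev G (Suc q))" using 2(2) by auto
    have "map (GFace G (Suc q) i) (map (partial_prod (Lev G (Suc q)) fs) t)
        = map (partial_prod (Lev G q) (map (GFace G (Suc q) i) fs)) t"
      using face_partial_prod[OF fs(2) _ 2(3)] fs(1) st(2) by (auto simp: std_simplex_simps)
    then show ?case
      using smap_face[OF \<chi>s mem[OF st 2(2)] 2(3)] face_partial_prod[OF fs(2) _ 2(3), of p] fs(1)
        face_simps(2)[OF 2(3) \<chi>c[OF st 2(2)] pc[OF 2(2) order_refl]] a
      by (simp add: map_omit[symmetric] del: map_map)
  next
    case (3 q i a fs)
    obtain s t where a: "a = (s, t)" by (cases a)
    have st: "s \<in> Simp (\<Delta> n) q" "t \<in> Simp (\<Delta> p) q" using 3(1) a by simp_all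
    have fs: "length fs = p" "set fs \<subseteq> carrier (Lev G q)" using 3(2) by auto
    have "map (GDegen G q i) (map (partial_prod (Lev G q) fs) t)
        = map (partial_prod (Lev G (Suc q)) (map (GDegen G q i) fs)) t"
      using degen_partial_prod[OF fs(2) _ 3(3)] fs(1) st(2) by (auto simp: std_simplex_simps)
    then show ?case
      using smap_degen[OF \<chi>s mem[OF st 3(2)] 3(3)] degen_partial_prod[OF fs(2) _ 3(3), of p] fs(1)
        degen_simps(2)[OF 3(3) \<chi>c[OF st 3(2)] pc[OF 3(2) order_refl]] a
      by (simp add: map_dup[symmetric] del: map_map)
  qed
  moreover have "bar_family n \<chi> (Suc p) m ((s, map (\<delta> k) t), fs) = coface_args (Lev G m) p k (\<lambda>fs. bar_family n \<chi> p m ((s, t), fs)) fs"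
    if k: "k \<le> Suc p" and s: "s \<in> Simp (\<Delta> n) m" and t: "t \<in> Simp (\<Delta> p) m" and fs: "fs \<in> Simp (gpow (Suc p)) m" for p k m s t fs
  proof -
    let ?M = "Lev G m"
    have dt: "map (\<delta> k) t \<in> Simp (\<Delta> (Suc p)) m" by (rule map_monotone_index[OF monotone_index_\<delta>[OF k] t])
    have lhs: "bar_family n \<chi> (Suc p) m ((s, map (\<delta> k) t), fs)
        = \<chi> m (s, map (\<lambda>j. partial_prod ?M fs (\<delta> k j)) t) \<otimes>\<^bsub>?M\<^esub> partial_prod ?M fs (Suc p)"
      using bar_family_apply[OF s dt fs, of \<chi>] by (simp add: comp_def)
    have jp: "j \<le> p" if "j \<in> set t" for j using t that by (auto simp: std_simplex_simps)
    note f = gpowD[OF fs]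
    note closed = coface_args_closed[OF fs]
    consider "k = 0" | "k = Suc p" | "0 < k" "k \<le> p" using k by linarith
    then show ?thesis
    proof cases
      case 1
      have h: "hd fs \<in> carrier ?M" using f nth_carrier[OF f(2), of 0] by (cases fs) auto
      let ?v = "map (partial_prod ?M (tl fs)) t"
      have "map (\<lambda>j. partial_prod ?M fs (\<delta> k j)) t = bar_action G m (hd fs) ?v"
        using partial_prod_tl[OF f(2)] f(1) jp 1 by (auto simp: bar_action_def \<delta>_def less_Suc_eq_le simp del: partial_prod.simps)
      then have "\<chi> m (s, map (\<lambda>j. partial_prod ?M fs (\<delta> k j)) t) = conj_action G m (hd fs) (\<chi> m (s, ?v))"
        using eq_maps_act[OF \<chi> h s vertices_bar[OF t closed(1)]] by simp
      moreover have "partial_prod ?M fs (Suc p) = hd fs \<otimes>\<^bsub>?M\<^esub> partial_prod ?M (tl fs) p"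
        using partial_prod_tl[OF f(2), of p] f(1) by simp
      ultimately show ?thesis
        unfolding lhs using 1 h \<chi>c[OF s t closed(1)] pc[OF closed(1) order_refl] bar_family_apply[OF s t closed(1), of \<chi>]
        by (simp add: coface_args_def conj_action_def level_assoc del: partial_prod.simps)
    next
      case 2
      have cut: "partial_prod ?M fs j = partial_prod ?M (butlast fs) j" if "j \<le> p" for j
        using f(1) that by (intro partial_prod_cong) (simp add: nth_butlast)
      have "map (\<lambda>j. partial_prod ?M fs (\<delta> k j)) t = map (partial_prod ?M (butlast fs)) t"
        using cut jp 2 by (auto simp: \<delta>_def le_imp_less_Suc)
      moreover have "partial_prod ?M fs (Suc p) = partial_prod ?M (butlast fs) p \<otimes>\<^bsub>?M\<^esub> last fs" "last fs \<in> carrier ?M"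
        using cut[of p] f last_conv_nth[of fs] nth_carrier[OF f(2), of p] by (cases "fs = []"; simp)+
      ultimately show ?thesis
        unfolding lhs using 2 \<chi>c[OF s t closed(2)] pc[OF closed(2) order_refl] bar_family_apply[OF s t closed(2), of \<chi>]
        by (simp add: coface_args_def level_assoc del: partial_prod.simps map_eq_conv)
    next
      case 3
      let ?ms = "take (k - 1) fs @ [fs ! (k - 1) \<otimes>\<^bsub>?M\<^esub> fs ! k] @ drop (Suc k) fs"
      note merge = partial_prod_merge[OF f(2,1) 3]
      have "map (\<lambda>j. partial_prod ?M fs (\<delta> k j)) t = map (partial_prod ?M ?ms) t"
        using merge jp by (auto simp del: append_Cons append_assoc)
      moreover have "partial_prod ?M fs (Suc p) = partial_prod ?M ?ms p"
        using merge[of p] 3 by (simp add: \<delta>_def del: append_Cons append_assoc partial_prod.simps)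
      ultimately show ?thesis
        unfolding lhs using 3 bar_family_apply[OF s t closed(3)[OF 3], of \<chi>]
        by (simp add: coface_args_def del: append_Cons append_assoc partial_prod.simps map_eq_conv)
    qed
  qed
  moreover have "bar_family n \<chi> p m ((s, map (\<sigma> k) t), fs) = bar_family n \<chi> (Suc p) m ((s, t), insert_one (Lev G m) k fs)"
    if k: "k \<le> p" and s: "s \<in> Simp (\<Delta> n) m" and t: "t \<in> Simp (\<Delta> (Suc p)) m" and fs: "fs \<in> Simp (gpow p) m" for p k m s t fs
  proof -
    let ?M = "Lev G m"
    have dt: "map (\<sigma> k) t \<in> Simp (\<Delta> p) m" by (rule map_monotone_index[OF monotone_index_\<sigma>[OF k] t])
    have jp: "j \<le> Suc p" if "j \<in> set t" for j using t that by (auto simp: std_simplex_simps)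
    note f = gpowD[OF fs]
    have ins: "partial_prod ?M (insert_one ?M k fs) j = partial_prod ?M fs (\<sigma> k j)" if "j \<le> Suc p" for j
      using partial_prod_insert_one[OF f(2)] f(1) k that by simp
    have "map (partial_prod ?M (insert_one ?M k fs)) t = map (partial_prod ?M fs) (map (\<sigma> k) t)"
      using ins jp by simp
    moreover have "partial_prod ?M (insert_one ?M k fs) (Suc p) = partial_prod ?M fs p"
      using ins[of "Suc p"] k by (simp add: \<sigma>_def del: partial_prod.simps)
    ultimately show ?thesis
      using bar_family_apply[OF s dt fs, of \<chi>] bar_family_apply[OF s t insert_one_closed[OF fs], of \<chi> k] by (simp del: map_eq_conv map_map partial_prod.simps)
  qed
  ultimately show ?thesis unfolding center_family_def by (intro conjI allI impI ballI) simp_all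
qed

text \<open>
  The inverse construction: by equivariance \<open>\<chi>[g_0, \<dots>, g_m]\<close> is the conjugate by \<open>g_0\<close> of
  \<open>\<chi>[1, f_1, \<dots>, f_1 \<cdots> f_m] = \<Phi>(f_1, \<dots>, f_m) \<cdot> (f_1 \<cdots> f_m)\<inverse>\<close>, where \<open>g_0 f_1 \<cdots> f_m = g_m\<close>.
\<close>

definition bar_map :: "nat \<Rightarrow> (nat \<Rightarrow> nat \<Rightarrow> (nat list \<times> nat list) \<times> 'g list \<Rightarrow> 'g) \<Rightarrow> nat \<Rightarrow> nat list \<times> 'g list \<Rightarrow> 'g" where
  "bar_map n w = restr (\<Delta> n \<times>\<^sub>s bar G) (\<lambda>m z. snd z ! 0 \<otimes>\<^bsub>Lev G m\<^esub>
     (w m m ((fst z, \<iota> m), quotients (Lev G m) (snd z)) \<otimes>\<^bsub>Lev G m\<^esub> inv\<^bsub>Lev G m\<^esub> (snd z ! m)))"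

lemma bar_map_apply:
  assumes "s \<in> Simp (\<Delta> n) m" "gs \<in> Simp (bar G) m"
  shows "bar_map n w m (s, gs) = gs ! 0 \<otimes>\<^bsub>Lev G m\<^esub>
     (w m m ((s, \<iota> m), quotients (Lev G m) gs) \<otimes>\<^bsub>Lev G m\<^esub> inv\<^bsub>Lev G m\<^esub> (gs ! m))"
  using assms unfolding bar_map_def by (subst restr_apply) auto

lemma map_quotients:
  assumes "set gs \<subseteq> carrier (Lev G m)"
    and "\<And>a b. a \<in> carrier (Lev G m) \<Longrightarrow> b \<in> carrier (Lev G m) \<Longrightarrow>
      h (inv\<^bsub>Lev G m\<^esub> a \<otimes>\<^bsub>Lev G m\<^esub> b) = inv\<^bsub>Lev G m'\<^esub> (h a) \<otimes>\<^bsub>Lev G m'\<^esub> h b"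
  shows "map h (quotients (Lev G m) gs) = quotients (Lev G m') (map h gs)"
proof (rule nth_equalityI)
  show "length (map h (quotients (Lev G m) gs)) = length (quotients (Lev G m') (map h gs))" by (simp add: quotients_def)
  fix i assume "i < length (map h (quotients (Lev G m) gs))"
  then have i: "Suc i < length gs" "i < length (quotients (Lev G m) gs)" by (simp_all add: quotients_def)
  then show "map h (quotients (Lev G m) gs) ! i = quotients (Lev G m') (map h gs) ! i"
    using assms(2) nth_carrier[OF assms(1)] by (simp add: nth_quotients)
qed

lemma quotients_bar_action:
  assumes g: "g \<in> carrier (Lev G m)" and gs: "set gs \<subseteq> carrier (Lev G m)"
  shows "quotients (Lev G m) (bar_action G m g gs) = quotients (Lev G m) gs"
proof (rule nth_equalityI)
  show "length (quotients (Lev G m) (bar_action G m g gs)) = length (quotients (Lev G m) gs)"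
    by (simp add: quotients_def bar_action_def)
  fix i assume "i < length (quotients (Lev G m) (bar_action G m g gs))"
  then have i: "Suc i < length gs" by (simp add: quotients_def bar_action_def)
  then show "quotients (Lev G m) (bar_action G m g gs) ! i = quotients (Lev G m) gs ! i"
    using g nth_carrier[OF gs, of i] nth_carrier[OF gs i]
    by (simp add: nth_quotients bar_action_def level_inv_mult level_assoc)
qed

lemma bar_map_eq_maps:
  assumes w: "center_family n w"
  shows "bar_map n w \<in> eq_maps G (bar G) (bar_action G) n"
proof -
  have wc: "w m m ((s, \<iota> m), fs) \<in> carrier (Lev G m)" if "s \<in> Simp (\<Delta> n) m" "fs \<in> Simp (gpow m) m" for m s fs
    using smap_carrier[OF center_family_smap[OF w, of m], of "((s, \<iota> m), fs)" m] that \<iota>_simplex[of m] by simp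
  have ends: "gs ! 0 \<in> carrier (Lev G m)" "gs ! m \<in> carrier (Lev G m)" if "gs \<in> Simp (bar G) m" for gs m
    using that nth_carrier[of gs m] by simp_all
  have "bar_map n w \<in> smap (\<Delta> n \<times>\<^sub>s bar G) (under G)"
    unfolding bar_map_def
  proof (rule restr_prod_smap[OF simplicial_set_std_simplex simplicial_set_bar], goal_cases)
    case (1 m s gs)
    then show ?case using wc[OF 1(1) quotients_simps(1)[OF 1(2)]] ends[OF 1(2)] by simp
  next
    case (2 m i s gs)
    let ?d = "GFace G (Suc m) i" and ?Q = "quotients (Lev G (Suc m)) gs"
    have gs: "length gs = Suc (Suc m)" "set gs \<subseteq> carrier (Lev G (Suc m))" using 2(2) by auto
    have hs: "length (map ?d gs) = Suc (Suc m)" "set (map ?d gs) \<subseteq> carrier (Lev G m)" using gs 2(3) by (auto simp: subset_iff)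
    have s: "omit i s \<in> Simp (\<Delta> n) m"
      using simplicial_set.face_closed[OF simplicial_set_std_simplex 2(1,3)] by (simp del: std_simplex_simps(1))
    have Q: "?Q \<in> Simp (gpow (Suc m)) (Suc m)" by (rule quotients_simps(1)[OF 2(2)])
    have dQ: "map ?d ?Q = quotients (Lev G m) (map ?d gs)" using gs(2) 2(3) by (intro map_quotients) auto
    have dQm: "map ?d ?Q \<in> Simp (gpow (Suc m)) m"
      using simplicial_set.face_closed[OF simplicial_set_pow_group Q 2(3)] by simp
    have "omit i (map ?d gs) \<in> Simp (bar G) m" using simplicial_set.face_closed[OF simplicial_set_bar 2(2,3)] by simp
    note u = wc[OF s quotients_simps(1)[OF this]]
    have "((s, \<iota> (Suc m)), ?Q) \<in> Simp ((\<Delta> n \<times>\<^sub>s \<Delta> (Suc m)) \<times>\<^sub>s gpow (Suc m)) (Suc m)"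
      using 2(1) Q \<iota>_simplex[of "Suc m"] by simp
    from smap_face[OF center_family_smap[OF w] this 2(3)]
    have "?d (w (Suc m) (Suc m) ((s, \<iota> (Suc m)), ?Q)) = coface_args (Lev G m) m i (\<lambda>fs. w m m ((omit i s, \<iota> m), fs)) (map ?d ?Q)"
      using center_family_coface[OF w 2(3) s \<iota>_simplex dQm] by (simp add: omit_\<iota>[OF 2(3)])
    then show ?case
      using coface_args_quotients[OF hs 2(3), where u = "\<lambda>fs. w m m ((omit i s, \<iota> m), fs)", OF u] ends[OF 2(2)] wc[OF 2(1) Q] gs(1) 2(3) dQ by (simp add: nth_map)
  next
    case (3 m i s gs)
    let ?d = "GDegen G m i" and ?Q = "quotients (Lev G m) gs"
    have gs: "length gs = Suc m" "set gs \<subseteq> carrier (Lev G m)" using 3(2) by auto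
    have hs: "length (map ?d gs) = Suc m" "set (map ?d gs) \<subseteq> carrier (Lev G (Suc m))" using gs 3(3) by (auto simp: subset_iff)
    have s: "dup i s \<in> Simp (\<Delta> n) (Suc m)"
      using simplicial_set.degen_closed[OF simplicial_set_std_simplex 3(1,3)] by (simp del: std_simplex_simps(1))
    have Q: "?Q \<in> Simp (gpow m) m" by (rule quotients_simps(1)[OF 3(2)])
    have dQ: "map ?d ?Q = quotients (Lev G (Suc m)) (map ?d gs)" using gs(2) 3(3) by (intro map_quotients) auto
    have dQm: "map ?d ?Q \<in> Simp (gpow m) (Suc m)"
      using simplicial_set.degen_closed[OF simplicial_set_pow_group Q 3(3)] by simp
    have "((s, \<iota> m), ?Q) \<in> Simp ((\<Delta> n \<times>\<^sub>s \<Delta> m) \<times>\<^sub>s gpow m) m"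
      using 3(1) Q \<iota>_simplex[of m] by simp
    from smap_degen[OF center_family_smap[OF w] this 3(3)]
    have "?d (w m m ((s, \<iota> m), ?Q)) = w (Suc m) (Suc m) ((dup i s, \<iota> (Suc m)), quotients (Lev G (Suc m)) (dup i (map ?d gs)))"
      using center_family_codegen[OF w 3(3) s \<iota>_simplex dQm] quotients_dup[OF hs 3(3)] by (simp add: dup_\<iota>[OF 3(3)] dQ)
    moreover have "dup i (map ?d gs) ! 0 = ?d (gs ! 0)" "dup i (map ?d gs) ! Suc m = ?d (gs ! m)"
      using gs(1) 3(3) by (simp_all add: nth_dup \<sigma>_def)
    ultimately show ?case
      using ends[OF 3(2)] wc[OF 3(1) Q] 3(3) by simp
  qed
  moreover have "bar_map n w m (s, bar_action G m g gs) = conj_action G m g (bar_map n w m (s, gs))"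
    if g: "g \<in> carrier (Lev G m)" and s: "s \<in> Simp (\<Delta> n) m" and gs: "gs \<in> Simp (bar G) m" for m s g gs
  proof -
    interpret bar: free_gspace G "bar G" "bar_action G" by (rule free_gspace_bar)
    have "bar_action G m g gs ! 0 = g \<otimes>\<^bsub>Lev G m\<^esub> gs ! 0" "bar_action G m g gs ! m = g \<otimes>\<^bsub>Lev G m\<^esub> gs ! m"
      using gs by (simp_all add: bar_action_def)
    moreover have "quotients (Lev G m) (bar_action G m g gs) = quotients (Lev G m) gs"
      using quotients_bar_action[OF g] gs by simp
    ultimately show ?thesis
      using bar_map_apply[OF s gs] bar_map_apply[OF s bar.act_closed[OF g gs]] g ends[OF gs] wc[OF s quotients_simps(1)[OF gs]]
      by (simp add: conj_action_def level_inv_mult level_assoc)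
  qed
  ultimately show ?thesis unfolding eq_maps_def by blast
qed

lemma bar_map_bar_family:
  assumes \<chi>: "\<chi> \<in> eq_maps G (bar G) (bar_action G) n"
  shows "bar_map n (bar_family n \<chi>) = \<chi>"
proof (rule smap_eqI[OF eq_maps_smap[OF bar_map_eq_maps[OF center_family_bar_family[OF \<chi>]]] eq_maps_smap[OF \<chi>]])
  fix m z assume "z \<in> Simp (\<Delta> n \<times>\<^sub>s bar G) m"
  then obtain s gs where z: "z = (s, gs)" "s \<in> Simp (\<Delta> n) m" "gs \<in> Simp (bar G) m" by (cases z) simp
  let ?M = "Lev G m"
  have c: "gs ! 0 \<in> carrier ?M" "gs ! m \<in> carrier ?M" using z(3) nth_carrier[of gs m] by simp_all
  have \<chi>c: "\<chi> m (s, gs) \<in> carrier ?M" using smap_carrier[OF eq_maps_smap[OF \<chi>], of "(s, gs)" m] z(2,3) by simp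
  have "map (partial_prod ?M (quotients ?M gs)) (\<iota> m) = bar_action G m (inv\<^bsub>?M\<^esub> (gs ! 0)) gs"
    using quotients_simps(2)[OF z(3)] z(3) by (intro nth_equalityI) (simp_all add: bar_action_def nth_\<iota>)
  then have "bar_family n \<chi> m m ((s, \<iota> m), quotients ?M gs)
      = conj_action G m (inv\<^bsub>?M\<^esub> (gs ! 0)) (\<chi> m (s, gs)) \<otimes>\<^bsub>?M\<^esub> (inv\<^bsub>?M\<^esub> (gs ! 0) \<otimes>\<^bsub>?M\<^esub> gs ! m)"
    using bar_family_apply[OF z(2) \<iota>_simplex quotients_simps(1)[OF z(3)], of \<chi>] quotients_simps(2)[OF z(3), of m]
      eq_maps_act[OF \<chi> level_simps(2)[OF c(1)] z(2,3)] by simp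
  then show "bar_map n (bar_family n \<chi>) m z = \<chi> m z"
    using bar_map_apply[OF z(2,3), of "bar_family n \<chi>"] c \<chi>c z(1)
    by (simp add: conj_action_def level_inv_mult level_assoc)
qed

lemma bar_family_bar_map:
  assumes w: "center_family n w"
  shows "bar_family n (bar_map n w) = w"
proof
  fix p
  note \<chi> = bar_map_eq_maps[OF w]
  note w' = center_family_bar_family[OF \<chi>]
  show "bar_family n (bar_map n w) p = w p"
  proof (rule smap_eqI[OF center_family_smap[OF w'] center_family_smap[OF w]])
    fix q z assume "z \<in> Simp ((\<Delta> n \<times>\<^sub>s \<Delta> p) \<times>\<^sub>s gpow p) q"
    then obtain s t fs where z: "z = ((s, t), fs)" "s \<in> Simp (\<Delta> n) q" "t \<in> Simp (\<Delta> p) q" "fs \<in> Simp (gpow p) q"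
      by (cases z) (auto simp del: pow_sset_simps std_simplex_simps)
    have "bar_family n (bar_map n w) q q ((s, \<iota> q), fs) = w q q ((s, \<iota> q), fs)"
      if s: "s \<in> Simp (\<Delta> n) q" and fs: "fs \<in> Simp (gpow q) q" for s fs
    proof -
      let ?M = "Lev G q" and ?v = "map (partial_prod (Lev G q) fs) (\<iota> q)"
      have "?v ! 0 = \<one>\<^bsub>?M\<^esub>" "?v ! q = partial_prod ?M fs q" by (simp_all add: nth_\<iota>)
      moreover have "partial_prod ?M fs q \<in> carrier ?M" using gpowD[OF fs] by simp
      moreover have "w q q ((s, \<iota> q), fs) \<in> carrier ?M"
        using smap_carrier[OF center_family_smap[OF w, of q], of "((s, \<iota> q), fs)" q] s fs \<iota>_simplex[of q] by simp
      ultimately show ?thesis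
        using bar_family_apply[OF s \<iota>_simplex fs, of "bar_map n w"] bar_map_apply[OF s vertices_bar[OF \<iota>_simplex fs], of w]
          quotients_partial_prod[OF fs] by (simp add: level_assoc)
    qed
    then show "bar_family n (bar_map n w) p q z = w p q z"
      unfolding z(1) by (rule center_family_unique[OF w' w _ z(3,2,4)])
  qed
qed

end

context simplicial_group
begin

lemma center_of_inject:
  assumes w: "center_family n w" and w': "center_family n w'" and eq: "center_of n w = center_of n w'"
  shows "w = w'"
proof
  fix p
  show "w p = w' p"
  proof (rule smap_eqI[OF center_family_smap[OF w] center_family_smap[OF w']])
    fix q z assume "z \<in> Simp ((\<Delta> n \<times>\<^sub>s \<Delta> p) \<times>\<^sub>s gpow p) q"
    then obtain s t fs where z: "z = ((s, t), fs)" "s \<in> Simp (\<Delta> n) q" "t \<in> Simp (\<Delta> p) q" "fs \<in> Simp (gpow p) q"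
      by (cases z) (auto simp del: pow_sset_simps std_simplex_simps)
    have at: "v p q ((s, t), fs) = center_of n v p q (s, t) q (\<iota> q, fs)" for v
      using map_nth_\<iota>[of s q] map_nth_\<iota>[of t q] z(2-4) \<iota>_simplex[of q]
      by (simp add: center_of_eq[OF z(2,3)] std_simplex_simps)
    show "w p q z = w' p q z" unfolding z(1) at[of w] at[of w'] eq by (rule refl)
  qed
qed

lemma center_of_surj:
  assumes \<phi>: "\<phi> \<in> Simp (homotopy_coherent_center G) n"
  obtains w where "center_family n w" "center_of n w = \<phi>"
proof -
  obtain w where w: "center_family n w"
    and \<phi>_w: "\<And>p m s t q s' fs. s \<in> Simp (\<Delta> n) m \<Longrightarrow> t \<in> Simp (\<Delta> p) m \<Longrightarrow> s' \<in> Simp (\<Delta> m) q \<Longrightarrow> fs \<in> Simp (gpow p) q \<Longrightarrow>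
      \<phi> p m (s, t) q (s', fs) = w p q ((map ((!) s) s', map ((!) t) s'), fs)"
    using center_family_exists[OF \<phi>] by blast
  have \<phi>s: "\<phi> p \<in> smap (\<Delta> n \<times>\<^sub>s \<Delta> p) (mspace (gpow p) (\<lambda>n. smap (\<Delta> n \<times>\<^sub>s gpow p) (under G)))" for p
    using \<phi>[unfolded center_simps mapping_space_eq] by (rule conjunct1[THEN spec])
  have cs: "center_of n w p \<in> smap (\<Delta> n \<times>\<^sub>s \<Delta> p) (mspace (gpow p) (\<lambda>n. smap (\<Delta> n \<times>\<^sub>s gpow p) (under G)))" for p
    using center_of_closed[OF w, unfolded center_simps mapping_space_eq] by (rule conjunct1[THEN spec])
  have "center_of n w p = \<phi> p" for p
  proof (rule smap_eqI[OF cs \<phi>s])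
    fix m z assume z: "z \<in> Simp (\<Delta> n \<times>\<^sub>s \<Delta> p) m"
    then obtain s t where st: "z = (s, t)" "s \<in> Simp (\<Delta> n) m" "t \<in> Simp (\<Delta> p) m" by (cases z) simp
    show "center_of n w p m z = \<phi> p m z"
    proof (rule smap_eqI[of _ "\<Delta> m \<times>\<^sub>s gpow p" "under G"])
      show "center_of n w p m z \<in> smap (\<Delta> m \<times>\<^sub>s gpow p) (under G)" using smap_closed[OF cs z] by simp
      show "\<phi> p m z \<in> smap (\<Delta> m \<times>\<^sub>s gpow p) (under G)" using smap_closed[OF \<phi>s z] by simp
      fix q y assume "y \<in> Simp (\<Delta> m \<times>\<^sub>s gpow p) q"
      then obtain s' fs where y: "y = (s', fs)" "s' \<in> Simp (\<Delta> m) q" "fs \<in> Simp (gpow p) q" by (cases y) simp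
      show "center_of n w p m z q y = \<phi> p m z q y"
        unfolding st(1) y(1) \<phi>_w[OF st(2,3) y(2,3)] using y(2,3) by (simp add: center_of_eq[OF st(2,3)])
    qed
  qed
  then show thesis using that[OF w] by blast
qed

lemma center_of_pre:
  assumes u: "monotone_index n' n u"
  shows "center_of n' (bar_family n' (pre (bar G) n' u \<chi>)) p = pre (\<Delta> p) n' u (center_of n (bar_family n \<chi>) p)"
proof (rule ext, rule ext)
  fix m and z :: "nat list \<times> nat list"
  obtain s t where z: "z = (s, t)" by (cases z)
  have "center_of n' (bar_family n' (pre (bar G) n' u \<chi>)) p m (s, t) = pre (\<Delta> p) n' u (center_of n (bar_family n \<chi>) p) m (s, t)"
  proof (cases "s \<in> Simp (\<Delta> n') m \<and> t \<in> Simp (\<Delta> p) m")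
    case True
    then have s: "s \<in> Simp (\<Delta> n') m" and t: "t \<in> Simp (\<Delta> p) m" by blast+
    have us: "map u s \<in> Simp (\<Delta> n) m" by (rule map_monotone_index[OF u s])
    have "bar_family n' (pre (bar G) n' u \<chi>) p q ((map ((!) s) s', map ((!) t) s'), fs)
        = bar_family n \<chi> p q ((map ((!) (map u s)) s', map ((!) t) s'), fs)"
      if s': "s' \<in> Simp (\<Delta> m) q" and fs: "fs \<in> Simp (gpow p) q" for q s' fs
    proof -
      have "map ((!) (map u s)) s' = map u (map ((!) s) s')" using s s' by (auto simp: std_simplex_simps subset_iff)
      moreover note mem = map_nth_simplex[OF s s'] map_nth_simplex[OF t s'] map_nth_simplex[OF us s']
      ultimately show ?thesis
        using bar_family_apply[OF mem(1,2) fs] bar_family_apply[OF mem(3,2) fs] pre_apply[OF mem(1) vertices_bar[OF mem(2) fs], of u \<chi>]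
        by (simp del: map_map)
    qed
    then show ?thesis
      unfolding pre_apply[OF s t] center_of_eq[OF s t] center_of_eq[OF us t]
      by (intro ext) (auto simp: restrict_def simp del: pow_sset_simps)
  next
    case False
    then show ?thesis by (auto simp: center_of_def restr_def pre_def)
  qed
  then show "center_of n' (bar_family n' (pre (bar G) n' u \<chi>)) p m z = pre (\<Delta> p) n' u (center_of n (bar_family n \<chi>) p) m z"
    unfolding z .
qed

end

text \<open>
  The simplicial identities pass along the bijections from \<open>X\<close> to \<open>Y\<close>; in this way the homotopy coherent
  center is seen to be a simplicial set.
\<close>

lemma bijective_smap_imp_homotopy_equivalent:
  assumes X: "simplicial_set X"
    and closed: "\<And>n x. x \<in> Simp X n \<Longrightarrow> f n x \<in> Simp Y n"
    and face: "\<And>n x i. x \<in> Simp X (Suc n) \<Longrightarrow> i \<le> Suc n \<Longrightarrow> f n (Face X (Suc n) i x) = Face Y (Suc n) i (f (Suc n) x)"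
    and degen: "\<And>n x i. x \<in> Simp X n \<Longrightarrow> i \<le> n \<Longrightarrow> f (Suc n) (Degen X n i x) = Degen Y n i (f n x)"
    and inj: "\<And>n x x'. x \<in> Simp X n \<Longrightarrow> x' \<in> Simp X n \<Longrightarrow> f n x = f n x' \<Longrightarrow> x = x'"
    and surj: "\<And>n y. y \<in> Simp Y n \<Longrightarrow> \<exists>x\<in>Simp X n. f n x = y"
  shows "simplicial_set Y" "X \<simeq>\<^sub>s Y"
proof -
  interpret X: simplicial_set X by fact
  define g where "g n y = (SOME x. x \<in> Simp X n \<and> f n x = y)" for n y
  have g: "g n y \<in> Simp X n" "f n (g n y) = y" if "y \<in> Simp Y n" for n y
    using someI_ex[of "\<lambda>x. x \<in> Simp X n \<and> f n x = y"] surj[OF that] unfolding g_def by blast+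
  have Yf: "Face Y (Suc n) i y \<in> Simp Y n" "Face Y (Suc n) i y = f n (Face X (Suc n) i (g (Suc n) y))"
    if "y \<in> Simp Y (Suc n)" "i \<le> Suc n" for n y i
    using face[OF g(1)[OF that(1)] that(2)] g(2)[OF that(1)] closed[OF X.face_closed[OF g(1)[OF that(1)] that(2)]] by simp_all
  have Yd: "Degen Y n i y \<in> Simp Y (Suc n)" "Degen Y n i y = f (Suc n) (Degen X n i (g n y))"
    if "y \<in> Simp Y n" "i \<le> n" for n y i
    using degen[OF g(1)[OF that(1)] that(2)] g(2)[OF that(1)] closed[OF X.degen_closed[OF g(1)[OF that(1)] that(2)]] by simp_all
  have gf: "g n (f n x) = x" if "x \<in> Simp X n" for n x
    using inj[OF g(1)[OF closed[OF that]] that] g(2)[OF closed[OF that]] by simp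
  have fde: "Face Y (Suc n) i (Degen Y n j y) = y" if "y \<in> Simp Y n" "j \<le> n" "i = j \<or> i = Suc j" for n i j y
  proof -
    have "i \<le> Suc n" using that(2,3) by auto
    from face[OF X.degen_closed[OF g(1)[OF that(1)] that(2)] this] show ?thesis
      using X.face_degen_eq[OF g(1)[OF that(1)] that(2,3)] that by (simp add: Yd g)
  qed
  show Y: "simplicial_set Y"
    by standard
      ((rule fde; assumption) | simp add: Yf Yd gf g closed X.face_closed X.degen_closed X.face_face X.degen_degen
        X.face_degen_less X.face_degen_greater)+
  have fs: "restr X f \<in> smap X Y" by (rule restr_smap[OF X closed face degen])
  have gs: "restr Y g \<in> smap Y X"
    by (rule restr_smap[OF Y]) (simp_all add: g Yf Yd gf X.face_closed X.degen_closed)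
  show "X \<simeq>\<^sub>s Y"
    by (rule isomorphic_imp_homotopy_equivalent[OF fs gs]) (simp_all add: restr_apply closed g gf)
qed

theorem (in simplicial_group) bar_mapping_space_equivalent_center:
  shows simplicial_set_center: "simplicial_set (homotopy_coherent_center G)"
    and center_equivalent_bar: "mspace (bar G) (eq_maps G (bar G) (bar_action G)) \<simeq>\<^sub>s homotopy_coherent_center G"
proof -
  let ?S = "eq_maps G (bar G) (bar_action G)"
  interpret bar: free_gspace G "bar G" "bar_action G" by (rule free_gspace_bar)
  interpret S: map_subspace "bar G" "under G" ?S by (rule eq_maps_map_subspace[OF bar.gspace_axioms])
  define f where "f n \<chi> = center_of n (bar_family n \<chi>)" for n \<chi>
  have closed: "f n \<chi> \<in> Simp (homotopy_coherent_center G) n" if "\<chi> \<in> Simp (mspace (bar G) ?S) n" for n \<chi>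
    unfolding f_def using that by (intro center_of_closed center_family_bar_family) simp
  have face: "f n (Face (mspace (bar G) ?S) (Suc n) i \<chi>) = Face (homotopy_coherent_center G) (Suc n) i (f (Suc n) \<chi>)"
    if "i \<le> Suc n" for n i \<chi>
    using center_of_pre[OF monotone_index_\<delta>[OF that]] by (simp add: f_def center_simps fun_eq_iff[of "center_of _ _"])
  have degen: "f (Suc n) (Degen (mspace (bar G) ?S) n i \<chi>) = Degen (homotopy_coherent_center G) n i (f n \<chi>)"
    if "i \<le> n" for n i \<chi>
    using center_of_pre[OF monotone_index_\<sigma>[OF that]] by (simp add: f_def center_simps fun_eq_iff[of "center_of _ _"])
  have inj: "\<chi> = \<chi>'"
    if "\<chi> \<in> Simp (mspace (bar G) ?S) n" "\<chi>' \<in> Simp (mspace (bar G) ?S) n" "f n \<chi> = f n \<chi>'" for n \<chi> \<chi>'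
  proof -
    have \<chi>: "\<chi> \<in> ?S n" "\<chi>' \<in> ?S n" using that by simp_all
    have "bar_family n \<chi> = bar_family n \<chi>'"
      using that(3) unfolding f_def by (rule center_of_inject[OF \<chi>[THEN center_family_bar_family]])
    then have "bar_map n (bar_family n \<chi>) = bar_map n (bar_family n \<chi>')" by simp
    then show ?thesis unfolding bar_map_bar_family[OF \<chi>(1)] bar_map_bar_family[OF \<chi>(2)] .
  qed
  have surj: "\<exists>\<chi>\<in>Simp (mspace (bar G) ?S) n. f n \<chi> = \<phi>" if \<phi>: "\<phi> \<in> Simp (homotopy_coherent_center G) n" for n \<phi>
  proof -
    obtain w where w: "center_family n w" "center_of n w = \<phi>" using center_of_surj[OF \<phi>] by blast
    show ?thesis
      by (rule bexI[of _ "bar_map n w"]) (simp_all add: f_def bar_family_bar_map[OF w(1)] w(2) bar_map_eq_maps[OF w(1)])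
  qed
  note iso = bijective_smap_imp_homotopy_equivalent[OF S.simplicial_set_mspace closed face degen inj surj]
  show "simplicial_set (homotopy_coherent_center G)" by (rule iso(1))
  show "mspace (bar G) ?S \<simeq>\<^sub>s homotopy_coherent_center G" by (rule iso(2))
qed

section \<open>Independence of the free resolution\<close>

lemma simplicial_set_eq_maps: "gspace G X \<alpha> \<Longrightarrow> simplicial_set (mspace X (eq_maps G X \<alpha>))"
  by (rule map_subspace.simplicial_set_mspace[OF eq_maps_map_subspace])

lemma free_action_imp_free_gspace:
  assumes G: "simplicial_group G" and X: "free_action G X \<alpha>"
  shows "free_gspace G X \<alpha>"
proof -
  interpret X: free_action G X \<alpha> by fact
  show ?thesis
  proof (intro free_gspace.intro gspace.intro free_gspace_axioms.intro G X.space)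
    fix n g h x
    show "g \<in> carrier (Lev G n) \<Longrightarrow> x \<in> Simp X n \<Longrightarrow> \<alpha> n g x \<in> Simp X n"
      by (rule group_action.element_image[OF X.action_level _ _ refl])
    show "x \<in> Simp X n \<Longrightarrow> \<alpha> n \<one>\<^bsub>Lev G n\<^esub> x = x"
      using group_action.id_eq_one[OF X.action_level[of n], symmetric] by simp
    show "g \<in> carrier (Lev G n) \<Longrightarrow> h \<in> carrier (Lev G n) \<Longrightarrow> x \<in> Simp X n \<Longrightarrow>
      \<alpha> n (g \<otimes>\<^bsub>Lev G n\<^esub> h) x = \<alpha> n g (\<alpha> n h x)"
      by (rule group_action.composition_rule[OF X.action_level])
    show "g \<in> carrier (Lev G n) \<Longrightarrow> x \<in> Simp X n \<Longrightarrow> \<alpha> n g x = x \<Longrightarrow> g = \<one>\<^bsub>Lev G n\<^esub>"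
      using X.free[of x n] by (auto simp: stabilizer_def)
  qed (fact X.action_face X.action_degen)+
qed

text \<open>
  Both spaces are compared with the equivariant maps on \<open>X \<times> Y\<close>.
\<close>

theorem mapping_space_free_resolution_independent:
  fixes X :: "'x sset" and Y :: "'y sset"
  assumes G: "simplicial_group G"
    and X: "free_gspace G X \<alpha>" "contractible X" and Y: "free_gspace G Y \<beta>" "contractible Y"
  shows "mspace X (eq_maps G X \<alpha>) \<simeq>\<^sub>s mspace Y (eq_maps G Y \<beta>)"
proof -
  interpret X: free_gspace G X \<alpha> by (rule X(1))
  interpret Y: free_gspace G Y \<beta> by (rule Y(1))
  interpret CX: contractible_gspace G X \<alpha>
    by (intro contractible_gspace.intro contractible_domain.intro contractible_domain_axioms.intro G X(2) X.gspace_axioms)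
  interpret CY: contractible_gspace G Y \<beta>
    by (intro contractible_gspace.intro contractible_domain.intro contractible_domain_axioms.intro G Y(2) Y.gspace_axioms)
  note s = simplicial_set_eq_maps
  note sX = s[OF X.gspace_axioms] and sY = s[OF Y.gspace_axioms]
    and sXY = s[OF gspace_prod[OF X.gspace_axioms Y.gspace_axioms]]
    and sYX = s[OF gspace_prod[OF Y.gspace_axioms X.gspace_axioms]]
  have "mspace X (eq_maps G X \<alpha>) \<simeq>\<^sub>s mspace (Y \<times>\<^sub>s X) (eq_maps G (Y \<times>\<^sub>s X) (prod_action \<beta> \<alpha>))"
    by (rule homotopy_equivalent_trans[OF sX sXY sYX CY.mapping_space_times_contractible[OF X(1)]
          eq_maps_swap[OF X.gspace_axioms Y.gspace_axioms]])
  then show ?thesis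
    by (rule homotopy_equivalent_trans[OF sX sYX sY _
          homotopy_equivalent_sym[OF CX.mapping_space_times_contractible[OF Y(1)]]])
qed

theorem theorem5p1:
  fixes G :: "'g sgroup"
    and EG :: "'e sset"
    and \<alpha> :: "nat \<Rightarrow> 'g \<Rightarrow> 'e \<Rightarrow> 'e"
  assumes "simplicial_group G"
    and "free_resolution G EG \<alpha>"
  shows "homotopy_coherent_center G
           \<simeq>\<^sub>s equivariant_mapping_space G EG \<alpha> (under G) (conj_action G)"
proof -
  interpret simplicial_group G by fact
  interpret EG: free_resolution G EG \<alpha> by fact
  have free: "free_gspace G EG \<alpha>"
    by (rule free_action_imp_free_gspace[OF assms(1) EG.free_action_axioms])
  note s = simplicial_set_eq_maps[OF free_gspace.axioms(1)]
  show ?thesis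
    unfolding equivariant_mapping_space_eq
    by (rule homotopy_equivalent_trans[OF simplicial_set_center s[OF free_gspace_bar] s[OF free]
          homotopy_equivalent_sym[OF center_equivalent_bar]
          mapping_space_free_resolution_independent[OF assms(1) free_gspace_bar contractible_bar free EG.contractible]])
qed

end
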